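(* Let $p$ be an odd prime, $\beta\in\mathbb Z_p^\times$ a nonsquare, $a\in\{1,\beta,p,p\beta\}$, $\mu_a(x)=(a,x)_p$, $\mu=\mu_a|\cdot|^{1/2}$, and let $\eta$ be trivial or $\left(\frac{\cdot}p\right)$ with $\eta(-1)=\mu_a(-1)$. Consider the cases: Case 1: $c(\mu_a)=c(\eta)=0$; Case 2: $c(\mu_a)=1$, $c(\eta)=0$; Case 3: $c(\mu_a)=0$, $c(\eta)=1$; Case 4: $c(\mu_a)=c(\eta)=1$. Then the $\eta$-conductors are $$\begin{array}{c|c|c|c}\text{Case}&c_\eta(\pi_\psi(\mu))&c_\eta(\omega^+_{\psi,\mu_a})&c_\eta(St_{\psi,\mu_a})\\\hline1&0&0&1\\2&2&3&2\\3&2&2&2\\4&1&1&1\end{array}$$ and $$\begin{array}{c|c|c|c|c}\text{Case}&m&\dim\pi_\psi(\mu)_\eta^{K_m}&\dim(\omega^+_{\psi,\mu_a})_\eta^{K_m}&\dim(St_{\psi,\mu_a})_\eta^{K_m}\\\hline1&0&1&1&0\\1&1&2&1&1\\2&2&2&0&2\\3&2&2&1&1\\4&1&2&1&1\end{array}$$ In Case 2 all three isotypic spaces vanish for $m<2$. In Case 3 the three $K_1$-isotypic spaces vanish. (For the ramified $\eta$ of Cases 3 and 4 only levels $m\ge1$ are considered, where $\eta$ is a character of $K_m$.)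
   Context: Let $G=\mathrm{SL}_2(\mathbb Q_p)$, $K=\mathrm{SL}_2(\mathbb Z_p)$, $K_m=K_0(p^m)=\{\begin{pmatrix}a&b\\c&d\end{pmatrix}\in K:c\in p^m\mathbb Z_p\}$ (so $K_0=K$). $(\cdot,\cdot)_p$ is the quadratic Hilbert symbol. For $A=\begin{pmatrix}a&b\\c&d\end{pmatrix}$ put $\tau(A)=c$ if $c\ne0$, $\tau(A)=d$ if $c=0$; for $g\in G$ put $s_p(g)=(c,d)_p$ if $cd\neq0$ and $\mathrm{ord}_p(c)$ is odd, $s_p(g)=1$ otherwise; $c(g,h)=(\tau(gh)\tau(g),\tau(gh)\tau(h))_p\,s_p(g)s_p(h)s_p(gh)$. $\widetilde G=G\times\{\pm1\}$ with $(g,\epsilon_1)(h,\epsilon_2)=(gh,\epsilon_1\epsilon_2c(g,h))$; $\overline S$ is the full inverse image of $S\subset G$; the cover splits over $K$ by $k\mapsto(k,1)$. $\eta$ defines the genuine character $\eta((\begin{pmatrix}a&b\\c&d\end{pmatrix},\epsilon))=\epsilon\eta(d)$ of $\overline{K_m}$, $m\ge c(\eta)$. $c(\cdot)$ of a multiplicative character is its conductor exponent. For a smooth representation $(\pi,V)$ of $\widetilde G$, $\pi_\eta^{K_m}=\{v:\pi(\tilde k)v=\eta(\tilde k)v\ \forall\tilde k\in\overline{K_m}\}$, and $c_\eta(\pi)$ is the least $m\ge c(\eta)$ with $\pi_\eta^{K_m}\ne0$. $x(s)=\begin{pmatrix}1&s\\0&1\end{pmatrix}$, $h(t)=\mathrm{diag}(t,t^{-1})$,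 $w(1)=\begin{pmatrix}0&1\\-1&0\end{pmatrix}$. $\psi$ is an additive character of $\mathbb Q_p$ of conductor $0$ (trivial on $\mathbb Z_p$, not on $p^{-1}\mathbb Z_p$), $\psi_a(x)=\psi(ax)$; $\gamma(\psi')$ is the Weil index of $x\mapsto x^2$ with respect to $\psi'$ and $\gamma(a,\psi')=\gamma(\psi'_a)/\gamma(\psi')$. $\pi_\psi(\mu)$ is right translation on locally constant $f:\widetilde G\to\mathbb C$ with $f((h(a)x(b),\epsilon)g)=\epsilon|a|\mu(a)\gamma(a,\psi)^{-1}f(g)$. For a nontrivial additive character $\psi'$, the Weil representation $\omega_{\psi'}$ on the Schwartz space $\mathcal S(\mathbb Q_p)$ is given by $[\omega_{\psi'}((h(a),\epsilon))\varphi](y)=\epsilon|a|^{1/2}\gamma(a,\psi')^{-1}\varphi(ay)$, $[\omega_{\psi'}((x(b),1))\varphi](y)=\psi'(by^2)\varphi(y)$, $[\omega_{\psi'}((w(1),1))\varphi](y)=\gamma(\psi')\int\varphi(x)\psi'(2xy)\,dx$ with $dx$ self-dual for $x\mapsto\psi'(2x)$; $\omega^+_{\psi'}$ is its restriction to even functions (irreducible), and $\omega^+_{\psi,\mu_a}:=\omega^+_{\psi_a}$. It is known that $\pi_\psi(\mu_a|\cdot|^{1/2})$ is reducible and sits in an exact sequence $0\to St_{\psi,\mu_a}\to\pi_\psi(\mu_a|\cdot|^{1/2})\to\omega^+_{\psi,\mu_a}\to0$ with $St_{\psi,\mu_a}$ irreducible; this defines $St_{\psi,\mu_a}$. *)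

theory Defs
  imports "HOL-Analysis.Analysis" "HOL-Number_Theory.Residues" "HOL-Library.Function_Algebras"
begin

section \<open>The field \<open>\<rat>\<^sub>p\<close>\<close>

text \<open>
  \<open>\<rat>\<^sub>p\<close> is constructed as the completion of the rationals, i.e. as Cauchy sequences modulo null
  sequences with respect to the \<open>p\<close>-adic absolute value \<open>rat_pnorm p\<close>.
\<close>

definition rat_pnorm :: "nat \<Rightarrow> rat \<Rightarrow> real" where
  "rat_pnorm p q =
     (if q = 0 then 0
      else case quotient_of q of (a, b) \<Rightarrow>
        real p powi (int (multiplicity (int p) b) - int (multiplicity (int p) a)))"

lemma rat_pnorm_0 [simp]: "rat_pnorm p 0 = 0"
  by (simp add: rat_pnorm_def)

lemma rat_pnorm_frac:
  assumes p: "prime p" and "a \<noteq> 0" "b \<noteq> 0"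
  shows "rat_pnorm p (of_int a / of_int b) =
    real p powi (int (multiplicity (int p) b) - int (multiplicity (int p) a))"
proof -
  obtain c d where cd: "quotient_of (of_int a / of_int b) = (c, d)"
    by (cases "quotient_of (of_int a / of_int b :: rat)")
  have d: "d > 0" using quotient_of_denom_pos[OF cd] .
  have eq: "of_int a / of_int b = (of_int c / of_int d :: rat)"
    using quotient_of_div[OF cd] .
  have c: "c \<noteq> 0" using eq assms d by auto
  have "(of_int (a * d) :: rat) = of_int (c * b)"
    using eq assms d by (simp add: field_simps)
  then have "a * d = c * b" by (simp only: of_int_eq_iff)
  moreover have "prime_elem (int p)" using p by simp
  ultimately have "multiplicity (int p) a + multiplicity (int p) d
      = multiplicity (int p) c + multiplicity (int p) b"
    using assms c d by (metis prime_elem_multiplicity_mult_distrib less_irrefl)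
  then have "int (multiplicity (int p) d) - int (multiplicity (int p) c)
      = int (multiplicity (int p) b) - int (multiplicity (int p) a)" by linarith
  then show ?thesis
    using assms cd by (simp add: rat_pnorm_def)
qed

lemma rat_frac:
  obtains a b where "q = (of_int a / of_int b :: rat)" "b \<noteq> 0"
  by (metis quotient_of_div quotient_of_denom_pos less_irrefl surj_pair)

lemma rat_pnorm_nonneg [simp]: "0 \<le> rat_pnorm p q"
  by (auto simp: rat_pnorm_def split: prod.split)

lemma rat_pnorm_eq_0 [simp]: "prime p \<Longrightarrow> rat_pnorm p q = 0 \<longleftrightarrow> q = 0"
  by (auto simp: rat_pnorm_def split: prod.split)

lemma rat_pnorm_1 [simp]: "rat_pnorm p 1 = 1"
  by (simp add: rat_pnorm_def)

lemma rat_pnorm_mult: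
  assumes "prime p"
  shows "rat_pnorm p (x * y) = rat_pnorm p x * rat_pnorm p y"
proof (cases "x = 0 \<or> y = 0")
  case False
  obtain a b c d where *: "x = of_int a / of_int b" "b \<noteq> 0" "y = of_int c / of_int d" "d \<noteq> 0"
    by (metis rat_frac)
  then have nz: "a \<noteq> 0" "c \<noteq> 0" using False by auto
  have "x * y = of_int (a * c) / of_int (b * d)" using * by simp
  moreover have "prime_elem (int p)" using assms by simp
  moreover have "real p \<noteq> 0" using assms prime_gt_0_nat by fastforce
  ultimately show ?thesis
    using * nz assms
    by (simp add: rat_pnorm_frac prime_elem_multiplicity_mult_distrib power_int_add [symmetric]
          del: of_int_mult) (simp add: algebra_simps)
qed auto

lemma rat_pnorm_minus [simp]: "rat_pnorm p (- x) = rat_pnorm p x"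
proof -
  have "multiplicity (int p) (- a) = multiplicity (int p) a" for a
    by (rule multiplicity_cong) simp
  then show ?thesis
    by (auto simp: rat_pnorm_def rat_uminus_code split: prod.split)
qed

lemma rat_pnorm_minus_commute: "rat_pnorm p (x - y) = rat_pnorm p (y - x)"
  using rat_pnorm_minus[of p "x - y"] by simp

lemma rat_pnorm_add:
  assumes p: "prime p"
  shows "rat_pnorm p (x + y) \<le> max (rat_pnorm p x) (rat_pnorm p y)"
proof (cases "x = 0 \<or> y = 0 \<or> x + y = 0")
  case False
  obtain a b c d where *: "x = of_int a / of_int b" "b \<noteq> 0" "y = of_int c / of_int d" "d \<noteq> 0"
    by (metis rat_frac)
  have x: "x = of_int (a * d) / of_int (b * d)" and y: "y = of_int (c * b) / of_int (b * d)"
    and s: "x + y = of_int (a * d + c * b) / of_int (b * d)"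
    using * by (auto simp: field_simps)
  have "(of_int (a * d + c * b) :: rat) \<noteq> 0"
    using False s by (metis div_0)
  then have "a * d + c * b \<noteq> 0" by (metis of_int_0)
  then have nz: "a * d \<noteq> 0" "c * b \<noteq> 0" "a * d + c * b \<noteq> 0" "b * d \<noteq> 0"
    using False * by auto
  let ?m = "multiplicity (int p)"
  have nu: "\<not> is_unit (int p)" using p prime_gt_1_nat[OF p] by auto
  have "int p ^ min (?m (a * d)) (?m (c * b)) dvd a * d + c * b"
    by (intro dvd_add; rule power_dvd_imp_le multiplicity_dvd' ) auto
  then have "min (?m (a * d)) (?m (c * b)) \<le> ?m (a * d + c * b)"
    using nz nu by (intro multiplicity_geI) auto
  then have le: "int (?m (b * d)) - int (?m (a * d + c * b)) \<le>
     max (int (?m (b * d)) - int (?m (a * d))) (int (?m (b * d)) - int (?m (c * b)))"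
    by linarith
  have "1 \<le> real p" using prime_ge_1_nat[OF p] by simp
  then have mono: "real p powi i \<le> real p powi j" if "i \<le> j" for i j
    using that by (intro power_int_increasing)
  have "rat_pnorm p (x + y) = real p powi (int (?m (b * d)) - int (?m (a * d + c * b)))"
    unfolding s by (rule rat_pnorm_frac[OF p nz(3,4)])
  also have "\<dots> \<le> max (real p powi (int (?m (b * d)) - int (?m (a * d))))
       (real p powi (int (?m (b * d)) - int (?m (c * b))))"
    using mono le by (smt (verit))
  also have "\<dots> = max (rat_pnorm p x) (rat_pnorm p y)"
    unfolding x y rat_pnorm_frac[OF p nz(1,4)] rat_pnorm_frac[OF p nz(2,4)] ..
  finally show ?thesis .
next
  case True
  then show ?thesis by (auto simp: le_max_iff_disj)
qed

lemma rat_pnorm_triangle: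
  assumes "prime p"
  shows "rat_pnorm p (x + y) \<le> rat_pnorm p x + rat_pnorm p y"
  using rat_pnorm_add[OF assms, of x y] rat_pnorm_nonneg[of p x] rat_pnorm_nonneg[of p y]
  by linarith

lemma rat_pnorm_inverse:
  assumes "prime p"
  shows "rat_pnorm p (inverse x) = inverse (rat_pnorm p x)"
proof (cases "x = 0")
  case False
  then have "rat_pnorm p x * rat_pnorm p (inverse x) = 1"
    using rat_pnorm_mult[OF assms, of x "inverse x"] by simp
  then show ?thesis by (metis inverse_unique)
qed simp

lemma rat_pnorm_diff_abs:
  assumes "prime p"
  shows "\<bar>rat_pnorm p x - rat_pnorm p y\<bar> \<le> rat_pnorm p (x - y)"
  using rat_pnorm_triangle[OF assms, of "x - y" y] rat_pnorm_triangle[OF assms, of "y - x" x]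
    rat_pnorm_minus_commute[of p x y] by simp

definition pvanishes :: "nat \<Rightarrow> (nat \<Rightarrow> rat) \<Rightarrow> bool" where
  "pvanishes p X \<longleftrightarrow> (\<lambda>n. rat_pnorm p (X n)) \<longlonglongrightarrow> 0"

definition pcauchy :: "nat \<Rightarrow> (nat \<Rightarrow> rat) \<Rightarrow> bool" where
  "pcauchy p X \<longleftrightarrow> (\<forall>e>0. \<exists>N. \<forall>m\<ge>N. \<forall>n\<ge>N. rat_pnorm p (X m - X n) < e)"

lemma pvanishes_dominated:
  assumes "pvanishes p X" "\<And>n. rat_pnorm p (Y n) \<le> C * rat_pnorm p (X n)"
  shows "pvanishes p Y"
  unfolding pvanishes_def
  by (rule Lim_null_comparison[OF always_eventually
        tendsto_mult_right_zero[OF assms(1)[unfolded pvanishes_def], of C]])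
    (simp add: assms(2))

lemma pvanishes_add:
  assumes "prime p" "pvanishes p X" "pvanishes p Y"
  shows "pvanishes p (\<lambda>n. X n + Y n)"
  unfolding pvanishes_def
proof (rule Lim_null_comparison[OF always_eventually])
  show "(\<lambda>n. rat_pnorm p (X n) + rat_pnorm p (Y n)) \<longlonglongrightarrow> 0"
    using tendsto_add[OF assms(2,3)[unfolded pvanishes_def]] by simp
qed (simp add: rat_pnorm_triangle[OF assms(1)])

lemma pvanishes_minus: "pvanishes p X \<Longrightarrow> pvanishes p (\<lambda>n. - X n)"
  by (simp add: pvanishes_def)

lemma pvanishes_const [simp]: "prime p \<Longrightarrow> pvanishes p (\<lambda>n. c) \<longleftrightarrow> c = 0"
  by (simp add: pvanishes_def LIMSEQ_const_iff)

lemma pcauchy_Cauchy_norm: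
  assumes "prime p" "pcauchy p X"
  shows "convergent (\<lambda>n. rat_pnorm p (X n))"
proof -
  have "Cauchy (\<lambda>n. rat_pnorm p (X n))"
    unfolding Cauchy_def dist_real_def
    using assms(2)[unfolded pcauchy_def] rat_pnorm_diff_abs[OF assms(1)]
    by (meson order_le_less_trans)
  then show ?thesis by (rule Cauchy_convergent)
qed

lemma pcauchy_bounded:
  assumes "prime p" "pcauchy p X"
  obtains C where "C > 0" "\<And>n. rat_pnorm p (X n) \<le> C"
  using convergent_imp_Bseq[OF pcauchy_Cauchy_norm[OF assms]]
  by (auto simp: Bseq_def)

lemma pcauchy_const [simp]: "pcauchy p (\<lambda>n. c)"
  by (simp add: pcauchy_def)

lemma pcauchy_minus: "pcauchy p X \<Longrightarrow> pcauchy p (\<lambda>n. - X n)"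
  unfolding pcauchy_def by (simp add: rat_pnorm_minus_commute)

lemma pcauchy_add:
  assumes p: "prime p" and X: "pcauchy p X" and Y: "pcauchy p Y"
  shows "pcauchy p (\<lambda>n. X n + Y n)"
  unfolding pcauchy_def
proof (intro allI impI)
  fix e :: real assume "e > 0"
  then obtain N M where N: "\<forall>m\<ge>N. \<forall>n\<ge>N. rat_pnorm p (X m - X n) < e"
    and M: "\<forall>m\<ge>M. \<forall>n\<ge>M. rat_pnorm p (Y m - Y n) < e"
    using X Y unfolding pcauchy_def by meson
  have "rat_pnorm p (X m + Y m - (X n + Y n)) < e" if "m \<ge> max N M" "n \<ge> max N M" for m n
  proof -
    have "rat_pnorm p ((X m - X n) + (Y m - Y n)) < e"
      using rat_pnorm_add[OF p, of "X m - X n" "Y m - Y n"] N M that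
      by (smt (verit) max.bounded_iff)
    then show ?thesis by (simp add: algebra_simps)
  qed
  then show "\<exists>N. \<forall>m\<ge>N. \<forall>n\<ge>N. rat_pnorm p (X m + Y m - (X n + Y n)) < e" by blast
qed

lemma pcauchy_mult:
  assumes p: "prime p" and X: "pcauchy p X" and Y: "pcauchy p Y"
  shows "pcauchy p (\<lambda>n. X n * Y n)"
  unfolding pcauchy_def
proof (intro allI impI)
  fix e :: real assume e: "e > 0"
  obtain C D where C: "C > 0" "\<And>n. rat_pnorm p (X n) \<le> C"
    and D: "D > 0" "\<And>n. rat_pnorm p (Y n) \<le> D"
    using pcauchy_bounded[OF p X] pcauchy_bounded[OF p Y] by metis
  have "e / D > 0" "e / C > 0" using e C D by auto
  then obtain N M where N: "\<forall>m\<ge>N. \<forall>n\<ge>N. rat_pnorm p (X m - X n) < e / D"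
    and M: "\<forall>m\<ge>M. \<forall>n\<ge>M. rat_pnorm p (Y m - Y n) < e / C"
    using X Y unfolding pcauchy_def by meson
  have "rat_pnorm p (X m * Y m - X n * Y n) < e" if "m \<ge> max N M" "n \<ge> max N M" for m n
  proof -
    have "rat_pnorm p ((X m - X n) * Y m) \<le> rat_pnorm p (X m - X n) * D"
      "rat_pnorm p (X n * (Y m - Y n)) \<le> C * rat_pnorm p (Y m - Y n)"
      using C D by (auto simp: rat_pnorm_mult[OF p] intro!: mult_left_mono mult_right_mono)
    moreover have "rat_pnorm p (X m - X n) * D < e" "C * rat_pnorm p (Y m - Y n) < e"
      using N M that C D by (auto simp: field_simps)
    moreover have "X m * Y m - X n * Y n = (X m - X n) * Y m + X n * (Y m - Y n)"
      by (simp add: algebra_simps)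
    ultimately show ?thesis
      using rat_pnorm_add[OF p, of "(X m - X n) * Y m" "X n * (Y m - Y n)"] by simp
  qed
  then show "\<exists>N. \<forall>m\<ge>N. \<forall>n\<ge>N. rat_pnorm p (X m * Y m - X n * Y n) < e" by blast
qed

lemma pcauchy_away:
  assumes p: "prime p" and X: "pcauchy p X" and nz: "\<not> pvanishes p X"
  obtains b N where "b > 0" "\<And>n. n \<ge> N \<Longrightarrow> b < rat_pnorm p (X n)"
proof -
  obtain l where l: "(\<lambda>n. rat_pnorm p (X n)) \<longlonglongrightarrow> l"
    using pcauchy_Cauchy_norm[OF p X] by (auto simp: convergent_def)
  have "l \<ge> 0" using l by (rule LIMSEQ_le_const) auto
  moreover have "l \<noteq> 0" using l nz by (auto simp: pvanishes_def)
  ultimately have "l > 0" by simp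
  then have "l / 2 < l" "l / 2 > 0" by auto
  then have "eventually (\<lambda>n. l / 2 < rat_pnorm p (X n)) sequentially"
    using order_tendstoD(1)[OF l] by blast
  then show ?thesis using that[OF \<open>l / 2 > 0\<close>] unfolding eventually_sequentially by blast
qed

lemma pcauchy_inverse:
  assumes p: "prime p" and X: "pcauchy p X" and nz: "\<not> pvanishes p X"
  shows "pcauchy p (\<lambda>n. inverse (X n))"
  unfolding pcauchy_def
proof (intro allI impI)
  fix e :: real assume e: "e > 0"
  obtain b N where b: "b > 0" "\<And>n. n \<ge> N \<Longrightarrow> b < rat_pnorm p (X n)"
    using pcauchy_away[OF assms] by blast
  have "e * b * b > 0" using e b by auto
  then obtain M where M: "\<forall>m\<ge>M. \<forall>n\<ge>M. rat_pnorm p (X m - X n) < e * b * b"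
    using X unfolding pcauchy_def by meson
  have "rat_pnorm p (inverse (X m) - inverse (X n)) < e"
    if mn: "m \<ge> max N M" "n \<ge> max N M" for m n
  proof -
    have g: "b < rat_pnorm p (X m)" "b < rat_pnorm p (X n)" using b mn by auto
    then have z: "X m \<noteq> 0" "X n \<noteq> 0" using b by auto
    have "(inverse (X m) - inverse (X n)) * (X m * X n) = X n - X m"
      using z by (simp add: field_simps)
    then have "rat_pnorm p (inverse (X m) - inverse (X n)) * (rat_pnorm p (X m) * rat_pnorm p (X n))
        = rat_pnorm p (X m - X n)"
      by (metis rat_pnorm_mult[OF p] rat_pnorm_minus_commute)
    also have "\<dots> < e * (b * b)" using M mn by (simp add: mult.assoc)
    also have "\<dots> \<le> e * (rat_pnorm p (X m) * rat_pnorm p (X n))"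
      using e b g by (intro mult_left_mono mult_mono) auto
    finally show ?thesis
      using b g by (simp add: mult_less_cancel_right)
  qed
  then show "\<exists>N. \<forall>m\<ge>N. \<forall>n\<ge>N. rat_pnorm p (inverse (X m) - inverse (X n)) < e" by blast
qed

definition padic_rel :: "nat \<Rightarrow> (nat \<Rightarrow> rat) \<Rightarrow> (nat \<Rightarrow> rat) \<Rightarrow> bool" where
  "padic_rel p X Y \<longleftrightarrow> pcauchy p X \<and> pcauchy p Y \<and> pvanishes p (\<lambda>n. X n - Y n)"

text \<open>
  The prime enters as the cardinality of a type: \<open>p = CARD('p)\<close>. A statement that is polymorphic
  in \<open>'p\<close> is a statement about all primes, since for each prime there is a (numeral) type of that
  cardinality.
\<close>

class prime_card = finite +
  assumes prime_card: "prime CARD('a)"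

lemma part_equivp_padic_rel:
  assumes p: "prime p"
  shows "part_equivp (padic_rel p)"
proof (rule part_equivpI)
  show "\<exists>X. padic_rel p X X"
    by (rule exI[of _ "\<lambda>n. 0"]) (simp add: padic_rel_def p)
  show "symp (padic_rel p)"
    by (auto simp: symp_def padic_rel_def pvanishes_def rat_pnorm_minus_commute)
  show "transp (padic_rel p)"
  proof (rule transpI)
    fix X Y Z assume "padic_rel p X Y" "padic_rel p Y Z"
    then show "padic_rel p X Z"
      using pvanishes_add[OF p, of "\<lambda>n. X n - Y n" "\<lambda>n. Y n - Z n"]
      by (auto simp: padic_rel_def)
  qed
qed

typedef (overloaded) ('p::prime_card) padic =
  "{C. \<exists>X. padic_rel CARD('p) X X \<and> C = Collect (padic_rel CARD('p) X)}"
proof -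
  have "padic_rel CARD('p) (\<lambda>n. 0) (\<lambda>n. 0)"
    by (simp add: padic_rel_def prime_card)
  then show ?thesis
    by (intro exI[of _ "Collect (padic_rel CARD('p) (\<lambda>n. 0))"] CollectI exI[of _ "\<lambda>n. 0"] conjI refl)
qed

definition padic_of :: "(nat \<Rightarrow> rat) \<Rightarrow> 'p::prime_card padic" where
  "padic_of X = Abs_padic (Collect (padic_rel CARD('p) X))"

definition padic_seq :: "'p::prime_card padic \<Rightarrow> nat \<Rightarrow> rat" where
  "padic_seq x = (SOME X. X \<in> Rep_padic x)"

definition cr_padic :: "(nat \<Rightarrow> rat) \<Rightarrow> 'p::prime_card padic \<Rightarrow> bool" where
  "cr_padic X x \<longleftrightarrow> padic_rel CARD('p) X X \<and> padic_of X = x"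

lemma Quotient_padic:
  "Quotient (padic_rel CARD('p)) padic_of padic_seq (cr_padic :: _ \<Rightarrow> 'p::prime_card padic \<Rightarrow> bool)"
proof -
  let ?R = "padic_rel CARD('p)"
  have pe: "?R X Y \<longleftrightarrow> ?R X X \<and> ?R Y Y \<and> ?R X = ?R Y" for X Y
    using conjunct2[OF part_equivp_padic_rel[OF prime_card[where 'a = 'p], unfolded part_equivp_def]]
    by blast
  have seq: "?R (padic_seq x) (padic_seq x)" "Rep_padic x = Collect (?R (padic_seq x))"
    for x :: "'p padic"
  proof -
    obtain X where X: "?R X X" "Rep_padic x = Collect (?R X)"
      using Rep_padic[of x] by blast
    then have "padic_seq x \<in> Rep_padic x"
      unfolding padic_seq_def by (simp add: someI[where P = "?R X" and x = X])
    then have "?R X (padic_seq x)" using X by simp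
    then show "?R (padic_seq x) (padic_seq x)" "Rep_padic x = Collect (?R (padic_seq x))"
      using X pe[of X "padic_seq x"] by simp_all
  qed
  have inj: "padic_of X = (padic_of Y :: 'p padic) \<longleftrightarrow> ?R X = ?R Y" if "?R X X" "?R Y Y" for X Y
  proof -
    have mem: "Collect (?R Z) \<in> {C. \<exists>X. ?R X X \<and> C = Collect (?R X)}" if "?R Z Z" for Z
      by (intro CollectI exI[of _ Z] conjI refl that)
    show ?thesis
      unfolding padic_of_def Abs_padic_inject[OF mem[OF that(1)] mem[OF that(2)]]
      by (auto simp: fun_eq_iff)
  qed
  show ?thesis
  proof (rule QuotientI)
    show "padic_of (padic_seq x) = x" for x :: "'p padic"
      unfolding padic_of_def seq(2)[symmetric] by (rule Rep_padic_inverse)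
    show "?R X Y \<longleftrightarrow> ?R X X \<and> ?R Y Y \<and> padic_of X = (padic_of Y :: 'p padic)" for X Y
      using pe[of X Y] inj[of X Y] by argo
    show "(cr_padic :: _ \<Rightarrow> 'p padic \<Rightarrow> bool) = (\<lambda>X x. ?R X X \<and> padic_of X = x)"
      by (simp add: fun_eq_iff cr_padic_def)
  qed (rule seq)
qed

setup_lifting Quotient_padic

instantiation padic :: (prime_card) field
begin

lift_definition zero_padic :: "'a padic" is "\<lambda>n. 0"
  by (simp add: padic_rel_def prime_card)

lift_definition one_padic :: "'a padic" is "\<lambda>n. 1"
  by (simp add: padic_rel_def prime_card)

lift_definition plus_padic :: "'a padic \<Rightarrow> 'a padic \<Rightarrow> 'a padic" is "\<lambda>X Y n. X n + Y n"
  using pvanishes_add[OF prime_card]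
  by (fastforce simp: padic_rel_def add_diff_add pcauchy_add[OF prime_card])

lift_definition uminus_padic :: "'a padic \<Rightarrow> 'a padic" is "\<lambda>X n. - X n"
  using pvanishes_minus by (fastforce simp: padic_rel_def pcauchy_minus)

lift_definition times_padic :: "'a padic \<Rightarrow> 'a padic \<Rightarrow> 'a padic" is "\<lambda>X Y n. X n * Y n"
proof -
  fix X X' Y Y' :: "nat \<Rightarrow> rat"
  let ?p = "CARD('a)"
  note p = prime_card[where 'a = 'a]
  assume "padic_rel ?p X X'" "padic_rel ?p Y Y'"
  then have c: "pcauchy ?p X" "pcauchy ?p X'" "pcauchy ?p Y" "pcauchy ?p Y'"
    and v: "pvanishes ?p (\<lambda>n. X n - X' n)" "pvanishes ?p (\<lambda>n. Y n - Y' n)"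
    by (auto simp: padic_rel_def)
  obtain C where C: "C > 0" "\<And>n. rat_pnorm ?p (X n) \<le> C"
    using pcauchy_bounded[OF p c(1)] by blast
  obtain D where D: "D > 0" "\<And>n. rat_pnorm ?p (Y' n) \<le> D"
    using pcauchy_bounded[OF p c(4)] by blast
  have "pvanishes ?p (\<lambda>n. X n * (Y n - Y' n))"
    by (rule pvanishes_dominated[OF v(2), of _ C])
      (auto simp: rat_pnorm_mult[OF p] intro: mult_right_mono C)
  moreover have "pvanishes ?p (\<lambda>n. (X n - X' n) * Y' n)"
    by (rule pvanishes_dominated[OF v(1), of _ D])
      (auto simp: rat_pnorm_mult[OF p] mult.commute[of D] intro: mult_left_mono D)
  ultimately have "pvanishes ?p (\<lambda>n. X n * (Y n - Y' n) + (X n - X' n) * Y' n)"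
    by (rule pvanishes_add[OF p])
  then have "pvanishes ?p (\<lambda>n. X n * Y n - X' n * Y' n)"
    by (simp add: algebra_simps)
  then show "padic_rel ?p (\<lambda>n. X n * Y n) (\<lambda>n. X' n * Y' n)"
    using c by (simp add: padic_rel_def pcauchy_mult[OF p])
qed

lift_definition inverse_padic :: "'a padic \<Rightarrow> 'a padic"
  is "\<lambda>X. if pvanishes CARD('a) X then (\<lambda>n. 0) else (\<lambda>n. inverse (X n))"
proof -
  fix X Y :: "nat \<Rightarrow> rat"
  let ?p = "CARD('a)"
  note p = prime_card[where 'a = 'a]
  assume "padic_rel ?p X Y"
  then have c: "pcauchy ?p X" "pcauchy ?p Y" and v: "pvanishes ?p (\<lambda>n. X n - Y n)"
    by (auto simp: padic_rel_def)
  have eq: "pvanishes ?p X \<longleftrightarrow> pvanishes ?p Y"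
    using pvanishes_add[OF p v, of Y] pvanishes_add[OF p pvanishes_minus[OF v], of X] by auto
  show "padic_rel ?p (if pvanishes ?p X then \<lambda>n. 0 else (\<lambda>n. inverse (X n)))
    (if pvanishes ?p Y then \<lambda>n. 0 else (\<lambda>n. inverse (Y n)))"
  proof (cases "pvanishes ?p X")
    case True
    then show ?thesis using eq by (simp add: padic_rel_def p)
  next
    case False
    obtain b N where b: "b > 0" "\<And>n. n \<ge> N \<Longrightarrow> b < rat_pnorm ?p (X n)"
      using pcauchy_away[OF p c(1) False] by blast
    obtain d M where d: "d > 0" "\<And>n. n \<ge> M \<Longrightarrow> d < rat_pnorm ?p (Y n)"
      using pcauchy_away[OF p c(2)] False eq by blast
    have "eventually (\<lambda>n. rat_pnorm ?p (inverse (X n) - inverse (Y n))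
        \<le> inverse (b * d) * rat_pnorm ?p (X n - Y n)) sequentially"
      using eventually_ge_at_top[of "max N M"]
    proof eventually_elim
      case (elim n)
      have g: "b < rat_pnorm ?p (X n)" "d < rat_pnorm ?p (Y n)" using b d elim by auto
      then have z: "X n \<noteq> 0" "Y n \<noteq> 0" using b d by auto
      have "inverse (X n) - inverse (Y n) = - (inverse (X n * Y n) * (X n - Y n))"
        using z by (simp add: field_simps)
      then have "rat_pnorm ?p (inverse (X n) - inverse (Y n))
          = inverse (rat_pnorm ?p (X n) * rat_pnorm ?p (Y n)) * rat_pnorm ?p (X n - Y n)"
        by (simp only: rat_pnorm_minus rat_pnorm_mult[OF p] rat_pnorm_inverse[OF p])
      also have "\<dots> \<le> inverse (b * d) * rat_pnorm ?p (X n - Y n)"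
        using b d g by (intro mult_right_mono le_imp_inverse_le mult_mono) auto
      finally show ?case .
    qed
    moreover have "(\<lambda>n. inverse (b * d) * rat_pnorm ?p (X n - Y n)) \<longlonglongrightarrow> 0"
      using tendsto_mult_right_zero v unfolding pvanishes_def by blast
    ultimately have "pvanishes ?p (\<lambda>n. inverse (X n) - inverse (Y n))"
      unfolding pvanishes_def
      by (rule tendsto_sandwich[OF always_eventually _ tendsto_const, rotated 1]) simp
    then show ?thesis
      using False eq c by (simp add: padic_rel_def pcauchy_inverse[OF p])
  qed
qed

definition "x - y = x + - y" for x y :: "'a padic"

definition "x div y = x * inverse y" for x y :: "'a padic"

instance
proof
  fix a b c :: "'a padic"
  note p = prime_card[where 'a = 'a]
  note * = padic_rel_def p pcauchy_add[OF p] pcauchy_mult[OF p] pcauchy_minus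
  show "a + b + c = a + (b + c)" by transfer (simp add: * ac_simps)
  show "a + b = b + a" by transfer (simp add: * ac_simps)
  show "0 + a = a" by transfer (simp add: *)
  show "- a + a = 0" by transfer (simp add: *)
  show "a - b = a + - b" by (rule minus_padic_def)
  show "a * b * c = a * (b * c)" by transfer (simp add: * ac_simps)
  show "a * b = b * a" by transfer (simp add: * ac_simps)
  show "1 * a = a" by transfer (simp add: *)
  show "(a + b) * c = a * c + b * c" by transfer (simp add: * distrib_right)
  show "(0 :: 'a padic) \<noteq> 1" by transfer (simp add: *)
  show "a div b = a * inverse b" by (rule divide_padic_def)
  show "inverse (0 :: 'a padic) = 0" by transfer (simp add: *)
  have "pvanishes CARD('a) (\<lambda>n. inverse (X n) * X n - 1)"
    if X: "pcauchy CARD('a) X" "\<not> pvanishes CARD('a) X" for X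
  proof -
    obtain b N where b: "b > 0" "\<And>n. n \<ge> N \<Longrightarrow> b < rat_pnorm CARD('a) (X n)"
      using pcauchy_away[OF p X] by blast
    have "inverse (X n) * X n - 1 = 0" if "n \<ge> N" for n
      using b(1) b(2)[OF that] by (cases "X n = 0") auto
    then show ?thesis
      unfolding pvanishes_def
      by (intro tendsto_eventually eventually_sequentiallyI[of N]) simp
  qed
  then have "padic_rel CARD('a)
      (\<lambda>n. (if pvanishes CARD('a) X then \<lambda>n. 0 else (\<lambda>n. inverse (X n))) n * X n) (\<lambda>n. 1)"
    if "padic_rel CARD('a) X X" "\<not> padic_rel CARD('a) X (\<lambda>n. 0)" for X
    using that pcauchy_mult[OF p pcauchy_inverse[OF p], of X X]
    by (simp add: padic_rel_def del: mult_1)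
  then show "a \<noteq> 0 \<Longrightarrow> inverse a * a = 1"
    by transfer blast
qed

end

lift_definition padic_abs :: "'p::prime_card padic \<Rightarrow> real" is "\<lambda>X. lim (\<lambda>n. rat_pnorm CARD('p) (X n))"
proof -
  fix X Y :: "nat \<Rightarrow> rat"
  let ?p = "CARD('p)"
  note p = prime_card[where 'a = 'p]
  assume "padic_rel ?p X Y"
  then have c: "pcauchy ?p X" "pcauchy ?p Y" and v: "pvanishes ?p (\<lambda>n. X n - Y n)"
    by (auto simp: padic_rel_def)
  have "(\<lambda>n. rat_pnorm ?p (X n) - rat_pnorm ?p (Y n)) \<longlonglongrightarrow> 0"
    by (rule Lim_null_comparison[OF always_eventually v[unfolded pvanishes_def]])
      (simp add: rat_pnorm_diff_abs[OF p])
  moreover obtain l where l: "(\<lambda>n. rat_pnorm ?p (Y n)) \<longlonglongrightarrow> l"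
    using pcauchy_Cauchy_norm[OF p c(2)] by (auto simp: convergent_def)
  ultimately have "(\<lambda>n. rat_pnorm ?p (X n)) \<longlonglongrightarrow> l"
    using tendsto_add[of "\<lambda>n. rat_pnorm ?p (X n) - rat_pnorm ?p (Y n)" 0 sequentially
       "\<lambda>n. rat_pnorm ?p (Y n)" l] by simp
  then show "lim (\<lambda>n. rat_pnorm ?p (X n)) = lim (\<lambda>n. rat_pnorm ?p (Y n))"
    using limI[OF l] limI by metis
qed

lemma padic_abs_of:
  assumes "pcauchy CARD('p) X"
  shows "(\<lambda>n. rat_pnorm CARD('p) (X n)) \<longlonglongrightarrow> padic_abs (padic_of X :: 'p::prime_card padic)"
proof -
  have "padic_rel CARD('p) X X" using assms by (simp add: padic_rel_def prime_card)
  then have "padic_abs (padic_of X :: 'p padic) = lim (\<lambda>n. rat_pnorm CARD('p) (X n))"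
    by (rule padic_abs.abs_eq)
  then show ?thesis
    using pcauchy_Cauchy_norm[OF prime_card assms] by (simp add: convergent_LIMSEQ_iff)
qed

lemma padic_cases:
  obtains X where "pcauchy CARD('p) X" "x = (padic_of X :: 'p::prime_card padic)"
proof (rule that[of "padic_seq x"])
  show "x = padic_of (padic_seq x)"
    by (simp add: Quotient_abs_rep[OF Quotient_padic])
  show "pcauchy CARD('p) (padic_seq x)"
    using Quotient_rep_reflp[OF Quotient_padic, of x] by (simp add: padic_rel_def)
qed

lemma padic_of_ring:
  assumes "pcauchy CARD('p) X" "pcauchy CARD('p) Y"
  shows "padic_of X + padic_of Y = (padic_of (\<lambda>n. X n + Y n) :: 'p::prime_card padic)"
    "padic_of X * padic_of Y = (padic_of (\<lambda>n. X n * Y n) :: 'p padic)"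
    "- padic_of X = (padic_of (\<lambda>n. - X n) :: 'p padic)"
proof -
  have "padic_rel CARD('p) X X" "padic_rel CARD('p) Y Y"
    using assms by (simp_all add: padic_rel_def prime_card)
  then show "padic_of X + padic_of Y = (padic_of (\<lambda>n. X n + Y n) :: 'p padic)"
    "padic_of X * padic_of Y = (padic_of (\<lambda>n. X n * Y n) :: 'p padic)"
    "- padic_of X = (padic_of (\<lambda>n. - X n) :: 'p padic)"
    by (simp_all add: plus_padic.abs_eq times_padic.abs_eq uminus_padic.abs_eq)
qed

lemma padic_abs_mult: "padic_abs (x * y) = padic_abs x * padic_abs (y :: 'p::prime_card padic)"
proof -
  obtain X Y where X: "pcauchy CARD('p) X" "x = padic_of X" and Y: "pcauchy CARD('p) Y" "y = padic_of Y"
    by (metis padic_cases)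
  have "(\<lambda>n. rat_pnorm CARD('p) (X n * Y n)) \<longlonglongrightarrow> padic_abs (x * y)"
    using padic_abs_of[OF pcauchy_mult[OF prime_card X(1) Y(1)]] X Y by (simp add: padic_of_ring)
  moreover have "(\<lambda>n. rat_pnorm CARD('p) (X n * Y n)) \<longlonglongrightarrow> padic_abs x * padic_abs y"
    unfolding rat_pnorm_mult[OF prime_card] X(2) Y(2)
    by (intro tendsto_mult padic_abs_of X Y)
  ultimately show ?thesis by (rule LIMSEQ_unique)
qed

lemma padic_abs_ultrametric: "padic_abs (x + y) \<le> max (padic_abs x) (padic_abs (y :: 'p::prime_card padic))"
proof -
  obtain X Y where X: "pcauchy CARD('p) X" "x = padic_of X" and Y: "pcauchy CARD('p) Y" "y = padic_of Y"
    by (metis padic_cases)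
  have "(\<lambda>n. rat_pnorm CARD('p) (X n + Y n)) \<longlonglongrightarrow> padic_abs (x + y)"
    using padic_abs_of[OF pcauchy_add[OF prime_card X(1) Y(1)]] X Y by (simp add: padic_of_ring)
  moreover have "(\<lambda>n. max (rat_pnorm CARD('p) (X n)) (rat_pnorm CARD('p) (Y n))) \<longlonglongrightarrow>
      max (padic_abs x) (padic_abs y)"
    unfolding X(2) Y(2) by (intro tendsto_max padic_abs_of X Y)
  ultimately show ?thesis
    by (rule LIMSEQ_le) (use rat_pnorm_add[OF prime_card] in blast)
qed

lemma padic_abs_minus [simp]: "padic_abs (- x) = padic_abs (x :: 'p::prime_card padic)"
proof -
  obtain X where X: "pcauchy CARD('p) X" "x = padic_of X" by (metis padic_cases)
  have "(\<lambda>n. rat_pnorm CARD('p) (X n)) \<longlonglongrightarrow> padic_abs (- x)"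
    using padic_abs_of[OF pcauchy_minus[OF X(1)]] X padic_of_ring(3)[OF X(1) X(1)] by simp
  then show ?thesis using padic_abs_of[OF X(1)] LIMSEQ_unique unfolding X(2) by blast
qed

lemma padic_abs_nonneg [simp]: "0 \<le> padic_abs (x :: 'p::prime_card padic)"
proof -
  obtain X where X: "pcauchy CARD('p) X" "x = padic_of X" by (metis padic_cases)
  show ?thesis unfolding X(2) by (rule LIMSEQ_le_const[OF padic_abs_of[OF X(1)]]) simp
qed

lemma padic_of_const_0: "padic_of (\<lambda>n. 0) = (0 :: 'p::prime_card padic)"
  by (simp add: zero_padic.abs_eq)

lemma padic_abs_eq_0 [simp]: "padic_abs x = 0 \<longleftrightarrow> x = (0 :: 'p::prime_card padic)"
proof -
  obtain X where X: "pcauchy CARD('p) X" "x = padic_of X" by (metis padic_cases)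
  have "x = 0 \<longleftrightarrow> padic_rel CARD('p) X (\<lambda>n. 0)"
    using Quotient_rel[OF Quotient_padic[where 'p = 'p], of X "\<lambda>n. 0"] X
    by (simp add: padic_of_const_0 padic_rel_def prime_card)
  also have "\<dots> \<longleftrightarrow> (\<lambda>n. rat_pnorm CARD('p) (X n)) \<longlonglongrightarrow> 0"
    using X by (simp add: padic_rel_def pvanishes_def)
  also have "\<dots> \<longleftrightarrow> padic_abs x = 0"
    using padic_abs_of[OF X(1)] LIMSEQ_unique unfolding X(2) by metis
  finally show ?thesis ..
qed

instantiation padic :: (prime_card) metric_space
begin

definition dist_padic :: "'a padic \<Rightarrow> 'a padic \<Rightarrow> real" where
  "dist_padic x y = padic_abs (x - y)"

definition uniformity_padic :: "('a padic \<times> 'a padic) filter" where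
  "uniformity_padic = (INF e\<in>{0 <..}. principal {(x, y). dist x y < e})"

definition open_padic :: "'a padic set \<Rightarrow> bool" where
  "open_padic U = (\<forall>x\<in>U. eventually (\<lambda>(x', y). x' = x \<longrightarrow> y \<in> U) uniformity)"

instance
proof
  show "(uniformity :: ('a padic \<times> 'a padic) filter) = (INF e\<in>{0 <..}. principal {(x, y). dist x y < e})"
    by (rule uniformity_padic_def)
  show "open U = (\<forall>x\<in>U. eventually (\<lambda>(x', y). x' = x \<longrightarrow> y \<in> U) uniformity)"
    for U :: "'a padic set"
    by (rule open_padic_def)
  fix x y z :: "'a padic"
  show "dist x y = 0 \<longleftrightarrow> x = y" by (simp add: dist_padic_def)
  have "padic_abs (x - y) \<le> max (padic_abs (x - z)) (padic_abs (z - y))"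
    using padic_abs_ultrametric[of "x - z" "z - y"] by simp
  also have "\<dots> \<le> padic_abs (x - z) + padic_abs (y - z)"
    using padic_abs_minus[of "y - z"] by simp
  finally show "dist x y \<le> dist x z + dist y z" by (simp add: dist_padic_def)
qed

end

lemma padic_of_nat: "of_nat k = (padic_of (\<lambda>n. of_nat k) :: 'p::prime_card padic)"
proof (induction k)
  case 0
  then show ?case by (simp add: padic_of_const_0)
next
  case (Suc k)
  then show ?case by (simp add: one_padic.abs_eq padic_of_ring)
qed

lemma padic_abs_of_const: "padic_abs (padic_of (\<lambda>n. q) :: 'p::prime_card padic) = rat_pnorm CARD('p) q"
  using padic_abs_of[of "\<lambda>n. q", where 'p = 'p] by (simp add: LIMSEQ_const_iff)

instance padic :: (prime_card) field_char_0
proof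
  have "i = j" if "(of_nat i :: 'a padic) = of_nat j" "i \<le> j" for i j
  proof -
    have "(of_nat (j - i) :: 'a padic) = 0" using that by (simp add: of_nat_diff)
    then have "rat_pnorm CARD('a) (of_nat (j - i)) = 0"
      by (metis padic_of_nat padic_abs_of_const padic_abs_eq_0)
    then show "i = j" using that(2) by (simp add: prime_card)
  qed
  then show "inj (of_nat :: nat \<Rightarrow> 'a padic)"
    by (metis injI linorder_le_cases)
qed

lemma padic_of_const: "padic_of (\<lambda>n. q) = (of_rat q :: 'p::prime_card padic)"
proof -
  have int: "padic_of (\<lambda>n. of_int k) = (of_int k :: 'p padic)" for k
  proof (cases k)
    case (nonneg m)
    then show ?thesis by (simp add: padic_of_nat)
  next
    case (neg m)
    have "padic_of (\<lambda>n. - rat_of_nat (Suc m)) = (- of_nat (Suc m) :: 'p padic)"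
      unfolding padic_of_nat by (rule padic_of_ring(3)[symmetric]) (rule pcauchy_const)+
    then show ?thesis using neg by simp
  qed
  obtain a b where q: "q = of_int a / of_int b" "b \<noteq> 0" by (metis rat_frac)
  have "padic_of (\<lambda>n. q) * of_int b = (padic_of (\<lambda>n. q * of_int b) :: 'p padic)"
    unfolding int[symmetric] by (rule padic_of_ring) simp_all
  also have "\<dots> = of_int a" using q by (simp add: int)
  finally have "padic_of (\<lambda>n. q) = (of_int a / of_int b :: 'p padic)"
    using q(2) by (simp add: eq_divide_eq)
  then show ?thesis unfolding q(1) by (simp add: of_rat_divide)
qed

text \<open>
  The characterization of the completion: the norm is a multiplicative ultrametric norm
  (lemmas above) restricting to the \<open>p\<close>-adic absolute value on the rationals, which are dense,
  and the field is complete.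
\<close>

lemma padic_abs_of_rat: "padic_abs (of_rat q :: 'p::prime_card padic) = rat_pnorm CARD('p) q"
  by (metis padic_abs_of_const padic_of_const)

lemma padic_of_rat_dense:
  assumes "e > 0"
  obtains q where "dist x (of_rat q :: 'p::prime_card padic) < e"
proof -
  obtain X where X: "pcauchy CARD('p) X" "x = padic_of X" by (metis padic_cases)
  obtain N where N: "\<And>m n. m \<ge> N \<Longrightarrow> n \<ge> N \<Longrightarrow> rat_pnorm CARD('p) (X m - X n) < e / 2"
    using X(1) assms unfolding pcauchy_def by (metis half_gt_zero)
  have c: "pcauchy CARD('p) (\<lambda>n. X n + - X N)"
    by (intro pcauchy_add[OF prime_card] X pcauchy_const)
  have "x - of_rat (X N) = padic_of (\<lambda>n. X n + - X N)"
    using padic_of_ring(1)[OF X(1) pcauchy_const, of "- X N"] X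
    by (simp add: padic_of_const of_rat_minus)
  then have "(\<lambda>n. rat_pnorm CARD('p) (X n + - X N)) \<longlonglongrightarrow> dist x (of_rat (X N))"
    using padic_abs_of[OF c] by (simp add: dist_padic_def)
  then have "dist x (of_rat (X N)) \<le> e / 2"
    by (rule LIMSEQ_le_const2) (use N in \<open>force intro: less_imp_le\<close>)
  then show ?thesis using that[of "X N"] assms by simp
qed

instance padic :: (prime_card) complete_space
proof
  fix Z :: "nat \<Rightarrow> 'a padic" assume Z: "Cauchy Z"
  have "\<exists>q. dist (Z n) (of_rat q) < 1 / real (Suc n)" for n
    using padic_of_rat_dense[of "1 / real (Suc n)" "Z n"] by auto
  then obtain X where X: "\<And>n. dist (Z n) (of_rat (X n)) < 1 / real (Suc n)" by metis
  have small: "eventually (\<lambda>n. 1 / real (Suc n) < e) sequentially" if "e > 0" for e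
    using LIMSEQ_Suc[OF lim_1_over_n] that order_tendstoD(2) by blast
  have c: "pcauchy CARD('a) X"
    unfolding pcauchy_def
  proof (intro allI impI)
    fix e :: real assume e: "e > 0"
    then have "e / 3 > 0" by simp
    then obtain N M where N: "\<And>m n. m \<ge> N \<Longrightarrow> n \<ge> N \<Longrightarrow> dist (Z m) (Z n) < e / 3"
      and M: "\<And>n. n \<ge> M \<Longrightarrow> 1 / real (Suc n) < e / 3"
      using Z small[of "e / 3"] unfolding Cauchy_def eventually_sequentially by metis
    have "rat_pnorm CARD('a) (X m - X n) < e" if "m \<ge> max N M" "n \<ge> max N M" for m n
    proof -
      have "rat_pnorm CARD('a) (X m - X n) = dist (of_rat (X m)) (of_rat (X n) :: 'a padic)"
        by (simp add: dist_padic_def padic_abs_of_rat flip: of_rat_diff)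
      also have "\<dots> \<le> dist (Z m) (of_rat (X m)) + dist (Z m) (Z n) + dist (Z n) (of_rat (X n))"
        using dist_triangle[of "of_rat (X m)" "of_rat (X n) :: 'a padic" "Z m"]
          dist_triangle[of "Z m" "of_rat (X n)" "Z n"] by (simp add: dist_commute)
      also have "\<dots> < e"
        using X[of m] X[of n] N[of m n] M[of m] M[of n] that by simp
      finally show ?thesis .
    qed
    then show "\<exists>N. \<forall>m\<ge>N. \<forall>n\<ge>N. rat_pnorm CARD('a) (X m - X n) < e" by blast
  qed
  have "(\<lambda>n. dist (Z n) (padic_of X)) \<longlonglongrightarrow> 0"
  proof (rule LIMSEQ_I)
    fix e :: real assume e: "e > 0"
    then have "e / 3 > 0" by simp
    then obtain N M where N: "\<And>m n. m \<ge> N \<Longrightarrow> n \<ge> N \<Longrightarrow> rat_pnorm CARD('a) (X m - X n) < e / 3"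
      and M: "\<And>n. n \<ge> M \<Longrightarrow> 1 / real (Suc n) < e / 3"
      using c small[of "e / 3"] unfolding pcauchy_def eventually_sequentially by metis
    have "norm (dist (Z n) (padic_of X) - 0) < e" if n: "n \<ge> max N M" for n
    proof -
      have c': "pcauchy CARD('a) (\<lambda>k. X k + - X n)"
        by (intro pcauchy_add[OF prime_card] c pcauchy_const)
      have "padic_of X - of_rat (X n) = (padic_of (\<lambda>k. X k + - X n) :: 'a padic)"
        using padic_of_ring(1)[OF c pcauchy_const, of "- X n"]
        by (simp add: padic_of_const of_rat_minus)
      then have "(\<lambda>k. rat_pnorm CARD('a) (X k + - X n)) \<longlonglongrightarrow>
          dist (padic_of X) (of_rat (X n) :: 'a padic)"
        using padic_abs_of[OF c'] by (simp add: dist_padic_def)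
      then have "dist (padic_of X) (of_rat (X n) :: 'a padic) \<le> e / 3"
        by (rule LIMSEQ_le_const2) (use N n in \<open>force intro: less_imp_le\<close>)
      moreover have "dist (Z n) (of_rat (X n)) < e / 3"
        using X[of n] M[of n] n by simp
      ultimately show ?thesis
        using dist_triangle2[of "Z n" "padic_of X" "of_rat (X n)"] e by simp
    qed
    then show "\<exists>no. \<forall>n\<ge>no. norm (dist (Z n) (padic_of X) - 0) < e" by blast
  qed
  then show "convergent Z"
    by (metis convergentI tendsto_dist_iff)
qed

section \<open>\<open>\<rat>\<^sub>p\<close>: integers, units, symbols\<close>

definition Zp :: "'p::prime_card padic set" where
  "Zp = {x. padic_abs x \<le> 1}"

definition Zp_units :: "'p::prime_card padic set" where
  "Zp_units = {x. padic_abs x = 1}"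

definition pZp :: "nat \<Rightarrow> 'p::prime_card padic set" where
  "pZp m = {of_nat CARD('p) ^ m * z | z. z \<in> Zp}"

definition padic_ord :: "'p::prime_card padic \<Rightarrow> int" where
  "padic_ord x = (THE k. padic_abs x = real CARD('p) powi (- k))"

text \<open>Only used for nonzero arguments.\<close>

definition hilbert :: "'p::prime_card padic \<Rightarrow> 'p padic \<Rightarrow> int" where
  "hilbert a b =
     (if \<exists>x y z. (x, y, z) \<noteq> (0, 0, 0) \<and> z^2 = a * x^2 + b * y^2 then 1 else - 1)"

definition unit_filtration :: "nat \<Rightarrow> 'p::prime_card padic set" where
  "unit_filtration n = (if n = 0 then Zp_units else {u. u - 1 \<in> pZp n})"

definition conductor_exp :: "('p::prime_card padic \<Rightarrow> complex) \<Rightarrow> nat" where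
  "conductor_exp \<xi> = (LEAST n. \<forall>u\<in>unit_filtration n. \<xi> u = 1)"

definition legendre_char :: "'p::prime_card padic \<Rightarrow> complex" where
  "legendre_char u = of_int (Legendre (SOME r. u - of_int r \<in> pZp 1) (int CARD('p)))"

definition quad_char :: "'p::prime_card padic \<Rightarrow> 'p padic \<Rightarrow> complex" where
  "quad_char a x = of_int (hilbert a x)"

section \<open>The metaplectic group\<close>

definition mat2 :: "'a \<Rightarrow> 'a \<Rightarrow> 'a \<Rightarrow> 'a \<Rightarrow> 'a::zero^2^2" where
  "mat2 a b c d = vector [vector [a, b], vector [c, d]]"

definition xmat :: "'p::prime_card padic \<Rightarrow> 'p padic^2^2" where
  "xmat s = mat2 1 s 0 1"

definition hmat :: "'p::prime_card padic \<Rightarrow> 'p padic^2^2" where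
  "hmat t = mat2 t 0 0 (inverse t)"

definition wmat :: "'p::prime_card padic^2^2" where
  "wmat = mat2 0 1 (- 1) 0"

definition SL2 :: "('p::prime_card padic^2^2) set" where
  "SL2 = {A. det A = 1}"

definition K0 :: "nat \<Rightarrow> ('p::prime_card padic^2^2) set" where
  "K0 m = {A \<in> SL2. (\<forall>i j. A $ i $ j \<in> Zp) \<and> A $ 2 $ 1 \<in> pZp m}"

definition Kcong :: "nat \<Rightarrow> ('p::prime_card padic^2^2) set" where
  "Kcong n = {A \<in> SL2. \<forall>i j. (A - mat 1) $ i $ j \<in> pZp n}"

definition tau :: "'p::prime_card padic^2^2 \<Rightarrow> 'p padic" where
  "tau A = (if A $ 2 $ 1 \<noteq> 0 then A $ 2 $ 1 else A $ 2 $ 2)"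

definition s_sign :: "'p::prime_card padic^2^2 \<Rightarrow> int" where
  "s_sign A =
     (if A $ 2 $ 1 * A $ 2 $ 2 \<noteq> 0 \<and> odd (padic_ord (A $ 2 $ 1))
      then hilbert (A $ 2 $ 1) (A $ 2 $ 2) else 1)"

definition cocycle :: "'p::prime_card padic^2^2 \<Rightarrow> 'p padic^2^2 \<Rightarrow> int" where
  "cocycle g h =
     hilbert (tau (g ** h) * tau g) (tau (g ** h) * tau h) * s_sign g * s_sign h * s_sign (g ** h)"

type_synonym 'p mp = "('p padic^2^2) \<times> int"

definition Mp :: "'p::prime_card mp set" where
  "Mp = SL2 \<times> {1, - 1}"

definition mp_mult :: "'p::prime_card mp \<Rightarrow> 'p mp \<Rightarrow> 'p mp" where
  "mp_mult x y = (fst x ** fst y, snd x * snd y * cocycle (fst x) (fst y))"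

text \<open>
  The topology of the metaplectic group is the one for which the subgroups
  \<open>Kcong n \<times> {1}\<close> form a neighbourhood basis of the identity. It is not the product topology
  of \<open>SL2 \<times> {1, - 1}\<close>, because the cocycle is not locally constant.
\<close>

definition mp_locally_constant :: "('p::prime_card mp \<Rightarrow> complex) \<Rightarrow> bool" where
  "mp_locally_constant f \<longleftrightarrow>
     (\<forall>x\<in>Mp. \<exists>n. \<forall>k\<in>Kcong n. f (mp_mult x (k, 1)) = f x)"

section \<open>Representations on spaces of functions\<close>

text \<open>
  All representations occur on subspaces of spaces of complex functions. A representation is
  given by the subspace \<open>V\<close> and the action \<open>\<rho>\<close>, of which only the values on \<open>Mp\<close> and \<open>V\<close> matter.
\<close>

definition cscale :: "complex \<Rightarrow> ('x \<Rightarrow> complex) \<Rightarrow> 'x \<Rightarrow> complex" where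
  "cscale c f = (\<lambda>x. c * f x)"

interpretation cfun: vector_space "cscale :: complex \<Rightarrow> ('x \<Rightarrow> complex) \<Rightarrow> _"
  by standard (simp_all add: cscale_def fun_eq_iff algebra_simps)

text \<open>\<open>cfun.dim\<close> is \<open>0\<close> on infinite-dimensional spaces, hence the explicit finite basis.\<close>

definition has_dim :: "('x \<Rightarrow> complex) set \<Rightarrow> nat \<Rightarrow> bool" where
  "has_dim V n \<longleftrightarrow>
     (\<exists>B. finite B \<and> card B = n \<and> B \<subseteq> V \<and> cfun.independent B \<and> cfun.span B = V)"

definition linear_on_space ::
  "('x \<Rightarrow> complex) set \<Rightarrow> (('x \<Rightarrow> complex) \<Rightarrow> ('y \<Rightarrow> complex)) \<Rightarrow> bool" where
  "linear_on_space V T \<longleftrightarrow>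
     (\<forall>u\<in>V. \<forall>v\<in>V. T (u + v) = T u + T v) \<and> (\<forall>c. \<forall>v\<in>V. T (cscale c v) = cscale c (T v))"

definition mp_representation ::
  "('x \<Rightarrow> complex) set \<Rightarrow> ('p::prime_card mp \<Rightarrow> ('x \<Rightarrow> complex) \<Rightarrow> 'x \<Rightarrow> complex) \<Rightarrow> bool" where
  "mp_representation V \<rho> \<longleftrightarrow>
     cfun.subspace V \<and>
     (\<forall>g\<in>Mp. \<rho> g ` V \<subseteq> V \<and> linear_on_space V (\<rho> g)) \<and>
     (\<forall>v\<in>V. \<rho> (mat 1, 1) v = v) \<and>
     (\<forall>g\<in>Mp. \<forall>h\<in>Mp. \<forall>v\<in>V. \<rho> (mp_mult g h) v = \<rho> g (\<rho> h v))"

definition mp_intertwiner ::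
  "('x \<Rightarrow> complex) set \<Rightarrow> ('p::prime_card mp \<Rightarrow> ('x \<Rightarrow> complex) \<Rightarrow> 'x \<Rightarrow> complex) \<Rightarrow>
   ('y \<Rightarrow> complex) set \<Rightarrow> ('p mp \<Rightarrow> ('y \<Rightarrow> complex) \<Rightarrow> 'y \<Rightarrow> complex) \<Rightarrow>
   (('x \<Rightarrow> complex) \<Rightarrow> 'y \<Rightarrow> complex) \<Rightarrow> bool" where
  "mp_intertwiner V \<rho> V' \<rho>' T \<longleftrightarrow>
     T ` V \<subseteq> V' \<and> linear_on_space V T \<and> (\<forall>g\<in>Mp. \<forall>v\<in>V. T (\<rho> g v) = \<rho>' g (T v))"

text \<open>
  For \<open>m = 0\<close> the lower right entry need not be a unit; \<open>isotypic\<close> is only meaningful for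
  \<open>m \<ge> conductor_exp \<eta>\<close>, and for \<open>m = 0\<close> only with \<open>\<eta>\<close> constantly \<open>1\<close>.
\<close>

definition isotypic ::
  "('x \<Rightarrow> complex) set \<Rightarrow> ('p::prime_card mp \<Rightarrow> ('x \<Rightarrow> complex) \<Rightarrow> 'x \<Rightarrow> complex) \<Rightarrow>
   ('p padic \<Rightarrow> complex) \<Rightarrow> nat \<Rightarrow> ('x \<Rightarrow> complex) set" where
  "isotypic V \<rho> \<eta> m =
     {v \<in> V. \<forall>k\<in>K0 m. \<forall>\<epsilon>\<in>{1, - 1}. \<rho> (k, \<epsilon>) v = cscale (of_int \<epsilon> * \<eta> (k $ 2 $ 2)) v}"

definition is_eta_conductor ::
  "('x \<Rightarrow> complex) set \<Rightarrow> ('p::prime_card mp \<Rightarrow> ('x \<Rightarrow> complex) \<Rightarrow> 'x \<Rightarrow> complex) \<Rightarrow>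
   ('p padic \<Rightarrow> complex) \<Rightarrow> nat \<Rightarrow> bool" where
  "is_eta_conductor V \<rho> \<eta> n \<longleftrightarrow>
     conductor_exp \<eta> \<le> n \<and> isotypic V \<rho> \<eta> n \<noteq> {0} \<and>
     (\<forall>m. conductor_exp \<eta> \<le> m \<and> m < n \<longrightarrow> isotypic V \<rho> \<eta> m = {0})"

section \<open>Additive characters, Fourier transform, Weil index\<close>

definition additive_character :: "('p::prime_card padic \<Rightarrow> complex) \<Rightarrow> bool" where
  "additive_character \<psi> \<longleftrightarrow>
     (\<forall>x y. \<psi> (x + y) = \<psi> x * \<psi> y) \<and> (\<forall>x. cmod (\<psi> x) = 1) \<and> continuous_on UNIV \<psi>"

definition conductor_zero :: "('p::prime_card padic \<Rightarrow> complex) \<Rightarrow> bool" where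
  "conductor_zero \<psi> \<longleftrightarrow>
     (\<forall>x\<in>Zp. \<psi> x = 1) \<and> (\<exists>x\<in>Zp. \<psi> (x / of_nat CARD('p)) \<noteq> 1)"

definition twist :: "('p::prime_card padic \<Rightarrow> complex) \<Rightarrow> 'p padic \<Rightarrow> 'p padic \<Rightarrow> complex" where
  "twist \<psi> a = (\<lambda>x. \<psi> (a * x))"

text \<open>Normalized by \<open>vol(Zp) = 1\<close>; this determines the translation invariant measure.\<close>

definition haar :: "'p::prime_card padic measure" where
  "haar = (SOME M. sets M = sets borel \<and> (\<forall>a. distr M borel ((+) a) = M) \<and> emeasure M Zp = 1)"

definition schwartz :: "('p::prime_card padic \<Rightarrow> complex) set" where
  "schwartz =
     {\<phi>. (\<forall>x. eventually (\<lambda>y. \<phi> y = \<phi> x) (nhds x)) \<and> compact (closure {x. \<phi> x \<noteq> 0})}"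

text \<open>The Haar measure that is self-dual for \<open>\<xi>\<close> is \<open>self_dual_factor \<xi>\<close> times \<open>haar\<close>.\<close>

definition self_dual_factor :: "('p::prime_card padic \<Rightarrow> complex) \<Rightarrow> real" where
  "self_dual_factor \<xi> =
     (THE c. c > 0 \<and> (\<forall>\<phi>\<in>schwartz. \<forall>y.
        of_real c * (LINT x|haar. of_real c * (LINT z|haar. \<phi> z * \<xi> (z * x)) * \<xi> (x * y)) = \<phi> (- y)))"

definition fourier ::
  "('p::prime_card padic \<Rightarrow> complex) \<Rightarrow> ('p padic \<Rightarrow> complex) \<Rightarrow> 'p padic \<Rightarrow> complex" where
  "fourier \<xi> \<phi> y = of_real (self_dual_factor \<xi>) * (LINT x|haar. \<phi> x * \<xi> (x * y))"

text \<open>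
  Weil's definition: the Fourier transform, as a distribution, of the character of second degree
  \<open>x \<mapsto> \<psi>'(x\<^sup>2)\<close> with respect to its associated pairing \<open>\<psi>'(2xy)\<close> is \<open>\<gamma>\<close> times its inverse.
\<close>

definition weil_index :: "('p::prime_card padic \<Rightarrow> complex) \<Rightarrow> complex" where
  "weil_index \<psi>' =
     (THE \<gamma>. \<forall>\<phi>\<in>schwartz.
        (LINT x|haar. fourier (twist \<psi>' 2) \<phi> x * \<psi>' (x^2)) =
        \<gamma> * (LINT x|haar. \<phi> x * inverse (\<psi>' (x^2))))"

definition gamma_rel :: "'p::prime_card padic \<Rightarrow> ('p padic \<Rightarrow> complex) \<Rightarrow> complex" where
  "gamma_rel a \<psi>' = weil_index (twist \<psi>' a) / weil_index \<psi>'"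

section \<open>The representations\<close>

definition abs_pow :: "'p::prime_card padic \<Rightarrow> real \<Rightarrow> complex" where
  "abs_pow x s = of_real (padic_abs x powr s)"

text \<open>
  Functions on the metaplectic group are functions on the ambient type of pairs that vanish
  outside \<open>Mp\<close>.
\<close>

definition principal_series ::
  "('p::prime_card padic \<Rightarrow> complex) \<Rightarrow> ('p padic \<Rightarrow> complex) \<Rightarrow> ('p mp \<Rightarrow> complex) set" where
  "principal_series \<psi> \<mu> =
     {f. (\<forall>g. g \<notin> Mp \<longrightarrow> f g = 0) \<and> mp_locally_constant f \<and>
         (\<forall>a b \<epsilon>. \<forall>g\<in>Mp. a \<noteq> 0 \<and> \<epsilon> \<in> {1, - 1} \<longrightarrow>
            f (mp_mult (hmat a ** xmat b, \<epsilon>) g) =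
              of_int \<epsilon> * of_real (padic_abs a) * \<mu> a * inverse (gamma_rel a \<psi>) * f g)}"

definition right_translation ::
  "'p::prime_card mp \<Rightarrow> ('p mp \<Rightarrow> complex) \<Rightarrow> 'p mp \<Rightarrow> complex" where
  "right_translation h f = (\<lambda>g. if g \<in> Mp then f (mp_mult g h) else 0)"

text \<open>
  The group is generated by the elements in the last three clauses, so these determine the
  representation.
\<close>

definition weil_representation ::
  "('p::prime_card padic \<Rightarrow> complex) \<Rightarrow>
   ('p mp \<Rightarrow> ('p padic \<Rightarrow> complex) \<Rightarrow> 'p padic \<Rightarrow> complex) \<Rightarrow> bool" where
  "weil_representation \<psi>' \<omega> \<longleftrightarrow>
     mp_representation schwartz \<omega> \<and>
     (\<forall>\<phi>\<in>schwartz. \<forall>a \<epsilon> y. a \<noteq> 0 \<and> \<epsilon> \<in> {1, - 1} \<longrightarrow>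
        \<omega> (hmat a, \<epsilon>) \<phi> y =
          of_int \<epsilon> * abs_pow a (1/2) * inverse (gamma_rel a \<psi>') * \<phi> (a * y)) \<and>
     (\<forall>\<phi>\<in>schwartz. \<forall>b y. \<omega> (xmat b, 1) \<phi> y = \<psi>' (b * y^2) * \<phi> y) \<and>
     (\<forall>\<phi>\<in>schwartz. \<forall>y. \<omega> (wmat, 1) \<phi> y = weil_index \<psi>' * fourier (twist \<psi>' 2) \<phi> y)"

definition even_schwartz :: "('p::prime_card padic \<Rightarrow> complex) set" where
  "even_schwartz = {\<phi> \<in> schwartz. \<forall>y. \<phi> (- y) = \<phi> y}"

text \<open>
  \<open>St\<close> is the kernel in the exact sequence
  \<open>0 \<rightarrow> St \<rightarrow> principal_series \<psi> (\<mu>\<^sub>a|\<cdot>|\<^sup>1\<^sup>/\<^sup>2) \<rightarrow> even_schwartz \<rightarrow> 0\<close> of representations,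
  where \<open>\<omega>\<close> is the Weil representation of \<open>twist \<psi> a\<close>. Irreducibility of the kernel is a
  consequence and not imposed.
\<close>

definition steinberg ::
  "('p::prime_card padic \<Rightarrow> complex) \<Rightarrow> 'p padic \<Rightarrow>
   ('p mp \<Rightarrow> ('p padic \<Rightarrow> complex) \<Rightarrow> 'p padic \<Rightarrow> complex) \<Rightarrow> ('p mp \<Rightarrow> complex) set \<Rightarrow> bool" where
  "steinberg \<psi> a \<omega> S \<longleftrightarrow>
     (let V = principal_series \<psi> (\<lambda>x. quad_char a x * abs_pow x (1/2)) in
      \<exists>T. mp_intertwiner V right_translation even_schwartz \<omega> T \<and> T ` V = even_schwartz \<and>
          S = {f \<in> V. T f = 0})"

end

theory Submission
  imports Defs "HOL-Number_Theory.Number_Theory"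
begin

text \<open>
  By the Iwasawa decomposition a vector in the principal series is a function on \<open>SL2(Zp)\<close> with a
  prescribed behaviour on the left under the Borel subgroup; the cocycle is trivial there, so an
  isotypic vector is determined by its values on representatives of the double cosets
  \<open>B(Zp) \ K / K0 m\<close>. A double coset carries such a function exactly if the two characters agree on
  the stabilizer. When only one of \<open>\<mu>\<^sub>a\<close>, \<open>\<eta>\<close> is ramified, the cosets of \<open>1\<close> and \<open>w\<close> drop
  out, and the two vectors of level 2 live on the lower unipotent elements with entry \<open>p\<close> times a
  square or a nonsquare unit.

  In the Schroedinger model the unipotent elements of \<open>K0 m\<close> turn isotypy into a support condition
  and (through the Fourier transform) a condition of invariance under a lattice, and the torus
  prescribes the behaviour under units. Only the indicator function of \<open>Zp\<close> or the Legendre symbol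
  on the units remain.

  Averaging over the image of \<open>K0 m\<close> in a finite quotient shows that the quotient map from the
  principal series to the Weil representation is surjective on isotypic vectors; hence the
  dimensions for the Steinberg representation are differences.
\<close>

text \<open>On units \<open>\<mu>\<^sub>a\<close> and \<open>\<eta>\<close> are each trivial or the
  Legendre symbol; the Booleans \<open>k\<close> and \<open>l\<close> say which. When they differ,
  the parity hypothesis says that -1 is a square. Two constructions rest on this: a function of a
  unit square may depend on the Legendre symbol of its root, which gives the vectors of level 2, and
  the Legendre symbol on the units is even, hence a vector of the even Weil representation. The
  asymmetry between levels 2 and 3 comes from the order of \<open>a\<close>. Lower unipotents with
  entry in \<open>p^m\<close> amount to a period lattice of exponent
  \<open>floor ((ord a + m) / 2) - ord a\<close>, and the Legendre symbol needs exponent 1; this is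
  first reached at \<open>m = 2\<close> for \<open>ord a = 0\<close> and at \<open>m = 3\<close> for
  \<open>ord a = 1\<close>. The cocycle is given only by a formula in Hilbert symbols. Its
  triviality on \<open>K\<close> and the cocycle identity with a Borel element on the left or
  elements of \<open>K\<close> on the right are derived from that formula, once the Hilbert symbol
  is known explicitly for odd \<open>p\<close>. Weil indices are computed from Gauss sums, since
  both the inducing character and the torus action involve them.\<close>

abbreviation pp :: "'p::prime_card padic" where "pp \<equiv> of_nat CARD('p)"

section \<open>Valuation, balls and residues in \<open>\<rat>\<^sub>p\<close>\<close>

lemma card_gt_1 [simp]: "1 < CARD('p::prime_card)"
  using prime_card[where 'a='p] prime_gt_1_nat by blast

lemma card_real_gt_1 [simp]: "1 < real CARD('p::prime_card)"
  using card_gt_1[where 'p='p] by linarith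

lemma padic_abs_0 [simp]: "padic_abs (0::'p::prime_card padic) = 0"
  by simp

lemma padic_abs_1 [simp]: "padic_abs (1::'p::prime_card padic) = 1"
  using padic_abs_of_rat[of 1, where 'p='p] by simp

lemma padic_abs_pp: "padic_abs (pp::'p::prime_card padic) = 1 / real CARD('p)"
proof -
  have p: "prime CARD('p)" by (rule prime_card)
  have nu: "\<not> is_unit (int CARD('p))" using p by (simp add: prime_nat_iff)
  have "padic_abs (pp::'p padic) = rat_pnorm CARD('p) (of_int (int CARD('p)) / of_int 1)"
    using padic_abs_of_rat[of "of_nat CARD('p)", where 'p='p] by simp
  also have "\<dots> = real CARD('p) powi (int (multiplicity (int CARD('p)) 1)
      - int (multiplicity (int CARD('p)) (int CARD('p))))"
    using p by (intro rat_pnorm_frac) auto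
  also have "\<dots> = 1 / real CARD('p)"
    using nu by (simp add: multiplicity_self power_int_minus inverse_eq_divide)
  finally show ?thesis .
qed

lemma padic_abs_inverse: "padic_abs (inverse x) = inverse (padic_abs (x::'p::prime_card padic))"
proof (cases "x = 0")
  case False
  then have "padic_abs x * padic_abs (inverse x) = 1"
    by (simp flip: padic_abs_mult)
  then show ?thesis by (metis inverse_unique)
qed simp

lemma padic_abs_divide: "padic_abs (x / y) = padic_abs x / padic_abs (y::'p::prime_card padic)"
  by (simp add: divide_inverse padic_abs_mult padic_abs_inverse)

lemma padic_abs_power: "padic_abs (x ^ n) = padic_abs (x::'p::prime_card padic) ^ n"
  by (induction n) (simp_all add: padic_abs_mult)

lemma padic_abs_power_int: "padic_abs (x powi n) = padic_abs (x::'p::prime_card padic) powi n"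
  by (simp add: power_int_def padic_abs_power padic_abs_inverse)

lemma padic_abs_pp_powi: "padic_abs (pp powi n::'p::prime_card padic) = real CARD('p) powi (-n)"
  by (simp add: padic_abs_power_int padic_abs_pp power_int_minus power_int_divide_distrib inverse_eq_divide)

lemma padic_abs_diff_commute: "padic_abs (x - y) = padic_abs (y - x::'p::prime_card padic)"
  using padic_abs_minus[of "x - y"] by simp

lemma padic_abs_ultrametric_diff:
  "padic_abs (x - y) \<le> max (padic_abs x) (padic_abs (y::'p::prime_card padic))"
  using padic_abs_ultrametric[of x "-y"] by simp

text \<open>Every triangle is isosceles for an ultrametric: \<open>x\<close> is also the difference
  of \<open>x + y\<close> and the shorter \<open>y\<close>.\<close>

lemma padic_abs_add_eq:
  assumes "padic_abs y < padic_abs (x::'p::prime_card padic)"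
  shows "padic_abs (x + y) = padic_abs x"
proof -
  have "padic_abs (x + y) \<le> padic_abs x" using padic_abs_ultrametric[of x y] assms by simp
  moreover have "padic_abs x \<le> max (padic_abs (x + y)) (padic_abs y)"
    using padic_abs_ultrametric_diff[of "x + y" y] by simp
  ultimately show ?thesis using assms by linarith
qed

lemma powi_card_less_iff [simp]:
  "real CARD('p::prime_card) powi i < real CARD('p) powi j \<longleftrightarrow> i < j"
  by (metis card_real_gt_1 power_int_strict_increasing linorder_neqE_linordered_idom order_less_asym)

lemma powi_card_le_iff [simp]:
  "real CARD('p::prime_card) powi i \<le> real CARD('p) powi j \<longleftrightarrow> i \<le> j"
  by (metis powi_card_less_iff linorder_not_le)

lemma powi_card_eq_iff [simp]:
  "real CARD('p::prime_card) powi i = real CARD('p) powi j \<longleftrightarrow> i = j"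
  by (metis powi_card_less_iff linorder_neqE_linordered_idom order_less_irrefl)

text \<open>A nonzero element has the same absolute value as any rational that is closer to it than
  0 is, and on rationals the values are powers of \<open>p\<close> by definition.\<close>

lemma padic_value_group:
  assumes "x \<noteq> (0::'p::prime_card padic)"
  obtains k where "padic_abs x = real CARD('p) powi (- k)"
proof -
  have "0 < padic_abs x" using assms padic_abs_eq_0[of x] padic_abs_nonneg[of x] by linarith
  then obtain q where q: "dist x (of_rat q) < padic_abs x" using padic_of_rat_dense by blast
  have "padic_abs (x + (of_rat q - x)) = padic_abs x"
    using q by (intro padic_abs_add_eq) (simp add: dist_padic_def padic_abs_diff_commute)
  then have e: "padic_abs x = rat_pnorm CARD('p) q" by (simp add: padic_abs_of_rat)
  have "q \<noteq> 0" using e assms by auto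
  obtain c d where "quotient_of q = (c, d)" by fastforce
  then have "padic_abs x = real CARD('p) powi (- (int (multiplicity (int CARD('p)) c)
      - int (multiplicity (int CARD('p)) d)))"
    using e \<open>q \<noteq> 0\<close> by (simp add: rat_pnorm_def)
  then show thesis by (rule that)
qed

lemma padic_ord_eq:
  assumes "padic_abs (x::'p::prime_card padic) = real CARD('p) powi (- k)"
  shows "padic_ord x = k"
  unfolding padic_ord_def using assms by (intro the_equality) auto

lemma padic_abs_ord:
  assumes "x \<noteq> (0::'p::prime_card padic)"
  shows "padic_abs x = real CARD('p) powi (- padic_ord x)"
  using padic_value_group[OF assms] padic_ord_eq by metis

lemma padic_ord_mult:
  assumes "x \<noteq> 0" "y \<noteq> (0::'p::prime_card padic)"
  shows "padic_ord (x * y) = padic_ord x + padic_ord y"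
  using assms by (intro padic_ord_eq) (simp add: padic_abs_mult padic_abs_ord flip: power_int_add)

lemma padic_ord_inverse:
  assumes "x \<noteq> (0::'p::prime_card padic)"
  shows "padic_ord (inverse x) = - padic_ord x"
  using assms by (intro padic_ord_eq) (simp add: padic_abs_inverse padic_abs_ord power_int_minus)

lemma padic_ord_divide:
  assumes "x \<noteq> 0" "y \<noteq> (0::'p::prime_card padic)"
  shows "padic_ord (x / y) = padic_ord x - padic_ord y"
  using assms by (simp add: divide_inverse padic_ord_mult padic_ord_inverse)

lemma padic_ord_pp_powi [simp]: "padic_ord (pp powi n::'p::prime_card padic) = n"
  by (intro padic_ord_eq padic_abs_pp_powi)

lemma padic_ord_pp [simp]: "padic_ord (pp::'p::prime_card padic) = 1"
  using padic_ord_pp_powi[of 1] by simp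

lemma padic_ord_minus [simp]: "padic_ord (- x) = padic_ord (x::'p::prime_card padic)"
  by (simp add: padic_ord_def)

lemma Zp_units_iff: "u \<in> Zp_units \<longleftrightarrow> u \<noteq> 0 \<and> padic_ord (u::'p::prime_card padic) = 0"
  by (auto simp: Zp_units_def padic_abs_ord) (metis padic_ord_eq minus_zero power_int_0_right)

text \<open>The fractional ideal \<open>p^n \<int>\<^sub>p\<close> for an integer \<open>n\<close>.
  Unlike \<open>pZp\<close> it allows negative exponents, which dual lattices and supports
  require.\<close>

definition pball :: "int \<Rightarrow> 'p::prime_card padic set" where
  "pball n = {x. padic_abs x \<le> real CARD('p) powi (- n)}"

lemma pball_iff: "x \<in> pball n \<longleftrightarrow> x = (0::'p::prime_card padic) \<or> n \<le> padic_ord x"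
  by (cases "x = 0") (auto simp: pball_def padic_abs_ord)

lemma Zp_pball: "Zp = pball 0" by (simp add: Zp_def pball_def)

lemma Zp_iff: "x \<in> Zp \<longleftrightarrow> x = (0::'p::prime_card padic) \<or> 0 \<le> padic_ord x"
  by (simp add: Zp_pball pball_iff)

lemma pZp_pball: "pZp m = (pball (int m) :: 'p::prime_card padic set)"
proof (intro equalityI subsetI)
  fix x :: "'p padic" assume "x \<in> pZp m"
  then obtain z where "x = pp ^ m * z" "z \<in> Zp" by (auto simp: pZp_def)
  then show "x \<in> pball (int m)"
    using padic_ord_pp_powi[of "int m", where 'p='p]
    by (cases "z = 0") (auto simp: pball_iff Zp_iff padic_ord_mult)
next
  fix x :: "'p padic" assume "x \<in> pball (int m)"
  then have "x / pp ^ m \<in> Zp" using padic_ord_pp_powi[of "int m", where 'p='p]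
    by (cases "x = 0") (auto simp: pball_iff Zp_iff padic_ord_divide)
  moreover have "x = pp ^ m * (x / pp ^ m)" by simp
  ultimately show "x \<in> pZp m" unfolding pZp_def by blast
qed

lemma pball_add: "x \<in> pball n \<Longrightarrow> y \<in> pball n \<Longrightarrow> x + y \<in> pball n"
  unfolding pball_def using padic_abs_ultrametric[of x y] by auto

lemma pball_minus_iff [simp]: "- x \<in> pball n \<longleftrightarrow> x \<in> pball n"
  by (simp add: pball_def)

lemma pball_diff: "x \<in> pball n \<Longrightarrow> y \<in> pball n \<Longrightarrow> x - y \<in> pball n"
  using pball_add[of x n "-y"] by simp

lemma pball_diff_commute: "x - y \<in> pball n \<longleftrightarrow> y - x \<in> pball n"
  using pball_minus_iff[of "x - y" n] by simp

lemma pball_0 [simp]: "0 \<in> pball n" by (simp add: pball_iff)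

lemma pball_mult: "x \<in> pball m \<Longrightarrow> y \<in> pball n \<Longrightarrow> x * y \<in> pball (m + n)"
  by (cases "x = 0 \<or> y = 0") (auto simp: pball_iff padic_ord_mult)

lemma pball_mono: "m \<le> n \<Longrightarrow> x \<in> pball n \<Longrightarrow> x \<in> pball m"
  by (auto simp: pball_iff)

lemma pball_1 [simp]: "(1::'p::prime_card padic) \<in> pball 0" by (simp add: pball_def)

lemma pball_of_nat [simp]: "of_nat n \<in> pball 0"
  by (induction n) (auto intro: pball_add)

lemma pball_of_int [simp]: "of_int n \<in> pball 0"
  by (cases n) (auto simp: pball_diff)

lemma cball_pball: "y \<in> cball (x::'p::prime_card padic) (real CARD('p) powi (-n)) \<longleftrightarrow> y - x \<in> pball n"
  by (auto simp: pball_def dist_padic_def padic_abs_diff_commute)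

lemma units_mult: "u \<in> Zp_units \<Longrightarrow> v \<in> Zp_units \<Longrightarrow> u * v \<in> (Zp_units::'p::prime_card padic set)"
  by (simp add: Zp_units_def padic_abs_mult)

lemma units_inverse: "u \<in> Zp_units \<Longrightarrow> inverse u \<in> (Zp_units::'p::prime_card padic set)"
  by (simp add: Zp_units_def padic_abs_inverse)

lemma units_divide: "u \<in> Zp_units \<Longrightarrow> v \<in> Zp_units \<Longrightarrow> u / v \<in> (Zp_units::'p::prime_card padic set)"
  by (simp add: Zp_units_def padic_abs_divide)

lemma units_minus [simp]: "- u \<in> Zp_units \<longleftrightarrow> u \<in> (Zp_units::'p::prime_card padic set)"
  by (simp add: Zp_units_def)

lemma units_1 [simp]: "1 \<in> (Zp_units::'p::prime_card padic set)"
  by (simp add: Zp_units_def)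

lemma units_nonzero: "u \<in> Zp_units \<Longrightarrow> u \<noteq> (0::'p::prime_card padic)"
  by (auto simp: Zp_units_def)

lemma units_pball: "u \<in> Zp_units \<longleftrightarrow> u \<in> pball 0 \<and> u \<notin> pball 1"
  by (auto simp: Zp_units_iff pball_iff)

lemma units_add_pball: "u \<in> Zp_units \<Longrightarrow> z \<in> pball 1 \<Longrightarrow> u + z \<in> (Zp_units::'p::prime_card padic set)"
  by (metis (no_types, opaque_lifting) units_pball pball_add pball_diff add_diff_cancel_right' pball_mono zero_le_one)

lemma units_mult_pball: "u \<in> Zp_units \<Longrightarrow> u * z \<in> pball n \<longleftrightarrow> z \<in> pball n"
  by (cases "z = 0") (auto simp: pball_iff Zp_units_iff padic_ord_mult)

lemma of_int_pball_iff:
  "(of_int j :: 'p::prime_card padic) \<in> pball (int n) \<longleftrightarrow> int CARD('p) ^ n dvd j"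
proof (cases "j = 0")
  case False
  have p: "prime CARD('p)" by (rule prime_card)
  have nu: "\<not> is_unit (int CARD('p))" using p by (simp add: prime_nat_iff)
  have "padic_abs (of_int j :: 'p padic) = rat_pnorm CARD('p) (of_int j / of_int 1)"
    using padic_abs_of_rat[of "of_int j", where 'p='p] by simp
  also have "\<dots> = real CARD('p) powi (int (multiplicity (int CARD('p)) 1) - int (multiplicity (int CARD('p)) j))"
    using p False by (intro rat_pnorm_frac) auto
  finally have "padic_abs (of_int j :: 'p padic) = real CARD('p) powi (- int (multiplicity (int CARD('p)) j))"
    by simp
  then have "padic_ord (of_int j :: 'p padic) = int (multiplicity (int CARD('p)) j)"
    by (rule padic_ord_eq)
  then show ?thesis using False nu by (simp add: pball_iff power_dvd_iff_le_multiplicity)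
qed simp

lemma of_nat_pball_iff:
  "(of_nat j :: 'p::prime_card padic) \<in> pball (int n) \<longleftrightarrow> CARD('p) ^ n dvd j"
  using of_int_pball_iff[of "int j" n, where 'p='p]
  by (metis int_dvd_int_iff of_int_of_nat_eq of_nat_power)

text \<open>A rational \<open>c / d\<close> in lowest terms that is close to \<open>z\<close> is
  itself integral, so \<open>p\<close> does not divide \<open>d\<close> and \<open>d\<close> has an
  inverse modulo \<open>p^n\<close>.\<close>

lemma Zp_approx_int:
  assumes "z \<in> (Zp::'p::prime_card padic set)"
  obtains j :: int where "z - of_int j \<in> pball (int n)"
proof -
  obtain q where q: "dist z (of_rat q) < real CARD('p) powi (- int n)"
    using padic_of_rat_dense[of "real CARD('p) powi (- int n)" z] by auto
  then have zq: "z - of_rat q \<in> pball (int n)"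
    by (simp add: pball_def dist_padic_def)
  then have "of_rat q \<in> (pball 0 :: 'p padic set)"
    using assms pball_mono[of 0 "int n" "z - of_rat q"] pball_diff[of z 0 "z - of_rat q"] by (simp add: Zp_pball)
  obtain c d where cd: "quotient_of q = (c, d)" by fastforce
  have d: "d > 0" "coprime c d" "q = of_int c / of_int d"
    using quotient_of_denom_pos[OF cd] quotient_of_coprime[OF cd] quotient_of_div[OF cd] by auto
  have cdq: "(of_rat q :: 'p padic) = of_int c / of_int d" by (simp add: d of_rat_divide)
  have nd: "\<not> int CARD('p) dvd d"
  proof
    assume dvd: "int CARD('p) dvd d"
    then have "of_int d \<in> (pball 1 :: 'p padic set)" using of_int_pball_iff[of d 1, where 'p='p] by simp
    then have "of_rat q * of_int d \<in> (pball 1 :: 'p padic set)"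
      using pball_mult[OF \<open>of_rat q \<in> pball 0\<close>] by fastforce
    then have "int CARD('p) dvd c" using of_int_pball_iff[of c 1, where 'p='p] d(1) by (simp add: cdq)
    then have "is_unit (int CARD('p))" using dvd d(2) by (meson coprime_common_divisor)
    then show False using card_gt_1[where 'p='p] by simp
  qed
  then have "coprime d (int CARD('p) ^ n)"
    using prime_card[where 'a='p] prime_imp_coprime by (metis coprime_commute coprime_power_right_iff prime_nat_int_transfer)
  then obtain e where e: "[d * e = 1] (mod (int CARD('p) ^ n))"
    using cong_solve_coprime_int by blast
  have "int CARD('p) ^ n dvd d * (c * e) - c"
  proof -
    have "d * (c * e) - c = c * (d * e - 1)" by (simp add: algebra_simps)
    then show ?thesis using e by (simp add: cong_iff_dvd_diff)
  qed
  then have "(of_int (d * (c * e) - c) :: 'p padic) \<in> pball (int n)"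
    by (simp only: of_int_pball_iff)
  moreover have "(of_int d::'p padic) \<in> Zp_units"
    using nd of_int_pball_iff[of d 1, where 'p='p] by (simp add: units_pball)
  moreover have "(of_int (d * (c * e) - c) :: 'p padic) = of_int d * (of_int (c * e) - of_rat q)"
    using d(1) by (simp add: cdq field_simps)
  ultimately have "of_int (c * e) - of_rat q \<in> (pball (int n) :: 'p padic set)"
    using units_mult_pball by metis
  then have "z - of_int (c * e) \<in> pball (int n)"
    using pball_diff[OF zq] by fastforce
  then show thesis by (rule that)
qed

lemma Zp_residue:
  assumes "z \<in> (Zp::'p::prime_card padic set)"
  obtains j where "j < CARD('p) ^ n" "z - of_nat j \<in> pball (int n)"
proof -
  obtain i where i: "z - of_int i \<in> pball (int n)" using Zp_approx_int[OF assms] .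
  let ?q = "int CARD('p) ^ n"
  define j where "j = nat (i mod ?q)"
  have pos: "?q > 0" using card_gt_1[where 'p='p] by simp
  then have ij: "int j = i mod ?q" by (simp add: j_def)
  have "(of_int (i - int j) :: 'p padic) \<in> pball (int n)"
    unfolding of_int_pball_iff by (simp add: ij minus_mod_eq_mult_div)
  then have "z - of_int i + (of_int i - of_nat j) \<in> pball (int n)"
    by (intro pball_add[OF i]) simp
  moreover have "int j < ?q" using pos by (simp add: ij)
  ultimately show thesis by (intro that[of j]) (simp_all flip: of_nat_power)
qed

lemma of_nat_residue_inj:
  assumes "(of_nat i - of_nat j :: 'p::prime_card padic) \<in> pball (int n)" "i < CARD('p) ^ n" "j < CARD('p) ^ n"
  shows "i = j"
proof -
  have "int CARD('p) ^ n dvd int i - int j"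
    using assms(1) of_int_pball_iff[of "int i - int j" n, where 'p='p] by simp
  then have "[int i = int j] (mod int (CARD('p) ^ n))" by (simp add: cong_iff_dvd_diff)
  then have "[i = j] (mod (CARD('p) ^ n))" by (simp only: cong_int_iff)
  then show ?thesis using assms by (simp add: cong_less_modulus_unique_nat)
qed

text \<open>Closed in a complete space, and totally bounded because after scaling the ball meets
  only finitely many residue classes modulo \<open>p^m\<close>.\<close>

lemma compact_pball [simp]: "compact (pball n :: 'p::prime_card padic set)"
proof -
  have eq: "(pball n :: 'p padic set) = cball 0 (real CARD('p) powi (-n))"
    by (auto simp: pball_def dist_padic_def)
  have "complete (pball n :: 'p padic set)" by (simp add: complete_eq_closed eq)
  moreover have "\<exists>k. finite k \<and> pball n \<subseteq> (\<Union>x\<in>k. ball (x::'p padic) e)" if "e > 0" for e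
  proof -
    obtain N where N: "(1 / real CARD('p)) ^ N < e" 
      using real_arch_pow_inv[OF \<open>e > 0\<close>, of "1 / real CARD('p)"] card_real_gt_1[where 'p='p]
      by (auto simp del: card_real_gt_1)
    define m where "m = nat (int N - n)"
    let ?k = "(\<lambda>j. pp powi n * of_nat j) ` {..<CARD('p) ^ m} :: 'p padic set"
    have "x \<in> (\<Union>x\<in>?k. ball x e)" if "x \<in> pball n" for x :: "'p padic"
    proof -
      have "x * pp powi (-n) \<in> Zp"
        using that by (cases "x = 0") (auto simp: Zp_iff pball_iff padic_ord_mult)
      then obtain j where j: "j < CARD('p) ^ m" "x * pp powi (-n) - of_nat j \<in> pball (int m)"
        using Zp_residue by blast
      have "pp powi n * (x * pp powi (-n) - of_nat j) \<in> pball (n + int m)"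
        using j by (intro pball_mult) (simp_all add: pball_iff)
      moreover have "pp powi n * (x * pp powi (-n) - of_nat j) = x - pp powi n * of_nat j"
        by (simp add: algebra_simps power_int_minus)
      ultimately have "x - pp powi n * of_nat j \<in> pball (int N)"
        using pball_mono[of "int N" "n + int m" "x - pp powi n * of_nat j"] by (simp add: m_def)
      then have "dist (pp powi n * of_nat j) x < e"
        using N by (simp add: pball_def dist_padic_def padic_abs_diff_commute power_int_minus power_divide inverse_eq_divide)
      then show ?thesis using j by auto
    qed
    then show ?thesis by (intro exI[of _ ?k]) auto
  qed
  ultimately show ?thesis by (simp add: compact_eq_totally_bounded)
qed

section \<open>Squares of units, Hensel's lemma and the Legendre symbol\<close>

definition leg :: "'p::prime_card padic \<Rightarrow> int" where
  "leg u = (if \<exists>x. x^2 = u then 1 else - 1)"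

lemma leg_cases: "leg u = 1 \<or> leg u = - 1"
  by (simp add: leg_def)

lemma leg_square_eq_1 [simp]: "leg u * leg u = 1"
  by (simp add: leg_def)

lemma leg_nonzero [simp]: "leg u \<noteq> 0"
  by (simp add: leg_def)

lemma leg_power2 [simp]: "leg (x^2) = 1"
  by (auto simp: leg_def)

lemma leg_1 [simp]: "leg 1 = 1"
  using leg_power2[of 1] by simp

lemma Zp_units_of_power2:
  assumes "x^2 \<in> Zp_units"
  shows "x \<in> (Zp_units::'p::prime_card padic set)"
  using assms padic_abs_nonneg[of x] by (simp add: Zp_units_def padic_abs_power power2_eq_1_iff)

locale odd_padic =
  fixes p_type :: "'p::prime_card itself"
  assumes odd_card: "odd CARD('p)"
begin

lemma card_gt_2: "2 < CARD('p)"
  using card_gt_1[where 'p='p] odd_card by (metis Suc_lessI even_numeral numeral_2_eq_2 One_nat_def)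

lemma two_unit: "2 \<in> (Zp_units :: 'p padic set)"
proof -
  have "\<not> CARD('p) ^ 1 dvd 2" using card_gt_2 by (auto dest: dvd_imp_le)
  then show ?thesis using of_nat_pball_iff[of 2 1, where 'p='p] pball_of_nat[of 2, where 'a='p]
    by (simp add: units_pball)
qed

text \<open>Newton's iteration with the derivative frozen at \<open>2 r\<close> maps the residue
  disc of \<open>r\<close> to itself and contracts it by the factor \<open>1 / p\<close>; its fixed
  point is the root.\<close>

lemma hensel_square:
  fixes u r :: "'p padic"
  assumes r: "r \<in> Zp_units" and ur: "u - r^2 \<in> pball 1"
  obtains x where "x^2 = u" "x - r \<in> pball 1"
proof -
  define c where "c = 1 / real CARD('p)"
  define S where "S = cball r (real CARD('p) powi (-1))"
  define f where "f x = x - (x^2 - u) / (2 * r)" for x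
  have c: "0 \<le> c" "c < 1" using card_real_gt_1[where 'p='p] by (simp_all add: c_def del: card_real_gt_1)
  have r2: "2 * r \<in> Zp_units" using two_unit r by (rule units_mult)
  then have i2: "inverse (2 * r) \<in> pball 0" using units_inverse units_pball by blast
  have rz: "r \<noteq> 0" "2 * r \<noteq> 0" using r r2 units_nonzero by blast+
  have S: "x \<in> S \<longleftrightarrow> x - r \<in> pball 1" for x
    unfolding S_def by (rule cball_pball)
  have fS: "f x \<in> S" if "x \<in> S" for x
  proof -
    have x: "x - r \<in> pball 1" using that S by blast
    have "x^2 - u = (x - r) * (x - r) + 2 * r * (x - r) - (u - r^2)"
      by (simp add: power2_eq_square algebra_simps)
    moreover have "(x - r) * (x - r) \<in> pball 1" "2 * r * (x - r) \<in> pball 1"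
      using pball_mult[OF x x] x r2 pball_mono[of 1 2] by (auto simp: units_mult_pball)
    ultimately have "x^2 - u \<in> pball 1" using ur by (metis pball_add pball_diff)
    then have "(x^2 - u) * inverse (2 * r) \<in> pball (1 + 0)" using i2 by (rule pball_mult)
    then have "x - r - (x^2 - u) / (2 * r) \<in> pball 1" 
      using pball_diff[OF x, of "(x^2 - u) * inverse (2 * r)"] unfolding divide_inverse by simp
    moreover have "f x - r = x - r - (x^2 - u) / (2 * r)" by (simp add: f_def)
    ultimately show ?thesis using S[of "f x"] by metis
  qed
  have lip: "dist (f x) (f y) \<le> c * dist x y" if "x \<in> S" "y \<in> S" for x y
  proof -
    have x: "x - r \<in> pball 1" "y - r \<in> pball 1" using that S by blast+
    have e: "f x - f y = (- ((x - r) + (y - r)) * inverse (2 * r)) * (x - y)"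
      using rz by (simp add: f_def field_simps power2_eq_square)
    have "- ((x - r) + (y - r)) * inverse (2 * r) \<in> pball (1 + 0)"
      using pball_add[OF x] i2 by (intro pball_mult) (simp_all only: pball_minus_iff)
    then have "padic_abs (- ((x - r) + (y - r)) * inverse (2 * r)) \<le> c"
      by (simp add: pball_def c_def inverse_eq_divide power_int_minus)
    then show ?thesis unfolding dist_padic_def e padic_abs_mult by (intro mult_right_mono) auto
  qed
  have "complete S" by (simp add: complete_eq_closed S_def)
  moreover have "S \<noteq> {}" using S[of r] by auto
  ultimately have "\<exists>!x\<in>S. f x = x" using c fS lip by (intro Banach_fix[where c=c]) auto
  then obtain x where "x \<in> S" "f x = x" by blast
  then show thesis using rz S by (intro that[of x]) (auto simp: f_def)
qed

text \<open>\<open>leg\<close> tests for squares in the whole field. For units this is decided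
  modulo \<open>p\<close>: a root of a unit is a unit and has an integer approximation, and
  conversely a root modulo \<open>p\<close> lifts by Hensel's lemma.\<close>

lemma leg_eq_1_iff_residue:
  fixes u :: "'p padic"
  assumes u: "u \<in> Zp_units"
  shows "leg u = 1 \<longleftrightarrow> (\<exists>j::int. u - of_int j ^ 2 \<in> pball 1)"
proof
  assume "leg u = 1"
  then obtain x where x: "x^2 = u" by (auto simp: leg_def split: if_splits)
  then have xu: "x \<in> Zp" using u Zp_units_of_power2[of x] by (simp add: Zp_pball units_pball)
  obtain j where j: "x - of_int j \<in> pball 1" using Zp_approx_int[OF xu, of 1] by auto
  have "u - of_int j ^ 2 = (x - of_int j) * (x + of_int j)"
    using x by (simp add: power2_eq_square algebra_simps)
  moreover have "x + of_int j \<in> pball 0" using xu by (intro pball_add) (auto simp: Zp_pball)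
  ultimately show "\<exists>j::int. u - of_int j ^ 2 \<in> pball 1" using pball_mult[OF j, of "x + of_int j" 0]
    by (intro exI[of _ j]) simp
next
  assume "\<exists>j::int. u - of_int j ^ 2 \<in> pball 1"
  then obtain j :: int where j: "u - of_int j ^ 2 \<in> pball 1" by blast
  then have "u - (u - of_int j ^ 2) \<in> Zp_units"
    using units_add_pball[OF u, of "- (u - of_int j ^ 2)"] by (simp del: minus_diff_eq)
  then have "of_int j \<in> (Zp_units :: 'p padic set)" using Zp_units_of_power2[of "of_int j"] by simp
  then show "leg u = 1" using hensel_square[OF _ j] by (metis leg_power2)
qed

lemma leg_of_int:
  assumes "(of_int j :: 'p padic) \<in> Zp_units"
  shows "Legendre j (int CARD('p)) = leg (of_int j :: 'p padic)"
proof -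
  have e: "(of_int i :: 'p padic) \<in> pball 1 \<longleftrightarrow> int CARD('p) dvd i" for i
    using of_int_pball_iff[of i 1, where 'p='p] by simp
  have "\<not> [j = 0] (mod int CARD('p))" using assms e[of j] by (simp add: units_pball cong_0_iff)
  moreover have "QuadRes (int CARD('p)) j \<longleftrightarrow> leg (of_int j :: 'p padic) = 1"
  proof -
    have "[y^2 = j] (mod int CARD('p)) \<longleftrightarrow> (of_int j :: 'p padic) - of_int y ^ 2 \<in> pball 1" for y
      using e[of "j - y ^ 2"] unfolding cong_iff_dvd_diff by (metis dvd_diff_commute of_int_diff of_int_power)
    then show ?thesis unfolding leg_eq_1_iff_residue[OF assms] QuadRes_def by simp
  qed
  ultimately show ?thesis using leg_cases[of "of_int j :: 'p padic"] by (auto simp: Legendre_def)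
qed

lemma leg_cong:
  fixes u v :: "'p padic"
  assumes "u \<in> Zp_units" "u - v \<in> pball 1"
  shows "leg u = leg v"
proof -
  have v: "v \<in> Zp_units" using units_add_pball[OF assms(1), of "v - u"] assms(2) by (simp add: pball_diff_commute)
  have "u - w \<in> pball 1 \<longleftrightarrow> v - w \<in> pball 1" for w
    using pball_add[OF assms(2), of "v - w"] pball_diff[OF _ assms(2), of "u - w"] by fastforce
  then have "leg u = 1 \<longleftrightarrow> leg v = 1"
    unfolding leg_eq_1_iff_residue[OF assms(1)] leg_eq_1_iff_residue[OF v] by simp
  then show ?thesis using leg_cases[of u] leg_cases[of v] by auto
qed

lemma legendre_char_leg:
  fixes u :: "'p padic"
  assumes "u \<in> Zp_units"
  shows "legendre_char u = of_int (leg u)"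
proof -
  define r where "r = (SOME r. u - of_int r \<in> pZp 1)"
  have "\<exists>r. u - of_int r \<in> pZp 1"
    using Zp_approx_int[of u 1] assms by (auto simp: pZp_pball Zp_pball units_pball)
  then have r: "u - of_int r \<in> pball 1"
    unfolding r_def using someI_ex[of "\<lambda>r. u - of_int r \<in> pZp 1"] by (simp add: pZp_pball)
  then have "of_int r \<in> (Zp_units :: 'p padic set)"
    using units_add_pball[OF assms, of "of_int r - u"] by (simp add: pball_diff_commute)
  then show ?thesis
    using leg_of_int[of r] leg_cong[OF assms r] by (simp only: legendre_char_def r_def)
qed

text \<open>Euler's criterion gives the identity modulo \<open>p\<close>, and two signs congruent
  modulo an odd prime are equal.\<close>

lemma leg_mult:
  fixes u v :: "'p padic"
  assumes u: "u \<in> Zp_units" and v: "v \<in> Zp_units"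
  shows "leg (u * v) = leg u * leg v"
proof -
  let ?p = "int CARD('p)"
  have uv: "u \<in> Zp" "v \<in> Zp" using u v by (auto simp: Zp_pball units_pball)
  obtain i where i: "u - of_int i \<in> pball 1" using Zp_approx_int[OF uv(1), of 1] by auto
  obtain j where j: "v - of_int j \<in> pball 1" using Zp_approx_int[OF uv(2), of 1] by auto
  have iu: "of_int i \<in> (Zp_units :: 'p padic set)" and ju: "of_int j \<in> (Zp_units :: 'p padic set)"
    using units_add_pball[OF u, of "of_int i - u"] units_add_pball[OF v, of "of_int j - v"] i j
    by (simp_all add: pball_diff_commute)
  have "u * v - of_int (i * j) = (u - of_int i) * v + of_int i * (v - of_int j)"
    by (simp add: algebra_simps)
  moreover have "(u - of_int i) * v \<in> pball 1"
    using pball_mult[OF i, of v 0] uv by (simp add: Zp_pball)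
  moreover have "of_int i * (v - of_int j) \<in> pball 1" using pball_mult[OF pball_of_int j, of i] by simp
  ultimately have k: "u * v - of_int (i * j) \<in> pball 1" by (simp add: pball_add)
  have ku: "of_int (i * j) \<in> (Zp_units :: 'p padic set)" using units_mult[OF iu ju] by simp
  have pr: "prime CARD('p)" by (rule prime_card)
  have "[Legendre (i * j) ?p = (i * j) ^ ((CARD('p) - 1) div 2)] (mod ?p)"
    "[Legendre i ?p * Legendre j ?p = i ^ ((CARD('p) - 1) div 2) * j ^ ((CARD('p) - 1) div 2)] (mod ?p)"
    by (intro cong_mult euler_criterion[OF pr card_gt_2])+
  then have "[Legendre (i * j) ?p = Legendre i ?p * Legendre j ?p] (mod ?p)"
    unfolding power_mult_distrib[symmetric] by (blast intro: cong_trans cong_sym)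
  then have "[leg (of_int (i * j) :: 'p padic) = leg (of_int i :: 'p padic) * leg (of_int j :: 'p padic)] (mod ?p)"
    by (simp only: leg_of_int[OF ku] leg_of_int[OF iu] leg_of_int[OF ju])
  then have "[leg (u * v) = leg u * leg v] (mod ?p)"
    by (metis leg_cong[OF u i] leg_cong[OF v j] leg_cong[OF units_mult[OF u v] k])
  moreover have "\<not> ?p dvd 2" "\<not> ?p dvd - 2" using card_gt_2 by (auto dest: zdvd_imp_le)
  ultimately show ?thesis
    using leg_cases[of "u * v"] leg_cases[of u] leg_cases[of v] by (auto simp: cong_iff_dvd_diff)
qed

lemma leg_power2_mult:
  fixes u v :: "'p padic"
  assumes "v \<noteq> 0"
  shows "leg (v^2 * u) = leg u"
proof -
  have "(\<exists>x. x^2 = v^2 * u) \<longleftrightarrow> (\<exists>x. x^2 = u)"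
    by (metis assms nonzero_mult_div_cancel_left power_divide power_mult_distrib power_not_zero)
  then show ?thesis by (simp add: leg_def)
qed

lemma leg_inverse:
  fixes u :: "'p padic"
  assumes "u \<noteq> 0"
  shows "leg (inverse u) = leg u"
  using leg_power2_mult[OF assms, of "inverse u"] assms by (simp add: power2_eq_square mult.assoc)

end

section \<open>The Hilbert symbol for odd \<open>p\<close>\<close>

definition angular :: "'p::prime_card padic \<Rightarrow> 'p padic" where
  "angular x = x * pp powi (- padic_ord x)"

lemma pp_nonzero [simp]: "(pp::'p::prime_card padic) \<noteq> 0"
  using card_gt_1[where 'p='p] by (metis of_nat_eq_0_iff not_one_less_zero)

lemma angular_unit: "x \<noteq> 0 \<Longrightarrow> angular x \<in> (Zp_units::'p::prime_card padic set)"
  by (simp add: angular_def Zp_units_iff padic_ord_mult)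

lemma angular_eq: "x = pp powi padic_ord x * angular (x::'p::prime_card padic)"
  by (simp add: angular_def power_int_minus)

lemma angular_mult:
  assumes "x \<noteq> 0" "y \<noteq> (0::'p::prime_card padic)"
  shows "angular (x * y) = angular x * angular y"
  using assms power_int_add[of "pp::'p padic" "- padic_ord x" "- padic_ord y"]
  by (simp add: angular_def padic_ord_mult)

lemma angular_of_unit: "u \<in> Zp_units \<Longrightarrow> angular u = (u::'p::prime_card padic)"
  by (simp add: angular_def Zp_units_iff)

lemma padic_ord_unit: "u \<in> Zp_units \<Longrightarrow> padic_ord (u::'p::prime_card padic) = 0"
  by (simp add: Zp_units_iff)

lemma hilbert_cases: "hilbert a b = 1 \<or> hilbert a b = - 1"
  by (simp add: hilbert_def)

lemma hilbert_square_eq_1 [simp]: "hilbert a b * hilbert a b = 1"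
  by (simp add: hilbert_def)

lemma hilbert_nonzero [simp]: "hilbert a b \<noteq> 0"
  by (simp add: hilbert_def)

lemma hilbert_eqI:
  assumes "\<And>x y z. (x, y, z) \<noteq> (0, 0, 0) \<Longrightarrow> z^2 = a * x^2 + b * y^2 \<Longrightarrow>
      \<exists>x y z. (x, y, z) \<noteq> (0, 0, 0) \<and> z^2 = c * x^2 + d * y^2"
    and "\<And>x y z. (x, y, z) \<noteq> (0, 0, 0) \<Longrightarrow> z^2 = c * x^2 + d * y^2 \<Longrightarrow>
      \<exists>x y z. (x, y, z) \<noteq> (0, 0, 0) \<and> z^2 = a * x^2 + b * y^2"
  shows "hilbert a b = hilbert c d"
proof -
  have "(\<exists>x y z. (x, y, z) \<noteq> (0, 0, 0) \<and> z^2 = a * x^2 + b * y^2) \<longleftrightarrow>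
    (\<exists>x y z. (x, y, z) \<noteq> (0, 0, 0) \<and> z^2 = c * x^2 + d * y^2)"
    by (rule iffI; elim exE conjE; rule assms)
  then show ?thesis unfolding hilbert_def by simp
qed

lemma hilbert_commute: "hilbert a b = hilbert b a"
proof -
  have *: "\<exists>x y z. (x, y, z) \<noteq> (0, 0, 0) \<and> z^2 = b * x^2 + a * y^2"
    if "(x, y, z) \<noteq> (0, 0, 0)" "z^2 = a * x^2 + b * y^2" for a b x y z :: "'a padic"
  proof (intro exI conjI)
    show "(y, x, z) \<noteq> (0, 0, 0)" using that(1) by auto
    show "z^2 = b * y^2 + a * x^2" unfolding that(2) by (rule add.commute)
  qed
  show ?thesis by (rule hilbert_eqI; rule *)
qed

lemma hilbert_power2_mult_left:
  assumes t: "t \<noteq> 0"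
  shows "hilbert (t^2 * a) b = hilbert a b"
proof (rule hilbert_eqI)
  fix x y z assume *: "(x, y, z) \<noteq> (0, 0, 0)" "z^2 = t^2 * a * x^2 + b * y^2"
  have "a * (t * x)^2 = t^2 * a * x^2" by (simp add: power2_eq_square)
  then have "z^2 = a * (t * x)^2 + b * y^2" using *(2) by (simp only:)
  moreover have "(t * x, y, z) \<noteq> (0, 0, 0)" using *(1) t by simp
  ultimately show "\<exists>x y z. (x, y, z) \<noteq> (0, 0, 0) \<and> z^2 = a * x^2 + b * y^2" by blast
next
  fix x y z assume *: "(x, y, z) \<noteq> (0, 0, 0)" "z^2 = a * x^2 + b * y^2"
  have "t^2 * a * (x / t)^2 = a * x^2" using t by (simp add: power2_eq_square)
  then have "z^2 = t^2 * a * (x / t)^2 + b * y^2" using *(2) by (simp only:)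
  moreover have "(x / t, y, z) \<noteq> (0, 0, 0)" using *(1) t by simp
  ultimately show "\<exists>x y z. (x, y, z) \<noteq> (0, 0, 0) \<and> z^2 = t^2 * a * x^2 + b * y^2" by blast
qed

lemma hilbert_eq_1I:
  assumes "z^2 = a * x^2 + b * y^2" "(x, y, z) \<noteq> (0, 0, 0)"
  shows "hilbert a b = 1"
  unfolding hilbert_def using assms by (intro if_P exI[of _ x] exI[of _ y] exI[of _ z] conjI)

lemma hilbert_steinberg: "a + b = 1 \<Longrightarrow> hilbert a b = 1"
  by (rule hilbert_eq_1I[of 1 a 1 b 1]) auto

lemma hilbert_minus_self [simp]: "hilbert a (- a) = 1" "hilbert (- a) a = 1"
  by (rule hilbert_eq_1I[of 0 _ 1 _ 1]; simp)+

text \<open>Multiplying the equation by \<open>a\<close> makes \<open>a x\<close> the new square and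
  \<open>z\<close> the new coefficient variable: \<open>(a x)^2 = a z^2 - a b y^2\<close>. The
  passage back is the same computation.\<close>

lemma hilbert_minus_mult:
  assumes "a \<noteq> 0"
  shows "hilbert a (- (a * b)) = hilbert a b"
proof (rule hilbert_eqI)
  fix x y z assume *: "(x, y, z) \<noteq> (0, 0, 0)" "z^2 = a * x^2 + - (a * b) * y^2"
  have "(a * x)^2 = a * (a * x^2)" by (simp add: power2_eq_square)
  also have "\<dots> = a * (z^2 + (a * b) * y^2)" using *(2) by simp
  also have "\<dots> = a * z^2 + b * (a * y)^2" by (simp add: power2_eq_square algebra_simps)
  finally show "\<exists>x y z. (x, y, z) \<noteq> (0, 0, 0) \<and> z^2 = a * x^2 + b * y^2"
    using *(1) assms by (intro exI[of _ z] exI[of _ "a * y"] exI[of _ "a * x"]) auto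
next
  fix x y z assume *: "(x, y, z) \<noteq> (0, 0, 0)" "z^2 = a * x^2 + b * y^2"
  have "(a * x)^2 = a * (a * x^2)" by (simp add: power2_eq_square)
  also have "\<dots> = a * (z^2 - b * y^2)" using *(2) by simp
  also have "\<dots> = a * z^2 + - (a * b) * y^2" by (simp add: algebra_simps)
  finally show "\<exists>x y z. (x, y, z) \<noteq> (0, 0, 0) \<and> z^2 = a * x^2 + - (a * b) * y^2"
    using *(1) assms by (intro exI[of _ z] exI[of _ y] exI[of _ "a * x"]) auto
qed

context odd_padic
begin

lemma leg_minus_1_eq: "leg (- 1 :: 'p padic) * leg u = leg (- u)" if "u \<in> Zp_units" for u :: "'p padic"
  using leg_mult[of "-1" u] that by simp

text \<open>By the pigeonhole principle the sets of residues of the form \<open>u x\<^sup>2\<close> and \<open>1 - v y\<^sup>2\<close>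
  meet, since both have \<open>(p + 1) / 2\<close> elements.\<close>

lemma hilbert_units:
  fixes u v :: "'p padic"
  assumes u: "u \<in> Zp_units" and v: "v \<in> Zp_units"
  shows "hilbert u v = 1"
proof -
  define h where "h = (CARD('p) - 1) div 2"
  have p: "CARD('p) = 2 * h + 1" using odd_card by (auto simp: h_def elim: oddE)
  have uz: "u \<in> pball 0" and vz: "v \<in> pball 0" using u v by (auto simp: units_pball)
  have sqr: "x = y" if "w \<in> Zp_units" "w * (of_nat x ^ 2 - of_nat y ^ 2) \<in> pball 1" "x \<le> h" "y \<le> h"
    for w :: "'p padic" and x y :: nat
  proof -
    have "(of_int ((int x - int y) * (int x + int y)) :: 'p padic) \<in> pball (int 1)"
      using that(2) unfolding units_mult_pball[OF that(1)] by (simp add: power2_eq_square algebra_simps)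
    then have "int CARD('p) dvd (int x - int y) * (int x + int y)"
      unfolding of_int_pball_iff by simp
    then have "int CARD('p) dvd int x - int y \<or> int CARD('p) dvd int x + int y"
      using prime_card[where 'a='p] by (simp add: prime_dvd_mult_iff)
    moreover have "\<bar>int x - int y\<bar> < int CARD('p)" "\<bar>int x + int y\<bar> < int CARD('p)"
      using that(3,4) p by auto
    ultimately have "int x - int y = 0 \<or> int x + int y = 0"
      by (metis dvd_imp_le_int linorder_not_le abs_of_nat)
    then show "x = y" by auto
  qed
  have res: "\<exists>j<CARD('p). z - of_nat j \<in> pball 1" if "z \<in> pball 0" for z :: "'p padic"
    using Zp_residue[of z 1] that by (auto simp: Zp_pball)
  define r where "r z = (SOME j. j < CARD('p) \<and> z - of_nat j \<in> pball 1)" for z :: "'p padic"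
  have r: "r z < CARD('p) \<and> z - of_nat (r z) \<in> pball 1" if "z \<in> pball 0" for z
    unfolding r_def by (rule someI_ex) (use res[OF that] in auto)
  have r_eq: "z - w \<in> pball 1" if "z \<in> pball 0" "w \<in> pball 0" "r z = r w" for z w
    using pball_diff[OF conjunct2[OF r[OF that(1)]] conjunct2[OF r[OF that(2)]]] that(3) by simp
  have x2: "u * of_nat x ^ 2 \<in> pball 0" "1 - v * of_nat x ^ 2 \<in> pball 0" for x
    using pball_mult[OF uz pball_of_nat[of "x^2"]] pball_mult[OF vz pball_of_nat[of "x^2"]]
    by (auto intro!: pball_diff)
  define A where "A = (\<lambda>x. r (u * of_nat x ^ 2)) ` {..h}"
  define B where "B = (\<lambda>x. r (1 - v * of_nat x ^ 2)) ` {..h}"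
  have "inj_on (\<lambda>x. r (u * of_nat x ^ 2)) {..h}"
  proof (rule inj_onI)
    fix x y assume xy: "x \<in> {..h}" "y \<in> {..h}" "r (u * of_nat x ^ 2) = r (u * of_nat y ^ 2)"
    then show "x = y" using r_eq[OF x2(1) x2(1) xy(3)] by (intro sqr[OF u]) (auto simp: algebra_simps)
  qed
  moreover have "inj_on (\<lambda>x. r (1 - v * of_nat x ^ 2)) {..h}"
  proof (rule inj_onI)
    fix x y assume xy: "x \<in> {..h}" "y \<in> {..h}" "r (1 - v * of_nat x ^ 2) = r (1 - v * of_nat y ^ 2)"
    then show "x = y" using r_eq[OF x2(2) x2(2) xy(3)[symmetric]] by (intro sqr[OF v]) (auto simp: algebra_simps)
  qed
  ultimately have "card A = h + 1" "card B = h + 1" by (simp_all add: A_def B_def card_image)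
  moreover have "A \<union> B \<subseteq> {..<CARD('p)}" using r x2 by (auto simp: A_def B_def)
  then have "card (A \<union> B) \<le> CARD('p)" using card_mono[of "{..<CARD('p)}"] by auto
  ultimately have "A \<inter> B \<noteq> {}"
    using card_Un_disjoint[of A B] p by (auto simp: A_def B_def)
  then obtain x y where "r (u * of_nat x ^ 2) = r (1 - v * of_nat y ^ 2)"
    by (auto simp: A_def B_def)
  then have "u * of_nat x ^ 2 - (1 - v * of_nat y ^ 2) \<in> pball 1" using r_eq x2 by blast
  then have w: "(u * of_nat x ^ 2 + v * of_nat y ^ 2) - 1^2 \<in> pball 1" by (simp add: algebra_simps)
  obtain z where "z^2 = u * of_nat x ^ 2 + v * of_nat y ^ 2" "z - 1 \<in> pball 1"
    using hensel_square[OF units_1 w] .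
  moreover have "z \<noteq> 0" using calculation(2) units_1[where 'p='p] by (auto simp: units_pball)
  ultimately show ?thesis by (intro hilbert_eq_1I[of z]) auto
qed

text \<open>For a nonsquare \<open>v\<close>, the parity of valuations excludes solutions with
  \<open>y = 0\<close>. After division by \<open>y\<close> the same parity argument makes
  \<open>X\<close> integral, and then \<open>v\<close> is congruent to \<open>Z^2\<close> modulo
  \<open>p\<close>, hence a square.\<close>

lemma hilbert_pp_unit:
  fixes u v :: "'p padic"
  assumes u: "u \<in> Zp_units" and v: "v \<in> Zp_units"
  shows "hilbert (pp * u) v = leg v"
proof (cases "leg v = 1")
  case True
  then obtain w where "w^2 = v" by (auto simp: leg_def split: if_splits)
  then have "hilbert (pp * u) v = 1" by (intro hilbert_eq_1I[of w _ 0 _ 1]) auto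
  then show ?thesis using True by simp
next
  case False
  have "hilbert (pp * u) v \<noteq> 1"
  proof
    assume "hilbert (pp * u) v = 1"
    then obtain x y z where nz: "(x, y, z) \<noteq> (0, 0, 0)" and e: "z^2 = pp * u * x^2 + v * y^2"
      unfolding hilbert_def by (metis one_neq_neg_one)
    have uv: "u \<noteq> 0" "v \<noteq> 0" "padic_ord u = 0" "padic_ord v = 0" using u v by (auto simp: Zp_units_iff)
    have y: "y \<noteq> 0"
    proof
      assume y: "y = 0"
      then have "x \<noteq> 0" "z \<noteq> 0" using nz e uv by auto
      then have "2 * padic_ord z = 1 + 2 * padic_ord x"
        using arg_cong[OF e, of padic_ord] y uv by (simp add: padic_ord_mult power2_eq_square)
      then show False by presburger
    qed
    define X Z where "X = x / y" and "Z = z / y"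
    have e': "Z^2 = pp * u * X^2 + v" using e y by (simp add: X_def Z_def field_simps)
    have "X \<in> pball 0"
    proof (rule ccontr)
      assume "X \<notin> pball 0"
      then have X: "X \<noteq> 0" "padic_ord X < 0" by (auto simp: pball_iff)
      then have o: "padic_ord (pp * u * X^2) = 1 + 2 * padic_ord X"
        using uv by (simp add: padic_ord_mult power2_eq_square)
      have nz: "pp * u * X^2 \<noteq> 0" using X uv by simp
      have "padic_abs v < padic_abs (pp * u * X^2)"
        unfolding padic_abs_ord[OF nz] padic_abs_ord[OF uv(2)] powi_card_less_iff using o X uv by simp
      then have "padic_abs (Z^2) = padic_abs (pp * u * X^2)" unfolding e' by (rule padic_abs_add_eq)
      moreover have "Z \<noteq> 0" using calculation nz by auto
      ultimately have "- (2 * padic_ord Z) = - (1 + 2 * padic_ord X)"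
        using nz o padic_abs_ord[OF nz] padic_abs_ord[of "Z^2"] by (simp add: padic_ord_mult power2_eq_square)
      then show False by presburger
    qed
    then have "pp * u * X^2 \<in> pball 1"
      using pball_mult[OF \<open>X \<in> pball 0\<close> \<open>X \<in> pball 0\<close>] u uv
      by (cases "X = 0") (auto simp: pball_iff padic_ord_mult power2_eq_square)
    then have "v - Z^2 \<in> pball 1" by (simp add: e')
    then have "leg v = leg (Z^2)" by (rule leg_cong[OF v])
    then show False using False by simp
  qed
  then show ?thesis using False hilbert_cases leg_cases by metis
qed

text \<open>By \<open>hilbert_minus_mult\<close> the second argument may be replaced by minus the
  product, which is \<open>p^2\<close> times a unit.\<close>

lemma hilbert_pp_pp:
  fixes u v :: "'p padic"
  assumes u: "u \<in> Zp_units" and v: "v \<in> Zp_units"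
  shows "hilbert (pp * u) (pp * v) = leg (- 1 :: 'p padic) * leg u * leg v"
proof -
  have nz: "u \<noteq> 0" "v \<noteq> 0" using u v units_nonzero by auto
  have "hilbert (pp * u) (pp * v) = hilbert (pp * u) (- (pp * u * (pp * v)))"
    using nz by (simp only: hilbert_minus_mult mult_eq_0_iff pp_nonzero simp_thms)
  also have "- (pp * u * (pp * v)) = pp^2 * - (u * v)" by (simp add: power2_eq_square algebra_simps)
  also have "hilbert (pp * u) \<dots> = hilbert (- (u * v)) (pp * u)"
    by (subst hilbert_commute) (simp only: hilbert_power2_mult_left pp_nonzero simp_thms)
  also have "\<dots> = leg (- (u * v))"
    by (subst hilbert_commute) (intro hilbert_pp_unit u, simp add: units_mult u v)
  finally show ?thesis using leg_minus_1_eq[of "u * v"] leg_mult[OF u v] units_mult[OF u v] by simp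
qed

text \<open>The tame symbol. Modulo squares each argument is its unit part or \<open>p\<close> times
  its unit part, so the three preceding evaluations cover all cases.\<close>

lemma hilbert_formula:
  fixes a b :: "'p padic"
  assumes a: "a \<noteq> 0" and b: "b \<noteq> 0"
  shows "hilbert a b = (if odd (padic_ord a) then leg (angular b) else 1) *
    (if odd (padic_ord b) then leg (angular a) else 1) *
    (if odd (padic_ord a) \<and> odd (padic_ord b) then leg (- 1 :: 'p padic) else 1)"
proof -
  define A where "A = (if odd (padic_ord a) then pp * angular a else angular a)"
  define B where "B = (if odd (padic_ord b) then pp * angular b else angular b)"
  have red: "x = (pp powi (padic_ord x div 2))^2 * (if odd (padic_ord x) then pp * angular x else angular x)"
    for x :: "'p padic"
  proof -
    have "x = pp powi (padic_ord x div 2 * 2 + padic_ord x mod 2) * angular x"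
      using angular_eq[of x] by simp
    also have "pp powi (padic_ord x div 2 * 2 + padic_ord x mod 2) =
        (pp powi (padic_ord x div 2))^2 * (if odd (padic_ord x) then pp else 1 :: 'p padic)"
      by (subst power_int_add) (auto simp: power_int_mult odd_iff_mod_2_eq_one)
    finally show ?thesis by (auto simp: mult.assoc)
  qed
  have "hilbert a b = hilbert ((pp powi (padic_ord a div 2))^2 * A) ((pp powi (padic_ord b div 2))^2 * B)"
    using red[of a] red[of b] by (simp only: A_def B_def)
  also have "\<dots> = hilbert A B"
    by (subst hilbert_power2_mult_left, simp, subst hilbert_commute,
        subst hilbert_power2_mult_left, simp, rule hilbert_commute)
  also have "\<dots> = (if odd (padic_ord a) then leg (angular b) else 1) *
    (if odd (padic_ord b) then leg (angular a) else 1) *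
    (if odd (padic_ord a) \<and> odd (padic_ord b) then leg (- 1 :: 'p padic) else 1)"
    using angular_unit[OF a] angular_unit[OF b]
    by (auto simp: A_def B_def hilbert_units hilbert_pp_unit hilbert_pp_pp
        hilbert_commute[of "angular a" "pp * angular b"])
  finally show ?thesis .
qed

text \<open>Bilinearity is invisible in the definition by solvability; it is read off from the tame
  formula.\<close>

lemma hilbert_mult_left:
  fixes a b c :: "'p padic"
  assumes "a \<noteq> 0" "b \<noteq> 0" "c \<noteq> 0"
  shows "hilbert (a * b) c = hilbert a c * hilbert b c"
  using assms angular_unit[of a] angular_unit[of b] leg_cases[of "angular c"] leg_cases[of "-1::'p padic"]
  by (auto simp: hilbert_formula padic_ord_mult angular_mult leg_mult)

lemma hilbert_mult_right:
  fixes a b c :: "'p padic"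
  assumes "a \<noteq> 0" "b \<noteq> 0" "c \<noteq> 0"
  shows "hilbert c (a * b) = hilbert c a * hilbert c b"
  using hilbert_mult_left[OF assms] hilbert_commute by metis

lemma hilbert_self:
  fixes a :: "'p padic"
  assumes "a \<noteq> 0"
  shows "hilbert a a = hilbert a (- 1)"
  using hilbert_minus_mult[OF assms, of "-1"] by simp

lemma hilbert_unit_right:
  fixes a u :: "'p padic"
  assumes "a \<noteq> 0" "u \<in> Zp_units"
  shows "hilbert a u = (if odd (padic_ord a) then leg u else 1)"
  using assms by (simp add: hilbert_formula units_nonzero padic_ord_unit angular_of_unit)

lemma hilbert_unit_left:
  fixes a u :: "'p padic"
  assumes "a \<noteq> 0" "u \<in> Zp_units"
  shows "hilbert u a = (if odd (padic_ord a) then leg u else 1)"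
  using hilbert_unit_right[OF assms] hilbert_commute by metis

end

section \<open>Matrices of determinant 1 and the groups \<open>K0 m\<close>\<close>

lemma mat2_nth [simp]:
  "mat2 a b c d $ 1 $ 1 = a" "mat2 a b c d $ 1 $ 2 = b" "mat2 a b c d $ 2 $ 1 = c" "mat2 a b c d $ 2 $ 2 = d"
  by (simp_all add: mat2_def vector_2)

lemma mat2_eqI:
  fixes A B :: "'a^2^2"
  assumes "A $ 1 $ 1 = B $ 1 $ 1" "A $ 1 $ 2 = B $ 1 $ 2" "A $ 2 $ 1 = B $ 2 $ 1" "A $ 2 $ 2 = B $ 2 $ 2"
  shows "A = B"
  using assms by (simp add: vec_eq_iff forall_2)

lemma matmul2_nth:
  fixes A B :: "'a::comm_ring_1^2^2"
  shows "(A ** B) $ i $ j = A $ i $ 1 * B $ 1 $ j + A $ i $ 2 * B $ 2 $ j"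
  by (simp add: matrix_matrix_mult_def sum_2)

lemma mat1_nth [simp]:
  "(mat 1 :: 'a::comm_ring_1^2^2) $ 1 $ 1 = 1" "(mat 1 :: 'a^2^2) $ 1 $ 2 = 0"
  "(mat 1 :: 'a^2^2) $ 2 $ 1 = 0" "(mat 1 :: 'a^2^2) $ 2 $ 2 = 1"
  by (simp_all add: mat_def)

lemma SL2_iff: "A \<in> SL2 \<longleftrightarrow> A $ 1 $ 1 * A $ 2 $ 2 - A $ 1 $ 2 * A $ 2 $ 1 = 1"
  by (simp add: SL2_def det_2)

lemma SL2_mult: "A \<in> SL2 \<Longrightarrow> B \<in> SL2 \<Longrightarrow> A ** B \<in> SL2"
  by (simp add: SL2_def det_mul)

text \<open>The adjugate, which is the inverse on \<open>SL2\<close> and visibly preserves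
  integrality and the divisibility of the lower left entry.\<close>

definition inv2 :: "'p::prime_card padic^2^2 \<Rightarrow> 'p padic^2^2" where
  "inv2 A = mat2 (A $ 2 $ 2) (- (A $ 1 $ 2)) (- (A $ 2 $ 1)) (A $ 1 $ 1)"

lemma inv2_SL2: "A \<in> SL2 \<Longrightarrow> inv2 A \<in> SL2"
  by (simp add: SL2_iff inv2_def algebra_simps)

lemma inv2_mult:
  assumes "A \<in> SL2"
  shows "inv2 A ** A = mat 1" "A ** inv2 A = mat 1"
  using assms by (auto intro!: mat2_eqI simp: matmul2_nth inv2_def SL2_iff algebra_simps)

lemma xmat_nth [simp]:
  "xmat s $ 1 $ 1 = 1" "xmat s $ 1 $ 2 = s" "xmat s $ 2 $ 1 = 0" "xmat s $ 2 $ 2 = 1"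
  by (simp_all add: xmat_def)

lemma hmat_nth [simp]:
  "hmat t $ 1 $ 1 = t" "hmat t $ 1 $ 2 = 0" "hmat t $ 2 $ 1 = 0" "hmat t $ 2 $ 2 = inverse t"
  by (simp_all add: hmat_def)

lemma wmat_nth [simp]:
  "wmat $ 1 $ 1 = 0" "wmat $ 1 $ 2 = 1" "wmat $ 2 $ 1 = - 1" "wmat $ 2 $ 2 = 0"
  by (simp_all add: wmat_def)

definition nmat :: "'p::prime_card padic \<Rightarrow> 'p padic^2^2" where
  "nmat c = mat2 1 0 c 1"

lemma nmat_nth [simp]:
  "nmat c $ 1 $ 1 = 1" "nmat c $ 1 $ 2 = 0" "nmat c $ 2 $ 1 = c" "nmat c $ 2 $ 2 = 1"
  by (simp_all add: nmat_def)

lemma SL2_generators [simp]: "xmat s \<in> SL2" "wmat \<in> SL2" "nmat c \<in> SL2" "t \<noteq> 0 \<Longrightarrow> hmat t \<in> SL2"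
    "mat 1 \<in> SL2"
  by (simp_all add: SL2_iff)

lemma xmat_0: "xmat 0 = mat 1" by (rule mat2_eqI) simp_all
lemma hmat_1: "hmat 1 = mat 1" by (rule mat2_eqI) simp_all

lemma K0_iff:
  "A \<in> K0 m \<longleftrightarrow> A \<in> SL2 \<and> A $ 1 $ 1 \<in> pball 0 \<and> A $ 1 $ 2 \<in> pball 0 \<and>
     A $ 2 $ 2 \<in> pball 0 \<and> A $ 2 $ 1 \<in> pball (int m)"
  by (auto simp: K0_def forall_2 Zp_pball pZp_pball intro: pball_mono[of 0 "int m"])

lemma K0_mono: "m \<le> n \<Longrightarrow> A \<in> K0 n \<Longrightarrow> A \<in> K0 m"
  by (auto simp: K0_iff intro: pball_mono[of "int m" "int n"])

lemma K0_SL2: "A \<in> K0 m \<Longrightarrow> A \<in> SL2"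
  by (simp add: K0_iff)

lemma K0_mult:
  assumes "A \<in> K0 m" "B \<in> K0 m"
  shows "A ** B \<in> K0 m"
proof -
  note pm = pball_mult[of _ 0 _ 0, simplified] pball_mult[of _ 0 _ "int m", simplified]
    pball_mult[of _ "int m" _ 0, simplified] pball_mono[of 0 "int m", simplified]
  show ?thesis using assms SL2_mult
    by (auto simp: K0_iff matmul2_nth intro!: pball_add intro: pm)
qed

lemma K0_inv2: "A \<in> K0 m \<Longrightarrow> inv2 A \<in> K0 m"
  by (auto simp: K0_iff inv2_SL2) (auto simp: inv2_def)

lemma K0_generators [simp]:
  "s \<in> pball 0 \<Longrightarrow> xmat s \<in> K0 m" "c \<in> pball (int m) \<Longrightarrow> nmat c \<in> K0 m" "wmat \<in> K0 0"
  "mat 1 \<in> K0 m"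
  by (simp_all add: K0_iff)

lemma K0_hmat: "u \<in> Zp_units \<Longrightarrow> hmat u \<in> K0 m"
  using units_inverse[of u] by (simp add: K0_iff units_pball units_nonzero)

text \<open>\<open>tau\<close> and \<open>s_sign\<close> see only the bottom row. Unlike membership
  in \<open>K0 0\<close>, this condition survives left multiplication by \<open>xmat s\<close> with
  arbitrary \<open>s\<close>, which is what the Iwasawa decomposition calls for.\<close>

definition primitive_row :: "'p::prime_card padic^2^2 \<Rightarrow> bool" where
  "primitive_row A \<longleftrightarrow> A $ 2 $ 1 \<in> pball 0 \<and> A $ 2 $ 2 \<in> pball 0 \<and>
     (A $ 2 $ 1 \<in> Zp_units \<or> A $ 2 $ 2 \<in> Zp_units)"

lemma K0_primitive: "A \<in> K0 0 \<Longrightarrow> primitive_row A"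
proof (rule ccontr)
  assume A: "A \<in> K0 0" "\<not> primitive_row A"
  then have "A $ 2 $ 1 \<in> pball 1" "A $ 2 $ 2 \<in> pball 1"
    by (auto simp: K0_iff primitive_row_def units_pball)
  then have "A $ 1 $ 1 * A $ 2 $ 2 - A $ 1 $ 2 * A $ 2 $ 1 \<in> pball (0 + 1)"
    using A by (intro pball_diff pball_mult) (auto simp: K0_iff)
  then show False using A units_1 by (auto simp: K0_iff SL2_iff units_pball)
qed

lemma K0_1_units:
  assumes "A \<in> K0 m" "m \<ge> 1"
  shows "A $ 2 $ 2 \<in> Zp_units" "A $ 1 $ 1 \<in> Zp_units" "A $ 1 $ 1 * A $ 2 $ 2 - 1 \<in> pball 1"
proof -
  have A: "A $ 2 $ 1 \<in> pball 1" "A $ 1 $ 2 \<in> pball 0" "A $ 1 $ 1 \<in> pball 0" "A $ 2 $ 2 \<in> pball 0" 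
     "A $ 1 $ 1 * A $ 2 $ 2 - 1 = A $ 1 $ 2 * A $ 2 $ 1"
    using assms pball_mono[of 1 "int m"] by (auto simp: K0_iff SL2_iff diff_eq_eq add.commute)
  show d: "A $ 1 $ 1 * A $ 2 $ 2 - 1 \<in> pball 1"
    unfolding A(5) using pball_mult[OF A(2,1)] by simp
  have "A $ 1 $ 1 * A $ 2 $ 2 \<in> Zp_units"
    using units_add_pball[OF units_1 d] by simp
  then show "A $ 2 $ 2 \<in> Zp_units" "A $ 1 $ 1 \<in> Zp_units"
    using A(3,4) pball_mult[OF A(3), of "A $ 2 $ 2" 1] pball_mult[of "A $ 1 $ 1" 1 "A $ 2 $ 2" 0]
    by (auto simp: units_pball)
qed

lemma primitive_row_mult:
  assumes "primitive_row A" "B \<in> K0 0"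
  shows "primitive_row (A ** B)"
proof (rule ccontr)
  assume n: "\<not> primitive_row (A ** B)"
  have b: "A $ 2 $ 1 \<in> pball 0" "A $ 2 $ 2 \<in> pball 0" "B $ i $ j \<in> pball 0" for i j
    using assms by (auto simp: primitive_row_def K0_def Zp_pball)
  have AB: "(A ** B) $ 2 $ j \<in> pball 0" for j
    unfolding matmul2_nth using pball_mult[OF b(1) b(3)[of 1 j]] pball_mult[OF b(2) b(3)[of 2 j]]
    by (simp add: pball_add)
  have AB: "(A ** B) $ 2 $ j \<in> pball 1" for j
    using n AB exhaust_2[of j] by (auto simp: primitive_row_def units_pball)
  have "inv2 B $ i $ j \<in> pball 0" for i j
    using K0_inv2[OF assms(2)] by (auto simp: K0_def Zp_pball)
  then have "((A ** B) ** inv2 B) $ 2 $ j \<in> pball 1" for j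
    unfolding matmul2_nth[of "A ** B"] using pball_mult[OF AB, of _ 0] by (simp add: pball_add)
  moreover have "(A ** B) ** inv2 B = A"
    using inv2_mult[OF K0_SL2[OF assms(2)]] by (simp flip: matrix_mul_assoc)
  ultimately show False using assms(1) by (auto simp: primitive_row_def units_pball)
qed

lemma tau_nonzero: "A \<in> SL2 \<Longrightarrow> tau A \<noteq> 0"
  by (auto simp: tau_def SL2_iff)

section \<open>Triviality of the cocycle over \<open>K\<close> and partial associativity\<close>

context odd_padic
begin

lemma s_sign_cases: "s_sign A = 1 \<or> s_sign A = - 1" 
  using hilbert_cases by (auto simp: s_sign_def)

lemma s_sign_square [simp]: "s_sign A * s_sign A = 1"
  by (simp add: s_sign_def)

lemma tau_borel:
  fixes g :: "'p padic^2^2"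
  assumes "t \<noteq> 0"
  shows "tau (hmat t ** xmat s ** g) = inverse t * tau g"
  using assms by (simp add: tau_def matmul2_nth)

text \<open>A Borel element on the left only rescales the bottom row, so \<open>tau\<close> changes
  by \<open>inverse t\<close>. Modulo squares the two arguments of the symbol become
  \<open>tau g\<close> and \<open>t\<close>.\<close>

lemma cocycle_borel:
  fixes g :: "'p padic^2^2"
  assumes t: "t \<noteq> 0" and g: "g \<in> SL2"
  shows "cocycle (hmat t ** xmat s) g = hilbert (tau g) t * s_sign g * s_sign (hmat t ** xmat s ** g)"
proof -
  have tb: "tau (hmat t ** xmat s) = inverse t" using t by (simp add: tau_def matmul2_nth)
  have sb: "s_sign (hmat t ** xmat s) = 1" by (simp add: s_sign_def matmul2_nth)
  have nz: "tau g \<noteq> 0" using g by (rule tau_nonzero)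
  have "hilbert (inverse t * tau g * inverse t) (inverse t * tau g * tau g) =
      hilbert ((inverse t)^2 * tau g) ((tau g / t)^2 * t)"
    using t by (simp add: power2_eq_square field_simps)
  also have "\<dots> = hilbert (tau g) t"
    using t nz by (metis hilbert_power2_mult_left hilbert_commute divide_eq_0_iff inverse_nonzero_iff_nonzero)
  finally show ?thesis unfolding cocycle_def tau_borel[OF t] tb sb by simp
qed

text \<open>Rescaling \<open>tau\<close> by \<open>inverse t\<close> produces the symbols of
  \<open>t\<close> with \<open>tau (g ** h)\<close> and with \<open>tau g\<close>, which are exactly
  those of the two Borel cocycles; all remaining signs occur twice or on both sides.\<close>

lemma cocycle_borel_assoc:
  fixes g h :: "'p padic^2^2" and s t :: "'p padic"
  assumes t: "t \<noteq> 0" and g: "g \<in> SL2" and h: "h \<in> SL2"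
  defines "b \<equiv> hmat t ** xmat s"
  shows "cocycle (b ** g) h * cocycle b (g ** h) = cocycle b g * cocycle g h"
proof -
  have nz: "tau g \<noteq> 0" "tau h \<noteq> 0" "tau (g ** h) \<noteq> 0" using g h SL2_mult tau_nonzero by auto
  let ?C = "tau (g ** h)"
  have "hilbert (inverse t * ?C * (inverse t * tau g)) (inverse t * ?C * tau h) =
      hilbert ((inverse t)^2 * (?C * tau g)) ((inverse t)^2 * (?C * tau h * t))"
    using t by (simp add: power2_eq_square field_simps)
  also have "\<dots> = hilbert (?C * tau g) (?C * tau h * t)"
    using t by (metis hilbert_power2_mult_left hilbert_commute inverse_nonzero_iff_nonzero)
  also have "\<dots> = hilbert (?C * tau g) (?C * tau h) * (hilbert ?C t * hilbert (tau g) t)"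
    using nz t by (simp add: hilbert_mult_right hilbert_mult_left)
  finally have e: "hilbert (inverse t * ?C * (inverse t * tau g)) (inverse t * ?C * tau h) = \<dots>" .
  have bgh: "b ** g ** h = b ** (g ** h)" by (simp add: matrix_mul_assoc)
  have "cocycle (b ** g) h = hilbert (?C * tau g) (?C * tau h) * (hilbert ?C t * hilbert (tau g) t) *
      s_sign (b ** g) * s_sign h * s_sign (b ** (g ** h))"
    unfolding cocycle_def bgh unfolding b_def tau_borel[OF t] e ..
  moreover have "cocycle b (g ** h) = hilbert ?C t * s_sign (g ** h) * s_sign (b ** (g ** h))"
    unfolding b_def by (rule cocycle_borel[OF t SL2_mult[OF g h]])
  moreover have "cocycle b g = hilbert (tau g) t * s_sign g * s_sign (b ** g)"
    unfolding b_def by (rule cocycle_borel[OF t g])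
  ultimately show ?thesis
    using hilbert_cases[of ?C t] s_sign_cases[of "b ** (g ** h)"] s_sign_cases[of g] cocycle_def[of g h]
    by (elim disjE) simp_all
qed

lemma s_sign_primitive:
  fixes A :: "'p padic^2^2"
  assumes "primitive_row A"
  shows "s_sign A = (if A $ 2 $ 1 = 0 \<or> A $ 2 $ 1 \<in> Zp_units then 1 else hilbert (A $ 2 $ 1) (A $ 2 $ 2))"
proof (cases "A $ 2 $ 1 = 0 \<or> A $ 2 $ 1 \<in> Zp_units")
  case True
  then show ?thesis by (auto simp: s_sign_def padic_ord_unit)
next
  case False
  then have d: "A $ 2 $ 2 \<in> Zp_units" using assms by (simp add: primitive_row_def)
  then show ?thesis using False units_nonzero[OF d]
    by (simp add: s_sign_def hilbert_unit_right)
qed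

text \<open>The change of \<open>s_sign\<close> is the very symbol that occurs in
  \<open>cocycle_borel\<close>, so the two cancel for primitive rows.\<close>

lemma s_sign_hmat_primitive:
  fixes A :: "'p padic^2^2"
  assumes A: "primitive_row A" and u: "u \<in> Zp_units"
  shows "s_sign (hmat u ** xmat s ** A) = s_sign A * hilbert (tau A) u"
proof -
  have u': "inverse u \<in> Zp_units" "u \<noteq> 0" using u units_inverse units_nonzero by auto
  have r: "(hmat u ** xmat s ** A) $ 2 $ 1 = inverse u * A $ 2 $ 1"
    "(hmat u ** xmat s ** A) $ 2 $ 2 = inverse u * A $ 2 $ 2"
    by (simp_all add: matmul2_nth)
  have uu: "inverse u * x \<in> Zp_units \<longleftrightarrow> x \<in> Zp_units" for x :: "'p padic"
    using u' units_mult_pball[OF u'(1)] by (simp add: units_pball)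
  have prim: "primitive_row (hmat u ** xmat s ** A)"
    using A unfolding primitive_row_def r uu units_mult_pball[OF u'(1)] .
  consider "A $ 2 $ 1 = 0" | "A $ 2 $ 1 \<in> Zp_units" | "A $ 2 $ 1 \<noteq> 0" "A $ 2 $ 1 \<notin> Zp_units" "A $ 2 $ 2 \<in> Zp_units"
    using A by (auto simp: primitive_row_def)
  then show ?thesis
  proof cases
    case 1
    then have "A $ 2 $ 2 \<in> Zp_units" using A units_nonzero by (auto simp: primitive_row_def)
    then show ?thesis using 1 u by (simp add: s_sign_def r tau_def hilbert_units)
  next
    case 2
    then show ?thesis using A prim u units_nonzero[OF 2]
      by (simp add: s_sign_primitive r uu tau_def hilbert_units)
  next
    case 3
    then have dz: "A $ 2 $ 2 \<noteq> 0" using units_nonzero by blast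
    have "hilbert (inverse u * A $ 2 $ 1) (inverse u * A $ 2 $ 2) =
        hilbert (A $ 2 $ 1) (A $ 2 $ 2) * hilbert (A $ 2 $ 1) u"
      using 3 dz u u' by (simp add: hilbert_mult_left hilbert_mult_right hilbert_units
        hilbert_unit_right units_inverse leg_inverse padic_ord_mult padic_ord_unit)
    then show ?thesis using 3 A prim u' by (simp add: s_sign_primitive r uu tau_def)
  qed
qed

lemma cocycle_borel_primitive:
  fixes k :: "'p padic^2^2"
  assumes "u \<in> Zp_units" "primitive_row k" "k \<in> SL2"
  shows "cocycle (hmat u ** xmat s) k = 1"
  using assms hilbert_cases[of "tau k" u] s_sign_cases[of k]
  by (auto simp: cocycle_borel units_nonzero s_sign_hmat_primitive)

text \<open>If \<open>c\<close> is a unit, \<open>c3 * c\<close> is a unit square modulo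
  \<open>p\<close> and every factor is 1. Otherwise \<open>a\<close>, \<open>d\<close> and
  \<open>d3\<close> are units with the same Legendre symbol, because \<open>a * d\<close> is 1
  modulo \<open>p\<close>, and so are interchangeable in all symbols. The generic case is then the
  Steinberg relation for \<open>x * a / c3 + c / c3 = 1\<close>; the cases with a vanishing entry
  are separate because \<open>tau\<close> changes its branch there.\<close>

lemma cocycle_nmat:
  fixes k :: "'p padic^2^2"
  assumes x: "x \<in> pball 1" and k: "k \<in> K0 0"
  shows "cocycle (nmat x) k = 1"
proof -
  define a b c d where abcd: "a = k $ 1 $ 1" "b = k $ 1 $ 2" "c = k $ 2 $ 1" "d = k $ 2 $ 2"
  define c3 d3 where c3: "c3 = x * a + c" and d3: "d3 = x * b + d"
  have kb: "a \<in> pball 0" "b \<in> pball 0" "c \<in> pball 0" "d \<in> pball 0" and det: "a * d - b * c = 1"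
    using k by (auto simp: K0_iff SL2_iff abcd)
  have row: "(nmat x ** k) $ 2 $ 1 = c3" "(nmat x ** k) $ 2 $ 2 = d3"
    by (simp_all add: matmul2_nth c3 d3 abcd)
  have xa: "x * a \<in> pball 1" "x * b \<in> pball 1" using pball_mult[OF x kb(1)] pball_mult[OF x kb(2)] by simp_all
  have pk: "primitive_row k" "primitive_row (nmat x)" "primitive_row (nmat x ** k)"
    using K0_primitive[OF k] K0_primitive[OF K0_generators(2)[of x 0]] x pball_mono[of 0 1 x]
      primitive_row_mult[of "nmat x" k] k by auto
  have sx: "s_sign (nmat x) = 1" using x hilbert_eq_1I[of 1 x 0 1 1] pk
    by (auto simp: s_sign_primitive)
  show ?thesis
  proof (cases "c \<in> Zp_units")
    case True
    have c3u: "c3 \<in> Zp_units" using units_add_pball[OF True xa(1)] by (simp add: c3 add.commute)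
    have cz: "c \<noteq> 0" "c3 \<noteq> 0" using True c3u units_nonzero by auto
    have "leg c3 = leg c" using xa by (intro leg_cong[OF c3u]) (simp add: c3)
    then have "hilbert (c3 * tau (nmat x)) (c3 * c) = 1"
      using True c3u cz by (auto simp: tau_def hilbert_units units_mult hilbert_unit_right leg_mult)
    then show ?thesis unfolding cocycle_def using True c3u cz pk sx
      by (simp add: tau_def row s_sign_primitive flip: abcd)
  next
    case False
    then have cp: "c \<in> pball 1" using kb by (simp add: units_pball)
    have du: "d \<in> Zp_units" using pk(1) False by (auto simp: primitive_row_def abcd)
    have "a * d - 1 \<in> pball 1" using pball_mult[OF kb(2) cp] det by (simp add: algebra_simps)
    then have adu: "a * d \<in> Zp_units" "leg (a * d) = 1"
      using units_add_pball[OF units_1, of "a * d - 1"] leg_cong[of "a * d" 1] by auto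
    have au: "a \<in> Zp_units"
      using adu(1) kb pball_mult[of a 1 d 0] by (auto simp: units_pball)
    have lad: "leg a = leg d" using adu(2) leg_mult[OF au du] leg_cases[of a] leg_cases[of d] by auto
    have d3u: "d3 \<in> Zp_units" using units_add_pball[OF du xa(2)] by (simp add: d3 add.commute)
    have ld3: "leg d3 = leg d" using xa by (intro leg_cong[OF d3u]) (simp add: d3)
    have c3p: "c3 \<in> pball 1" using xa cp by (simp add: c3 pball_add)
    have nu: "c3 \<notin> Zp_units" "c \<notin> Zp_units" using c3p cp by (simp_all add: units_pball)
    have nz: "a \<noteq> 0" "d \<noteq> 0" "d3 \<noteq> 0" using au du d3u units_nonzero by auto
    have hd: "hilbert y a = hilbert y d" "hilbert y d3 = hilbert y d"
        "hilbert a y = hilbert y d" "hilbert d3 y = hilbert y d" "hilbert d y = hilbert y d"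
      if "y \<noteq> 0" for y
      using that au du d3u lad ld3 by (simp_all add: hilbert_unit_right hilbert_unit_left)
    have h1: "hilbert y y = hilbert y (-1)" if "y \<noteq> 0" for y :: "'p padic" using that by (rule hilbert_self)
    have sk: "s_sign k = (if c = 0 then 1 else hilbert c d)"
      and s3: "s_sign (nmat x ** k) = (if c3 = 0 then 1 else hilbert c3 d)"
      using pk nu hd(2)[of c3] by (simp_all add: s_sign_primitive row flip: abcd)
    consider "x = 0" | "x \<noteq> 0" "c = 0" | "x \<noteq> 0" "c \<noteq> 0" "c3 = 0" | "x \<noteq> 0" "c \<noteq> 0" "c3 \<noteq> 0" by blast
    then have "hilbert (tau (nmat x ** k) * tau (nmat x)) (tau (nmat x ** k) * tau k) = s_sign k * s_sign (nmat x ** k)"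
    proof cases
      case 1
      then have "nmat x ** k = k" by (auto intro!: mat2_eqI simp: matmul2_nth)
      moreover have "tau k \<noteq> 0" using k by (simp add: tau_nonzero K0_SL2)
      ultimately show ?thesis
        using 1 hilbert_eq_1I[of "tau k" "tau k" 0 "tau k * tau k" 1] by (simp add: tau_def power2_eq_square)
    next
      case 2
      then have "c3 = x * a" by (simp add: c3)
      moreover have "hilbert (x * a * x) (x * a * d) = hilbert (x^2 * a) (x * a * d)"
        by (simp add: power2_eq_square algebra_simps)
      moreover have "hilbert (x^2 * a) (x * a * d) = hilbert a (x * a * d)"
        by (rule hilbert_power2_mult_left[OF 2(1)])
      moreover have "hilbert a d = 1" "hilbert a a = 1" using au du by (simp_all add: hilbert_units)
      ultimately show ?thesis using 2 nz au du hd[of x]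
        by (simp add: tau_def row sk s3 hilbert_mult_left hilbert_mult_right hilbert_units flip: abcd)
    next
      case 3
      then have cx: "c = - (x * a)" by (simp add: c3 eq_neg_iff_add_eq_0 add.commute)
      have hm: "hilbert y (- 1) = 1" if "y \<in> Zp_units" for y :: "'p padic" using that by (simp add: hilbert_units)
      have "hilbert (d3 * x) (d3 * c) = hilbert x d * hilbert x c * hilbert c d"
        using 3 nz d3u hd(4,5)[of c] hd(2)[of x] by (simp add: hilbert_mult_left hilbert_mult_right hilbert_units)
      also have "hilbert x c = hilbert x a" using cx 3 by (simp add: hilbert_minus_mult)
      finally show ?thesis using 3 hd[of x] by (simp add: tau_def row sk s3 flip: abcd)
    next
      case 4
      have "hilbert (x * a / c3) (c / c3) = 1" using 4 by (intro hilbert_steinberg) (simp add: c3 flip: add_divide_distrib)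
      moreover have "x * a / c3 = (inverse c3)^2 * (x * a * c3)" "c / c3 = (inverse c3)^2 * (c * c3)"
        using 4 by (simp_all add: power2_eq_square field_simps)
      ultimately have "hilbert (x * a * c3) (c * c3) = 1"
        using 4 by (metis hilbert_power2_mult_left hilbert_commute inverse_nonzero_iff_nonzero)
      then have "hilbert (c3 * x) (c3 * c) * hilbert a (c3 * c) = 1"
        using 4 nz hilbert_mult_left[of "c3 * x" a "c3 * c"] by (simp add: mult_ac)
      moreover have "hilbert a (c3 * c) = hilbert c3 d * hilbert c d"
        using 4 nz hd[of c] hd[of c3] by (simp add: hilbert_mult_right)
      ultimately show ?thesis using 4 hilbert_cases[of c3 d] hilbert_cases[of c d]
        by (auto simp: tau_def row sk s3 simp flip: abcd)
    qed
    then show ?thesis unfolding cocycle_def sx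
      using s_sign_cases[of k] s_sign_cases[of "nmat x ** k"] by auto
  qed
qed

text \<open>For \<open>a\<close> nonzero, \<open>hilbert_minus_mult\<close> turns the symbol into
  that of \<open>a\<close> and \<open>tau k\<close>. What remains depends on which of
  \<open>a\<close> and \<open>c\<close> are units; the determinant modulo \<open>p\<close> relates
  the Legendre symbols of the entries.\<close>

lemma cocycle_wmat:
  fixes k :: "'p padic^2^2"
  assumes k: "k \<in> K0 0"
  shows "cocycle wmat k = 1"
proof -
  define a b c d where abcd: "a = k $ 1 $ 1" "b = k $ 1 $ 2" "c = k $ 2 $ 1" "d = k $ 2 $ 2"
  have kb: "a \<in> pball 0" "b \<in> pball 0" "c \<in> pball 0" "d \<in> pball 0" and det: "a * d - b * c = 1"
    using k by (auto simp: K0_iff SL2_iff abcd)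
  have row: "(wmat ** k) $ 2 $ 1 = - a" "(wmat ** k) $ 2 $ 2 = - b"
    by (simp_all add: matmul2_nth abcd)
  have pk: "primitive_row k" "primitive_row (wmat ** k)"
    using K0_primitive[OF k] K0_primitive[OF K0_mult[OF K0_generators(3) k]] by auto
  have sw: "s_sign wmat = 1" by (simp add: s_sign_def)
  have sk: "s_sign k = (if c = 0 \<or> c \<in> Zp_units then 1 else hilbert c d)"
    and s3: "s_sign (wmat ** k) = (if a = 0 \<or> a \<in> Zp_units then 1 else hilbert (- a) (- b))"
    using pk by (simp_all add: s_sign_primitive row flip: abcd)
  have m1: "- 1 \<in> (Zp_units :: 'p padic set)" by simp
  have "hilbert (tau (wmat ** k) * tau wmat) (tau (wmat ** k) * tau k) = s_sign k * s_sign (wmat ** k)"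
  proof (cases "a = 0")
    case True
    then have bu: "b \<in> Zp_units" using pk(2) units_nonzero by (auto simp: primitive_row_def row)
    have "c = - inverse b" using det True units_nonzero[OF bu] by (simp add: field_simps) (metis minus_equation_iff)
    then have "c \<in> Zp_units" using units_inverse[OF bu] by simp
    then show ?thesis using True bu units_nonzero[of c]
      by (simp add: tau_def row sk s3 hilbert_units units_mult flip: abcd)
  next
    case az: False
    have "tau k \<noteq> 0" using k by (simp add: tau_nonzero K0_SL2)
    have "hilbert (tau (wmat ** k) * tau wmat) (tau (wmat ** k) * tau k) = hilbert a (- (a * tau k))"
      using az by (simp add: tau_def row)
    also have "\<dots> = hilbert a (tau k)" by (rule hilbert_minus_mult[OF az])
    finally have e: "hilbert (tau (wmat ** k) * tau wmat) (tau (wmat ** k) * tau k) = hilbert a (tau k)" .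
    show ?thesis
    proof (cases "c \<in> Zp_units")
      case True
      then have tk: "tau k = c" "c \<noteq> 0" using units_nonzero by (auto simp: tau_def abcd)
      show ?thesis
      proof (cases "a \<in> Zp_units")
        case au: True
        then show ?thesis unfolding e sk s3 using True tk by (simp add: hilbert_units)
      next
        case False
        then have ap: "a \<in> pball 1" using kb by (simp add: units_pball)
        have bu: "b \<in> Zp_units" using pk(2) False by (auto simp: primitive_row_def row)
        have "- b * c - 1 \<in> pball 1" using pball_mult[OF ap kb(4)] det
          by (simp add: algebra_simps pball_diff_commute[of "-(b*c)" 1])
        then have "- b * c \<in> Zp_units" "leg (- b * c) = 1"
          using units_add_pball[OF units_1, of "- b * c - 1"] leg_cong[of "- b * c" 1] by auto
        then have "leg (- b) = leg c"
          using leg_mult[of "-b" c] bu True leg_cases[of "-b"] leg_cases[of c] by auto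
        moreover have "hilbert (- 1) (- b) = 1" using bu by (simp add: hilbert_units)
        ultimately have "hilbert (- a) (- b) = hilbert a c"
          using hilbert_mult_left[of "-1" a "-b"] az bu True units_nonzero[OF bu]
          by (simp add: hilbert_unit_right)
        then show ?thesis unfolding e unfolding sk s3 tk using True az False by simp
      qed
    next
      case False
      then have cp: "c \<in> pball 1" using kb by (simp add: units_pball)
      have du: "d \<in> Zp_units" using pk(1) False by (auto simp: primitive_row_def abcd)
      have "a * d - 1 \<in> pball 1" using pball_mult[OF kb(2) cp] det by (simp add: algebra_simps)
      then have adu: "a * d \<in> Zp_units" "leg (a * d) = 1"
        using units_add_pball[OF units_1, of "a * d - 1"] leg_cong[of "a * d" 1] by auto
      have au: "a \<in> Zp_units"
        using adu(1) kb pball_mult[of a 1 d 0] by (auto simp: units_pball)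
      have lad: "leg a = leg d" using adu(2) leg_mult[OF au du] leg_cases[of a] leg_cases[of d] by auto
      show ?thesis
      proof (cases "c = 0")
        case True
        then show ?thesis unfolding e sk s3 using au du by (simp add: tau_def hilbert_units flip: abcd)
      next
        case cz: False
        then show ?thesis unfolding e sk s3 using au du lad False
          by (simp add: tau_def hilbert_unit_left hilbert_unit_right flip: abcd)
      qed
    qed
  qed
  then show ?thesis unfolding cocycle_def sw
    using s_sign_cases[of k] s_sign_cases[of "wmat ** k"] by auto
qed

text \<open>An upper unipotent factor can change sides: on the left it preserves the bottom row, and
  on the right of \<open>wmat\<close> it preserves the lower left entry, a unit, which alone
  determines \<open>tau\<close> and \<open>s_sign\<close>.\<close>

lemma cocycle_xmat_middle:
  fixes k :: "'p padic^2^2"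
  shows "cocycle (wmat ** xmat y) k = cocycle wmat (xmat y ** k)"
proof -
  have "tau (wmat ** xmat y) = tau wmat" "tau (xmat y ** k) = tau k"
    "s_sign (wmat ** xmat y) = s_sign (wmat :: 'p padic^2^2)" "s_sign (xmat y ** k) = s_sign k"
    by (simp_all add: tau_def s_sign_def matmul2_nth padic_ord_unit)
  then show ?thesis by (simp add: cocycle_def matrix_mul_assoc)
qed

text \<open>The Bruhat decomposition modulo \<open>p\<close>: the two cells are told apart by
  whether the lower left entry is a unit.\<close>

lemma primitive_row_decomp:
  fixes g :: "'p padic^2^2"
  assumes g: "g \<in> SL2" "primitive_row g"
  obtains u s x where "u \<in> Zp_units" "x \<in> pball 1" "g = hmat u ** xmat s ** nmat x"
    | u s y where "u \<in> Zp_units" "y \<in> pball 0" "g = hmat u ** xmat s ** (wmat ** xmat y)"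
proof (cases "g $ 2 $ 1 \<in> Zp_units")
  case True
  let ?c = "g $ 2 $ 1" and ?d = "g $ 2 $ 2"
  have cz: "?c \<noteq> 0" using True units_nonzero by blast
  have "g = hmat (- inverse ?c) ** xmat (?c * g $ 1 $ 1) ** (wmat ** xmat (?d / ?c))"
    using g cz by (intro mat2_eqI) (auto simp: matmul2_nth SL2_iff field_simps)
  moreover have "?d / ?c \<in> pball 0"
    using pball_mult[of ?d 0 "inverse ?c" 0] g(2) units_inverse[OF True]
    by (auto simp: primitive_row_def divide_inverse units_pball)
  ultimately show thesis using that(2)[of "- inverse ?c"] units_inverse[OF True] by simp
next
  case False
  let ?c = "g $ 2 $ 1" and ?d = "g $ 2 $ 2"
  have du: "?d \<in> Zp_units" and cp: "?c \<in> pball 1" using False g(2) by (auto simp: primitive_row_def units_pball)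
  have dz: "?d \<noteq> 0" using du units_nonzero by blast
  have "g = hmat (inverse ?d) ** xmat (?d * g $ 1 $ 2) ** nmat (?c / ?d)"
    using g dz by (intro mat2_eqI) (auto simp: matmul2_nth SL2_iff field_simps)
  moreover have "?c / ?d \<in> pball 1"
    using pball_mult[OF cp, of "inverse ?d" 0] units_inverse[OF du]
    by (auto simp: divide_inverse units_pball)
  ultimately show thesis using that(1)[of "inverse ?d"] units_inverse[OF du] by simp
qed

text \<open>The Borel factor of \<open>g\<close> is peeled off with
  \<open>cocycle_borel_assoc\<close>, as its cocycles with primitive rows are trivial. The remaining
  representative is \<open>nmat x\<close> or \<open>wmat ** xmat y\<close>.\<close>

theorem cocycle_splits:
  fixes g k :: "'p padic^2^2"
  assumes g: "g \<in> SL2" "primitive_row g" and k: "k \<in> K0 0"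
  shows "cocycle g k = 1"
proof -
  have *: "cocycle (hmat u ** xmat s ** r) k = 1"
    if "u \<in> Zp_units" "r \<in> K0 0" "cocycle r k = 1" for u s r
    using cocycle_borel_assoc[of u r k s] that k
      cocycle_borel_primitive[OF that(1) K0_primitive[OF that(2)] K0_SL2[OF that(2)]]
      cocycle_borel_primitive[OF that(1) K0_primitive K0_SL2, OF K0_mult[OF that(2) k] K0_mult[OF that(2) k]]
      units_nonzero[OF that(1)] by (simp add: K0_SL2)
  from g show ?thesis
  proof (cases rule: primitive_row_decomp)
    case (1 u s x)
    then show ?thesis using k pball_mono[of 0 1 x] by (auto intro!: * cocycle_nmat)
  next
    case (2 u s y)
    have "cocycle (wmat ** xmat y) k = 1"
      unfolding cocycle_xmat_middle using 2 k by (intro cocycle_wmat K0_mult) auto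
    then show ?thesis using 2 K0_mult[OF K0_generators(3) K0_generators(1)[OF 2(2)]] by (auto intro!: *)
  qed
qed

text \<open>The bottom entry of larger absolute value serves as pivot, so that the quotient of the
  two entries is integral.\<close>

lemma iwasawa:
  fixes g :: "'p padic^2^2"
  assumes g: "g \<in> SL2"
  obtains t s k where "t \<noteq> 0" "k \<in> K0 0" "g = hmat t ** xmat s ** k"
proof -
  let ?c = "g $ 2 $ 1" and ?d = "g $ 2 $ 2"
  show thesis
  proof (cases "padic_abs ?c \<le> padic_abs ?d")
    case True
    have dz: "?d \<noteq> 0"
    proof
      assume d0: "?d = 0"
      then have "padic_abs ?c = 0" using True padic_abs_nonneg[of ?c] by simp
      then show False using g d0 by (simp add: SL2_iff)
    qed
    have "nmat (?c / ?d) \<in> K0 0" using True dz padic_abs_eq_0[of ?d] padic_abs_nonneg[of ?d]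
      by (intro K0_generators) (simp add: pball_def padic_abs_divide divide_le_eq_1 order.strict_iff_order del: padic_abs_eq_0)
    moreover have "g = hmat (inverse ?d) ** xmat (?d * g $ 1 $ 2) ** nmat (?c / ?d)"
      using g dz by (intro mat2_eqI) (auto simp: matmul2_nth SL2_iff field_simps)
    ultimately show thesis using that[of "inverse ?d"] dz by simp
  next
    case False
    then have cz: "?c \<noteq> 0" by auto
    have "wmat ** xmat (?d / ?c) \<in> K0 0"
      using False order.strict_trans1[OF padic_abs_nonneg[of ?d], of "padic_abs ?c"]
      by (intro K0_mult K0_generators) (simp add: pball_def padic_abs_divide divide_le_eq_1)
    moreover have "g = hmat (- inverse ?c) ** xmat (?c * g $ 1 $ 1) ** (wmat ** xmat (?d / ?c))"
      using g cz by (intro mat2_eqI) (auto simp: matmul2_nth SL2_iff field_simps)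
    ultimately show thesis using that[of "- inverse ?c"] cz by simp
  qed
qed

text \<open>By the Iwasawa decomposition it suffices to treat a first entry in the Borel subgroup.\<close>

lemma cocycle_K_assoc:
  fixes g k1 k2 :: "'p padic^2^2"
  assumes g: "g \<in> SL2" and k: "k1 \<in> K0 0" "k2 \<in> K0 0"
  shows "cocycle g k1 * cocycle (g ** k1) k2 = cocycle g (k1 ** k2)"
proof -
  obtain t s k where t: "t \<noteq> 0" and k0: "k \<in> K0 0" and gk: "g = hmat t ** xmat s ** k"
    using iwasawa[OF g] .
  let ?b = "hmat t ** xmat s"
  have e: "cocycle (?b ** k') k'' * cocycle ?b (k' ** k'') = cocycle ?b k'"
    if "k' \<in> K0 0" "k'' \<in> K0 0" for k' k''
    using cocycle_borel_assoc[OF t K0_SL2[OF that(1)] K0_SL2[OF that(2)]]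
      cocycle_splits[OF K0_SL2[OF that(1)] K0_primitive[OF that(1)] that(2)] by simp
  have c: "cocycle x y = 1 \<or> cocycle x y = - 1" for x y :: "'p padic^2^2"
    using hilbert_cases[of "tau (x ** y) * tau x" "tau (x ** y) * tau y"]
      s_sign_cases[of x] s_sign_cases[of y] s_sign_cases[of "x ** y"]
    by (auto simp: cocycle_def)
  show ?thesis
    using e[OF k0 k(1)] e[OF k0 K0_mult[OF k]] e[OF K0_mult[OF k0 k(1)] k(2)]
      c[of ?b k] c[of ?b "k ** k1"] c[of ?b "k ** k1 ** k2"]
    by (auto simp: gk matrix_mul_assoc)
qed

lemma cocycle_cases: "cocycle x y = 1 \<or> cocycle x y = - 1" for x y :: "'p padic^2^2"
    using hilbert_cases[of "tau (x ** y) * tau x" "tau (x ** y) * tau y"]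
      s_sign_cases[of x] s_sign_cases[of y] s_sign_cases[of "x ** y"]
    by (auto simp: cocycle_def)

end

section \<open>Balls as cosets, and the topology they generate\<close>

definition coset :: "'p::prime_card padic \<Rightarrow> int \<Rightarrow> 'p padic set" where
  "coset b n = {y. y - b \<in> pball n}"

lemma coset_0: "coset 0 n = pball n" by (simp add: coset_def)

lemma coset_eq_cball: "coset b n = cball (b::'p::prime_card padic) (real CARD('p) powi (-n))"
  unfolding coset_def using cball_pball[of _ b n] by blast

lemma coset_eqI: "c \<in> coset b n \<Longrightarrow> coset b n = coset c n"
proof -
  assume c: "c \<in> coset b n"
  have "y - b \<in> pball n \<longleftrightarrow> y - c \<in> pball n" for y
    using c pball_add[of "y - c" n "c - b"] pball_diff[of "y - b" n "c - b"] by (auto simp: coset_def)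
  then show ?thesis by (auto simp: coset_def)
qed

lemma open_coset: "open (coset (b::'p::prime_card padic) n)"
  unfolding open_dist
proof (intro ballI exI[of _ "real CARD('p) powi (-n)"] conjI allI impI)
  fix x y assume x: "x \<in> coset b n" and "dist y x < real CARD('p) powi (-n)"
  then have "y \<in> coset x n" by (simp add: coset_def pball_def dist_padic_def)
  then show "y \<in> coset b n" using coset_eqI[OF x] by simp
qed simp

lemma sets_borel_coset [measurable, simp]: "coset (b::'p::prime_card padic) n \<in> sets borel"
  by (simp add: open_coset borel_open)

lemma coset_neighbourhood:
  assumes "e > 0"
  obtains n :: nat where "coset (x::'p::prime_card padic) (int n) \<subseteq> ball x e"
proof -
  have "1 / real CARD('p) < 1" using card_real_gt_1[where 'p='p] by (simp del: card_real_gt_1)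
  then obtain n where "(1 / real CARD('p)) ^ n < e" using real_arch_pow_inv[OF assms] by blast
  then show thesis
    by (intro that[of n]) (auto simp: coset_eq_cball power_int_minus power_divide inverse_eq_divide)
qed

lemma open_coset_iff: "open U \<longleftrightarrow> (\<forall>x\<in>U. \<exists>n::nat. coset (x::'p::prime_card padic) (int n) \<subseteq> U)"
proof
  assume U: "open U"
  show "\<forall>x\<in>U. \<exists>n::nat. coset x (int n) \<subseteq> U"
  proof
    fix x assume "x \<in> U"
    then obtain e where "e > 0" "ball x e \<subseteq> U" using U open_contains_ball by blast
    then show "\<exists>n::nat. coset x (int n) \<subseteq> U" using coset_neighbourhood by (metis order_trans)
  qed
next
  assume *: "\<forall>x\<in>U. \<exists>n::nat. coset x (int n) \<subseteq> U"
  show "open U"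
    unfolding open_subopen[of U]
  proof
    fix x assume "x \<in> U"
    then obtain n where "coset x (int n) \<subseteq> U" using * by blast
    then show "\<exists>T. open T \<and> x \<in> T \<and> T \<subseteq> U"
      by (intro exI[of _ "coset x (int n)"] conjI open_coset) (auto simp: coset_def)
  qed
qed

section \<open>Haar measure\<close>

text \<open>\<open>digit_rev\<close> enumerates \<open>\<rat>\<^sub>p/\<int>\<^sub>p\<close> by reversing base \<open>p\<close> digits across the radix point.
  The Monna map, its scaling limit, carries Lebesgue measure on \<open>[0, \<infinity>)\<close> to Haar measure,
  since the preimage of a ball is an interval.\<close>

function digit_rev :: "nat \<Rightarrow> 'p::prime_card padic" where
  "digit_rev k = (if k = 0 then 0 else (of_nat (k mod CARD('p)) + digit_rev (k div CARD('p))) / pp)"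
  by pat_completeness auto
termination
  by (relation "Wellfounded.measure id") (simp_all add: div_less_dividend[OF card_gt_1])

declare digit_rev.simps [simp del]

lemma digit_rev_0 [simp]: "digit_rev 0 = 0" by (subst digit_rev.simps) simp

lemma digit_rev_rec:
  "digit_rev k = (of_nat (k mod CARD('p)) + digit_rev (k div CARD('p))) / (pp::'p::prime_card padic)"
  by (cases "k = 0", simp, subst digit_rev.simps, simp)

lemma pp_mult_pball: "pp * x \<in> pball (n + 1) \<longleftrightarrow> x \<in> pball n"
  by (cases "x = 0") (auto simp: pball_iff padic_ord_mult)

text \<open>After multiplication by \<open>pp\<close> the difference splits into a digit part
  \<open>D\<close> and a tail \<open>R\<close>. Integrality of \<open>D\<close> gives that of
  \<open>R\<close>, so the tails agree by induction, and then the digits agree modulo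
  \<open>p\<close>.\<close>

lemma digit_rev_inj:
  assumes "digit_rev i - digit_rev j \<in> (pball 0 :: 'p::prime_card padic set)"
  shows "i = j"
  using assms
proof (induction "i + j" arbitrary: i j rule: less_induct)
  case less
  show ?case
  proof (cases "i = 0 \<and> j = 0")
    case False
    let ?p = "CARD('p)"
    define D R where "D = (of_nat (i mod ?p) - of_nat (j mod ?p) :: 'p padic)"
      and "R = (digit_rev (i div ?p) - digit_rev (j div ?p) :: 'p padic)"
    have "pp * (digit_rev i - digit_rev j) = D + R"
      by (simp add: digit_rev_rec[of i] digit_rev_rec[of j] D_def R_def field_simps)
    then have DR: "D + R \<in> pball 1" using pp_mult_pball[of _ 0] less.prems by (metis add_0)
    moreover have "D \<in> pball 0" unfolding D_def by (intro pball_diff) auto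
    ultimately have "R \<in> pball 0" using pball_diff[of "D + R" 0 D] pball_mono[of 0 1] by fastforce
    moreover have "i div ?p + j div ?p < i + j"
      using False card_gt_1[where 'p='p] by (metis add_less_le_mono add_le_less_mono div_le_dividend div_less_dividend gr0I)
    ultimately have e: "i div ?p = j div ?p" unfolding R_def using less.hyps by blast
    then have "D \<in> pball (int 1)" using DR by (simp add: R_def)
    then have "i mod ?p = j mod ?p"
      unfolding D_def by (rule of_nat_residue_inj) simp_all
    then show ?thesis using e by (metis div_mult_mod_eq)
  qed simp
qed

lemma digit_rev_surj:
  assumes "y \<in> (pball (- int n) :: 'p::prime_card padic set)"
  obtains k where "y - digit_rev k \<in> pball 0"
  using assms
proof (induction n arbitrary: y thesis)
  case 0
  then show ?case using 0(1)[of 0] by simp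
next
  case (Suc n)
  have "pp * y \<in> pball (- int n)" using Suc.prems(2) pp_mult_pball[of y "- int (Suc n)"] by simp
  then obtain k where k: "pp * y - digit_rev k \<in> pball 0" using Suc.IH by blast
  then obtain d where d: "d < CARD('p)" "pp * y - digit_rev k - of_nat d \<in> pball 1"
    using Zp_residue[of "pp * y - digit_rev k" 1] by (auto simp: Zp_pball)
  have "digit_rev (k * CARD('p) + d) = (of_nat d + digit_rev k) / (pp::'p padic)"
    using d(1) by (subst digit_rev_rec) simp
  then have "pp * (y - digit_rev (k * CARD('p) + d)) = pp * y - digit_rev k - of_nat d"
    by (simp add: field_simps)
  then have "y - digit_rev (k * CARD('p) + d) \<in> pball 0"
    using d(2) pp_mult_pball[of _ 0] by (metis add_0)
  then show ?case by (rule Suc.prems(1))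
qed

lemma pball_exhaust:
  obtains n :: nat where "(x::'p::prime_card padic) \<in> pball (- int n)"
  by (cases "x = 0") (auto simp: pball_iff intro: that[of "nat (- padic_ord x)"])

lemma digit_rev_ex1: "\<exists>!k. (y::'p::prime_card padic) - digit_rev k \<in> pball 0"
proof -
  obtain n :: nat where "y \<in> pball (- int n)" by (rule pball_exhaust)
  then obtain k where k: "y - digit_rev k \<in> pball 0" by (rule digit_rev_surj)
  have "l = k" if "y - digit_rev l \<in> pball 0" for l
    using digit_rev_inj[of l k, where 'p='p] pball_diff[OF k that] by simp
  then show ?thesis using k by blast
qed

text \<open>Uses the digits of \<open>x\<close> before the radix point and the first
  \<open>n\<close> after it; the factor \<open>p^n\<close> puts the reversed expansion in its
  place.\<close>

definition monna_approx :: "nat \<Rightarrow> real \<Rightarrow> 'p::prime_card padic" where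
  "monna_approx n x = pp ^ n * digit_rev (nat \<lfloor>x * real CARD('p) ^ n\<rfloor>)"

definition monna :: "real \<Rightarrow> 'p::prime_card padic" where
  "monna x = (SOME y. \<forall>n. y - monna_approx n x \<in> pball (int n))"

lemma pp_power_mult_pball: "pp ^ m * x \<in> pball (int m + n) \<longleftrightarrow> (x::'p::prime_card padic) \<in> pball n"
  using padic_ord_pp_powi[of "int m", where 'p='p] by (cases "x = 0") (auto simp: pball_iff padic_ord_mult)

lemma monna_approx_Suc:
  assumes "x \<ge> 0"
  shows "monna_approx (Suc n) x - monna_approx n x \<in> (pball (int n) :: 'p::prime_card padic set)"
proof -
  let ?p = "CARD('p)"
  define K where "K = nat \<lfloor>x * real ?p ^ Suc n\<rfloor>"
  have "\<lfloor>x * real ?p ^ n\<rfloor> = \<lfloor>x * real ?p ^ Suc n / real_of_int (int ?p)\<rfloor>" by simp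
  also have "\<dots> = \<lfloor>x * real ?p ^ Suc n\<rfloor> div int ?p" by (rule floor_divide_real_eq_div) simp
  finally have "nat \<lfloor>x * real ?p ^ n\<rfloor> = K div ?p"
    using assms by (simp add: K_def nat_div_distrib)
  then have "monna_approx n x = pp ^ n * (digit_rev (K div ?p) :: 'p padic)"
    by (simp only: monna_approx_def)
  moreover have "monna_approx (Suc n) x = pp ^ Suc n * (digit_rev K :: 'p padic)"
    by (simp only: monna_approx_def K_def)
  moreover have "pp * digit_rev K = (of_nat (K mod ?p) + digit_rev (K div ?p) :: 'p padic)"
    by (subst digit_rev_rec) simp
  ultimately have "monna_approx (Suc n) x - monna_approx n x = pp ^ n * (of_nat (K mod ?p) :: 'p padic)"
    by (simp add: power_Suc2 mult.assoc distrib_left del: power_Suc)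
  then show ?thesis using pp_power_mult_pball[of n _ 0, where 'p='p] by simp
qed

lemma monna_approx_diff:
  assumes "x \<ge> 0"
  shows "monna_approx (n + m) x - monna_approx n x \<in> (pball (int n) :: 'p::prime_card padic set)"
proof (induction m)
  case (Suc m)
  have "monna_approx (n + Suc m) x - monna_approx (n + m) x \<in> (pball (int n) :: 'p padic set)"
    using monna_approx_Suc[OF assms, of "n + m"] pball_mono[of "int n" "int (n + m)"] by simp
  from pball_add[OF this Suc] show ?case by simp
qed simp

lemma monna:
  assumes "x \<ge> 0"
  shows "monna x - monna_approx n x \<in> (pball (int n) :: 'p::prime_card padic set)"
proof -
  let ?M = "\<lambda>n. monna_approx n x :: 'p padic"
  have c: "?M m \<in> cball (?M n) (real CARD('p) powi (- int n))" if "m \<ge> n" for m n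
    using monna_approx_diff[OF assms, of n "m - n", where 'p='p] that by (simp only: cball_pball) simp
  have "Cauchy ?M"
  proof (rule metric_CauchyI)
    fix e :: real assume "e > 0"
    then obtain n where n: "coset (0::'p padic) (int n) \<subseteq> ball 0 e" using coset_neighbourhood by blast
    have "dist (?M i) (?M j) < e" if "i \<ge> n" "j \<ge> n" for i j
    proof -
      have "?M i - ?M n \<in> pball (int n)" "?M j - ?M n \<in> pball (int n)"
        using c[OF that(1)] c[OF that(2)] by (simp_all only: cball_pball)
      then have "?M i - ?M j \<in> pball (int n)" using pball_diff by fastforce
      then have "?M i - ?M j \<in> ball 0 e" using n by (auto simp: coset_0)
      then show ?thesis by (simp add: dist_padic_def padic_abs_diff_commute[of "?M i"])
    qed
    then show "\<exists>M. \<forall>m\<ge>M. \<forall>n\<ge>M. dist (?M m) (?M n) < e" by blast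
  qed
  then obtain L where L: "?M \<longlonglongrightarrow> L" using Cauchy_convergent convergent_def by blast
  have "L - ?M n \<in> pball (int n)" for n
  proof -
    have "L \<in> cball (?M n) (real CARD('p) powi (- int n))"
      by (rule Lim_in_closed_set[OF closed_cball eventually_sequentiallyI[of n, OF c]
            trivial_limit_sequentially L])
    then show ?thesis by (simp only: cball_pball)
  qed
  then have "\<exists>y. \<forall>n. y - ?M n \<in> pball (int n)" by blast
  then have "\<forall>n. monna x - ?M n \<in> pball (int n)" unfolding monna_def by (rule someI_ex)
  then show ?thesis by blast
qed

text \<open>Modulo \<open>p^n\<close> only the \<open>n\<close>-th approximation counts. It depends
  on the integer part of \<open>x p^n\<close>, and \<open>digit_rev_ex1\<close> singles out the one
  integer that hits the coset.\<close>

lemma monna_vimage_coset: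
  obtains k :: nat where "monna -` coset (b::'p::prime_card padic) (int n) \<inter> {0..} =
    {real k / real CARD('p) ^ n ..< (real k + 1) / real CARD('p) ^ n}"
proof -
  obtain k where k: "\<And>j. b / pp ^ n - digit_rev j \<in> pball 0 \<longleftrightarrow> j = k"
    using digit_rev_ex1[of "b / pp ^ n"] by metis
  have "monna x \<in> coset b (int n) \<longleftrightarrow> real k / real CARD('p) ^ n \<le> x \<and> x < (real k + 1) / real CARD('p) ^ n"
    if x: "x \<ge> 0" for x
  proof -
    let ?j = "nat \<lfloor>x * real CARD('p) ^ n\<rfloor>"
    have "monna x \<in> coset b (int n) \<longleftrightarrow> b \<in> coset (monna x) (int n)"
      by (simp add: coset_def pball_diff_commute)
    also have "coset (monna x) (int n) = coset (monna_approx n x :: 'p padic) (int n)"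
      using monna[OF x, of n, where 'p='p] by (intro coset_eqI[symmetric]) (simp add: coset_def)
    also have "b \<in> \<dots> \<longleftrightarrow> pp ^ n * (b / pp ^ n - digit_rev ?j) \<in> pball (int n + 0)"
      by (simp add: coset_def monna_approx_def algebra_simps)
    also have "\<dots> \<longleftrightarrow> ?j = k" unfolding pp_power_mult_pball k ..
    also have "\<dots> \<longleftrightarrow> \<lfloor>x * real CARD('p) ^ n\<rfloor> = int k" using x by auto
    also have "\<dots> \<longleftrightarrow> real k \<le> x * real CARD('p) ^ n \<and> x * real CARD('p) ^ n < real k + 1"
      by (simp add: floor_eq_iff)
    finally show ?thesis by (simp add: field_simps)
  qed
  moreover have "x \<ge> 0" if "real k / real CARD('p) ^ n \<le> x" for x
    using that by (meson divide_nonneg_nonneg of_nat_0_le_iff order_trans zero_le_power)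
  ultimately have "monna -` coset b (int n) \<inter> {0..} =
    {real k / real CARD('p) ^ n ..< (real k + 1) / real CARD('p) ^ n}" by auto
  then show thesis by (rule that)
qed

text \<open>The empty set is included to make the family closed under intersection: two balls are
  nested or disjoint.\<close>

definition cosets :: "'p::prime_card padic set set" where
  "cosets = insert {} (range (\<lambda>(b, n::nat). coset b (int n)))"

text \<open>Every open set is a countable union of balls, since \<open>digit_rev\<close> supplies
  countably many centres for each radius.\<close>

lemma borel_eq_cosets: "sets borel = sigma_sets UNIV (cosets :: 'p::prime_card padic set set)"
proof
  show "sigma_sets UNIV cosets \<subseteq> (sets borel :: 'p padic set set)"
    unfolding cosets_def by (intro sets.sigma_sets_subset[of _ borel, simplified]) (auto intro: open_coset)
  have "U \<in> sigma_sets UNIV cosets" if U: "open U" for U :: "'p padic set"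
  proof -
    define F :: "'p padic set set"
      where "F = {coset (pp ^ n * digit_rev k) (int n) | n k. coset (pp ^ n * digit_rev k) (int n) \<subseteq> U}"
    have "countable F"
    proof (rule countable_subset)
      show "F \<subseteq> range (\<lambda>(n, k). coset (pp ^ n * digit_rev k) (int n))" by (auto simp: F_def)
    qed auto
    moreover have "F \<subseteq> cosets" by (auto simp: F_def cosets_def)
    moreover have "x \<in> \<Union>F" if "x \<in> U" for x
    proof -
      obtain n :: nat where n: "coset x (int n) \<subseteq> U" using U \<open>x \<in> U\<close> open_coset_iff by blast
      obtain k where "x / pp ^ n - digit_rev k \<in> pball 0" using digit_rev_ex1 by blast
      then have "pp ^ n * (x / pp ^ n - digit_rev k) \<in> pball (int n + 0)" by (simp only: pp_power_mult_pball)
      then have "x \<in> coset (pp ^ n * digit_rev k) (int n)" by (simp add: coset_def algebra_simps)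
      moreover from this have "coset (pp ^ n * digit_rev k) (int n) \<subseteq> U" using n coset_eqI by blast
      ultimately show ?thesis by (auto simp: F_def)
    qed
    then have "U = \<Union>F" by (auto simp: F_def)
    ultimately show ?thesis using sigma_sets_UNION[of F UNIV cosets] by (auto intro: sigma_sets.Basic)
  qed
  then show "sets borel \<subseteq> sigma_sets UNIV (cosets :: 'p padic set set)"
    unfolding borel_def by (simp, intro sigma_sets_mono) blast
qed

lemma coset_in_cosets: "coset b (int n) \<in> cosets"
  unfolding cosets_def by (rule insertI2, rule range_eqI[of _ _ "(b, n)"]) simp

lemma Int_stable_cosets: "Int_stable (cosets :: 'p::prime_card padic set set)"
proof -
  have *: "coset b (int m) \<inter> coset c (int n) \<in> cosets" if "m \<le> n" for b c :: "'p padic" and m n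
  proof (cases "coset b (int m) \<inter> coset c (int n) = {}")
    case False
    then obtain x where x: "x \<in> coset b (int m)" "x \<in> coset c (int n)" by blast
    have "coset x (int n) \<subseteq> coset x (int m)"
      using that pball_mono[of "int m" "int n"] by (auto simp: coset_def)
    then have "coset b (int m) \<inter> coset c (int n) = coset c (int n)"
      using coset_eqI[OF x(1)] coset_eqI[OF x(2)] by auto
    then show ?thesis by (auto simp: cosets_def)
  qed (simp add: cosets_def)
  have "A \<inter> B \<in> cosets" if AB: "A \<in> cosets" "B \<in> cosets" for A B :: "'p padic set"
  proof -
    consider "A = {} \<or> B = {}" | b m c n where "A = coset b (int m)" "B = coset c (int n)"
      using AB by (auto simp: cosets_def)
    then show ?thesis
    proof cases
      case 2
      then show ?thesis using *[of m n b c] *[of n m c b] by (cases "m \<le> n") (auto simp: Int_commute)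
    qed (auto simp: cosets_def)
  qed
  then show ?thesis by (auto simp: Int_stable_def)
qed

lemma measurable_cosetsI:
  assumes "\<And>b n. f -` coset (b::'p::prime_card padic) (int n) \<inter> space M \<in> sets M"
  shows "f \<in> measurable M borel"
proof -
  have "f \<in> measurable M (measure_of UNIV cosets (\<lambda>_. 0))"
    using assms by (intro measurable_measure_of) (auto simp: cosets_def)
  moreover have "sets (measure_of UNIV cosets (\<lambda>_. 0)) = (sets borel :: 'p padic set set)"
    by (simp add: borel_eq_cosets)
  ultimately show ?thesis using measurable_cong_sets by blast
qed

lemma vimage_plus_coset: "(+) a -` coset b n = coset (b - a) n"
  by (auto simp: coset_def algebra_simps)

lemma measurable_plus [measurable]: "(+) (a::'p::prime_card padic) \<in> measurable borel borel"
  by (rule measurable_cosetsI) (simp add: vimage_plus_coset)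

lemma coset_self [simp]: "x \<in> coset x n" by (simp add: coset_def)

text \<open>The image of Lebesgue measure gives a coset of \<open>p^n\<close> the mass
  \<open>p^(-n)\<close>, whatever its centre. Translations permute these cosets, and the cosets form
  an intersection-stable generator.\<close>

lemma haar_exists:
  "\<exists>M. sets M = sets (borel :: 'p::prime_card padic measure) \<and>
     (\<forall>a. distr M borel ((+) a) = M) \<and> emeasure M Zp = 1"
proof -
  define L where "L = restrict_space lborel {0::real..}"
  define M where "M = distr L borel (monna :: real \<Rightarrow> 'p padic)"
  have sL: "space L = {0..}" by (simp add: L_def space_restrict_space)
  have m: "monna \<in> measurable L (borel :: 'p padic measure)"
  proof (rule measurable_cosetsI)
    fix b :: "'p padic" and n
    obtain k :: nat where "monna -` coset b (int n) \<inter> {0..} =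
        {real k / real CARD('p) ^ n ..< (real k + 1) / real CARD('p) ^ n}" by (rule monna_vimage_coset)
    then show "monna -` coset b (int n) \<inter> space L \<in> sets L"
      by (auto simp: sL L_def sets_restrict_space_iff)
  qed
  have eM: "emeasure M (coset b (int n)) = ennreal (1 / real CARD('p) ^ n)" for b and n :: nat
  proof -
    obtain k :: nat where k: "monna -` coset b (int n) \<inter> {0..} =
        {real k / real CARD('p) ^ n ..< (real k + 1) / real CARD('p) ^ n}" by (rule monna_vimage_coset)
    have "emeasure M (coset b (int n)) = emeasure L (monna -` coset b (int n) \<inter> {0..})"
      unfolding M_def by (subst emeasure_distr[OF m]) (simp_all add: sL)
    also have "\<dots> = emeasure lborel (monna -` coset b (int n) \<inter> {0..})"
      unfolding L_def by (rule emeasure_restrict_space) auto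
    also have "\<dots> = ennreal ((real k + 1) / real CARD('p) ^ n - real k / real CARD('p) ^ n)"
      unfolding k by (rule emeasure_lborel_Ico) (simp add: divide_right_mono)
    finally show ?thesis by (simp add: diff_divide_distrib[symmetric])
  qed
  have "distr M borel ((+) a) = M" for a
  proof (rule measure_eqI_generator_eq[OF Int_stable_cosets, of UNIV _ _ "\<lambda>k. coset (digit_rev k) (int 0)"])
    have mp: "(+) a \<in> measurable M borel" by (simp add: M_def)
    show "emeasure (distr M borel ((+) a)) X = emeasure M X" if X: "X \<in> cosets" for X
    proof -
      consider "X = {}" | b n where "X = coset b (int n)" using X by (auto simp: cosets_def)
      then show ?thesis
      proof cases
        case 2
        have "emeasure (distr M borel ((+) a)) X = emeasure M (coset (b - a) (int n))"
          unfolding 2 by (subst emeasure_distr[OF mp]) (simp_all add: vimage_plus_coset M_def)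
        then show ?thesis by (simp add: 2 eM)
      qed simp
    qed
    show "(\<Union>i. coset (digit_rev i) (int 0)) = (UNIV :: 'p padic set)"
      by (auto simp: coset_def intro: ex1_implies_ex[OF digit_rev_ex1])
    show "emeasure (distr M borel ((+) a)) (coset (digit_rev i) (int 0)) \<noteq> \<infinity>" for i
      by (subst emeasure_distr[OF mp]) (use eM[of _ 0] in \<open>simp_all add: vimage_plus_coset M_def\<close>)
    show "range (\<lambda>k. coset (digit_rev k) (int 0)) \<subseteq> (cosets :: 'p padic set set)"
      by (intro image_subsetI coset_in_cosets)
    show "sets (distr M borel ((+) a)) = sigma_sets UNIV cosets" "sets M = sigma_sets UNIV cosets"
      by (simp_all add: M_def borel_eq_cosets)
  qed simp
  moreover have "emeasure M Zp = 1" using eM[of 0 0] by (simp add: coset_0 Zp_pball)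
  moreover have "sets M = sets borel" by (simp add: M_def)
  ultimately show ?thesis by blast
qed

lemma
  shows sets_haar [simp, measurable_cong]: "sets haar = sets (borel :: 'p::prime_card padic measure)"
    and distr_haar: "distr haar borel ((+) a) = (haar :: 'p padic measure)"
    and emeasure_haar_Zp: "emeasure haar (Zp :: 'p padic set) = 1"
proof -
  have "sets haar = sets (borel :: 'p padic measure) \<and>
     (\<forall>a. distr haar borel ((+) a) = (haar :: 'p padic measure)) \<and> emeasure haar (Zp :: 'p padic set) = 1"
    unfolding haar_def by (rule someI_ex[OF haar_exists])
  then show "sets haar = sets (borel :: 'p padic measure)" "distr haar borel ((+) a) = (haar :: 'p padic measure)"
    "emeasure haar (Zp :: 'p padic set) = 1" by blast+
qed

lemma space_haar [simp]: "space haar = (UNIV :: 'p::prime_card padic set)"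
  using sets_eq_imp_space_eq[OF sets_haar] by simp

lemma emeasure_haar_coset_eq: "emeasure haar (coset (b::'p::prime_card padic) n) = emeasure haar (pball n :: 'p::prime_card padic set)"
proof -
  have "emeasure haar (coset b n) = emeasure (distr haar borel ((+) b)) (coset b n)"
    by (simp add: distr_haar)
  also have "\<dots> = emeasure haar (pball n :: 'p padic set)"
    by (subst emeasure_distr) (simp_all add: vimage_plus_coset coset_0)
  finally show ?thesis .
qed

lemma pp_powi_mult_pball: "pp powi m * x \<in> pball (m + n) \<longleftrightarrow> (x::'p::prime_card padic) \<in> pball n"
  by (cases "x = 0") (auto simp: pball_iff padic_ord_mult)

lemma pball_residue:
  assumes "x \<in> (pball n :: 'p::prime_card padic set)"
  shows "\<exists>!j. j < CARD('p) ^ d \<and> x \<in> coset (pp powi n * of_nat j) (n + int d)"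
proof -
  have e: "x \<in> coset (pp powi n * of_nat j) (n + int d) \<longleftrightarrow> x / pp powi n - of_nat j \<in> pball (int d)" for j
    using pp_powi_mult_pball[of n "x / pp powi n - of_nat j" "int d"] by (simp add: coset_def algebra_simps)
  have "x / pp powi n \<in> Zp"
    using assms pp_powi_mult_pball[of n "x / pp powi n" 0] by (simp add: Zp_pball)
  then obtain j where j: "j < CARD('p) ^ d" "x / pp powi n - of_nat j \<in> pball (int d)" by (rule Zp_residue)
  have "i = j" if "i < CARD('p) ^ d" "x / pp powi n - of_nat i \<in> pball (int d)" for i
    using that j pball_diff[OF j(2) that(2)] by (intro of_nat_residue_inj[where 'p='p and n=d]) simp_all
  then show ?thesis unfolding e using j by blast
qed

lemma coset_residue_unique:
  assumes "i < CARD('p) ^ d" "j < CARD('p) ^ d"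
    "x \<in> coset (pp powi n * of_nat i :: 'p::prime_card padic) (n + int d)"
    "x \<in> coset (pp powi n * of_nat j) (n + int d)"
  shows "i = j"
proof -
  have "pp powi n * (of_nat i - of_nat j :: 'p padic) \<in> pball (n + int d)"
    using assms(3,4) pball_diff[of "x - pp powi n * of_nat j" "n + int d" "x - pp powi n * of_nat i"]
    by (simp add: coset_def right_diff_distrib)
  then show ?thesis using assms(1,2) by (intro of_nat_residue_inj[where 'p='p and n=d]) (simp_all add: pp_powi_mult_pball)
qed

text \<open>\<open>haar\<close> is an unspecified choice, so the volume of a ball has to come from
  translation invariance and the partition into \<open>p^d\<close> cosets instead of the
  construction above.\<close>

lemma emeasure_haar_pball_split:
  "emeasure haar (pball n :: 'p::prime_card padic set) =
    of_nat (CARD('p) ^ d) * emeasure haar (pball (n + int d) :: 'p padic set)"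
proof -
  let ?C = "\<lambda>j. coset (pp powi n * of_nat j) (n + int d) :: 'p padic set"
  have sub: "?C j \<subseteq> pball n" for j
  proof
    fix x assume x: "x \<in> ?C j"
    have "pp powi n * of_nat j \<in> (pball (n + 0) :: 'p padic set)" unfolding pp_powi_mult_pball by simp
    then have "(x - pp powi n * of_nat j) + pp powi n * of_nat j \<in> pball n"
      using x pball_mono[of n "n + int d"] by (intro pball_add) (auto simp: coset_def)
    then show "x \<in> pball n" by simp
  qed
  have "x \<in> (\<Union>j<CARD('p) ^ d. ?C j)" if "x \<in> pball n" for x :: "'p padic"
  proof -
    have "\<exists>!j. j < CARD('p) ^ d \<and> x \<in> ?C j" using that by (rule pball_residue)
    then obtain j where "j < CARD('p) ^ d" "x \<in> ?C j" by blast
    then show ?thesis by (intro UN_I[of j]) simp_all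
  qed
  then have "pball n = (\<Union>j<CARD('p) ^ d. ?C j)" using sub by (intro subset_antisym subsetI UN_least) auto
  moreover have "disjoint_family_on ?C {..<CARD('p) ^ d}"
    unfolding disjoint_family_on_def
  proof (intro ballI impI equals0I)
    fix i j x assume *: "i \<in> {..<CARD('p) ^ d}" "j \<in> {..<CARD('p) ^ d}" "i \<noteq> j" "x \<in> ?C i \<inter> ?C j"
    then have "x \<in> pball n" using sub[of i] by blast
    then have "\<exists>!j. j < CARD('p) ^ d \<and> x \<in> ?C j" by (rule pball_residue)
    then show False using * by (metis IntE lessThan_iff)
  qed
  then have "(\<Sum>j<CARD('p) ^ d. emeasure haar (?C j)) = emeasure haar (\<Union>j<CARD('p) ^ d. ?C j)"
    by (intro sum_emeasure) (auto simp del: of_nat_power)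
  ultimately show ?thesis by (simp add: emeasure_haar_coset_eq)
qed

lemma emeasure_haar_coset:
  "emeasure haar (coset (b::'p::prime_card padic) n) = ennreal (real CARD('p) powi (-n))"
proof -
  let ?e = "\<lambda>n. emeasure haar (pball n :: 'p padic set)"
  have "?e 0 = 1" using emeasure_haar_Zp[where 'p='p] by (simp add: Zp_pball)
  have "?e n = ennreal (real CARD('p) powi (-n))"
  proof (cases "n \<ge> 0")
    case True
    then have n: "n = int (nat n)" by simp
    define q where "q = real CARD('p) ^ nat n"
    have q: "q > 0" by (simp add: q_def)
    have "1 = ennreal q * ?e n"
      using emeasure_haar_pball_split[of 0 "nat n", where 'p='p] \<open>?e 0 = 1\<close> n
      by (simp add: q_def ennreal_of_nat_eq_real_of_nat)
    then have "ennreal (1 / q) * 1 = ennreal (1 / q) * ennreal q * ?e n" by (simp add: mult.assoc)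
    also have "\<dots> = ?e n" using q by (simp flip: ennreal_mult)
    finally show ?thesis using n q_def by (metis mult.right_neutral power_int_minus power_int_of_nat inverse_eq_divide)
  next
    case False
    then have "?e n = of_nat (CARD('p) ^ nat (-n))"
      using emeasure_haar_pball_split[of n "nat (-n)", where 'p='p] \<open>?e 0 = 1\<close> by simp
    then show ?thesis using False by (simp add: ennreal_of_nat_eq_real_of_nat power_int_def)
  qed
  then show ?thesis by (simp add: emeasure_haar_coset_eq)
qed

lemma measure_haar_coset: "measure haar (coset (b::'p::prime_card padic) n) = real CARD('p) powi (-n)"
  by (simp add: measure_def emeasure_haar_coset)

lemma integral_haar_translate:
  fixes a :: "'p::prime_card padic"
  assumes "f \<in> borel_measurable borel"
  shows "(LINT x|haar. f (x + a)) = (LINT x|haar. (f x :: complex))"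
proof -
  have "(LINT x|haar. f x) = (LINT x|distr haar borel ((+) a). f x)" by (simp add: distr_haar)
  also have "\<dots> = (LINT x|haar. f (a + x))"
    using assms by (intro integral_distr) (auto simp: measurable_plus)
  finally show ?thesis by (simp add: add.commute)
qed

section \<open>Schwartz functions\<close>

definition ind :: "'p::prime_card padic \<Rightarrow> int \<Rightarrow> 'p padic \<Rightarrow> complex" where
  "ind b n x = (if x \<in> coset b n then 1 else 0)"

text \<open>The uniform form of a Schwartz function: \<open>a\<close> bounds the support and
  \<open>n\<close> is the exponent of a period lattice.\<close>

definition step_fun :: "int \<Rightarrow> int \<Rightarrow> ('p::prime_card padic \<Rightarrow> complex) \<Rightarrow> bool" where
  "step_fun a n f \<longleftrightarrow> (\<forall>x. x \<notin> pball a \<longrightarrow> f x = 0) \<and> (\<forall>x. \<forall>z\<in>pball n. f (x + z) = f x)"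

lemma step_fun_mono: "step_fun a n f \<Longrightarrow> a' \<le> a \<Longrightarrow> n \<le> n' \<Longrightarrow> step_fun a' n' f"
  unfolding step_fun_def by (meson pball_mono)

text \<open>Compactness of a ball containing the support makes the radius of local constancy
  uniform. Integral translations preserve the complement of that ball, so the period is valid there
  too.\<close>

lemma schwartz_step:
  assumes "f \<in> schwartz"
  obtains a n where "step_fun a n f" "a \<le> n"
proof -
  have f: "\<And>x. eventually (\<lambda>y. f y = f x) (nhds x)" and c: "compact (closure {x. f x \<noteq> 0})"
    using assms by (auto simp: schwartz_def)
  have "bounded {x. f x \<noteq> 0}" by (rule bounded_subset[OF compact_imp_bounded[OF c] closure_subset])
  then obtain B where B: "\<And>x. f x \<noteq> 0 \<Longrightarrow> dist 0 x \<le> B"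
    unfolding bounded_any_center[of _ 0] by blast
  obtain m where m: "B < real CARD('a) ^ m" using real_arch_pow[OF card_real_gt_1] by blast
  have supp: "f x = 0" if "x \<notin> pball (- int m)" for x
  proof (rule ccontr)
    assume "f x \<noteq> 0"
    then have "padic_abs x \<le> B" using B[of x] by (simp add: dist_padic_def)
    then show False using that m by (simp add: pball_def)
  qed
  have "\<exists>n::nat. \<forall>y\<in>coset x (int n). f y = f x" for x
  proof -
    obtain U where "open U" "x \<in> U" "\<And>y. y \<in> U \<Longrightarrow> f y = f x"
      using f[of x] unfolding eventually_nhds by blast
    then show ?thesis using open_coset_iff[of U] by blast
  qed
  then obtain N :: "'a padic \<Rightarrow> nat" where N: "\<And>x y. y \<in> coset x (int (N x)) \<Longrightarrow> f y = f x" by metis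
  have "pball (- int m) \<subseteq> (\<Union>x\<in>UNIV. coset x (int (N x)))"
  proof
    show "x \<in> (\<Union>x\<in>UNIV. coset x (int (N x)))" for x by (rule UN_I[of x]) simp_all
  qed
  from compactE_image[OF compact_pball open_coset this]
  obtain D where D: "finite D" "pball (- int m) \<subseteq> (\<Union>x\<in>D. coset x (int (N x)))" .
  define n where "n = Max (insert 0 (N ` D))"
  have "f (x + z) = f x" if z: "z \<in> pball (int n)" for x z
  proof (cases "x \<in> pball (- int m)")
    case True
    then obtain y where y: "y \<in> D" "x \<in> coset y (int (N y))" using D by blast
    have "N y \<le> n" using y D by (simp add: n_def)
    then have "z \<in> pball (int (N y))" using z pball_mono[of "int (N y)" "int n"] by simp
    then have "x + z \<in> coset x (int (N y))" by (simp add: coset_def)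
    then have "x + z \<in> coset y (int (N y))" using coset_eqI[OF y(2)] by simp
    then show ?thesis using N y(2) by metis
  next
    case False
    moreover have "x + z \<notin> pball (- int m)"
      using False pball_diff[of "x + z" "- int m" z] pball_mono[of "- int m" "int n" z] z by auto
    ultimately show ?thesis using supp by simp
  qed
  then have "step_fun (- int m) (int n) f" using supp by (auto simp: step_fun_def)
  then show thesis by (rule that) simp
qed

lemma step_fun_schwartz:
  assumes "step_fun a n f"
  shows "f \<in> schwartz"
proof -
  have "eventually (\<lambda>y. f y = f x) (nhds x)" for x
    unfolding eventually_nhds
  proof (intro exI[of _ "coset x n"] conjI ballI)
    show "f y = f x" if "y \<in> coset x n" for y
      using assms that unfolding step_fun_def coset_def
      by (metis (no_types, lifting) add_diff_cancel_left' diff_add_cancel add.commute mem_Collect_eq)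
  qed (simp_all add: open_coset)
  moreover have "{x. f x \<noteq> 0} \<subseteq> pball a" using assms by (auto simp: step_fun_def)
  then have "closure {x. f x \<noteq> 0} \<subseteq> pball a" by (intro closure_minimal compact_imp_closed) auto
  then have "compact (closure {x. f x \<noteq> 0})" using compact_pball closed_closure compact_Int_closed
    by (metis inf.absorb_iff2)
  ultimately show ?thesis by (simp add: schwartz_def)
qed

lemma step_fun_ind: "step_fun (min n 0 + (if b = 0 then 0 else min 0 (padic_ord b))) n (ind b n)"
proof -
  have "ind b n x = 0" if "x \<notin> pball (min n 0 + (if b = 0 then 0 else min 0 (padic_ord b)))" for x
  proof (rule ccontr)
    assume "ind b n x \<noteq> 0"
    then have "x - b \<in> pball n" by (auto simp: ind_def coset_def split: if_splits)
    then have "(x - b) + b \<in> pball (min n 0 + (if b = 0 then 0 else min 0 (padic_ord b)))"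
      by (intro pball_add) (auto simp: pball_iff)
    then show False using that by simp
  qed
  moreover have "x + z \<in> coset b n \<longleftrightarrow> x \<in> coset b n" if "z \<in> pball n" for x z
    using that pball_add[of "x - b" n z] pball_diff[of "x + z - b" n z] by (auto simp: coset_def algebra_simps)
  ultimately show ?thesis by (auto simp: step_fun_def ind_def)
qed

lemma ind_schwartz [simp]: "ind b n \<in> schwartz"
  using step_fun_ind by (rule step_fun_schwartz)

lemma step_fun_decomp:
  assumes f: "step_fun a (a + int d) (f :: 'p::prime_card padic \<Rightarrow> complex)"
  shows "f x = (\<Sum>j<CARD('p) ^ d. f (pp powi a * of_nat j) * ind (pp powi a * of_nat j) (a + int d) x)"
proof -
  let ?c = "\<lambda>j. pp powi a * of_nat j :: 'p padic"
  have c: "?c j \<in> pball a" for j using pp_powi_mult_pball[of a "of_nat j" 0] by simp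
  show ?thesis
  proof (cases "x \<in> pball a")
    case True
    obtain j where j1: "j < CARD('p) ^ d \<and> x \<in> coset (?c j) (a + int d)"
      using ex1_implies_ex[OF pball_residue[OF True, of d]] ..
    note j = conjunct1[OF j1] conjunct2[OF j1]
    have ji: "i = j" if "i < CARD('p) ^ d" "x \<in> coset (?c i) (a + int d)" for i
      by (rule coset_residue_unique[OF that(1) j(1) that(2) j(2)])
    have z: "f (?c i) * ind (?c i) (a + int d) x = (if i = j then f (?c j) else 0)" if "i \<in> {..<CARD('p) ^ d}" for i
    proof (cases "i = j")
      case True
      then show ?thesis unfolding ind_def if_P[OF j(2)] True by simp
    next
      case False
      then have "x \<notin> coset (?c i) (a + int d)" using ji that by blast
      then show ?thesis using False unfolding ind_def by simp
    qed
    have "(\<Sum>j<CARD('p) ^ d. f (?c j) * ind (?c j) (a + int d) x) =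
        (\<Sum>i<CARD('p) ^ d. if i = j then f (?c j) else 0)"
      by (rule sum.cong[OF refl z])
    also have "\<dots> = f (?c j)" using j(1) by simp
    also have "\<dots> = f (?c j + (x - ?c j))" using f j(2) unfolding step_fun_def coset_def by (metis mem_Collect_eq)
    finally show ?thesis by (metis add_diff_eq add_diff_cancel_left')
  next
    case False
    have "ind (?c j) (a + int d) x = 0" for j
      using False pball_add[OF pball_mono[of a "a + int d"] c[of j], of "x - ?c j"] by (auto simp: ind_def coset_def)
    then show ?thesis using False f by (simp add: step_fun_def)
  qed
qed

lemma ind_integral:
  "integrable haar (ind b n)" "(LINT x|haar. ind (b::'p::prime_card padic) n x) = of_real (real CARD('p) powi (-n))"
proof -
  have e: "ind b n = (\<lambda>x. complex_of_real (indicator (coset b n) x))" by (auto simp: ind_def)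
  have "integrable haar (indicator (coset b n) :: _ \<Rightarrow> real)"
    by (subst integrable_indicator_iff) (auto simp: emeasure_haar_coset)
  then show "integrable haar (ind b n)" unfolding e by (rule integrable_of_real)
  show "(LINT x|haar. ind b n x) = of_real (real CARD('p) powi (-n))"
    unfolding e by (simp add: measure_haar_coset)
qed

lemma step_fun_integral:
  assumes f: "step_fun a (a + int d) (f :: 'p::prime_card padic \<Rightarrow> complex)"
  shows "integrable haar f"
    and "(LINT x|haar. f x) = of_real (real CARD('p) powi (- (a + int d))) * (\<Sum>j<CARD('p) ^ d. f (pp powi a * of_nat j))"
proof -
  have e: "f = (\<lambda>x. \<Sum>j<CARD('p) ^ d. f (pp powi a * of_nat j) * ind (pp powi a * of_nat j) (a + int d) x)"
    using step_fun_decomp[OF f] by blast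
  show "integrable haar f" by (subst e) (simp add: ind_integral)
  show "(LINT x|haar. f x) = of_real (real CARD('p) powi (- (a + int d))) * (\<Sum>j<CARD('p) ^ d. f (pp powi a * of_nat j))"
    by (subst e) (simp add: ind_integral sum_distrib_left mult.commute)
qed

lemma schwartz_integrable: "f \<in> schwartz \<Longrightarrow> integrable haar f"
proof -
  assume "f \<in> schwartz"
  then obtain a n where an: "step_fun a n f" "a \<le> n" by (rule schwartz_step)
  show ?thesis using an by (intro step_fun_integral(1)[of a "nat (n - a)"]) simp
qed

lemma schwartz_measurable: "f \<in> schwartz \<Longrightarrow> f \<in> borel_measurable borel"
  using borel_measurable_integrable[OF schwartz_integrable] measurable_cong_sets[OF sets_haar refl] by blast

lemma schwartz_0 [simp]: "(\<lambda>x. 0) \<in> schwartz"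
  by (rule step_fun_schwartz[of 0 0]) (simp add: step_fun_def)

lemma schwartz_add:
  assumes "f \<in> schwartz" "g \<in> schwartz"
  shows "(\<lambda>x. f x + g x) \<in> schwartz"
proof -
  obtain a n where "step_fun a n f" "a \<le> n" using schwartz_step[OF assms(1)] .
  moreover obtain b m where "step_fun b m g" "b \<le> m" using schwartz_step[OF assms(2)] .
  ultimately have "step_fun (min a b) (max n m) f" "step_fun (min a b) (max n m) g"
    by (auto intro: step_fun_mono)
  then show ?thesis by (intro step_fun_schwartz[of "min a b" "max n m"]) (auto simp: step_fun_def)
qed

lemma schwartz_scale: "f \<in> schwartz \<Longrightarrow> (\<lambda>x. c * f x) \<in> schwartz"
  by (erule schwartz_step, rule step_fun_schwartz) (auto simp: step_fun_def)

lemma schwartz_sum: "(\<And>i. i \<in> A \<Longrightarrow> f i \<in> schwartz) \<Longrightarrow> (\<lambda>x. \<Sum>i\<in>A. f i x) \<in> schwartz"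
  by (induction A rule: infinite_finite_induct) (auto intro: schwartz_add)

lemma schwartz_mult:
  assumes f: "f \<in> schwartz" and g: "\<And>a. \<exists>n. \<forall>x\<in>pball a. \<forall>z\<in>pball n. g (x + z) = g x"
  shows "(\<lambda>x. f x * g x) \<in> schwartz"
proof -
  obtain a n where an: "step_fun a n f" "a \<le> n" using schwartz_step[OF f] .
  obtain m where m: "\<And>x z. x \<in> pball a \<Longrightarrow> z \<in> pball m \<Longrightarrow> g (x + z) = g x" using g[of a] by blast
  have "step_fun a (max n m) (\<lambda>x. f x * g x)"
    using an m unfolding step_fun_def by (metis max.cobounded1 max.cobounded2 mult_zero_left pball_mono)
  then show ?thesis by (rule step_fun_schwartz)
qed

text \<open>A step function can be refined at will. The base case is therefore demanded only for
  small balls, with a threshold that may depend on the region of their centres; the evaluation of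
  the Weil functional needs this freedom.\<close>

lemma schwartz_induct [consumes 1, case_names ind zero add scale]:
  assumes "f \<in> schwartz"
    and ind: "\<And>a. \<exists>n0. \<forall>n\<ge>n0. \<forall>b\<in>pball a. P (ind b n)"
    and zero: "P (\<lambda>x. 0)"
    and add: "\<And>f g. f \<in> schwartz \<Longrightarrow> g \<in> schwartz \<Longrightarrow> P f \<Longrightarrow> P g \<Longrightarrow> P (\<lambda>x. f x + g x)"
    and scale: "\<And>f c. f \<in> schwartz \<Longrightarrow> P f \<Longrightarrow> P (\<lambda>x. c * f x)"
  shows "P (f :: 'p::prime_card padic \<Rightarrow> complex)"
proof -
  obtain a n where an: "step_fun a n f" "a \<le> n" using schwartz_step[OF assms(1)] .
  obtain n0 where n0: "\<And>n b. n \<ge> n0 \<Longrightarrow> b \<in> pball a \<Longrightarrow> P (ind b n)" using ind by blast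
  define d where "d = nat (max n n0 - a)"
  have d: "a + int d \<ge> n0" "a + int d \<ge> n" using an(2) by (auto simp: d_def)
  have f: "step_fun a (a + int d) f" using an d step_fun_mono by blast
  have sum: "P (\<lambda>x. \<Sum>j\<in>A. c j * ind (b j) (a + int d) x)"
    if "finite A" "\<And>j. b j \<in> pball a" for A :: "nat set" and b c
    using that(1)
  proof (induction A rule: finite_induct)
    case (insert j A)
    have "P (\<lambda>x. c j * ind (b j) (a + int d) x + (\<Sum>j\<in>A. c j * ind (b j) (a + int d) x))"
      using insert that(2) d n0 by (intro add scale schwartz_scale schwartz_sum) auto
    then show ?case using insert by simp
  qed (simp add: zero)
  have "pp powi a * of_nat j \<in> (pball a :: 'p padic set)" for j
    using pp_powi_mult_pball[of a "of_nat j :: 'p padic" 0] by simp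
  then show ?thesis
    using sum[of "{..<CARD('p) ^ d}" "\<lambda>j. pp powi a * of_nat j" "\<lambda>j. f (pp powi a * of_nat j)"]
    by (simp flip: step_fun_decomp[OF f])
qed

section \<open>Weil indices\<close>

locale padic_char = odd_padic p_type for p_type :: "'p::prime_card itself" +
  fixes \<psi> :: "'p padic \<Rightarrow> complex"
  assumes psi_char: "additive_character \<psi>" and psi_cond: "conductor_zero \<psi>"
begin

lemma psi_add: "\<psi> (x + y) = \<psi> x * \<psi> y"
  using psi_char by (simp add: additive_character_def)

lemma psi_nonzero [simp]: "\<psi> x \<noteq> 0"
  using psi_char by (auto simp: additive_character_def) (metis norm_zero zero_neq_one)

lemma psi_integral: "x \<in> pball 0 \<Longrightarrow> \<psi> x = 1"
  using psi_cond by (simp add: conductor_zero_def Zp_pball)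

lemma psi_0 [simp]: "\<psi> 0 = 1" by (rule psi_integral) simp

lemma psi_minus: "\<psi> (- x) = inverse (\<psi> x)"
  using psi_add[of x "- x"] by (simp add: field_simps)

lemma psi_of_nat_mult: "\<psi> (of_nat n * x) = \<psi> x ^ n"
  by (induction n) (simp_all add: psi_add distrib_right)

lemma psi_add_integral: "z \<in> pball 0 \<Longrightarrow> \<psi> (x + z) = \<psi> x"
  by (simp add: psi_add psi_integral)

text \<open>Modulo \<open>\<int>\<^sub>p\<close>, an element of order -1 generates
  \<open>p\<^sup>-\<^sup>1 \<int>\<^sub>p\<close>; triviality at one generator would contradict the
  conductor.\<close>

lemma psi_nontrivial:
  assumes "x \<noteq> 0" "padic_ord x = - 1"
  shows "\<psi> x \<noteq> 1"
proof
  assume 1: "\<psi> x = 1"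
  have "\<psi> (y / pp) = 1" if "y \<in> Zp" for y
  proof -
    have "y / (pp * x) \<in> Zp"
      using that assms by (cases "y = 0") (auto simp: Zp_iff padic_ord_divide padic_ord_mult)
    then obtain n where "y / (pp * x) - of_nat n \<in> pball (int 1)" using Zp_residue by blast
    then have "x * (y / (pp * x) - of_nat n) \<in> pball (- 1 + 1)"
      using assms by (intro pball_mult) (simp_all add: pball_iff)
    then have "\<psi> (of_nat n * x + x * (y / (pp * x) - of_nat n)) = 1"
      using 1 by (simp add: psi_add_integral psi_of_nat_mult)
    moreover have "of_nat n * x + x * (y / (pp * x) - of_nat n) = y / pp"
      using assms by (simp add: field_simps)
    ultimately show ?thesis by simp
  qed
  then show False using psi_cond by (auto simp: conductor_zero_def)
qed

lemma psi_dual: "(\<forall>z\<in>pball n. \<psi> (b * z) = 1) \<longleftrightarrow> b \<in> pball (- n)"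
proof
  assume *: "\<forall>z\<in>pball n. \<psi> (b * z) = 1"
  show "b \<in> pball (- n)"
  proof (rule ccontr)
    assume b: "b \<notin> pball (- n)"
    let ?z = "pp powi (- 1 - padic_ord b)"
    have "b \<noteq> 0" "?z \<in> pball n" using b by (auto simp: pball_iff)
    then have "\<psi> (b * ?z) \<noteq> 1" by (intro psi_nontrivial) (auto simp: padic_ord_mult)
    then show False using * \<open>?z \<in> pball n\<close> by blast
  qed
next
  assume "b \<in> pball (- n)"
  then show "\<forall>z\<in>pball n. \<psi> (b * z) = 1" using pball_mult[of b "- n" _ n] psi_integral by auto
qed

lemma psi_quadratic_local:
  "\<exists>n. \<forall>x\<in>pball a. \<forall>z\<in>pball n. \<psi> (b * (x + z)^2 + c * (x + z)) = \<psi> (b * x^2 + c * x)"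
proof -
  define B where "B = (if b = 0 then 0 else padic_ord b)"
  define C where "C = (if c = 0 then 0 else padic_ord c)"
  have bc: "b \<in> pball B" "c \<in> pball C" by (simp_all add: B_def C_def pball_iff)
  \<comment> \<open>The bounds make the three increments of the phase integral:
    \<open>- B - a\<close> serves the cross term, \<open>0\<close> and \<open>- B\<close> together
    the square of \<open>z\<close>, and \<open>- C\<close> the linear term.\<close>
  define n where "n = max 0 (max (- B) (max (- B - a) (- C)))"
  have n: "0 \<le> n" "- B \<le> n" "- B - a \<le> n" "- C \<le> n" by (auto simp: n_def)
  show ?thesis
  proof (intro exI[of _ n] ballI)
    fix x z :: "'p padic" assume x: "x \<in> pball a" and z: "z \<in> pball n"
    have "of_nat 2 * (b * (x * z)) \<in> pball (0 + (B + (a + n)))" by (intro pball_mult pball_of_nat bc x z)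
    moreover have "b * (z * z) \<in> pball (B + (n + n))" by (intro pball_mult bc z)
    moreover have "c * z \<in> pball (C + n)" by (intro pball_mult bc z)
    ultimately have "of_nat 2 * (b * (x * z)) + b * (z * z) + c * z \<in> pball 0"
      by (intro pball_add) (erule pball_mono[rotated], use n in linarith)+
    then have "\<psi> (b * x^2 + c * x + (of_nat 2 * (b * (x * z)) + b * (z * z) + c * z)) = \<psi> (b * x^2 + c * x)"
      by (rule psi_add_integral)
    then show "\<psi> (b * (x + z)^2 + c * (x + z)) = \<psi> (b * x^2 + c * x)"
      by (simp add: power2_eq_square algebra_simps)
  qed
qed

lemma schwartz_psi:
  assumes "\<phi> \<in> schwartz"
  shows "(\<lambda>x. \<phi> x * \<psi> (b * x^2 + c * x)) \<in> schwartz" "(\<lambda>x. \<phi> x * \<psi> (c * x)) \<in> schwartz"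
    "(\<lambda>x. \<phi> x * \<psi> (b * x^2)) \<in> schwartz"
  using schwartz_mult[OF assms psi_quadratic_local[of _ b c]] schwartz_mult[OF assms psi_quadratic_local[of _ 0 c]]
    schwartz_mult[OF assms psi_quadratic_local[of _ b 0]] by simp_all

lemma schwartz_translate:
  assumes "\<phi> \<in> schwartz"
  shows "(LINT x|haar. \<phi> (x + a)) = (LINT x|haar. \<phi> x)"
  by (rule integral_haar_translate[OF schwartz_measurable[OF assms]])

lemma ind_0_shift: "a \<in> pball n \<Longrightarrow> ind 0 n (x + a) = ind 0 n (x :: 'p padic)"
  using step_fun_ind[of n "0 :: 'p padic"] by (simp add: step_fun_def)

lemma ind_shift: "ind e n (x + e) = ind 0 n x"
  by (simp add: ind_def coset_def)

lemma ind_0_iff: "ind 0 n x = (if x \<in> pball n then 1 else 0)"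
  by (simp add: ind_def coset_0)

text \<open>Orthogonality: translation by a \<open>z\<close> in the ball with
  \<open>\<psi> (b * z) \<noteq> 1\<close> preserves the integral and multiplies it by that
  value.\<close>

lemma fourier_ind_0:
  "(LINT x|haar. ind 0 n x * \<psi> (b * x)) = of_real (real CARD('p) powi (- n)) * ind 0 (- n) b"
proof (cases "b \<in> pball (- n)")
  case True
  then have "ind 0 n x * \<psi> (b * x) = ind 0 n x" for x using psi_dual[of n b] by (simp add: ind_0_iff)
  then show ?thesis using True by (simp only: ind_integral) (simp add: ind_0_iff)
next
  case False
  then obtain z where z: "z \<in> pball n" "\<psi> (b * z) \<noteq> 1" using psi_dual[of n b] by blast
  let ?I = "LINT x|haar. ind 0 n x * \<psi> (b * x)"
  have "?I = (LINT x|haar. ind 0 n (x + z) * \<psi> (b * (x + z)))"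
    by (rule schwartz_translate[symmetric]) (rule schwartz_psi(2)[OF ind_schwartz])
  also have "\<dots> = (LINT x|haar. \<psi> (b * z) * (ind 0 n x * \<psi> (b * x)))"
    by (simp only: ind_0_shift[OF z(1)] distrib_left psi_add mult_ac)
  also have "\<dots> = \<psi> (b * z) * ?I" by (rule integral_mult_right_zero)
  finally have "?I = 0" using z(2) by (metis mult_cancel_right1)
  then show ?thesis using False by (simp add: ind_0_iff)
qed

lemma fourier_ind:
  "(LINT x|haar. ind e n x * \<psi> (b * x)) = of_real (real CARD('p) powi (- n)) * (ind 0 (- n) b * \<psi> (b * e))"
proof -
  have "(LINT x|haar. ind e n x * \<psi> (b * x)) = (LINT x|haar. ind e n (x + e) * \<psi> (b * (x + e)))"
    by (rule schwartz_translate[symmetric]) (rule schwartz_psi(2)[OF ind_schwartz])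
  also have "\<dots> = (LINT x|haar. \<psi> (b * e) * (ind 0 n x * \<psi> (b * x)))"
    by (simp only: ind_shift distrib_left psi_add mult_ac)
  also have "\<dots> = \<psi> (b * e) * (LINT x|haar. ind 0 n x * \<psi> (b * x))" by (rule integral_mult_right_zero)
  finally show ?thesis unfolding fourier_ind_0 by simp
qed

lemma ind_0_mult:
  assumes "b \<noteq> 0"
  shows "ind 0 n (b * x) = ind 0 (n - padic_ord b) x"
  using assms by (cases "x = 0") (auto simp: ind_0_iff pball_iff padic_ord_mult)

text \<open>The Fourier transform for the pairing by \<open>b\<close>, taken with
  \<open>haar\<close> and not yet normalized by the self-dual factor.\<close>

definition fint :: "'p padic \<Rightarrow> ('p padic \<Rightarrow> complex) \<Rightarrow> 'p padic \<Rightarrow> complex" where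
  "fint b \<phi> y = (LINT x|haar. \<phi> x * \<psi> (b * (x * y)))"

lemma schwartz_psi_mult: "\<phi> \<in> schwartz \<Longrightarrow> (\<lambda>x. \<phi> x * \<psi> (b * (x * y))) \<in> schwartz"
  using schwartz_psi(2)[of \<phi> "b * y"] by (simp add: mult_ac)

lemma fint_add: "f \<in> schwartz \<Longrightarrow> g \<in> schwartz \<Longrightarrow> fint b (\<lambda>x. f x + g x) = (\<lambda>y. fint b f y + fint b g y)"
  unfolding fint_def
  by (rule ext) (simp add: distrib_right Bochner_Integration.integral_add schwartz_integrable schwartz_psi_mult)

lemma fint_scale: "fint b (\<lambda>x. c * f x) = (\<lambda>y. c * fint b f y)"
  by (rule ext) (simp only: fint_def mult.assoc integral_mult_right_zero)

lemma fint_ind: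
  assumes "b \<noteq> 0"
  shows "fint b (ind e n) = (\<lambda>y. of_real (real CARD('p) powi (- n)) * (ind 0 (- n - padic_ord b) y * \<psi> (b * e * y)))"
proof
  fix y
  show "fint b (ind e n) y = of_real (real CARD('p) powi (- n)) * (ind 0 (- n - padic_ord b) y * \<psi> (b * e * y))"
    using fourier_ind[of e n "b * y"] assms by (simp add: fint_def ind_0_mult mult_ac)
qed

text \<open>The constant is \<open>1 / |b|\<close>: it is the volume of a lattice times that of its
  dual, whose exponents are \<open>n\<close> and \<open>- n - ord b\<close>.\<close>

lemma fint_inversion:
  assumes b: "b \<noteq> 0" and "\<phi> \<in> schwartz"
  shows "fint b \<phi> \<in> schwartz \<and> (\<forall>y. fint b (fint b \<phi>) y = of_real (real CARD('p) powi padic_ord b) * \<phi> (- y))"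
  using assms(2)
proof (induction \<phi> rule: schwartz_induct)
  case (ind a)
  let ?q = "\<lambda>k. complex_of_real (real CARD('p) powi k)"
  have "fint b (ind e n) \<in> schwartz" for e n
    unfolding fint_ind[OF b] by (intro schwartz_scale schwartz_psi(2) ind_schwartz)
  moreover have "fint b (fint b (ind e n)) y = ?q (padic_ord b) * ind e n (- y)" for e n y
  proof -
    have "fint b (fint b (ind e n)) y =
      ?q (- n) * (LINT x|haar. ind 0 (- n - padic_ord b) x * \<psi> ((b * (e + y)) * x))"
      unfolding fint_ind[OF b] unfolding fint_def
      by (simp add: mult.assoc psi_add[symmetric] flip: integral_mult_right_zero) (simp add: algebra_simps)
    also have "\<dots> = ?q (- n) * (?q (n + padic_ord b) * ind 0 (n + padic_ord b) (b * (e + y)))"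
      unfolding fourier_ind_0 by (simp add: algebra_simps)
    also have "ind 0 (n + padic_ord b) (b * (e + y)) = ind e n (- y)"
    proof -
      have "- y - e = - (e + y)" by simp
      then have "ind e n (- y) = ind 0 n (e + y)"
        by (simp only: ind_def coset_def mem_Collect_eq pball_minus_iff diff_zero)
      then show ?thesis unfolding ind_0_mult[OF b] by simp
    qed
    also have "?q (- n) * (?q (n + padic_ord b) * ind e n (- y)) = ?q (padic_ord b) * ind e n (- y)"
    proof -
      have "real CARD('p) powi (- n) * real CARD('p) powi (n + padic_ord b) = real CARD('p) powi padic_ord b"
        by (subst power_int_add[symmetric]) auto
      then show ?thesis by (metis mult.assoc of_real_mult)
    qed
    finally show ?thesis .
  qed
  ultimately show ?case by blast
next
  case zero
  show ?case using fint_scale[of b 0 "\<lambda>x. 0"] by (simp add: fint_def)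
next
  case (add f g)
  then have "fint b (\<lambda>x. f x + g x) = (\<lambda>y. fint b f y + fint b g y)" by (intro fint_add)
  moreover have "fint b (\<lambda>y. fint b f y + fint b g y) = (\<lambda>y. fint b (fint b f) y + fint b (fint b g) y)"
    using add by (intro fint_add) auto
  ultimately show ?case using add by (simp add: schwartz_add distrib_left)
next
  case (scale f c)
  then show ?case by (simp add: fint_scale schwartz_scale)
qed

text \<open>Inversion forces \<open>c^2 = |b|\<close>; uniqueness is tested on the indicator of
  \<open>\<int>\<^sub>p\<close> at the origin.\<close>

lemma self_dual_factor_psi:
  assumes b: "b \<noteq> 0"
  shows "self_dual_factor (\<lambda>x. \<psi> (b * x)) = sqrt (padic_abs b)"
  unfolding self_dual_factor_def
proof (rule the_equality)
  have e: "of_real c * (LINT x|haar. of_real c * (LINT z|haar. \<phi> z * \<psi> (b * (z * x))) * \<psi> (b * (x * y)))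
      = of_real (c^2 * real CARD('p) powi padic_ord b) * \<phi> (- y)" if "\<phi> \<in> schwartz" for \<phi> y and c :: real
  proof -
    have "(LINT x|haar. of_real c * (LINT z|haar. \<phi> z * \<psi> (b * (z * x))) * \<psi> (b * (x * y))) =
      of_real c * fint b (fint b \<phi>) y"
      by (simp add: fint_def mult.assoc)
    then show ?thesis using fint_inversion[OF b that] by (simp add: power2_eq_square)
  qed
  have pos: "padic_abs b > 0" using b padic_abs_nonneg[of b] padic_abs_eq_0[of b] by linarith
  have ab: "padic_abs b * real CARD('p) powi padic_ord b = 1"
    using padic_abs_ord[OF b] by (simp add: power_int_minus)
  show "0 < sqrt (padic_abs b) \<and> (\<forall>\<phi>\<in>schwartz. \<forall>y. of_real (sqrt (padic_abs b)) *
      (LINT x|haar. of_real (sqrt (padic_abs b)) * (LINT z|haar. \<phi> z * \<psi> (b * (z * x))) * \<psi> (b * (x * y))) = \<phi> (- y))"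
    using pos ab by (simp add: e del: of_real_mult)
  fix c assume c: "0 < c \<and> (\<forall>\<phi>\<in>schwartz. \<forall>y. of_real c *
      (LINT x|haar. of_real c * (LINT z|haar. \<phi> z * \<psi> (b * (z * x))) * \<psi> (b * (x * y))) = \<phi> (- y))"
  have "of_real (c^2 * real CARD('p) powi padic_ord b) * ind 0 0 (- 0 :: 'p padic) = ind 0 0 (- 0 :: 'p padic)"
    using trans[OF e[OF ind_schwartz[of 0 0], of c 0, symmetric]
      bspec[OF conjunct2[OF c] ind_schwartz[of 0 0], THEN spec[of _ 0]]] .
  then have "complex_of_real (c^2 * real CARD('p) powi padic_ord b) = of_real 1" by (simp add: ind_0_iff)
  then have "c^2 * real CARD('p) powi padic_ord b = 1" by (simp only: of_real_eq_iff)
  then have "c^2 = padic_abs b" using ab by (metis mult_cancel_right mult_zero_right zero_neq_one)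
  then show "c = sqrt (padic_abs b)" using c by (metis real_sqrt_unique less_imp_le)
qed

lemma fourier_psi:
  assumes "b \<noteq> 0"
  shows "fourier (\<lambda>x. \<psi> (b * x)) \<phi> y = of_real (sqrt (padic_abs b)) * fint b \<phi> y"
  by (simp add: fourier_def self_dual_factor_psi[OF assms] fint_def)

text \<open>A Gauss integral truncated to a ball. It stabilizes as the ball grows, and the
  normalized stable value is the Weil index.\<close>

definition gauss_int :: "'p padic \<Rightarrow> int \<Rightarrow> complex" where
  "gauss_int b n = (LINT x|haar. ind 0 n x * \<psi> (b * x^2))"

lemma twist_two: "twist (twist \<psi> b) 2 = (\<lambda>x. \<psi> (2 * b * x))"
  by (simp add: twist_def mult_ac)

lemma two_mult:
  "padic_abs (2 * b :: 'p padic) = padic_abs b" "b \<noteq> 0 \<Longrightarrow> padic_ord (2 * b :: 'p padic) = padic_ord b"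
  using two_unit padic_ord_unit[OF two_unit] units_nonzero[OF two_unit]
  by (simp_all add: padic_abs_mult Zp_units_def padic_ord_mult)

text \<open>Completing the square. The transform of an indicator carries the phase
  \<open>2 b e x\<close> on the dual ball, and the assumption on \<open>e\<close> makes that ball
  invariant under the shift by \<open>e\<close>.\<close>

lemma weil_functional_ind:
  assumes b: "b \<noteq> 0" and e: "e \<in> pball (- n - padic_ord b)"
  shows "(LINT x|haar. fourier (twist (twist \<psi> b) 2) (ind e n) x * twist \<psi> b (x^2)) =
    of_real (sqrt (padic_abs b) * real CARD('p) powi (- n)) * inverse (\<psi> (b * e^2)) * gauss_int b (- n - padic_ord b)"
proof -
  let ?n = "- n - padic_ord b"
  let ?c = "complex_of_real (sqrt (padic_abs b) * real CARD('p) powi (- n))"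
  have b2: "2 * b \<noteq> 0" using b by simp
  have "gauss_int b ?n = (LINT x|haar. ind 0 ?n (x + e) * \<psi> (b * (x + e)^2))"
    unfolding gauss_int_def by (rule schwartz_translate[symmetric]) (rule schwartz_psi(3)[OF ind_schwartz])
  also have "\<dots> = (LINT x|haar. \<psi> (b * e^2) * (ind 0 ?n x * \<psi> (2 * b * e * x + b * x^2)))"
  proof (intro Bochner_Integration.integral_cong refl)
    fix x
    have "b * (x + e)^2 = b * e^2 + (2 * b * e * x + b * x^2)" by (simp add: power2_eq_square algebra_simps)
    then show "ind 0 ?n (x + e) * \<psi> (b * (x + e)^2) = \<psi> (b * e^2) * (ind 0 ?n x * \<psi> (2 * b * e * x + b * x^2))"
      by (simp only: ind_0_shift[OF e] psi_add[of "b * e^2"] mult.left_commute)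
  qed
  also have "\<dots> = \<psi> (b * e^2) * (LINT x|haar. ind 0 ?n x * \<psi> (2 * b * e * x + b * x^2))"
    by (rule integral_mult_right_zero)
  finally have g: "gauss_int b ?n = \<dots>" .
  have "fourier (twist (twist \<psi> b) 2) (ind e n) x * twist \<psi> b (x^2) = ?c * (ind 0 ?n x * \<psi> (2 * b * e * x + b * x^2))" for x
    unfolding twist_two fourier_psi[OF b2] fint_ind[OF b2] two_mult two_mult(2)[OF b]
    by (simp add: twist_def psi_add)
  then have "(LINT x|haar. fourier (twist (twist \<psi> b) 2) (ind e n) x * twist \<psi> b (x^2)) =
      ?c * (LINT x|haar. ind 0 ?n x * \<psi> (2 * b * e * x + b * x^2))"
    by (simp only: integral_mult_right_zero)
  then show ?thesis unfolding g by simp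
qed

text \<open>On a ball this small the quadratic phase differs from its value at the centre by an
  integer only.\<close>

lemma inverse_psi_ind:
  assumes b: "b \<in> pball (padic_ord b)" and e: "e \<in> pball (- n - padic_ord b)" and n: "0 \<le> 2 * n + padic_ord b"
  shows "(LINT x|haar. ind e n x * inverse (twist \<psi> b (x^2))) = of_real (real CARD('p) powi (- n)) * inverse (\<psi> (b * e^2))"
proof -
  have "ind e n x * inverse (twist \<psi> b (x^2)) = inverse (\<psi> (b * e^2)) * ind e n x" for x
  proof (cases "x - e \<in> pball n")
    case True
    have "b * (of_nat 2 * (e * (x - e))) \<in> pball (padic_ord b + (0 + (- n - padic_ord b + n)))"
      by (intro pball_mult pball_of_nat b e True)
    moreover have "b * ((x - e) * (x - e)) \<in> pball (padic_ord b + (n + n))" by (intro pball_mult b True)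
    ultimately have "b * (of_nat 2 * (e * (x - e))) + b * ((x - e) * (x - e)) \<in> pball 0"
      using n by (intro pball_add) (erule pball_mono[rotated], simp)+
    then have "\<psi> (b * e^2 + (b * (of_nat 2 * (e * (x - e))) + b * ((x - e) * (x - e)))) = \<psi> (b * e^2)"
      by (rule psi_add_integral)
    then show ?thesis by (simp add: twist_def power2_eq_square algebra_simps)
  qed (simp add: ind_def coset_def)
  then show ?thesis by (simp only: integral_mult_right_zero ind_integral) (rule mult.commute)
qed

text \<open>On small balls both sides of Weil's identity carry the same phase and volume, leaving
  the normalized Gauss integral over a large dual ball. Linearity extends this to all Schwartz
  functions, and one small ball with nonzero right-hand integral gives uniqueness.\<close>

lemma weil_index_eqI:
  assumes b: "b \<noteq> 0"
    and g: "\<And>n. n \<le> N \<Longrightarrow> of_real (sqrt (padic_abs b)) * gauss_int b n = \<gamma>"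
  shows "weil_index (twist \<psi> b) = \<gamma>"
  unfolding weil_index_def
proof (rule the_equality)
  let ?q = "\<lambda>k. complex_of_real (real CARD('p) powi k)"
  have bb: "b \<in> pball (padic_ord b)" by (simp add: pball_iff)
  have ev: "(LINT x|haar. fourier (twist (twist \<psi> b) 2) (ind e n) x * twist \<psi> b (x^2)) =
      \<gamma> * (LINT x|haar. ind e n x * inverse (twist \<psi> b (x^2)))"
    and ev0: "(LINT x|haar. ind e n x * inverse (twist \<psi> b (x^2))) \<noteq> 0"
    if "- n - padic_ord b \<le> N" "0 \<le> 2 * n + padic_ord b" "e \<in> pball (- n - padic_ord b)"
    for e :: "'p padic" and n
    using inverse_psi_ind[OF bb that(3,2)] weil_functional_ind[OF b that(3)] g[OF that(1)] by auto
  have 2: "2 * b \<noteq> 0" using b by simp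
  have sF: "fourier (twist (twist \<psi> b) 2) \<phi> \<in> schwartz" if "\<phi> \<in> schwartz" for \<phi>
    unfolding twist_two fourier_psi[OF 2, abs_def] using fint_inversion[OF 2 that] by (intro schwartz_scale) blast
  have sl: "(\<lambda>x. fourier (twist (twist \<psi> b) 2) \<phi> x * twist \<psi> b (x^2)) \<in> schwartz" if "\<phi> \<in> schwartz" for \<phi>
    using schwartz_psi(3)[OF sF[OF that], of b] by (simp add: twist_def)
  have sr: "(\<lambda>x. \<phi> x * inverse (twist \<psi> b (x^2))) \<in> schwartz" if "\<phi> \<in> schwartz" for \<phi>
    using schwartz_psi(3)[OF that, of "- b"] by (simp add: twist_def psi_minus)
  show "\<forall>\<phi>\<in>schwartz. (LINT x|haar. fourier (twist (twist \<psi> b) 2) \<phi> x * twist \<psi> b (x^2)) =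
      \<gamma> * (LINT x|haar. \<phi> x * inverse (twist \<psi> b (x^2)))"
  proof
    fix \<phi> :: "'p padic \<Rightarrow> complex" assume "\<phi> \<in> schwartz"
    then show "(LINT x|haar. fourier (twist (twist \<psi> b) 2) \<phi> x * twist \<psi> b (x^2)) =
      \<gamma> * (LINT x|haar. \<phi> x * inverse (twist \<psi> b (x^2)))"
    proof (induction \<phi> rule: schwartz_induct)
      case (ind a)
      show ?case
      proof (intro exI[of _ "max (- padic_ord b - N) (max \<bar>padic_ord b\<bar> (- a - padic_ord b))"] allI impI ballI)
        fix n and e :: "'p padic" assume n: "max (- padic_ord b - N) (max \<bar>padic_ord b\<bar> (- a - padic_ord b)) \<le> n" and e: "e \<in> pball a"
        show "(LINT x|haar. fourier (twist (twist \<psi> b) 2) (ind e n) x * twist \<psi> b (x^2)) =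
          \<gamma> * (LINT x|haar. ind e n x * inverse (twist \<psi> b (x^2)))"
          using n by (intro ev pball_mono[OF _ e]) auto
      qed
    next
      case zero
      show ?case by (simp add: twist_two fourier_def)
    next
      case (add f g)
      have "fourier (twist (twist \<psi> b) 2) (\<lambda>x. f x + g x) x =
          fourier (twist (twist \<psi> b) 2) f x + fourier (twist (twist \<psi> b) 2) g x" for x
        unfolding twist_two fourier_psi[OF 2] fint_add[OF add(1,2)] by (simp add: distrib_left)
      then show ?case using add sl[OF add(1)] sl[OF add(2)] sr[OF add(1)] sr[OF add(2)]
        by (simp add: distrib_right distrib_left Bochner_Integration.integral_add schwartz_integrable)
    next
      case (scale f c)
      have "fourier (twist (twist \<psi> b) 2) (\<lambda>x. c * f x) x = c * fourier (twist (twist \<psi> b) 2) f x" for x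
        unfolding twist_two fourier_psi[OF 2] fint_scale by simp
      then show ?case using scale by (simp add: mult.assoc)
    qed
  qed
  fix \<gamma>' assume *: "\<forall>\<phi>\<in>schwartz. (LINT x|haar. fourier (twist (twist \<psi> b) 2) \<phi> x * twist \<psi> b (x^2)) =
      \<gamma>' * (LINT x|haar. \<phi> x * inverse (twist \<psi> b (x^2)))"
  define n where "n = max (- padic_ord b - N) \<bar>padic_ord b\<bar>"
  have "- padic_ord b - N \<le> n" "padic_ord b \<le> n" "- padic_ord b \<le> n" by (auto simp: n_def)
  then have n: "- n - padic_ord b \<le> N" "0 \<le> 2 * n + padic_ord b" by linarith+
  show "\<gamma>' = \<gamma>" using ev[OF n pball_0] ev0[OF n pball_0] *[rule_format, OF ind_schwartz[of 0 n]] by simp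
qed

lemma psi_character_sum:
  assumes "y \<in> pball (- 1)"
  shows "(\<Sum>j<CARD('p). \<psi> (of_nat j * y)) = (if y \<in> pball 0 then of_nat CARD('p) else 0)"
proof (cases "y \<in> pball 0")
  case True
  then have "\<psi> (of_nat j * y) = 1" for j by (simp add: psi_of_nat_mult psi_integral)
  then show ?thesis using True by simp
next
  case False
  then have "y \<noteq> 0" "padic_ord y = - 1" using assms by (auto simp: pball_iff)
  then have ne: "\<psi> y \<noteq> 1" by (rule psi_nontrivial)
  have "pp * y \<in> pball 0" using pp_mult_pball[of y "- 1"] assms by simp
  then have "\<psi> y ^ CARD('p) = 1" using psi_of_nat_mult[of "CARD('p)" y] psi_integral by metis
  then have "(\<Sum>j<CARD('p). \<psi> y ^ j) = 0" using geometric_sum[OF ne, of "CARD('p)"] by simp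
  then show ?thesis using False by (simp add: psi_of_nat_mult)
qed

text \<open>Averaging over the \<open>p\<close> translates by \<open>j z\<close> with \<open>z = p\<^bsup>-k-n-1\<^esup>\<close> kills the outermost shell.\<close>

lemma gauss_int_stable:
  assumes b: "b \<noteq> 0" and n: "2 * n + padic_ord b \<le> - 2"
  shows "gauss_int b n = gauss_int b (n + 1)"
proof -
  define z where "z = (pp powi (- padic_ord b - n - 1) :: 'p padic)"
  have z: "z \<noteq> 0" "padic_ord z = - padic_ord b - n - 1" by (simp_all add: z_def)
  have zn: "of_nat j * z \<in> pball n" for j
    using pball_mult[OF pball_of_nat, of z n j] z n by (simp add: pball_iff)
  have zz: "\<psi> (b * (of_nat j * z)^2) = 1" for j
  proof -
    have "of_nat (j * j) * (b * (z * z)) \<in> pball (0 + (padic_ord b + (padic_ord z + padic_ord z)))"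
      by (intro pball_mult pball_of_nat) (simp_all add: pball_iff)
    moreover have "of_nat (j * j) * (b * (z * z)) = b * (of_nat j * z)^2"
      by (simp add: power2_eq_square mult_ac)
    ultimately have "b * (of_nat j * z)^2 \<in> pball (padic_ord b + (padic_ord z + padic_ord z))"
      by (simp only: add_0)
    then have "b * (of_nat j * z)^2 \<in> pball 0" by (rule pball_mono[rotated]) (use n z in linarith)
    then show ?thesis by (rule psi_integral)
  qed
  have "gauss_int b n = (LINT x|haar. ind 0 n x * \<psi> (b * x^2) * \<psi> (of_nat j * (2 * b * z * x)))" for j
  proof -
    have "gauss_int b n = (LINT x|haar. ind 0 n (x + of_nat j * z) * \<psi> (b * (x + of_nat j * z)^2))"
      unfolding gauss_int_def by (rule schwartz_translate[symmetric]) (rule schwartz_psi(3)[OF ind_schwartz])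
    moreover have "\<psi> (b * (x + of_nat j * z)^2) = \<psi> (b * x^2) * \<psi> (of_nat j * (2 * b * z * x))" for x
    proof -
      have "b * (x + of_nat j * z)^2 = b * x^2 + of_nat j * (2 * b * z * x) + b * (of_nat j * z)^2"
        by (simp add: power2_eq_square algebra_simps)
      then show ?thesis by (simp only: psi_add zz mult_1_right)
    qed
    ultimately show ?thesis by (simp only: ind_0_shift[OF zn] mult.assoc)
  qed
  then have "(\<Sum>j<CARD('p). gauss_int b n) =
      (\<Sum>j<CARD('p). (LINT x|haar. ind 0 n x * \<psi> (b * x^2) * \<psi> (of_nat j * (2 * b * z * x))))"
    by (intro sum.cong refl)
  also have "\<dots> = (LINT x|haar. (\<Sum>j<CARD('p). ind 0 n x * \<psi> (b * x^2) * \<psi> (of_nat j * (2 * b * z * x))))"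
  proof (rule Bochner_Integration.integral_sum[symmetric])
    fix j
    have "integrable haar (\<lambda>x. ind 0 n x * \<psi> (b * x^2) * \<psi> (of_nat j * (2 * b * z) * x))"
      by (intro schwartz_integrable schwartz_psi(2) schwartz_psi(3) ind_schwartz)
    then show "integrable haar (\<lambda>x. ind 0 n x * \<psi> (b * x^2) * \<psi> (of_nat j * (2 * b * z * x)))"
      by (simp only: mult.assoc)
  qed
  also have "\<dots> = (LINT x|haar. of_nat CARD('p) * (ind 0 (n + 1) x * \<psi> (b * x^2)))"
  proof (intro Bochner_Integration.integral_cong refl)
    fix x
    have u: "2 * b * z * x \<in> pball (m - n - 1) \<longleftrightarrow> x \<in> pball m" for m
      using b z two_mult(2)[OF b] by (cases "x = 0") (auto simp: pball_iff padic_ord_mult)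
    have "ind 0 n x * (\<Sum>j<CARD('p). \<psi> (of_nat j * (2 * b * z * x))) = of_nat CARD('p) * ind 0 (n + 1) x"
      using psi_character_sum[of "2 * b * z * x"] u[of n] u[of "n + 1"] pball_mono[of n "n + 1" x]
      by (auto simp: ind_0_iff)
    then show "(\<Sum>j<CARD('p). ind 0 n x * \<psi> (b * x^2) * \<psi> (of_nat j * (2 * b * z * x))) =
        of_nat CARD('p) * (ind 0 (n + 1) x * \<psi> (b * x^2))"
      by (simp only: sum_distrib_left[symmetric] mult_ac) (simp add: mult_ac)
  qed
  also have "\<dots> = of_nat CARD('p) * gauss_int b (n + 1)" unfolding gauss_int_def by simp
  finally show ?thesis by simp
qed

lemma gauss_int_integral:
  assumes "b \<noteq> 0" "0 \<le> 2 * n + padic_ord b"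
  shows "gauss_int b n = of_real (real CARD('p) powi (- n))"
proof -
  have "ind 0 n x * \<psi> (b * x^2) = ind 0 n x" for x
  proof (cases "x \<in> pball n")
    case True
    have "b * (x * x) \<in> pball (padic_ord b + (n + n))" using True by (intro pball_mult) (auto simp: pball_iff)
    then have "b * x^2 \<in> pball 0" using assms(2) by (intro pball_mono[of 0 "padic_ord b + (n + n)"]) (auto simp: power2_eq_square)
    then show ?thesis by (simp add: psi_integral)
  qed (simp add: ind_0_iff)
  then show ?thesis by (simp only: gauss_int_def ind_integral)
qed

definition gauss_sum :: "'p padic \<Rightarrow> complex" where
  "gauss_sum c = (\<Sum>j<CARD('p). \<psi> (c * of_nat j ^ 2))"

text \<open>At this exponent the phase depends only on \<open>x / p^n\<close> modulo
  \<open>p\<close>, so the integral is a finite sum over residues.\<close>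

lemma gauss_int_sum:
  assumes b: "b \<noteq> 0" "2 * n + padic_ord b = - 1"
  shows "gauss_int b n = of_real (real CARD('p) powi (- n - 1)) * gauss_sum (b * pp powi (2 * n))"
proof -
  have "\<psi> (b * (x + z)^2) = \<psi> (b * x^2)" if x: "x \<in> pball n" "z \<in> pball (n + 1)" for x z
  proof -
    have "of_nat 2 * (b * (x * z)) \<in> pball (0 + (padic_ord b + (n + (n + 1))))"
      by (intro pball_mult pball_of_nat x) (simp add: pball_iff)
    moreover have "b * (z * z) \<in> pball (padic_ord b + ((n + 1) + (n + 1)))"
      by (intro pball_mult x) (simp add: pball_iff)
    ultimately have "of_nat 2 * (b * (x * z)) + b * (z * z) \<in> pball 0"
      using b(2) by (intro pball_add) (erule pball_mono[rotated], simp)+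
    from psi_add_integral[OF this, of "b * x^2"] show ?thesis by (simp add: power2_eq_square algebra_simps)
  qed
  moreover have "x + z \<in> pball n \<longleftrightarrow> x \<in> pball n" if "z \<in> pball (n + 1)" for x z :: "'p padic"
    using pball_mono[of n "n + 1", OF _ that] pball_add[of x n z] pball_diff[of "x + z" n z] by auto
  ultimately have "step_fun n (n + int 1) (\<lambda>x. ind 0 n x * \<psi> (b * x^2))"
    by (auto simp: step_fun_def ind_0_iff)
  then have "gauss_int b n = of_real (real CARD('p) powi (- (n + int 1))) *
      (\<Sum>j<CARD('p) ^ 1. ind 0 n (pp powi n * of_nat j :: 'p padic) * \<psi> (b * (pp powi n * of_nat j)^2))"
    unfolding gauss_int_def by (rule step_fun_integral(2)[where 'p='p and a=n and d=1])
  moreover have "pp powi n * of_nat j \<in> (pball n :: 'p padic set)" for j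
    using pp_powi_mult_pball[of n "of_nat j :: 'p padic" 0] by simp
  moreover have "b * (pp powi n * of_nat j)^2 = b * pp powi (2 * n) * of_nat j ^ 2" for j
    by (simp add: power_mult_distrib power_int_mult mult.commute[of 2 n])
  ultimately show ?thesis by (simp only: gauss_sum_def ind_0_iff if_True mult_1 power_one_right) simp
qed

end

section \<open>Quadratic Gauss sums and the values of the Weil index\<close>

context odd_padic
begin

lemma of_nat_pball_1_iff: "j < CARD('p) \<Longrightarrow> (of_nat j :: 'p padic) \<in> pball 1 \<longleftrightarrow> j = 0"
  using of_nat_pball_iff[of j 1, where 'p='p] by (auto dest: dvd_imp_le)

text \<open>Substitution in a sum over residues modulo \<open>p\<close>. Working with maps of
  integral elements avoids the passage to the residue field; an injective map of a finite set is a
  bijection.\<close>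

lemma sum_residues_reindex:
  fixes F :: "'p padic \<Rightarrow> complex" and h :: "'p padic \<Rightarrow> 'p padic"
  assumes F: "\<And>x z. x \<in> pball 0 \<Longrightarrow> z \<in> pball 1 \<Longrightarrow> F (x + z) = F x"
    and h: "\<And>x. x \<in> pball 0 \<Longrightarrow> h x \<in> pball 0"
    and inj: "\<And>x y. x \<in> pball 0 \<Longrightarrow> y \<in> pball 0 \<Longrightarrow> h x - h y \<in> pball 1 \<Longrightarrow> x - y \<in> pball 1"
  shows "(\<Sum>j<CARD('p). F (h (of_nat j))) = (\<Sum>j<CARD('p). F (of_nat j))"
proof -
  have "\<exists>i. i < CARD('p) \<and> h (of_nat j) - of_nat i \<in> pball 1" for j
    using Zp_residue[of "h (of_nat j)" 1] h[OF pball_of_nat[of j]] by (auto simp: Zp_pball)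
  then obtain s where s: "\<And>j. s j < CARD('p)" "\<And>j. h (of_nat j) - of_nat (s j) \<in> pball 1" by metis
  have "inj_on s {..<CARD('p)}"
  proof (rule inj_onI)
    fix i j assume ij: "i \<in> {..<CARD('p)}" "j \<in> {..<CARD('p)}" "s i = s j"
    then have "h (of_nat i) - h (of_nat j) \<in> pball 1"
      using pball_diff[OF s(2)[of i] s(2)[of j]] by simp
    then have "(of_nat i - of_nat j :: 'p padic) \<in> pball (int 1)"
      using inj[OF pball_of_nat pball_of_nat] by simp
    then show "i = j" using ij by (intro of_nat_residue_inj[where 'p='p and n=1]) simp_all
  qed
  then have "bij_betw s {..<CARD('p)} {..<CARD('p)}"
    using endo_inj_surj[of "{..<CARD('p)}" s] s(1) by (auto simp: bij_betw_def)
  moreover have "F (h (of_nat j)) = F (of_nat (s j))" for j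
    using F[OF pball_of_nat s(2)[of j], of "s j"] by simp
  ultimately show ?thesis
    using sum.reindex_bij_betw[of s "{..<CARD('p)}" "{..<CARD('p)}" "\<lambda>j. F (of_nat j)"] by simp
qed

definition leg0 :: "'p padic \<Rightarrow> int" where
  "leg0 y = (if y \<in> pball 1 then 0 else leg y)"

lemma leg0_mult:
  assumes "v \<in> Zp_units" "y \<in> pball 0"
  shows "leg0 (v * y) = leg v * leg0 y"
  using assms leg_mult[of v y] by (auto simp: leg0_def units_mult_pball) (auto simp: units_pball)

text \<open>A unit residue has either no root or the two roots \<open>r\<close> and
  \<open>p - r\<close>, which differ because \<open>p\<close> is odd.\<close>

lemma card_square_roots:
  assumes y: "y < CARD('p)"
  shows "int (card {j. j < CARD('p) \<and> (of_nat j ^ 2 - of_nat y :: 'p padic) \<in> pball 1}) = 1 + leg0 (of_nat y)"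
proof -
  let ?p = "CARD('p)"
  let ?S = "{j. j < ?p \<and> (of_nat j ^ 2 - of_nat y :: 'p padic) \<in> pball 1}"
  have split: "x * w \<in> pball 1 \<Longrightarrow> x \<in> pball 0 \<Longrightarrow> x \<in> pball 1 \<or> w \<in> pball 1" for x w :: "'p padic"
    using units_mult_pball[of x w 1] by (auto simp: units_pball)
  consider "y = 0" | "y \<noteq> 0" "leg (of_nat y :: 'p padic) = 1" | "y \<noteq> 0" "leg (of_nat y :: 'p padic) = - 1"
    using leg_cases by blast
  then show ?thesis
  proof cases
    case 1
    have "?S = {0}"
      using 1 split[of "of_nat _" "of_nat _"] of_nat_pball_1_iff by (auto simp: power2_eq_square)
    then show ?thesis using 1 by (simp add: leg0_def)
  next
    case 2
    have yu: "(of_nat y :: 'p padic) \<in> Zp_units" using 2 of_nat_pball_1_iff[OF y] by (simp add: units_pball)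
    obtain i :: int where i: "of_nat y - of_int i ^ 2 \<in> (pball 1 :: 'p padic set)"
      using 2 leg_eq_1_iff_residue[OF yu] by blast
    obtain r where r: "r < ?p" "of_int i - of_nat r \<in> (pball 1 :: 'p padic set)"
      using Zp_residue[of "of_int i :: 'p padic" 1] by (auto simp: Zp_pball)
    have "(of_int i - of_nat r) * (of_int i + of_nat r) \<in> (pball (1 + 0) :: 'p padic set)"
      by (intro pball_mult r pball_add) simp_all
    then have "of_nat y - of_int i ^ 2 + (of_int i - of_nat r) * (of_int i + of_nat r) \<in> (pball 1 :: 'p padic set)"
      using i by (intro pball_add) simp_all
    then have yr: "of_nat y - of_nat r ^ 2 \<in> (pball 1 :: 'p padic set)"
      by (simp add: power2_eq_square algebra_simps)
    have r0: "r \<noteq> 0"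
    proof
      assume "r = 0"
      then show False using yr yu by (simp add: units_pball)
    qed
    have pr: "(of_nat (?p - r) + of_nat r :: 'p padic) \<in> pball 1"
      using r(1) of_nat_pball_iff[of ?p 1, where 'p='p] by (simp flip: of_nat_add)
    have "j \<in> ?S \<longleftrightarrow> j = r \<or> j = ?p - r" for j
    proof
      assume j: "j \<in> ?S"
      have "(of_nat j - of_nat r :: 'p padic) * (of_nat j + of_nat r) \<in> pball 1"
        using j pball_add[OF _ yr, of "of_nat j ^ 2 - of_nat y"] by (simp add: power2_eq_square algebra_simps)
      then have "(of_nat j - of_nat r :: 'p padic) \<in> pball 1 \<or> (of_nat j + of_nat r :: 'p padic) \<in> pball 1"
        by (rule split) (simp add: pball_diff)
      then show "j = r \<or> j = ?p - r"
      proof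
        assume "(of_nat j - of_nat r :: 'p padic) \<in> pball 1"
        then show ?thesis using j r(1) of_nat_residue_inj[of j r 1, where 'p='p] by simp
      next
        assume "(of_nat j + of_nat r :: 'p padic) \<in> pball 1"
        then have "(of_nat j - of_nat (?p - r) :: 'p padic) \<in> pball 1"
          using pball_diff[OF _ pr, of "of_nat j + of_nat r"] by (simp add: algebra_simps)
        then show ?thesis using j r(1) r0 of_nat_residue_inj[of j "?p - r" 1, where 'p='p] by simp
      qed
    next
      have A: "(of_nat (?p - r) + of_nat r :: 'p padic) * (of_nat (?p - r) - of_nat r) \<in> pball 1"
        using pball_mult[OF pr pball_diff[OF pball_of_nat pball_of_nat]] by simp
      from pball_diff[OF A yr] have "of_nat (?p - r) ^ 2 - of_nat y \<in> (pball 1 :: 'p padic set)"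
        by (simp add: power2_eq_square algebra_simps)
      then show "j \<in> ?S" if "j = r \<or> j = ?p - r"
        using that r(1) r0 yr by (auto simp: pball_diff_commute)
    qed
    then have "?S = {r, ?p - r}" by blast
    moreover have "r \<noteq> ?p - r" using odd_card r(1) by presburger
    ultimately show ?thesis using 2 yu by (simp add: leg0_def units_pball)
  next
    case 3
    have yu: "(of_nat y :: 'p padic) \<in> Zp_units" using 3 of_nat_pball_1_iff[OF y] by (simp add: units_pball)
    have "of_nat y - of_int (int j) ^ 2 \<notin> (pball 1 :: 'p padic set)" for j
      using 3 leg_eq_1_iff_residue[OF yu] by fastforce
    then have "?S = {}" by (auto simp: pball_diff_commute)
    then show ?thesis using 3 yu by (simp only: leg0_def units_pball) simp
  qed
qed

end

context padic_char
begin

lemma psi_periodic: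
  assumes "padic_ord c = - 1" "x \<in> pball 0" "z \<in> pball 1"
  shows "\<psi> (c * (x + z)) = \<psi> (c * x)"
proof -
  have "c * z \<in> pball (- 1 + 1)" using assms by (intro pball_mult) (simp_all add: pball_iff)
  then show ?thesis using psi_add_integral[of "c * z" "c * x"] by (simp add: distrib_left)
qed

text \<open>Grouping the summands by the value of the square weights each residue with its number of
  roots; the constant part of this weight contributes a full character sum, which vanishes.\<close>

lemma gauss_sum_leg:
  assumes c: "c \<noteq> 0" "padic_ord c = - 1"
  shows "gauss_sum c = (\<Sum>y<CARD('p). of_int (leg0 (of_nat y)) * \<psi> (c * of_nat y))"
proof -
  let ?p = "CARD('p)"
  have one: "\<psi> (c * of_nat j ^ 2) =
      (\<Sum>y<?p. if (of_nat j ^ 2 - of_nat y :: 'p padic) \<in> pball 1 then \<psi> (c * of_nat y) else 0)" for j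
  proof -
    have "of_nat (j ^ 2) \<in> (Zp :: 'p padic set)" unfolding Zp_pball by (rule pball_of_nat)
    then obtain i where "i < ?p ^ 1" "of_nat (j ^ 2) - of_nat i \<in> (pball (int 1) :: 'p padic set)"
      by (rule Zp_residue)
    then have i: "i < ?p" "of_nat j ^ 2 - of_nat i \<in> (pball 1 :: 'p padic set)" by simp_all
    have u: "(of_nat j ^ 2 - of_nat y :: 'p padic) \<in> pball 1 \<longleftrightarrow> y = i" if "y < ?p" for y
      using i that pball_diff[OF i(2), of "of_nat j ^ 2 - of_nat y"] of_nat_residue_inj[of y i 1, where 'p='p] by auto
    have "(\<Sum>y<?p. if (of_nat j ^ 2 - of_nat y :: 'p padic) \<in> pball 1 then \<psi> (c * of_nat y) else 0) =
        (\<Sum>y<?p. if y = i then \<psi> (c * of_nat i) else 0)"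
      using u by (intro sum.cong) auto
    also have "\<dots> = \<psi> (c * of_nat i)" using i(1) by simp
    also have "\<dots> = \<psi> (c * (of_nat i + (of_nat j ^ 2 - of_nat i)))"
      by (rule psi_periodic[OF c(2) pball_of_nat i(2), symmetric])
    finally show ?thesis by simp
  qed
  have "gauss_sum c = (\<Sum>y<?p. \<Sum>j<?p. if (of_nat j ^ 2 - of_nat y :: 'p padic) \<in> pball 1 then \<psi> (c * of_nat y) else 0)"
    unfolding gauss_sum_def one by (rule sum.swap)
  also have "\<dots> = (\<Sum>y<?p. of_int (1 + leg0 (of_nat y)) * \<psi> (c * of_nat y))"
  proof (intro sum.cong refl)
    fix y assume "y \<in> {..<?p}"
    then have "complex_of_int (int (card {j. j < ?p \<and> (of_nat j ^ 2 - of_nat y :: 'p padic) \<in> pball 1})) =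
        of_int (1 + leg0 (of_nat y))" using card_square_roots by simp
    then show "(\<Sum>j<?p. if (of_nat j ^ 2 - of_nat y :: 'p padic) \<in> pball 1 then \<psi> (c * of_nat y) else 0) =
        of_int (1 + leg0 (of_nat y)) * \<psi> (c * of_nat y)"
      by (simp add: sum.If_cases Int_def)
  qed
  also have "\<dots> = (\<Sum>y<?p. \<psi> (of_nat y * c)) + (\<Sum>y<?p. of_int (leg0 (of_nat y)) * \<psi> (c * of_nat y))"
    unfolding sum.distrib[symmetric] by (intro sum.cong refl) (simp add: algebra_simps)
  also have "(\<Sum>y<?p. \<psi> (of_nat y * c)) = 0"
    using psi_character_sum[of c] c by (simp add: pball_iff)
  finally show ?thesis by simp
qed

text \<open>In the character form of the sum, the substitution of \<open>v y\<close> for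
  \<open>y\<close> moves \<open>v\<close> from the additive to the multiplicative character.\<close>

lemma gauss_sum_unit:
  assumes c: "c \<noteq> 0" "padic_ord c = - 1" and v: "v \<in> Zp_units"
  shows "gauss_sum (c * v) = of_int (leg v) * gauss_sum c"
proof -
  let ?F = "\<lambda>y. complex_of_int (leg0 y) * \<psi> (c * y)"
  have cv: "c * v \<noteq> 0" "padic_ord (c * v) = - 1"
    using c v units_nonzero[OF v] padic_ord_unit[OF v] by (auto simp: padic_ord_mult)
  have vp: "v \<in> pball 0" using v by (simp add: units_pball)
  have "gauss_sum (c * v) = (\<Sum>y<CARD('p). of_int (leg v) * ?F (v * of_nat y))"
    unfolding gauss_sum_leg[OF cv] using leg0_mult[OF v pball_of_nat]
    by (intro sum.cong refl) (simp add: mult_ac flip: of_int_mult)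
  also have "\<dots> = of_int (leg v) * (\<Sum>y<CARD('p). ?F (v * of_nat y))" by (simp only: sum_distrib_left)
  also have "(\<Sum>y<CARD('p). ?F (v * of_nat y)) = (\<Sum>y<CARD('p). ?F (of_nat y))"
  proof (rule sum_residues_reindex[of ?F "\<lambda>x. v * x"])
    show "?F (x + z) = ?F x" if xz: "x \<in> pball 0" "z \<in> pball 1" for x z
    proof -
      have "leg0 (x + z) = leg0 x"
      proof (cases "x \<in> pball 1")
        case True
        then show ?thesis using xz by (simp add: leg0_def pball_add)
      next
        case False
        then have xu: "x \<in> Zp_units" using xz by (simp add: units_pball)
        then have "x + z \<in> Zp_units" "leg (x + z) = leg x"
          using xz units_add_pball[of x z] leg_cong[of "x + z" x] by auto
        then show ?thesis using False by (simp add: leg0_def units_pball)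
      qed
      then show ?thesis using psi_periodic[OF c(2) xz] by simp
    qed
    show "v * x \<in> pball 0" if "x \<in> pball 0" for x using that units_mult_pball[OF v] by simp
    show "x - y \<in> pball 1" if "v * x - v * y \<in> pball 1" for x y
      using that units_mult_pball[OF v, of "x - y" 1] by (simp add: right_diff_distrib)
  qed
  finally show ?thesis unfolding gauss_sum_leg[OF c] .
qed

text \<open>The product of the sums for \<open>c\<close> and \<open>- c\<close> is \<open>p\<close>:
  shifting \<open>j\<close> by \<open>i\<close> makes the phase linear in \<open>i\<close>, and
  summing over \<open>i\<close> leaves only \<open>j = 0\<close>. The sum for \<open>- c\<close> is
  then rewritten by \<open>gauss_sum_unit\<close>.\<close>

lemma gauss_sum_square:
  assumes c: "c \<noteq> 0" "padic_ord c = - 1"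
  shows "gauss_sum c * gauss_sum c = of_int (leg (- 1 :: 'p padic)) * of_nat CARD('p)"
proof -
  let ?p = "CARD('p)"
  have "gauss_sum c * gauss_sum (- c) = (\<Sum>i<?p. \<Sum>j<?p. \<psi> (c * (of_nat j ^ 2 - of_nat i ^ 2)))"
    unfolding gauss_sum_def sum_product by (subst sum.swap) (simp add: right_diff_distrib flip: psi_add)
  also have "\<dots> = (\<Sum>i<?p. \<Sum>j<?p. \<psi> (c * of_nat j ^ 2) * \<psi> (of_nat i * (2 * c * of_nat j)))"
  proof (rule sum.cong[OF refl])
    fix i assume "i \<in> {..<?p}"
    let ?F = "\<lambda>x. \<psi> (c * (x ^ 2 - of_nat i ^ 2))"
    have "(\<Sum>j<?p. ?F (of_nat j)) = (\<Sum>j<?p. ?F (of_nat j + of_nat i))"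
    proof (rule sum_residues_reindex[of ?F "\<lambda>x. x + of_nat i", symmetric])
      show "?F (x + z) = ?F x" if xz: "x \<in> pball 0" "z \<in> pball 1" for x z
      proof -
        have "x * z \<in> pball (0 + 1)" "z * z \<in> pball (1 + 1)" using xz by (intro pball_mult; simp)+
        then have zz: "x * z + x * z + z * z \<in> pball 1" using pball_mono[of 1 2 "z * z"] by (intro pball_add) auto
        have "x ^ 2 - of_nat i ^ 2 \<in> pball 0"
          using pball_mult[OF xz(1) xz(1)] pball_of_nat[of "i ^ 2", where 'a='p]
          by (intro pball_diff) (simp_all add: power2_eq_square)
        moreover have "(x + z)^2 - of_nat i ^ 2 = (x ^ 2 - of_nat i ^ 2) + (x * z + x * z + z * z)"
          by (simp add: power2_eq_square algebra_simps)
        ultimately show ?thesis using psi_periodic[OF c(2) _ zz] by metis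
      qed
    qed (auto intro: pball_add)
    also have "\<dots> = (\<Sum>j<?p. \<psi> (c * of_nat j ^ 2) * \<psi> (of_nat i * (2 * c * of_nat j)))"
      by (intro sum.cong refl) (simp add: power2_eq_square algebra_simps flip: psi_add)
    finally show "(\<Sum>j<?p. \<psi> (c * (of_nat j ^ 2 - of_nat i ^ 2))) = \<dots>" .
  qed
  also have "\<dots> = (\<Sum>j<?p. \<psi> (c * of_nat j ^ 2) * (\<Sum>i<?p. \<psi> (of_nat i * (2 * c * of_nat j))))"
    by (subst sum.swap) (simp only: sum_distrib_left)
  also have "\<dots> = (\<Sum>j<?p. if j = 0 then of_nat ?p else 0)"
  proof (intro sum.cong refl)
    fix j assume j: "j \<in> {..<?p}"
    have c2: "2 * c \<noteq> 0" "padic_ord (2 * c) = - 1" using c two_mult(2)[of c] by auto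
    have "2 * c * of_nat j \<in> pball (- 1 + m) \<longleftrightarrow> (of_nat j :: 'p padic) \<in> pball m" for m
      using c2 by (cases "j = 0") (auto simp: pball_iff padic_ord_mult simp del: mult_eq_0_iff)
    from this[of 0] this[of 1] have "2 * c * of_nat j \<in> pball (- 1)" "2 * c * of_nat j \<in> pball 0 \<longleftrightarrow> j = 0"
      using of_nat_pball_1_iff[of j] j by auto
    then show "\<psi> (c * of_nat j ^ 2) * (\<Sum>i<?p. \<psi> (of_nat i * (2 * c * of_nat j))) = (if j = 0 then of_nat ?p else 0)"
      using psi_character_sum by simp
  qed
  also have "\<dots> = of_nat ?p" by simp
  finally have e: "gauss_sum c * gauss_sum (- c) = of_nat ?p" .
  have "gauss_sum (- c) = of_int (leg (- 1 :: 'p padic)) * gauss_sum c"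
    using gauss_sum_unit[OF c, of "- 1"] by simp
  then have "of_int (leg (- 1 :: 'p padic)) * (gauss_sum c * gauss_sum c) = of_nat ?p" using e by (simp add: mult_ac)
  then show ?thesis using leg_cases[of "- 1 :: 'p padic"] by (auto simp: minus_equation_iff)
qed

lemma gauss_int_const:
  assumes b: "b \<noteq> 0" and N: "2 * N + padic_ord b \<le> 0" and n: "n \<le> N"
  shows "gauss_int b n = gauss_int b N"
  using n
proof (induction n rule: int_le_induct)
  case (step i)
  then show ?case using gauss_int_stable[OF b, of "i - 1"] N by simp
qed simp

text \<open>The Gauss sum scaled to absolute value 1; this is the common Weil index of the twists of
  \<open>\<psi>\<close> by \<open>p\<close> and by \<open>1 / p\<close>.\<close>

definition weil_odd :: complex where
  "weil_odd = gauss_sum (inverse pp) / of_real (sqrt (real CARD('p)))"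

lemma weil_odd_square: "weil_odd * weil_odd = of_int (leg (- 1 :: 'p padic))"
proof -
  have c: "inverse pp \<noteq> (0 :: 'p padic)" "padic_ord (inverse pp :: 'p padic) = - 1"
    by (simp_all add: padic_ord_inverse)
  have "weil_odd * weil_odd = (gauss_sum (inverse pp) * gauss_sum (inverse pp)) / of_real (real CARD('p))"
    by (simp add: weil_odd_def flip: of_real_mult)
  then show ?thesis using gauss_sum_square[OF c] by simp
qed

text \<open>Only the smallest ball of the stable range counts. It contributes its volume when the
  order of \<open>b\<close> is even and a Gauss sum modulo \<open>p\<close> when it is odd.\<close>

lemma weil_index_psi:
  assumes b: "b \<noteq> 0"
  shows "weil_index (twist \<psi> b) = (if odd (padic_ord b) then of_int (leg (angular b)) * weil_odd else 1)"
proof (cases "odd (padic_ord b)")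
  case False
  then obtain m where m: "padic_ord b = 2 * m" by (auto elim: evenE)
  have "- (2 * m) = - m + - m" by simp
  then have "padic_abs b = (real CARD('p) powi (- m))^2"
    using power_int_add[of "real CARD('p)" "- m" "- m"] by (simp only: padic_abs_ord[OF b] m power2_eq_square) simp
  then have "sqrt (padic_abs b) = real CARD('p) powi (- m)" by (metis real_sqrt_unique zero_le_power_int of_nat_0_le_iff)
  then have "of_real (sqrt (padic_abs b)) * gauss_int b n = 1" if "n \<le> - m" for n
    using gauss_int_const[OF b _ that] gauss_int_integral[OF b, of "- m"] m by (simp add: power_int_minus)
  then have "weil_index (twist \<psi> b) = 1" by (rule weil_index_eqI[OF b])
  then show ?thesis using False by simp
next
  case True
  then obtain m where m: "padic_ord b = 2 * m + 1" by (auto elim: oddE)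
  let ?q = "real CARD('p)"
  have q: "?q \<noteq> 0" by simp
  have e: "- (2 * m + 1) = (- m + - m) + - 1" by simp
  have "?q powi (- (2 * m + 1)) = ?q powi (- m) * ?q powi (- m) * ?q powi (- 1)"
    unfolding e using q by (simp only: power_int_add simp_thms)
  then have "padic_abs b = (?q powi (- m) * (?q powi (- m))) * inverse ?q"
    unfolding padic_abs_ord[OF b] m by simp
  then have "sqrt (padic_abs b) = ?q powi (- m) / sqrt ?q"
    by (simp add: real_sqrt_mult real_sqrt_inverse divide_inverse)
  moreover have "b * pp powi (2 * (- m - 1)) = inverse pp * angular b"
  proof -
    have e: "2 * (- m - 1) = - padic_ord b + - 1" by (simp add: m)
    have "pp powi (2 * (- m - 1)) = pp powi (- padic_ord b) * (pp powi (- 1) :: 'p padic)"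
      unfolding e by (rule power_int_add) simp
    then show ?thesis by (simp add: angular_def)
  qed
  moreover have "gauss_sum (inverse pp * angular b) = of_int (leg (angular b)) * gauss_sum (inverse pp)"
    by (intro gauss_sum_unit angular_unit b) (simp_all add: padic_ord_inverse)
  ultimately have "of_real (sqrt (padic_abs b)) * gauss_int b n = of_int (leg (angular b)) * weil_odd" if "n \<le> - m - 1" for n
    using gauss_int_const[OF b _ that] gauss_int_sum[OF b, of "- m - 1"] m
    by (simp add: power_int_minus weil_odd_def)
  then have "weil_index (twist \<psi> b) = of_int (leg (angular b)) * weil_odd" by (rule weil_index_eqI[OF b])
  then show ?thesis using True by simp
qed

lemma twist_1: "twist \<psi> 1 = \<psi>" by (simp add: twist_def)

lemma weil_index_1: "weil_index \<psi> = 1"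
  using weil_index_psi[of 1] padic_ord_unit[OF units_1, where 'p='p] by (simp add: twist_1)

lemma weil_odd_nonzero: "weil_odd \<noteq> 0"
  using weil_odd_square leg_nonzero[of "- 1 :: 'p padic"] by (metis mult_zero_left of_int_eq_0_iff)

lemma gamma_rel_psi:
  "b \<noteq> 0 \<Longrightarrow> gamma_rel b \<psi> = (if odd (padic_ord b) then of_int (leg (angular b)) * weil_odd else 1)"
  by (simp add: gamma_rel_def weil_index_1 weil_index_psi)

text \<open>Weil's relation between the index and the Hilbert symbol, read off from the explicit
  values; when both orders are odd, the Legendre symbol of -1 comes from
  \<open>weil_odd_square\<close>.\<close>

lemma gamma_rel_mult:
  assumes "a \<noteq> 0" "b \<noteq> 0"
  shows "gamma_rel a \<psi> * gamma_rel b \<psi> = gamma_rel (a * b) \<psi> * of_int (hilbert a b)"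
  using assms angular_unit[of a] angular_unit[of b] weil_odd_square leg_cases[of "angular a"] leg_cases[of "angular b"]
  by (auto simp: gamma_rel_psi hilbert_formula padic_ord_mult angular_mult leg_mult)

lemma gamma_rel_unit: "u \<in> Zp_units \<Longrightarrow> gamma_rel u \<psi> = 1"
  by (simp add: gamma_rel_psi units_nonzero padic_ord_unit)

lemma twist_twist: "twist (twist \<psi> a) u = twist \<psi> (a * u)"
  by (simp add: twist_def mult.assoc)

text \<open>The unit multiplies the angular part of \<open>a\<close>, which matters only for odd
  order. In this way the ramification of \<open>\<mu>\<^sub>a\<close> enters the torus action of the
  Weil representation.\<close>

lemma gamma_rel_twist_unit:
  assumes "a \<noteq> 0" "u \<in> Zp_units"
  shows "gamma_rel u (twist \<psi> a) = (if odd (padic_ord a) then of_int (leg u) else 1)"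
  using assms angular_unit[of a] weil_odd_nonzero units_nonzero[of u]
  by (simp add: gamma_rel_def twist_twist weil_index_psi padic_ord_mult padic_ord_unit angular_mult
      angular_of_unit leg_mult)

end

lemma sum_fun_apply: "(\<Sum>x\<in>A. f x) y = (\<Sum>x\<in>A. f x y :: complex)"
  by (induction A rule: infinite_finite_induct) auto

text \<open>Evaluation at the points of \<open>X\<close> is injective on \<open>V\<close>, and the
  family \<open>b\<close> is dual to these evaluations, hence a basis.\<close>

lemma has_dim_eval:
  assumes V: "cfun.subspace V" and X: "finite X"
    and b: "\<And>x. x \<in> X \<Longrightarrow> b x \<in> V" "\<And>x y. x \<in> X \<Longrightarrow> y \<in> X \<Longrightarrow> b x y = (if x = y then 1 else 0)"
    and inj: "\<And>f. f \<in> V \<Longrightarrow> (\<And>x. x \<in> X \<Longrightarrow> f x = 0) \<Longrightarrow> f = 0"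
  shows "has_dim V (card X)"
proof -
  have inj_b: "inj_on b X"
  proof (rule inj_onI)
    fix x y assume xy: "x \<in> X" "y \<in> X" "b x = b y"
    have "b y x = 1" using b(2)[OF xy(1,1)] by (simp only: xy(3)) simp
    then show "x = y" using b(2)[OF xy(2,1)] by (metis zero_neq_one)
  qed
  have "cfun.independent (b ` X)"
  proof (rule cfun.independent_if_scalars_zero)
    fix f v assume z: "(\<Sum>v\<in>b ` X. cscale (f v) v) = 0" and "v \<in> b ` X"
    then obtain y where y: "y \<in> X" "v = b y" by blast
    have "0 = (\<Sum>v\<in>b ` X. cscale (f v) v) y" using z by simp
    also have "\<dots> = (\<Sum>x\<in>X. f (b x) * b x y)"
      by (simp add: sum_fun_apply sum.reindex[OF inj_b] cscale_def)
    also have "\<dots> = (\<Sum>x\<in>X. if x = y then f (b y) else 0)"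
      using b(2) y by (intro sum.cong) auto
    also have "\<dots> = f v" using X y by simp
    finally show "f v = 0" by simp
  qed (use X in simp)
  moreover have "cfun.span (b ` X) = V"
  proof
    show "cfun.span (b ` X) \<subseteq> V" using V b(1) by (intro cfun.span_minimal) auto
    show "V \<subseteq> cfun.span (b ` X)"
    proof
      fix f assume f: "f \<in> V"
      define g where "g = (\<Sum>x\<in>X. cscale (f x) (b x))"
      have "g \<in> V" unfolding g_def using b(1) by (intro cfun.subspace_sum V cfun.subspace_scale)
      have "f - g = 0"
      proof (rule inj)
        show "f - g \<in> V" using f \<open>g \<in> V\<close> by (intro cfun.subspace_diff V)
        fix y assume y: "y \<in> X"
        have "g y = (\<Sum>x\<in>X. f x * b x y)" by (simp add: g_def sum_fun_apply cscale_def)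
        also have "\<dots> = (\<Sum>x\<in>X. if x = y then f y else 0)" using b(2) y by (intro sum.cong) auto
        also have "\<dots> = f y" using X y by simp
        finally show "(f - g) y = 0" by simp
      qed
      moreover have "g \<in> cfun.span (b ` X)"
        unfolding g_def by (intro cfun.span_sum cfun.span_scale cfun.span_base) auto
      ultimately show "f \<in> cfun.span (b ` X)" by simp
    qed
  qed
  ultimately show ?thesis unfolding has_dim_def
    using X b(1) by (intro exI[of _ "b ` X"]) (auto simp: card_image[OF inj_b])
qed

section \<open>Genuine principal series\<close>

lemma borel_mult:
  assumes "t \<noteq> 0" "t' \<noteq> (0::'p::prime_card padic)"
  shows "hmat t ** xmat s ** (hmat t' ** xmat s') = hmat (t * t') ** xmat (s' + s / t'^2)"
  using assms by (intro mat2_eqI) (auto simp: matmul2_nth field_simps power2_eq_square)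

lemma borel_mult_assoc:
  assumes "t \<noteq> 0" "t' \<noteq> (0::'p::prime_card padic)"
  shows "hmat t ** xmat s ** (hmat t' ** xmat s' ** g) = hmat (t * t') ** xmat (s' + s / t'^2) ** g"
  by (simp only: borel_mult[OF assms, symmetric] matrix_mul_assoc)

lemma borel_SL2: "t \<noteq> 0 \<Longrightarrow> hmat t ** xmat s \<in> SL2"
  by (intro SL2_mult) simp_all

lemma borel_1: "hmat 1 ** xmat 0 = mat 1" by (simp add: xmat_0 hmat_1)

context odd_padic
begin

text \<open>Uniform notation for the two characters of the units that occur, the trivial one and the
  Legendre symbol; \<open>b\<close> records ramification.\<close>

definition lc :: "bool \<Rightarrow> 'p padic \<Rightarrow> complex" where
  "lc b u = of_int (if b then leg u else 1)"

lemma lc_1 [simp]: "lc b 1 = 1" by (simp add: lc_def)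

lemma lc_mult: "u \<in> Zp_units \<Longrightarrow> v \<in> Zp_units \<Longrightarrow> lc b (u * v) = lc b u * lc b v"
  by (simp add: lc_def leg_mult)

lemma lc_cong: "u \<in> Zp_units \<Longrightarrow> u - v \<in> pball 1 \<Longrightarrow> lc b u = lc b v"
  by (simp add: lc_def leg_cong)

lemma lc_inverse: "u \<in> Zp_units \<Longrightarrow> lc b (inverse u) = lc b u"
  by (simp add: lc_def leg_inverse units_nonzero)

lemma lc_square [simp]: "lc b u * lc b u = 1"
  using leg_cases[of u] by (auto simp: lc_def)

lemma lc_nonzero [simp]: "lc b u \<noteq> 0" by (simp add: lc_def)

lemma hilbert_1 [simp]: "hilbert x 1 = 1"
  by (rule hilbert_eq_1I[of 1 _ 0 _ 1]) auto

lemma cocycle_1: "g \<in> SL2 \<Longrightarrow> cocycle (mat 1) (g :: 'p padic^2^2) = 1"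
  using cocycle_borel[of 1 g 0] by (simp add: borel_1)

lemma cocycle_borel_borel:
  assumes "t \<noteq> 0" "t' \<noteq> (0::'p padic)"
  shows "cocycle (hmat t ** xmat s) (hmat t' ** xmat s') = hilbert t' t"
proof -
  have e: "tau (hmat t' ** xmat s') = inverse t'" "s_sign (hmat t' ** xmat s') = 1" for t' s' :: "'p padic"
    by (simp_all add: tau_def s_sign_def matmul2_nth)
  have "t'^2 * inverse t' = t'" using assms by (simp add: power2_eq_square)
  then have "hilbert (inverse t') t = hilbert t' t"
    using hilbert_power2_mult_left[OF assms(2), of "inverse t'" t] by simp
  moreover have "s_sign (hmat (t * t') ** xmat (s' + s / t'^2)) = 1" by (simp add: s_sign_def matmul2_nth)
  ultimately show ?thesis
    unfolding cocycle_borel[OF assms(1) borel_SL2[OF assms(2)]] borel_mult[OF assms] e by simp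
qed

lemma cocycle_sign: "cocycle g (h :: 'p padic^2^2) \<in> {1, - 1}" using cocycle_cases by blast

lemma cocycle_square [simp]: "cocycle g (h :: 'p padic^2^2) * cocycle g h = 1" using cocycle_sign[of g h] by auto

lemma mp_mult_Mp: "g \<in> Mp \<Longrightarrow> h \<in> Mp \<Longrightarrow> mp_mult g (h :: 'p mp) \<in> Mp"
  using cocycle_sign[of "fst g" "fst h"] by (auto simp: Mp_def mp_mult_def SL2_mult)

lemma Kcong_K0: "m \<le> n \<Longrightarrow> k \<in> Kcong n \<Longrightarrow> (k :: 'p padic^2^2) \<in> K0 m"
proof -
  assume mn: "m \<le> n" and k: "k \<in> Kcong n"
  have e: "(k - mat 1) $ i $ j \<in> pball (int n)" for i j using k by (simp add: Kcong_def pZp_pball)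
  have e0: "(k - mat 1) $ i $ j \<in> pball 0" for i j using pball_mono[OF _ e] by simp
  have "k $ 1 $ 1 \<in> pball 0" "k $ 1 $ 2 \<in> pball 0" "k $ 2 $ 2 \<in> pball 0"
    using pball_add[OF e0[of 1 1] pball_1] e0[of 1 2] pball_add[OF e0[of 2 2] pball_1] by simp_all
  moreover have "k $ 2 $ 1 \<in> pball (int m)" using pball_mono[OF _ e[of 2 1], of "int m"] mn by simp
  ultimately show ?thesis using k by (simp add: K0_iff Kcong_def)
qed

lemma Kcong_22:
  assumes "n \<ge> 1" "k \<in> Kcong n"
  shows "(k :: 'p padic^2^2) $ 2 $ 2 - 1 \<in> pball 1" "k $ 2 $ 2 \<in> Zp_units"
proof -
  have "(k - mat 1) $ 2 $ 2 \<in> pball (int n)" using assms(2) unfolding Kcong_def pZp_pball by blast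
  then show *: "k $ 2 $ 2 - 1 \<in> pball 1" using pball_mono[of 1 "int n" "k $ 2 $ 2 - 1"] assms(1) by simp
  show "k $ 2 $ 2 \<in> Zp_units" using units_add_pball[OF units_1 *] by simp
qed

lemma Kcong_mono: "m \<le> n \<Longrightarrow> Kcong n \<subseteq> (Kcong m :: ('p padic^2^2) set)"
  by (auto simp: Kcong_def pZp_pball intro: pball_mono[of "int m" "int n"])

text \<open>Congruence subgroups are normal in \<open>K0 0\<close>, because conjugation carries
  \<open>h - 1\<close> to an integral combination of its entries.\<close>

lemma Kcong_conj:
  assumes k: "k \<in> K0 0" and h: "h \<in> Kcong n"
  shows "inv2 k ** h ** (k :: 'p padic^2^2) \<in> Kcong n"
proof -
  have kz: "k $ i $ j \<in> pball 0" "inv2 k $ i $ j \<in> pball 0" for i j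
    using k K0_inv2[OF k] by (auto simp: K0_def Zp_pball)
  have hz: "(h - mat 1) $ i $ j \<in> pball (int n)" for i j using h by (simp add: Kcong_def pZp_pball)
  have "inv2 k ** (h - mat 1) ** k = inv2 k ** h ** k - inv2 k ** k"
    by (intro mat2_eqI) (simp_all add: matmul2_nth algebra_simps)
  then have e: "inv2 k ** h ** k - mat 1 = inv2 k ** (h - mat 1) ** k"
    using inv2_mult[OF K0_SL2[OF k]] by simp
  have "(inv2 k ** (h - mat 1)) $ i $ j \<in> pball (int n)" for i j
    unfolding matmul2_nth using pball_mult[OF kz(2) hz] by (intro pball_add) simp_all
  then have "(inv2 k ** h ** k - mat 1) $ i $ j \<in> pball (int n)" for i j
    unfolding e matmul2_nth[of "inv2 k ** (h - mat 1)"] using pball_mult[OF _ kz(1), of _ "int n"]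
    by (intro pball_add) simp_all
  moreover have "inv2 k ** h ** k \<in> SL2"
    using h by (intro SL2_mult inv2_SL2 K0_SL2[OF k]) (simp add: Kcong_def)
  ultimately show ?thesis unfolding Kcong_def pZp_pball by blast
qed

end

locale pair = padic_char p_type \<psi> for p_type :: "'p::prime_card itself" and \<psi> +
  fixes a :: "'p padic" and k l :: bool and \<mu> \<eta> :: "'p padic \<Rightarrow> complex"
  assumes a_nonzero: "a \<noteq> 0" and k_def: "k \<longleftrightarrow> odd (padic_ord a)"
    and mu_def: "\<mu> = (\<lambda>x. quad_char a x * abs_pow x (1/2))"
    and eta_def: "\<eta> = (if l then legendre_char else (\<lambda>_. 1))"
    and parity: "lc k (- 1) = lc l (- 1)"
begin

lemma mu_apply: "\<mu> x = quad_char a x * abs_pow x (1/2)"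
  by (rule fun_cong[OF mu_def])

lemma eta_unit: "u \<in> Zp_units \<Longrightarrow> \<eta> u = lc l u"
  by (simp add: eta_def lc_def legendre_char_leg)

lemma eta_1 [simp]: "\<eta> 1 = 1" by (simp add: eta_unit)

lemma quad_char_unit: "u \<in> Zp_units \<Longrightarrow> quad_char a u = lc k u"
  by (simp add: quad_char_def hilbert_unit_right a_nonzero k_def lc_def)

lemma eta_K0_mult:
  assumes "A \<in> K0 m" "B \<in> K0 m" "l \<Longrightarrow> m \<ge> 1"
  shows "\<eta> ((A ** B) $ 2 $ 2) = \<eta> (A $ 2 $ 2) * \<eta> (B $ 2 $ 2)"
proof (cases l)
  case True
  then have m: "m \<ge> 1" using assms(3) by simp
  have u: "A $ 2 $ 2 \<in> Zp_units" "B $ 2 $ 2 \<in> Zp_units" "(A ** B) $ 2 $ 2 \<in> Zp_units"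
    using K0_1_units(1)[OF _ m] K0_mult[OF assms(1,2)] assms(1,2) by auto
  have "A $ 2 $ 1 \<in> pball 1" "B $ 1 $ 2 \<in> pball 0"
    using assms(1,2) m pball_mono[of 1 "int m"] by (auto simp: K0_iff)
  then have "A $ 2 $ 1 * B $ 1 $ 2 \<in> pball (1 + 0)" by (rule pball_mult)
  then have "(A ** B) $ 2 $ 2 - A $ 2 $ 2 * B $ 2 $ 2 \<in> pball 1" by (simp add: matmul2_nth)
  from lc_cong[OF u(3) this] show ?thesis using u by (simp add: eta_unit lc_mult)
qed (simp add: eta_def)

lemma eta_square:
  assumes "A \<in> K0 m" "l \<Longrightarrow> m \<ge> 1"
  shows "\<eta> (A $ 2 $ 2) * \<eta> (A $ 2 $ 2) = 1"
proof (cases l)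
  case True
  then show ?thesis using K0_1_units(1)[OF assms(1)] assms(2) by (simp add: eta_unit)
qed (simp add: eta_def)

text \<open>The inducing character on the torus. On the base group it is multiplicative only up to a
  Hilbert symbol, which compensates the cocycle of two Borel elements.\<close>

definition delta :: "'p padic \<Rightarrow> complex" where
  "delta t = of_real (padic_abs t) * \<mu> t * inverse (gamma_rel t \<psi>)"

lemma delta_unit: "u \<in> Zp_units \<Longrightarrow> delta u = lc k u"
  by (simp add: delta_def mu_apply quad_char_unit gamma_rel_unit abs_pow_def) (simp add: Zp_units_def)

lemma delta_mult:
  assumes "t \<noteq> 0" "u \<noteq> 0"
  shows "delta (t * u) = delta t * delta u * of_int (hilbert t u)"
proof -
  have "\<mu> (t * u) = \<mu> t * \<mu> u"
    using assms a_nonzero by (simp add: mu_apply quad_char_def hilbert_mult_right abs_pow_def padic_abs_mult powr_mult)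
  moreover have "inverse (gamma_rel (t * u) \<psi>) = inverse (gamma_rel t \<psi>) * inverse (gamma_rel u \<psi>) * of_int (hilbert t u)"
  proof -
    have "gamma_rel (t * u) \<psi> * of_int (hilbert t u) * of_int (hilbert t u) = gamma_rel t \<psi> * gamma_rel u \<psi> * of_int (hilbert t u)"
      using gamma_rel_mult[OF assms] by simp
    moreover have hh: "complex_of_int (hilbert t u) * of_int (hilbert t u) = 1"
      unfolding of_int_mult[symmetric] by simp
    ultimately have "gamma_rel (t * u) \<psi> = gamma_rel t \<psi> * gamma_rel u \<psi> * of_int (hilbert t u)"
      by (simp only: mult.assoc mult_1_right)
    moreover have "inverse (complex_of_int (hilbert t u)) = of_int (hilbert t u)"
      using hh by (rule inverse_unique)
    ultimately show ?thesis by simp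
  qed
  ultimately show ?thesis by (simp add: delta_def padic_abs_mult)
qed

definition PS :: "('p mp \<Rightarrow> complex) set" where "PS = principal_series \<psi> \<mu>"

lemma PS_iff:
  "f \<in> PS \<longleftrightarrow> (\<forall>x. x \<notin> Mp \<longrightarrow> f x = 0) \<and> mp_locally_constant f \<and>
    (\<forall>t s \<epsilon>. \<forall>x\<in>Mp. t \<noteq> 0 \<and> \<epsilon> \<in> {1, - 1} \<longrightarrow>
      f (mp_mult (hmat t ** xmat s, \<epsilon>) x) = of_int \<epsilon> * delta t * f x)"
  by (simp only: PS_def principal_series_def delta_def mem_Collect_eq mult.assoc)

lemma PS_I:
  assumes "\<And>x. x \<notin> Mp \<Longrightarrow> f x = 0" "mp_locally_constant f"
    "\<And>t s \<epsilon> x. x \<in> Mp \<Longrightarrow> t \<noteq> 0 \<Longrightarrow> \<epsilon> \<in> {1, - 1} \<Longrightarrow>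
      f (mp_mult (hmat t ** xmat s, \<epsilon>) x) = of_int \<epsilon> * delta t * f x"
  shows "f \<in> PS"
  unfolding PS_iff using assms by blast

lemma PS_outside: "f \<in> PS \<Longrightarrow> g \<notin> Mp \<Longrightarrow> f g = 0"
  unfolding PS_iff by blast

lemma PS_locally_constant: "f \<in> PS \<Longrightarrow> x \<in> Mp \<Longrightarrow> \<exists>n. \<forall>h\<in>Kcong n. f (mp_mult x (h, 1)) = f x"
  unfolding PS_iff mp_locally_constant_def by blast

lemma PS_equivariant:
  "f \<in> PS \<Longrightarrow> g \<in> Mp \<Longrightarrow> t \<noteq> 0 \<Longrightarrow> \<epsilon> \<in> {1, - 1} \<Longrightarrow>
    f (mp_mult (hmat t ** xmat s, \<epsilon>) g) = of_int \<epsilon> * delta t * f g"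
  unfolding PS_iff by blast

lemma PS_borel:
  assumes "f \<in> PS" "g \<in> SL2" "t \<noteq> 0" "\<epsilon> \<in> {1, - 1}"
  shows "f (hmat t ** xmat s ** g, \<epsilon>) = of_int (cocycle (hmat t ** xmat s) g) * delta t * f (g, \<epsilon>)"
proof -
  let ?c = "cocycle (hmat t ** xmat s) g"
  have "mp_mult (hmat t ** xmat s, ?c) (g, \<epsilon>) = (hmat t ** xmat s ** g, \<epsilon>)"
    by (simp add: mp_mult_def mult.commute mult.left_commute)
  then show ?thesis
    using PS_equivariant[OF assms(1) _ assms(3) cocycle_sign[of "hmat t ** xmat s" g], of "(g, \<epsilon>)" s] assms
    by (simp add: Mp_def)
qed

lemma PS_sign:
  assumes "f \<in> PS" "g \<in> SL2" "\<epsilon> \<in> {1, - 1}" "\<epsilon>' \<in> {1, - 1}"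
  shows "f (g, \<epsilon> * \<epsilon>') = of_int \<epsilon> * f (g, \<epsilon>')"
proof -
  have "mp_mult (hmat 1 ** xmat 0, \<epsilon>) (g, \<epsilon>') = (g, \<epsilon> * \<epsilon>')"
    using assms(2) by (simp add: mp_mult_def borel_1 cocycle_1)
  then show ?thesis
    using PS_equivariant[OF assms(1) _ _ assms(3), of "(g, \<epsilon>')" 1 0] assms by (simp add: Mp_def delta_unit)
qed

lemma PS_K:
  assumes "f \<in> PS" "primitive_row g" "g \<in> SL2" "u \<in> Zp_units"
  shows "f (hmat u ** xmat s ** g, 1) = lc k u * f (g, 1)"
  using PS_borel[OF assms(1,3), of u 1 s] assms by (simp add: cocycle_borel_primitive delta_unit units_nonzero)

lemma PS_ext:
  assumes f: "f \<in> PS" and f': "f' \<in> PS" and eq: "\<And>k0. k0 \<in> K0 0 \<Longrightarrow> f (k0, 1) = f' (k0, 1)"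
  shows "f = f'"
proof
  fix x :: "'p mp"
  show "f x = f' x"
  proof (cases "x \<in> Mp")
    case True
    then obtain g \<epsilon> where x: "x = (g, \<epsilon>)" "g \<in> SL2" "\<epsilon> \<in> {1, - 1}" by (auto simp: Mp_def)
    obtain t s k0 where t: "t \<noteq> 0" "k0 \<in> K0 0" "g = hmat t ** xmat s ** k0" using iwasawa[OF x(2)] .
    have "h x = of_int \<epsilon> * (of_int (cocycle (hmat t ** xmat s) k0) * delta t * h (k0, 1))" if "h \<in> PS" for h
      using PS_sign[OF that x(2,3), of 1] PS_borel[OF that K0_SL2[OF t(2)] t(1), of 1 s] t(3) x(1) by simp
    from this[OF f] this[OF f'] eq[OF t(2)] show ?thesis by simp
  qed (simp add: PS_outside[OF f] PS_outside[OF f'])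
qed

lemma PS_subspace: "cfun.subspace PS"
proof (rule cfun.subspaceI)
  show "0 \<in> PS" by (rule PS_I) (simp_all add: mp_locally_constant_def)
next
  fix f g assume fg: "f \<in> PS" "g \<in> PS"
  show "f + g \<in> PS"
  proof (rule PS_I)
    show "mp_locally_constant (f + g)"
      unfolding mp_locally_constant_def
    proof
      fix x :: "'p mp" assume x: "x \<in> Mp"
      obtain m where m: "\<forall>h\<in>Kcong m. f (mp_mult x (h, 1)) = f x" using PS_locally_constant[OF fg(1) x] by blast
      obtain n where n: "\<forall>h\<in>Kcong n. g (mp_mult x (h, 1)) = g x" using PS_locally_constant[OF fg(2) x] by blast
      have "(f + g) (mp_mult x (h, 1)) = (f + g) x" if h: "h \<in> Kcong (max m n)" for h
        using m n h Kcong_mono[of m "max m n"] Kcong_mono[of n "max m n"] by (simp add: subset_iff)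
      then show "\<exists>n. \<forall>h\<in>Kcong n. (f + g) (mp_mult x (h, 1)) = (f + g) x" by blast
    qed
  qed (simp_all add: PS_outside[OF fg(1)] PS_outside[OF fg(2)] PS_equivariant[OF fg(1)] PS_equivariant[OF fg(2)] distrib_left)
next
  fix c f assume f: "f \<in> PS"
  show "cscale c f \<in> PS"
  proof (rule PS_I)
    show "mp_locally_constant (cscale c f)"
      unfolding mp_locally_constant_def cscale_def using PS_locally_constant[OF f] by metis
  qed (simp_all add: PS_outside[OF f] PS_equivariant[OF f] cscale_def)
qed

lemma rt_apply: "g \<in> SL2 \<Longrightarrow> \<epsilon> \<in> {1, - 1} \<Longrightarrow>
    right_translation (h, \<epsilon>') f (g, \<epsilon>) = f (g ** h, \<epsilon> * \<epsilon>' * cocycle g (h :: 'p padic^2^2))"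
  by (simp add: right_translation_def Mp_def mp_mult_def)

lemma rt_outside: "x \<notin> Mp \<Longrightarrow> right_translation h f x = 0"
  by (simp add: right_translation_def)

lemma rt_apply_K: "k0 \<in> K0 0 \<Longrightarrow> h \<in> K0 0 \<Longrightarrow>
    right_translation (h, 1) f (k0, 1) = f (k0 ** (h :: 'p padic^2^2), 1)"
  by (simp add: rt_apply K0_SL2 cocycle_splits K0_primitive)

lemma mp_mult_K_assoc:
  fixes x :: "'p mp"
  assumes "x \<in> Mp" "k1 \<in> K0 0" "k2 \<in> K0 0"
  shows "mp_mult (mp_mult x (k1, 1)) (k2, 1) = mp_mult x (k1 ** k2, 1 :: int)"
  using cocycle_K_assoc[of "fst x" k1 k2] assms
  by (auto simp: mp_mult_def Mp_def matrix_mul_assoc mult.assoc)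

lemma rt_mult:
  fixes k1 :: "'p padic^2^2"
  assumes "k1 \<in> K0 0" "k2 \<in> K0 0"
  shows "right_translation (k1, 1) (right_translation (k2, 1) f) = right_translation (k1 ** k2, 1 :: int) f"
proof
  fix x :: "'p mp"
  have "(k1, 1) \<in> Mp" using assms by (simp add: Mp_def K0_SL2)
  then show "right_translation (k1, 1) (right_translation (k2, 1) f) x = right_translation (k1 ** k2, 1) f x"
    using mp_mult_K_assoc[OF _ assms, of x] mp_mult_Mp[of x] by (simp add: right_translation_def)
qed

lemma rt_PS:
  assumes f: "f \<in> PS" and h: "h \<in> K0 0"
  shows "right_translation (h, 1) f \<in> PS"
proof -
  let ?r = "right_translation (h, 1) f"
  have hM: "(h, 1) \<in> Mp" using h by (simp add: Mp_def K0_SL2)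
  have "mp_locally_constant ?r"
    unfolding mp_locally_constant_def
  proof
    fix x :: "'p mp" assume x: "x \<in> Mp"
    obtain n where n: "\<And>c. c \<in> Kcong n \<Longrightarrow> f (mp_mult (mp_mult x (h, 1)) (c, 1)) = f (mp_mult x (h, 1))"
      using PS_locally_constant[OF f mp_mult_Mp[OF x hM]] by blast
    have "?r (mp_mult x (c, 1)) = ?r x" if c: "c \<in> Kcong n" for c
    proof -
      have c0: "c \<in> K0 0" using Kcong_K0[of 0 n] c by simp
      \<comment> \<open>Normality lets \<open>c\<close> be moved past \<open>h\<close> within the
        same congruence subgroup, so the level of \<open>f\<close> at \<open>x h\<close> also serves
        for the translate at \<open>x\<close>.\<close>
      have cc: "inv2 h ** c ** h \<in> Kcong n" by (rule Kcong_conj[OF h c])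
      have cc0: "inv2 h ** c ** h \<in> K0 0" using Kcong_K0[of 0 n] cc by simp
      have hc: "h ** (inv2 h ** c ** h) = c ** h"
        using inv2_mult(2)[OF K0_SL2[OF h]] by (simp add: matrix_mul_assoc)
      have xc: "mp_mult x (c, 1) \<in> Mp" using c0 x by (intro mp_mult_Mp) (auto simp: Mp_def K0_SL2)
      have "?r (mp_mult x (c, 1)) = f (mp_mult x (c ** h, 1))"
        using xc mp_mult_K_assoc[OF x c0 h] by (simp add: right_translation_def)
      also have "\<dots> = f (mp_mult (mp_mult x (h, 1)) (inv2 h ** c ** h, 1))"
        using mp_mult_K_assoc[OF x h cc0] by (simp only: hc)
      also have "\<dots> = ?r x" using n[OF cc] x by (simp add: right_translation_def)
      finally show ?thesis .
    qed
    then show "\<exists>n. \<forall>c\<in>Kcong n. ?r (mp_mult x (c, 1)) = ?r x" by blast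
  qed
  moreover have "?r (mp_mult (hmat t ** xmat s, \<epsilon>) x) = of_int \<epsilon> * delta t * ?r x"
    if t: "t \<noteq> 0" "\<epsilon> \<in> {1, - 1}" "x \<in> Mp" for t s \<epsilon> and x :: "'p mp"
  proof -
    let ?b = "hmat t ** xmat s"
    have bM: "(?b, \<epsilon>) \<in> Mp" using t by (simp add: Mp_def borel_SL2)
    have "mp_mult (mp_mult (?b, \<epsilon>) x) (h, 1) = mp_mult (?b, \<epsilon>) (mp_mult x (h, 1))"
    proof -
      have "fst x \<in> SL2" using t(3) by (auto simp: Mp_def)
      then have c: "cocycle (?b ** fst x) h * cocycle ?b (fst x ** h) = cocycle ?b (fst x) * cocycle (fst x) h"
        by (rule cocycle_borel_assoc[OF t(1) _ K0_SL2[OF h]])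
      have "cocycle ?b (fst x) * cocycle (?b ** fst x) h =
          cocycle ?b (fst x) * (cocycle (?b ** fst x) h * cocycle ?b (fst x ** h)) * cocycle ?b (fst x ** h)"
        by (simp add: mult.assoc)
      also have "\<dots> = cocycle (fst x) h * cocycle ?b (fst x ** h)"
        unfolding c by (simp flip: mult.assoc)
      finally show ?thesis
        by (simp add: mp_mult_def matrix_mul_assoc mult.assoc)
    qed
    then show ?thesis
      using PS_equivariant[OF f mp_mult_Mp[OF t(3) hM] t(1,2)] mp_mult_Mp[OF bM t(3)] t(3)
      by (simp add: right_translation_def)
  qed
  ultimately show ?thesis by (intro PS_I) (simp_all add: rt_outside)
qed

definition iso :: "nat \<Rightarrow> ('p mp \<Rightarrow> complex) set" where "iso m = isotypic PS right_translation \<eta> m"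

lemma rt_sign:
  assumes f: "f \<in> PS" and h: "h \<in> SL2" and e: "\<epsilon> \<in> {1, - 1}"
  shows "right_translation (h, \<epsilon>) f = cscale (of_int \<epsilon>) (right_translation (h, 1) f)"
proof
  fix x :: "'p mp"
  show "right_translation (h, \<epsilon>) f x = cscale (of_int \<epsilon>) (right_translation (h, 1) f) x"
  proof (cases "x \<in> Mp")
    case True
    then obtain g \<epsilon>' where x: "x = (g, \<epsilon>')" "g \<in> SL2" "\<epsilon>' \<in> {1, - 1}" by (auto simp: Mp_def)
    have "\<epsilon>' * cocycle g h \<in> {1, - 1}" using x(3) cocycle_sign[of g h] by auto
    then have "f (g ** h, \<epsilon> * (\<epsilon>' * cocycle g h)) = of_int \<epsilon> * f (g ** h, \<epsilon>' * cocycle g h)"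
      by (intro PS_sign f SL2_mult x h e)
    then show ?thesis using x by (simp add: rt_apply cscale_def mult_ac)
  qed (simp add: rt_outside cscale_def)
qed

text \<open>Isotypy reduces to a condition on functions on \<open>K0 0\<close>: genuineness settles
  the sign, the splitting removes the cocycle, and elements of \<open>PS\<close> are determined by
  their values on \<open>K0 0\<close>.\<close>

lemma iso_iff:
  "f \<in> iso m \<longleftrightarrow> f \<in> PS \<and> (\<forall>h\<in>K0 m. \<forall>k0\<in>K0 0. f (k0 ** h, 1) = \<eta> (h $ 2 $ 2) * f (k0, 1))"
proof
  assume f: "f \<in> iso m"
  have "f (k0 ** h, 1) = \<eta> (h $ 2 $ 2) * f (k0, 1)" if "h \<in> K0 m" "k0 \<in> K0 0" for h k0
    using f that rt_apply_K[of k0 h f] K0_mono[of 0 m h]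
    by (auto simp: iso_def isotypic_def cscale_def)
  then show "f \<in> PS \<and> (\<forall>h\<in>K0 m. \<forall>k0\<in>K0 0. f (k0 ** h, 1) = \<eta> (h $ 2 $ 2) * f (k0, 1))"
    using f by (auto simp: iso_def isotypic_def)
next
  assume f: "f \<in> PS \<and> (\<forall>h\<in>K0 m. \<forall>k0\<in>K0 0. f (k0 ** h, 1) = \<eta> (h $ 2 $ 2) * f (k0, 1))"
  have "right_translation (h, \<epsilon>) f = cscale (of_int \<epsilon> * \<eta> (h $ 2 $ 2)) f" if h: "h \<in> K0 m" "\<epsilon> \<in> {1, - 1}" for h \<epsilon>
  proof -
    have h0: "h \<in> K0 0" using h K0_mono[of 0 m] by simp
    have "right_translation (h, 1) f = cscale (\<eta> (h $ 2 $ 2)) f"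
      using f h h0 by (intro PS_ext rt_PS cfun.subspace_scale[OF PS_subspace]) (auto simp: rt_apply_K cscale_def)
    then show ?thesis using rt_sign[of f h \<epsilon>] f h(2) K0_SL2[OF h0] by (simp add: cscale_def mult.assoc)
  qed
  then show "f \<in> iso m" using f by (auto simp: iso_def isotypic_def)
qed

lemma iso_subspace: "cfun.subspace (iso m)"
  using PS_subspace by (auto simp: cfun.subspace_def iso_iff cscale_def distrib_left)

lemma iso_mono: "m \<le> n \<Longrightarrow> iso m \<subseteq> iso n"
  unfolding iso_iff subset_iff using K0_mono[of m n] by blast

text \<open>Iwasawa decomposition extends functions on primitive bottom rows to the whole group.\<close>

lemma iso_extension:
  fixes \<Psi> :: "'p padic^2^2 \<Rightarrow> complex"
  assumes hom: "\<And>A u s. A \<in> SL2 \<Longrightarrow> primitive_row A \<Longrightarrow> u \<in> Zp_units \<Longrightarrow> \<Psi> (hmat u ** xmat s ** A) = lc k u * \<Psi> A"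
    and right: "\<And>A h. A \<in> SL2 \<Longrightarrow> primitive_row A \<Longrightarrow> h \<in> K0 m \<Longrightarrow> \<Psi> (A ** h) = \<eta> (h $ 2 $ 2) * \<Psi> A"
  shows "\<exists>f\<in>iso m. \<forall>k0\<in>K0 0. f (k0, 1) = \<Psi> k0"
proof -
  define E where "E t s A = of_int (cocycle (hmat t ** xmat s) A) * delta t * \<Psi> A" for t s A
  define P where "P g v \<longleftrightarrow> (\<exists>t s A. t \<noteq> 0 \<and> A \<in> SL2 \<and> primitive_row A \<and> g = hmat t ** xmat s ** A \<and> v = E t s A)" for g v
  define val where "val g = (SOME v. P g v)" for g
  \<comment> \<open>Two decompositions of one element differ by a Borel element whose diagonal entry
    \<open>u\<close> is a unit because both rows are primitive. Passing between them, the cocycle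
    and \<open>delta\<close> change by the same Hilbert symbol, and the remaining factor
    \<open>lc k u\<close> is supplied by \<open>hom\<close>.\<close>
  have wd: "E t s A = E t' s' A'"
    if t: "t \<noteq> 0" "t' \<noteq> 0" and A: "A \<in> SL2" "primitive_row A" and A': "A' \<in> SL2" "primitive_row A'"
      and e: "hmat t ** xmat s ** A = hmat t' ** xmat s' ** A'" for t s A t' s' A'
  proof -
    define u s1 where "u = inverse t' * t" and "s1 = s + (- s' * t'^2) / t^2"
    have u0: "u \<noteq> 0" using t by (simp add: u_def)
    have "hmat (inverse t') ** xmat (- s' * t'^2) ** (hmat t' ** xmat s' ** A') = A'"
      using t by (subst borel_mult_assoc) (simp_all add: borel_1)
    then have A'eq: "A' = hmat u ** xmat s1 ** A"
      unfolding e[symmetric] using t by (subst (asm) borel_mult_assoc) (simp_all add: u_def s1_def)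
    have b: "hmat t ** xmat s = hmat t' ** xmat s' ** (hmat u ** xmat s1)"
      using t u0 by (subst borel_mult) (simp_all add: u_def s1_def field_simps)
    have row: "A' $ 2 $ j = inverse u * A $ 2 $ j" for j by (simp add: A'eq matmul2_nth)
    have u: "u \<in> Zp_units"
    proof -
      obtain i where i: "A $ 2 $ i \<in> Zp_units" using A(2) by (auto simp: primitive_row_def)
      obtain j where j: "A' $ 2 $ j \<in> Zp_units" using A'(2) by (auto simp: primitive_row_def)
      have r: "X $ 2 $ i \<in> pball 0" if "primitive_row X" for X :: "'p padic^2^2" and i
        using that exhaust_2[of i] by (auto simp: primitive_row_def)
      have "padic_abs (inverse u) * padic_abs (A $ 2 $ i) \<le> 1" 
        using r[OF A'(2), of i] by (simp add: row pball_def flip: padic_abs_mult)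
      then have 1: "padic_abs (inverse u) \<le> 1" using i by (simp add: Zp_units_def)
      have 2: "padic_abs (A $ 2 $ j) \<le> 1" using r[OF A(2), of j] by (simp add: pball_def)
      have 3: "padic_abs (inverse u) * padic_abs (A $ 2 $ j) = 1"
        using j by (simp add: row Zp_units_def flip: padic_abs_mult)
      then have "1 \<le> padic_abs (inverse u)" using 2 mult_left_mono[OF 2 padic_abs_nonneg[of "inverse u"]] by simp
      then have "inverse u \<in> Zp_units" using 1 by (simp add: Zp_units_def)
      then show ?thesis using units_inverse[of "inverse u"] by simp
    qed
    have c: "cocycle (hmat t ** xmat s) A * cocycle (hmat t' ** xmat s') A' = hilbert u t'"
      using cocycle_borel_assoc[OF t(2) borel_SL2[OF u0] A(1), of s' s1]
        cocycle_borel_primitive[OF u A(2,1)] cocycle_borel_borel[OF t(2) u0]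
      by (simp add: b A'eq)
    have "cocycle (hmat t ** xmat s) A = cocycle (hmat t ** xmat s) A * cocycle (hmat t' ** xmat s') A' * cocycle (hmat t' ** xmat s') A'"
      by (simp add: mult.assoc)
    then have c': "cocycle (hmat t ** xmat s) A = hilbert u t' * cocycle (hmat t' ** xmat s') A'" unfolding c .
    have "t = t' * u" using t by (simp add: u_def)
    then have d: "delta t = delta t' * lc k u * of_int (hilbert u t')"
      using delta_mult[OF t(2) u0] delta_unit[OF u] hilbert_commute[of t' u] by simp
    have "E t s A = of_int (hilbert u t' * hilbert u t') * (of_int (cocycle (hmat t' ** xmat s') A') * delta t' * (lc k u * \<Psi> A))"
      unfolding E_def c' d by (simp only: of_int_mult mult_ac)
    then show ?thesis unfolding E_def using hom[OF A u, of s1] A'eq by simp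
  qed
  have ex: "\<exists>v. P g v" if "g \<in> SL2" for g
    using iwasawa[OF that] K0_SL2 K0_primitive unfolding P_def by metis
  have val: "val (hmat t ** xmat s ** A) = E t s A" if "t \<noteq> 0" "A \<in> SL2" "primitive_row A" for t s A
  proof -
    have "P (hmat t ** xmat s ** A) (E t s A)" using that unfolding P_def by blast
    then have "P (hmat t ** xmat s ** A) (val (hmat t ** xmat s ** A))" unfolding val_def by (rule someI)
    then show ?thesis unfolding P_def using wd that by metis
  qed
  define f where "f x = (if x \<in> Mp then of_int (snd x) * val (fst x) else 0)" for x
  have fK: "f (k0, 1) = \<Psi> k0" if "k0 \<in> K0 0" for k0
    using val[of 1 k0 0] that K0_SL2[OF that] K0_primitive[OF that]
    by (simp add: f_def Mp_def E_def borel_1 cocycle_1 delta_unit)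
  have fr: "f (mp_mult x (h, 1)) = \<eta> (h $ 2 $ 2) * f x" if x: "x \<in> Mp" and h: "h \<in> K0 m" for x h
  proof -
    obtain g \<epsilon> where ge: "x = (g, \<epsilon>)" "g \<in> SL2" "\<epsilon> \<in> {1, - 1}" using x by (auto simp: Mp_def)
    obtain t s A where t: "t \<noteq> 0" "A \<in> K0 0" "g = hmat t ** xmat s ** A" using iwasawa[OF ge(2)] .
    let ?b = "hmat t ** xmat s"
    have h0: "h \<in> K0 0" using h K0_mono[of 0 m] by simp
    note A = K0_SL2[OF t(2)] K0_primitive[OF t(2)]
    note Ah = SL2_mult[OF A(1) K0_SL2[OF h0]] primitive_row_mult[OF A(2) h0]
    have gh: "g ** h = ?b ** (A ** h)" by (simp add: t(3) matrix_mul_assoc)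
    have c: "cocycle g h * cocycle ?b (A ** h) = cocycle ?b A"
      using cocycle_borel_assoc[OF t(1) A(1) K0_SL2[OF h0], of s] cocycle_splits[OF A h0] by (simp add: t(3))
    have "(h, 1) \<in> Mp" using h0 by (simp add: Mp_def K0_SL2)
    then have "f (mp_mult x (h, 1)) = of_int (\<epsilon> * cocycle g h) * val (g ** h)"
      using mp_mult_Mp[OF x] ge(1) by (simp add: f_def) (simp add: mp_mult_def)
    also have "\<dots> = of_int (\<epsilon> * (cocycle g h * cocycle ?b (A ** h))) * delta t * \<Psi> (A ** h)"
      unfolding gh val[OF t(1) Ah] E_def by simp
    also have "\<dots> = \<eta> (h $ 2 $ 2) * (of_int \<epsilon> * E t s A)"
      unfolding c right[OF A h] E_def by simp
    also have "of_int \<epsilon> * E t s A = f x" using x ge(1) val[OF t(1) A, of s] by (simp add: f_def t(3))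
    finally show ?thesis .
  qed
  have fb: "f (mp_mult (hmat t0 ** xmat s0, \<epsilon>0) x) = of_int \<epsilon>0 * delta t0 * f x"
    if x: "x \<in> Mp" and t0: "t0 \<noteq> 0" "\<epsilon>0 \<in> {1, - 1}" for x t0 s0 \<epsilon>0
  proof -
    obtain g \<epsilon> where ge: "x = (g, \<epsilon>)" "g \<in> SL2" "\<epsilon> \<in> {1, - 1}" using x by (auto simp: Mp_def)
    obtain t s A where t: "t \<noteq> 0" "A \<in> K0 0" "g = hmat t ** xmat s ** A" using iwasawa[OF ge(2)] .
    let ?b = "hmat t ** xmat s" and ?B = "hmat t0 ** xmat s0"
    note A = K0_SL2[OF t(2)] K0_primitive[OF t(2)]
    have bg: "?B ** g = hmat (t0 * t) ** xmat (s + s0 / t^2) ** A"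
      using borel_mult_assoc[OF t0(1) t(1)] by (simp add: t(3))
    have tt: "t0 * t \<noteq> 0" using t t0 by simp
    have c: "cocycle (hmat (t0 * t) ** xmat (s + s0 / t^2)) A * cocycle ?B g = hilbert t t0 * cocycle ?b A"
      using cocycle_borel_assoc[OF t0(1) borel_SL2[OF t(1)] A(1), of s0 s,
          unfolded cocycle_borel_borel[OF t0(1) t(1)], unfolded borel_mult[OF t0(1) t(1)]]
      by (simp only: t(3))
    have "(?B, \<epsilon>0) \<in> Mp" using t0 by (simp add: Mp_def borel_SL2)
    then have "f (mp_mult (?B, \<epsilon>0) x) = of_int (\<epsilon>0 * \<epsilon> * cocycle ?B g) * val (?B ** g)"
      using mp_mult_Mp[OF _ x] ge(1) by (simp add: f_def) (simp add: mp_mult_def)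
    also have "\<dots> = of_int (\<epsilon>0 * \<epsilon> * (cocycle (hmat (t0 * t) ** xmat (s + s0 / t^2)) A * cocycle ?B g)) * delta (t0 * t) * \<Psi> A"
      unfolding bg val[OF tt A] E_def by (simp add: mult_ac)
    also have "\<dots> = of_int (hilbert t t0 * hilbert t t0) * (of_int \<epsilon>0 * delta t0 * (of_int \<epsilon> * E t s A))"
      unfolding c E_def delta_mult[OF t0(1) t(1)] hilbert_commute[of t0 t] by (simp only: of_int_mult mult_ac)
    also have "of_int \<epsilon> * E t s A = f x" using x ge(1) val[OF t(1) A, of s] by (simp add: f_def t(3))
    finally show ?thesis by simp
  qed
  have "mp_locally_constant f"
    unfolding mp_locally_constant_def
  proof (intro ballI exI[of _ "max m 1"])
    fix x :: "'p mp" and h :: "'p padic^2^2" assume x: "x \<in> Mp" and h: "h \<in> Kcong (max m 1)"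
    have "h \<in> K0 m" using Kcong_K0[of m "max m 1"] h by simp
    moreover have "\<eta> (h $ 2 $ 2) = 1"
      using Kcong_22[OF _ h] lc_cong[of "h $ 2 $ 2" 1] by (simp add: eta_unit)
    ultimately show "f (mp_mult x (h, 1)) = f x" using fr[OF x] by simp
  qed
  then have "f \<in> PS"
    using fb by (intro PS_I) (simp_all add: f_def)
  moreover have "f (k0 ** h, 1) = \<eta> (h $ 2 $ 2) * f (k0, 1)" if "h \<in> K0 m" "k0 \<in> K0 0" for h k0
    using fr[of "(k0, 1)" h] that K0_mono[of 0 m h] cocycle_splits[of k0 h] K0_primitive[of k0]
    by (simp add: Mp_def K0_SL2 mp_mult_def)
  ultimately have "f \<in> iso m" by (simp add: iso_iff)
  then show ?thesis using fK by blast
qed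

end

section \<open>Isotypic vectors in the principal series\<close>

locale pair_beta = pair p_type \<psi> a k l \<mu> \<eta>
  for p_type :: "'p::prime_card itself" and \<psi> a k l \<mu> \<eta> +
  fixes \<beta> :: "'p padic"
  assumes beta_unit: "\<beta> \<in> Zp_units" and leg_beta: "leg \<beta> = - 1"
    and ord_a: "padic_ord a = (if k then 1 else 0)"
begin

lemma lc_beta: "k \<noteq> l \<Longrightarrow> lc k \<beta> \<noteq> lc l \<beta>"
  by (auto simp: lc_def leg_beta)

text \<open>The only consequence of the parity hypothesis: of the two characters, one is trivial and
  the other is the Legendre symbol, and they agree at -1.\<close>

lemma leg_minus_1: "k \<noteq> l \<Longrightarrow> leg (- 1 :: 'p padic) = 1"
  using parity by (cases k; cases l) (auto simp: lc_def)

lemma lc_neq: "k \<noteq> l \<Longrightarrow> lc l u * of_int (leg u) = lc k u"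
  using leg_square_eq_1[of u] by (cases k; cases l) (auto simp: lc_def simp flip: of_int_mult)

lemma lc_neq': "k \<noteq> l \<Longrightarrow> lc k u * lc l u = of_int (leg u)"
  by (cases k; cases l) (auto simp: lc_def)

lemma iso_PS: "f \<in> iso m \<Longrightarrow> f \<in> PS"
  by (simp add: iso_iff)

lemma iso_right: "f \<in> iso m \<Longrightarrow> h \<in> K0 m \<Longrightarrow> k0 \<in> K0 0 \<Longrightarrow> f (k0 ** h, 1) = \<eta> (h $ 2 $ 2) * f (k0, 1)"
  by (simp add: iso_iff)

text \<open>By \<open>primitive_row_decomp\<close> every element of \<open>K0 0\<close> is a Borel
  element times \<open>nmat x\<close> or \<open>wmat ** xmat y\<close>. In the second cell the
  factor \<open>xmat y\<close> lies in every \<open>K0 m\<close> and is absorbed by isotypy.\<close>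

lemma iso_eq_0I:
  assumes f: "f \<in> iso m"
    and 1: "\<And>x. x \<in> pball 1 \<Longrightarrow> f (nmat x, 1) = 0" and 2: "f (wmat, 1) = 0"
  shows "f = 0"
proof (rule PS_ext)
  show "f \<in> PS" by (rule iso_PS[OF f])
  show "0 \<in> PS" by (rule cfun.subspace_0[OF PS_subspace])
  fix k0 :: "'p padic^2^2" assume k0: "k0 \<in> K0 0"
  from K0_SL2[OF k0] K0_primitive[OF k0] have "f (k0, 1) = 0"
  proof (cases rule: primitive_row_decomp)
    case (1 u s x)
    have "nmat x \<in> K0 0" using 1(2) pball_mono[of 0 1 x] by (intro K0_generators) simp
    then show ?thesis
      using PS_K[OF iso_PS[OF f] K0_primitive K0_SL2 1(1)] assms(2)[OF 1(2)] by (simp add: 1(3))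
  next
    case (2 u s y)
    have x: "xmat y \<in> K0 m" "xmat y \<in> K0 0" using 2(2) by simp_all
    then have wx: "wmat ** xmat y \<in> K0 0" by (intro K0_mult K0_generators(3))
    have "f (wmat ** xmat y, 1) = 0" using iso_right[OF f x(1) K0_generators(3)] assms(3) by simp
    then show ?thesis
      using PS_K[OF iso_PS[OF f] K0_primitive[OF wx] K0_SL2[OF wx] 2(1), of s] by (simp add: 2(3))
  qed
  then show "f (k0, 1) = (0 :: 'p mp \<Rightarrow> complex) (k0, 1)" by simp
qed

lemma iso_nmat:
  assumes "f \<in> iso m" "x \<in> pball (int m)"
  shows "f (nmat x, 1) = f (mat 1, 1)"
  using iso_right[OF assms(1) K0_generators(2)[OF assms(2)], of "mat 1"] by simp

lemma iso_1_inj: "f \<in> iso 1 \<Longrightarrow> f (mat 1, 1) = 0 \<Longrightarrow> f (wmat, 1) = 0 \<Longrightarrow> f = 0"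
  by (rule iso_eq_0I[of f 1]) (simp_all add: iso_nmat[of f 1])

lemma iso_0_inj:
  assumes "f \<in> iso 0" "f (mat 1, 1) = 0"
  shows "f = 0"
proof (rule iso_1_inj)
  show "f \<in> iso 1" using assms(1) iso_mono[of 0 1] by auto
  show "f (wmat, 1) = 0" using iso_right[OF assms(1) K0_generators(3), of "mat 1"] assms(2) by simp
qed (rule assms(2))

text \<open>The torus element \<open>h(\<beta>)\<close> fixes the cosets of \<open>1\<close> and \<open>w\<close>, which excludes them from the support.\<close>

lemma iso_neq_vanish:
  assumes kl: "k \<noteq> l" and f: "f \<in> iso m"
  shows "f (mat 1, 1) = 0" "f (wmat, 1) = 0"
proof -
  let ?v = "inverse \<beta>"
  have v: "?v \<in> Zp_units" "\<beta> \<noteq> 0" using beta_unit units_inverse units_nonzero by auto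
  have "f (hmat \<beta> ** xmat 0 ** mat 1, 1) = lc k \<beta> * f (mat 1, 1)"
    using beta_unit by (intro PS_K iso_PS[OF f] K0_primitive K0_SL2) auto
  moreover have "f (mat 1 ** hmat \<beta>, 1) = \<eta> (hmat \<beta> $ 2 $ 2) * f (mat 1, 1)"
    using beta_unit by (intro iso_right[OF f] K0_hmat) auto
  ultimately have "lc k \<beta> * f (mat 1, 1) = lc l \<beta> * f (mat 1, 1)"
    using v beta_unit by (simp add: xmat_0 eta_unit lc_inverse)
  then show "f (mat 1, 1) = 0" using lc_beta[OF kl] by simp
  have "f (hmat \<beta> ** xmat 0 ** wmat, 1) = lc k \<beta> * f (wmat, 1)"
    by (intro PS_K iso_PS[OF f] K0_primitive[OF K0_generators(3)] K0_SL2[OF K0_generators(3)] beta_unit)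
  moreover have "hmat \<beta> ** xmat 0 ** wmat = wmat ** hmat ?v"
    by (intro mat2_eqI) (simp_all add: matmul2_nth)
  moreover have "f (wmat ** hmat ?v, 1) = \<eta> (hmat ?v $ 2 $ 2) * f (wmat, 1)"
    using v by (intro iso_right[OF f] K0_hmat K0_generators)
  ultimately have "lc k \<beta> * f (wmat, 1) = lc l \<beta> * f (wmat, 1)"
    using beta_unit by (auto simp: eta_unit)
  then show "f (wmat, 1) = 0" using lc_beta[OF kl] by simp
qed

lemma iso_neq_1: "k \<noteq> l \<Longrightarrow> m \<le> 1 \<Longrightarrow> iso m = {0}"
  using iso_mono[of m 1] iso_1_inj iso_neq_vanish cfun.subspace_0[OF iso_subspace[of m]] by blast

lemma nonsquare_class:
  assumes "c \<in> Zp_units"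
  obtains e u where "e \<in> {1, \<beta>}" "u \<in> Zp_units" "c = e * u^2"
proof -
  obtain e where e: "e \<in> {1, \<beta>}" "leg e = leg c" "e \<in> Zp_units"
    using leg_cases[of c] leg_beta beta_unit by (metis insertCI leg_1 units_1)
  then have "leg (c * inverse e) = 1"
    using leg_mult[OF assms units_inverse[OF e(3)]] leg_inverse[OF units_nonzero[OF e(3)]] e(2) by simp
  then obtain u where u: "u^2 = c * inverse e" by (auto simp: leg_def split: if_splits)
  have "u^2 \<in> Zp_units" unfolding u by (rule units_mult[OF assms units_inverse[OF e(3)]])
  then have "u \<in> Zp_units" by (rule Zp_units_of_power2)
  moreover have "c = e * u^2" unfolding u using units_nonzero[OF e(3)] by simp
  ultimately show thesis using e(1) by (intro that)
qed

text \<open>Conjugating a lower unipotent by \<open>hmat u\<close> multiplies its entry by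
  \<open>u^2\<close>, and entries in \<open>p^2\<close> belong to \<open>K0 2\<close>. Apart from
  the coset of 1, only the square class of \<open>x / p\<close> is left.\<close>

lemma iso_2_inj:
  assumes kl: "k \<noteq> l" and f: "f \<in> iso 2"
    and z: "f (nmat pp, 1) = 0" "f (nmat (pp * \<beta>), 1) = 0"
  shows "f = 0"
proof (rule iso_eq_0I[OF f])
  show "f (wmat, 1) = 0" by (rule iso_neq_vanish(2)[OF kl f])
  fix x :: "'p padic" assume x: "x \<in> pball 1"
  show "f (nmat x, 1) = 0"
  proof (cases "x \<in> pball 2")
    case True
    then show ?thesis using iso_nmat[OF f] iso_neq_vanish(1)[OF kl f] by simp
  next
    case False
    then have "x \<noteq> 0" "padic_ord x = 1" using x by (auto simp: pball_iff)
    then have "x / pp \<in> Zp_units" by (simp add: Zp_units_iff padic_ord_divide)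
    then obtain e u where eu: "e \<in> {1, \<beta>}" "u \<in> Zp_units" "x / pp = e * u^2" by (rule nonsquare_class)
    have x: "x = pp * e * u^2" using eu(3) by (simp add: field_simps)
    have ez: "f (nmat (pp * e), 1) = 0" using eu(1) z by auto
    have "e \<in> pball 0" using eu(1) beta_unit by (auto simp: units_pball)
    then have "pp * e \<in> pball 1" using pp_mult_pball[of e 0] by simp
    then have n: "nmat (pp * e) \<in> K0 0" using pball_mono[of 0 1] by (intro K0_generators) simp
    have nu: "nmat (pp * e) ** hmat u \<in> K0 0" by (rule K0_mult[OF n K0_hmat[OF eu(2)]])
    have "nmat x = hmat (inverse u) ** xmat 0 ** (nmat (pp * e) ** hmat u)"
      using units_nonzero[OF eu(2)] by (intro mat2_eqI) (simp_all add: matmul2_nth x power2_eq_square)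
    moreover have "f (nmat (pp * e) ** hmat u, 1) = 0"
      using iso_right[OF f K0_hmat[OF eu(2)] n] ez by simp
    ultimately show ?thesis
      using PS_K[OF iso_PS[OF f] K0_primitive[OF nu] K0_SL2[OF nu] units_inverse[OF eu(2)], of 0] by simp
  qed
qed

lemma primitive_pball: "primitive_row A \<Longrightarrow> A $ 2 $ i \<in> pball 0"
  using exhaust_2[of i] by (auto simp: primitive_row_def)

lemma row_units_or:
  assumes "primitive_row A"
  shows "A $ 2 $ 1 \<in> Zp_units \<or> A $ 2 $ 1 \<in> pball 1 \<and> A $ 2 $ 2 \<in> Zp_units"
  using assms by (auto simp: primitive_row_def units_pball)

lemma borel_row: "(hmat u ** xmat s ** A) $ 2 $ j = inverse u * (A :: 'p padic^2^2) $ 2 $ j"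
  by (simp add: matmul2_nth)

lemma units_scale: "u \<in> Zp_units \<Longrightarrow> inverse u * x \<in> Zp_units \<longleftrightarrow> x \<in> (Zp_units :: 'p padic set)"
  using units_mult_pball[OF units_inverse[of u]] by (simp add: units_pball)

text \<open>From level 1 on, right multiplication preserves the two cells and multiplies the
  decisive bottom entry modulo \<open>p\<close> by a diagonal entry of \<open>h\<close>. The
  diagonal entries are inverse to each other modulo \<open>p\<close>, so their quadratic characters
  agree.\<close>

lemma K0_right_row:
  assumes A: "primitive_row A" and h: "h \<in> K0 m" "m \<ge> 1"
  shows "A $ 2 $ 1 \<in> Zp_units \<Longrightarrow> (A ** h) $ 2 $ 1 \<in> Zp_units \<and> lc b ((A ** h) $ 2 $ 1) = lc b (A $ 2 $ 1) * lc b (h $ 2 $ 2)"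
    and "A $ 2 $ 1 \<in> pball 1 \<Longrightarrow> (A ** h) $ 2 $ 1 \<in> pball 1 \<and> (A ** h) $ 2 $ 2 \<in> Zp_units \<and>
        (A ** h) $ 2 $ 2 - A $ 2 $ 2 * h $ 2 $ 2 \<in> pball 1 \<and> lc b ((A ** h) $ 2 $ 2) = lc b (A $ 2 $ 2) * lc b (h $ 2 $ 2)"
proof -
  note hu = K0_1_units[OF h]
  have h21: "h $ 2 $ 1 \<in> pball 1" and h12: "h $ 1 $ 2 \<in> pball 0" and h11: "h $ 1 $ 1 \<in> pball 0"
    using h pball_mono[of 1 "int m"] by (auto simp: K0_iff)
  have "h $ 1 $ 1 * h $ 2 $ 2 \<in> Zp_units" by (rule units_mult[OF hu(2,1)])
  then have l1: "lc b (h $ 1 $ 1) * lc b (h $ 2 $ 2) = 1" for b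
    using lc_cong[OF _ hu(3), of b] lc_mult[OF hu(2,1), of b] by simp
  have lh: "lc b (h $ 1 $ 1) = lc b (h $ 2 $ 2)" for b
  proof -
    have "lc b (h $ 1 $ 1) = (lc b (h $ 1 $ 1) * lc b (h $ 2 $ 2)) * lc b (h $ 2 $ 2)" by (simp add: mult.assoc)
    then show ?thesis unfolding l1 by simp
  qed
  {
    assume u: "A $ 2 $ 1 \<in> Zp_units"
    have "A $ 2 $ 2 * h $ 2 $ 1 \<in> pball (0 + 1)" by (rule pball_mult[OF primitive_pball[OF A] h21])
    then have d: "(A ** h) $ 2 $ 1 - A $ 2 $ 1 * h $ 1 $ 1 \<in> pball 1" by (simp add: matmul2_nth)
    have "(A ** h) $ 2 $ 1 \<in> Zp_units"
      using units_add_pball[OF units_mult[OF u hu(2)] d] by simp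
    then show "(A ** h) $ 2 $ 1 \<in> Zp_units \<and> lc b ((A ** h) $ 2 $ 1) = lc b (A $ 2 $ 1) * lc b (h $ 2 $ 2)"
      using lc_cong[OF _ d, of b] lc_mult[OF u hu(2), of b] lh[of b] by simp
  }
  {
    assume p: "A $ 2 $ 1 \<in> pball 1"
    then have u: "A $ 2 $ 2 \<in> Zp_units" using A by (auto simp: primitive_row_def units_pball)
    have "A $ 2 $ 1 * h $ 1 $ 2 \<in> pball (1 + 0)" by (rule pball_mult[OF p h12])
    then have d: "(A ** h) $ 2 $ 2 - A $ 2 $ 2 * h $ 2 $ 2 \<in> pball 1" by (simp add: matmul2_nth)
    have "A $ 2 $ 1 * h $ 1 $ 1 \<in> pball (1 + 0)" by (rule pball_mult[OF p h11])
    moreover have "A $ 2 $ 2 * h $ 2 $ 1 \<in> pball (0 + 1)" by (rule pball_mult[OF primitive_pball[OF A] h21])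
    ultimately have "(A ** h) $ 2 $ 1 \<in> pball 1" by (simp add: matmul2_nth pball_add)
    moreover have "(A ** h) $ 2 $ 2 \<in> Zp_units"
      using units_add_pball[OF units_mult[OF u hu(1)] d] by simp
    ultimately show "(A ** h) $ 2 $ 1 \<in> pball 1 \<and> (A ** h) $ 2 $ 2 \<in> Zp_units \<and>
        (A ** h) $ 2 $ 2 - A $ 2 $ 2 * h $ 2 $ 2 \<in> pball 1 \<and> lc b ((A ** h) $ 2 $ 2) = lc b (A $ 2 $ 2) * lc b (h $ 2 $ 2)"
      using lc_cong[OF _ d, of b] lc_mult[OF u hu(1), of b] d by simp
  }
qed

lemma dim_iso_0:
  assumes "\<not> k" "\<not> l"
  shows "has_dim (iso 0) 1"
proof -
  have "\<exists>f\<in>iso 0. \<forall>k0\<in>K0 0. f (k0, 1) = (\<lambda>_. 1) k0"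
    by (rule iso_extension) (use assms in \<open>auto simp: lc_def eta_def\<close>)
  then obtain f where f: "f \<in> iso 0" "\<And>k0. k0 \<in> K0 0 \<Longrightarrow> f (k0, 1) = 1" by blast
  have "has_dim (iso 0) (card {(mat 1 :: 'p padic^2^2, 1 :: int)})"
    by (rule has_dim_eval[OF iso_subspace, where b="\<lambda>_. f"]) (use f iso_0_inj in auto)
  then show ?thesis by simp
qed

lemma dim_iso_1:
  assumes kl: "k = l"
  shows "has_dim (iso 1) 2"
proof -
  let ?x = "(mat 1 :: 'p padic^2^2, 1 :: int)" and ?y = "(wmat :: 'p padic^2^2, 1 :: int)"
  let ?P = "\<lambda>A :: 'p padic^2^2. if A $ 2 $ 1 \<in> pball 1 then lc l (A $ 2 $ 2) else 0"
  \<comment> \<open>The sign normalizes the value at \<open>wmat\<close>, whose lower left entry is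
    -1, to 1.\<close>
  let ?Q = "\<lambda>A :: 'p padic^2^2. if A $ 2 $ 1 \<in> Zp_units then lc l (- (A $ 2 $ 1)) else 0"
  have "\<exists>f\<in>iso 1. \<forall>k0\<in>K0 0. f (k0, 1) = ?P k0"
  proof (rule iso_extension[where m=1 and \<Psi>="?P"])
    fix A :: "'p padic^2^2" and u s :: "'p padic" assume A: "A \<in> SL2" "primitive_row A" and u: "u \<in> Zp_units"
    show "?P (hmat u ** xmat s ** A) = lc k u * ?P A"
      using row_units_or[OF A(2)] units_inverse[OF u]
      by (auto simp: borel_row units_mult_pball lc_mult lc_inverse[OF u] kl units_pball)
  next
    fix A h :: "'p padic^2^2" assume A: "A \<in> SL2" "primitive_row A" and h: "h \<in> K0 1"
    show "?P (A ** h) = \<eta> (h $ 2 $ 2) * ?P A"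
      using K0_right_row[OF A(2) h, of l] row_units_or[OF A(2)] K0_1_units(1)[OF h]
      by (auto simp: units_pball eta_unit)
  qed
  then obtain f1 where f1: "f1 \<in> iso 1" "\<And>k0. k0 \<in> K0 0 \<Longrightarrow> f1 (k0, 1) = ?P k0" by blast
  have "\<exists>f\<in>iso 1. \<forall>k0\<in>K0 0. f (k0, 1) = ?Q k0"
  proof (rule iso_extension[where m=1 and \<Psi>="?Q"])
    fix A :: "'p padic^2^2" and u s :: "'p padic" assume A: "A \<in> SL2" "primitive_row A" and u: "u \<in> Zp_units"
    show "?Q (hmat u ** xmat s ** A) = lc k u * ?Q A"
      using lc_mult[OF units_inverse[OF u], of "- (A $ 2 $ 1)" l]
      by (simp add: borel_row units_scale[OF u] lc_inverse[OF u] kl)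
  next
    fix A h :: "'p padic^2^2" assume A: "A \<in> SL2" "primitive_row A" and h: "h \<in> K0 1"
    have m: "lc l (- x) = lc l (- 1) * lc l x" if "x \<in> Zp_units" for x
      using lc_mult[OF _ that, of "- 1" l] by simp
    show "?Q (A ** h) = \<eta> (h $ 2 $ 2) * ?Q A"
      using K0_right_row[OF A(2) h, of l] row_units_or[OF A(2)] K0_1_units(1)[OF h] m
      by (auto simp: units_pball eta_unit)
  qed
  then obtain f2 where f2: "f2 \<in> iso 1" "\<And>k0. k0 \<in> K0 0 \<Longrightarrow> f2 (k0, 1) = ?Q k0" by blast
  have m: "mat 1 \<in> (K0 0 :: ('p padic^2^2) set)" "wmat \<in> (K0 0 :: ('p padic^2^2) set)" by simp_all
  have ne: "?x \<noteq> ?y"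
  proof
    assume "?x = ?y"
    then have "fst ?x $ 2 $ 1 = fst ?y $ 2 $ 1" by (rule arg_cong)
    then show False by simp
  qed
  have "has_dim (iso 1) (card {?x, ?y})"
  proof (rule has_dim_eval[OF iso_subspace, where b="\<lambda>z. if z = ?x then f1 else f2"])
    show "(if x = ?x then f1 else f2) \<in> iso 1" for x using f1 f2 by simp
    have v: "f1 ?x = 1" "f1 ?y = 0" "f2 ?x = 0" "f2 ?y = 1"
      using f1(2)[OF m(1)] f1(2)[OF m(2)] f2(2)[OF m(1)] f2(2)[OF m(2)] units_1[where 'p='p]
      by (simp_all add: units_pball)
    show "(if x = ?x then f1 else f2) y = (if x = y then 1 else 0)" if "x \<in> {?x, ?y}" "y \<in> {?x, ?y}" for x y
      using that v ne by auto
    show "f = 0" if "f \<in> iso 1" "\<And>x. x \<in> {?x, ?y} \<Longrightarrow> f x = 0" for f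
      using that by (intro iso_1_inj) auto
  qed simp
  then show ?thesis using ne by (simp add: numeral_2_eq_2)
qed

text \<open>On unit squares this is the quartic residue symbol. It does not depend on the chosen
  root exactly when -1 has Legendre symbol 1.\<close>

definition root_leg :: "'p padic \<Rightarrow> int" where
  "root_leg x = leg (SOME u. u \<in> Zp_units \<and> u^2 = x)"

lemma root_leg:
  assumes kl: "k \<noteq> l" and u: "u \<in> Zp_units"
  shows "root_leg (u^2) = leg u"
proof -
  define v where "v = (SOME v. v \<in> Zp_units \<and> v^2 = u^2)"
  have v: "v \<in> Zp_units \<and> v^2 = u^2" unfolding v_def by (rule someI[of _ u]) (simp add: u)
  then have "v = u \<or> v = - u" by (simp add: power2_eq_iff)
  then have "leg v = leg u" using leg_minus_1_eq[OF u] leg_minus_1[OF kl] by auto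
  then show ?thesis by (simp add: root_leg_def v_def)
qed

text \<open>The orbits of \<open>K0 2\<close> on \<open>B\G\<close> with \<open>v(c) = 1\<close> are told apart by the square class of \<open>c d / p\<close>.\<close>

lemma iso_2_function:
  assumes kl: "k \<noteq> l" and e: "e \<in> Zp_units"
  shows "\<exists>f\<in>iso 2. \<forall>c\<in>Zp_units.
    f (nmat (pp * c), 1) = (if leg c = leg e then of_int (root_leg (c / e)) else 0)"
proof -
  let ?S = "\<lambda>x. x \<in> Zp_units \<and> leg x = 1"
  \<comment> \<open>The torus on the left divides both bottom entries by \<open>u\<close>, hence
    this quantity by \<open>u^2\<close>. Its root then contributes the factor \<open>leg u\<close>,
    which converts the character \<open>lc l\<close> of the lower right entry into the required
    \<open>lc k\<close>.\<close>
  let ?x = "\<lambda>A :: 'p padic^2^2. A $ 2 $ 1 * A $ 2 $ 2 / (pp * e)"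
  let ?C = "\<lambda>A :: 'p padic^2^2. A $ 2 $ 1 \<in> pball 1 \<and> ?S (?x A)"
  let ?P = "\<lambda>A. if ?C A then lc l (A $ 2 $ 2) * of_int (root_leg (?x A)) else 0"
  have S: "\<exists>u\<in>Zp_units. x = u^2" if "?S x" for x :: "'p padic"
    using that Zp_units_of_power2 by (auto simp: leg_def split: if_splits)
  have ez: "e \<noteq> 0" using e units_nonzero by blast
  have "\<exists>f\<in>iso 2. \<forall>k0\<in>K0 0. f (k0, 1) = ?P k0"
  proof (rule iso_extension[where m=2 and \<Psi>="?P"])
    fix A :: "'p padic^2^2" and u s :: "'p padic" assume A: "A \<in> SL2" "primitive_row A" and u: "u \<in> Zp_units"
    have u': "inverse u \<in> Zp_units" "inverse u \<noteq> 0" using units_inverse[OF u] units_nonzero[OF u] by auto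
    have x: "?x (hmat u ** xmat s ** A) = (inverse u)^2 * ?x A" by (simp add: borel_row power2_eq_square)
    have Sx: "?S ((inverse u)^2 * y) \<longleftrightarrow> ?S y" for y
      using units_scale[OF u] leg_power2_mult[OF u'(2)] by (simp add: power2_eq_square mult.assoc)
    have C: "?C (hmat u ** xmat s ** A) \<longleftrightarrow> ?C A"
      unfolding x Sx unfolding borel_row using units_mult_pball[OF u'(1)] by blast
    show "?P (hmat u ** xmat s ** A) = lc k u * ?P A"
    proof (cases "?C A")
      case True
      then obtain v where v: "v \<in> Zp_units" "?x A = v^2" using S by blast
      have "A $ 2 $ 2 \<in> Zp_units" using True row_units_or[OF A(2)] by (auto simp: units_pball)
      then have "lc l (inverse u * A $ 2 $ 2) = lc l u * lc l (A $ 2 $ 2)" using u' by (simp add: lc_mult lc_inverse u)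
      moreover have "root_leg ((inverse u)^2 * v^2) = leg u * leg v"
        using root_leg[OF kl units_mult[OF u'(1) v(1)]] leg_mult[OF u'(1) v(1)] leg_inverse[of u] u' by (simp add: power_mult_distrib)
      ultimately show ?thesis using True C root_leg[OF kl v(1)] lc_neq[OF kl, of u]
        unfolding x v(2) by (simp add: borel_row v(2))
    next
      case False
      then have "\<not> ?C (hmat u ** xmat s ** A)" using C by blast
      then show ?thesis using False by (simp only: if_False mult_zero_right)
    qed
  next
    fix A h :: "'p padic^2^2" assume A: "A \<in> SL2" "primitive_row A" and h: "h \<in> K0 2"
    note hu = K0_1_units[OF h, simplified]
    show "?P (A ** h) = \<eta> (h $ 2 $ 2) * ?P A"
    proof (cases "A $ 2 $ 1 \<in> pball 1")
      case False
      then have "(A ** h) $ 2 $ 1 \<notin> pball 1"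
        using K0_right_row(1)[OF A(2) h] row_units_or[OF A(2)] by (auto simp: units_pball)
      then show ?thesis using False by simp
    next
      case True
      note r = K0_right_row(2)[OF A(2) h _ True, of l, simplified]
      have du: "A $ 2 $ 2 \<in> Zp_units" using True row_units_or[OF A(2)] by (auto simp: units_pball)
      have h21: "h $ 2 $ 1 \<in> pball 2" and h11: "h $ 1 $ 1 \<in> pball 0" using h by (auto simp: K0_iff)
      show ?thesis
      proof (cases "A $ 2 $ 1 \<in> pball 2")
        case True
        have n: "\<not> ?S (c * d / (pp * e))" if "c \<in> pball 2" "d \<in> pball 0" for c d :: "'p padic"
        proof
          assume "?S (c * d / (pp * e))"
          then have z: "c \<noteq> 0" "d \<noteq> 0" "padic_ord (c * d / (pp * e)) = 0" by (auto simp: Zp_units_iff)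
          then show False using that ez padic_ord_unit[OF e] by (simp add: padic_ord_divide padic_ord_mult pball_iff)
        qed
        have "A $ 2 $ 1 * h $ 1 $ 1 \<in> pball (2 + 0)" by (rule pball_mult[OF True h11])
        moreover have "A $ 2 $ 2 * h $ 2 $ 1 \<in> pball (0 + 2)" by (rule pball_mult[OF primitive_pball[OF A(2)] h21])
        ultimately have "(A ** h) $ 2 $ 1 \<in> pball 2" by (simp add: matmul2_nth pball_add)
        then have "\<not> ?C (A ** h)" "\<not> ?C A" using n True r du by (auto simp: units_pball)
        then show ?thesis by (simp only: if_False mult_zero_right)
      next
        case False
        let ?c = "A $ 2 $ 1" and ?d = "A $ 2 $ 2" and ?c1 = "(A ** h) $ 2 $ 1" and ?d1 = "(A ** h) $ 2 $ 2"
        have cz: "?c \<noteq> 0" "padic_ord ?c = 1" using False \<open>?c \<in> pball 1\<close> by (auto simp: pball_iff)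
        have dz: "?d \<noteq> 0" using du units_nonzero by blast
        \<comment> \<open>Level 2 enters here: as \<open>c\<close> has order 1, divisibility of
          \<open>d * h21 / c\<close> by \<open>p\<close> requires \<open>p^2\<close> to divide
          \<open>h21\<close>.\<close>
        have "?d * h $ 2 $ 1 * inverse ?c \<in> pball (0 + 2 + - 1)"
          using cz by (intro pball_mult primitive_pball[OF A(2)] h21) (simp add: pball_iff padic_ord_inverse)
        moreover have "?c1 / ?c - h $ 1 $ 1 = ?d * h $ 2 $ 1 * inverse ?c"
          using cz by (simp add: matmul2_nth field_simps)
        ultimately have y1: "?c1 / ?c - h $ 1 $ 1 \<in> pball 1" by simp
        have "inverse ?d * (?d1 - ?d * h $ 2 $ 2) \<in> pball 1" using r units_mult_pball[OF units_inverse[OF du]] by blast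
        moreover have "inverse ?d * (?d1 - ?d * h $ 2 $ 2) = ?d1 / ?d - h $ 2 $ 2" using dz by (simp add: field_simps)
        ultimately have y2: "?d1 / ?d - h $ 2 $ 2 \<in> pball 1" by simp
        \<comment> \<open>The factor by which \<open>?x\<close> changes. It is congruent to the
          product of the diagonal entries of \<open>h\<close>, hence to 1, so it has a root
          congruent to 1 and does not affect \<open>root_leg\<close>.\<close>
        define y where "y = (?c1 / ?c) * (?d1 / ?d)"
        have eq: "y - 1 = (?c1 / ?c - h $ 1 $ 1) * (?d1 / ?d) + h $ 1 $ 1 * (?d1 / ?d - h $ 2 $ 2) + (h $ 1 $ 1 * h $ 2 $ 2 - 1)"
          by (simp add: y_def algebra_simps)
        have d0: "?d1 / ?d \<in> pball 0" using units_divide[OF _ du, of ?d1] r by (simp add: units_pball)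
        have X: "(?c1 / ?c - h $ 1 $ 1) * (?d1 / ?d) \<in> pball (1 + 0)" by (rule pball_mult[OF y1 d0])
        have Y: "h $ 1 $ 1 * (?d1 / ?d - h $ 2 $ 2) \<in> pball (0 + 1)" by (rule pball_mult[OF h11 y2])
        have "y - 1^2 \<in> pball 1"
          using pball_add[OF pball_add[OF X[simplified add_0_right] Y[simplified add_0_left]] hu(3)] by (simp only: eq power_one)
        then obtain w where w: "w^2 = y" "w - 1 \<in> pball 1" using hensel_square[OF units_1] by blast
        have wu: "w \<in> Zp_units" using units_add_pball[OF units_1 w(2)] by simp
        have lw: "leg w = 1" using leg_cong[OF wu w(2)] by simp
        have x: "?x (A ** h) = w^2 * ?x A" using cz dz by (simp add: w y_def field_simps)
        have Sx: "?S (w^2 * z) \<longleftrightarrow> ?S z" for z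
        proof -
          have "w^2 * z \<in> Zp_units \<longleftrightarrow> z \<in> Zp_units"
            using units_mult_pball[OF units_mult[OF wu wu]] by (simp add: units_pball power2_eq_square)
          then show ?thesis using leg_power2_mult[of w z] units_nonzero[OF wu] by simp
        qed
        have C: "?C (A ** h) \<longleftrightarrow> ?C A" unfolding x Sx using r \<open>?c \<in> pball 1\<close> by blast
        show ?thesis
        proof (cases "?C A")
          case True
          then obtain v where v: "v \<in> Zp_units" "?x A = v^2" using S by blast
          have "root_leg (w^2 * v^2) = root_leg (v^2)"
            using root_leg[OF kl units_mult[OF wu v(1)]] leg_mult[OF wu v(1)] lw root_leg[OF kl v(1)] by (simp add: power_mult_distrib)
          then have "root_leg (?x (A ** h)) = root_leg (?x A)" unfolding x v(2) .
          then show ?thesis using True C r hu(1) by (simp add: eta_unit)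
        next
          case False
          then have "\<not> ?C (A ** h)" using C by blast
          then show ?thesis using False by (simp only: if_False mult_zero_right)
        qed
      qed
    qed
  qed
  then obtain f where f: "f \<in> iso 2" "\<And>k0. k0 \<in> K0 0 \<Longrightarrow> f (k0, 1) = ?P k0" by blast
  show ?thesis
  proof (intro bexI[OF _ f(1)] ballI)
    fix c :: "'p padic" assume c: "c \<in> Zp_units"
    have pc: "pp * c \<in> pball 1" using c pp_mult_pball[of c 0] by (simp add: units_pball)
    then have n: "nmat (pp * c) \<in> K0 0" using pball_mono[of 0 1] by (intro K0_generators) simp
    have "leg (c / e) = 1 \<longleftrightarrow> leg c = leg e"
      using leg_mult[OF c units_inverse[OF e]] leg_inverse[OF ez] leg_cases[of c] leg_cases[of e] by (auto simp: divide_inverse)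
    then show "f (nmat (pp * c), 1) = (if leg c = leg e then of_int (root_leg (c / e)) else 0)"
      using f(2)[OF n] pc units_divide[OF c e] by simp
  qed
qed

lemma dim_iso_2:
  assumes kl: "k \<noteq> l"
  shows "has_dim (iso 2) 2"
proof -
  let ?x = "(nmat pp :: 'p padic^2^2, 1 :: int)" and ?y = "(nmat (pp * \<beta>) :: 'p padic^2^2, 1 :: int)"
  have b1: "\<beta> \<noteq> 0" "\<beta> \<noteq> 1" using leg_beta leg_1[where 'a='p] units_nonzero[OF beta_unit] by auto
  obtain f1 where f1: "f1 \<in> iso 2"
    "\<And>c. c \<in> Zp_units \<Longrightarrow> f1 (nmat (pp * c), 1) = (if leg c = leg (1 :: 'p padic) then of_int (root_leg (c / 1)) else 0)"
    using iso_2_function[OF kl units_1] by blast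
  obtain f2 where f2: "f2 \<in> iso 2"
    "\<And>c. c \<in> Zp_units \<Longrightarrow> f2 (nmat (pp * c), 1) = (if leg c = leg \<beta> then of_int (root_leg (c / \<beta>)) else 0)"
    using iso_2_function[OF kl beta_unit] by blast
  have r1: "root_leg 1 = 1" using root_leg[OF kl units_1] by simp
  have v: "f1 ?x = 1" "f1 ?y = 0" "f2 ?x = 0" "f2 ?y = 1"
    using f1(2)[OF units_1] f1(2)[OF beta_unit] f2(2)[OF units_1] f2(2)[OF beta_unit] r1 leg_beta b1 by simp_all
  have ne: "?x \<noteq> ?y"
  proof
    assume "?x = ?y"
    then have "f1 ?x = f1 ?y" by (rule arg_cong)
    then show False using v by simp
  qed
  have "has_dim (iso 2) (card {?x, ?y})"
  proof (rule has_dim_eval[OF iso_subspace, where b="\<lambda>z. if z = ?x then f1 else f2"])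
    show "(if x = ?x then f1 else f2) \<in> iso 2" for x using f1 f2 by simp
    show "(if x = ?x then f1 else f2) y = (if x = y then 1 else 0)" if "x \<in> {?x, ?y}" "y \<in> {?x, ?y}" for x y
      using that v ne by auto
    show "f = 0" if "f \<in> iso 2" "\<And>x. x \<in> {?x, ?y} \<Longrightarrow> f x = 0" for f
      using that by (intro iso_2_inj[OF kl]) auto
  qed simp
  then show ?thesis using ne by (simp add: numeral_2_eq_2)
qed

end

section \<open>Isotypic vectors in the even Weil representation\<close>

locale weil = pair_beta p_type \<psi> a k l \<mu> \<eta> \<beta>
  for p_type :: "'p::prime_card itself" and \<psi> a k l \<mu> \<eta> \<beta> +
  fixes \<omega> :: "'p mp \<Rightarrow> ('p padic \<Rightarrow> complex) \<Rightarrow> 'p padic \<Rightarrow> complex"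
  assumes weil: "weil_representation (twist \<psi> a) \<omega>"
begin

lemma w_rep: "mp_representation schwartz \<omega>"
  using weil unfolding weil_representation_def by blast

lemma w_mult:
  assumes "g \<in> Mp" "h \<in> Mp" "\<phi> \<in> schwartz"
  shows "\<omega> (mp_mult g h) \<phi> = \<omega> g (\<omega> h \<phi>)"
  using w_rep assms unfolding mp_representation_def by blast

lemma w_schwartz: "g \<in> Mp \<Longrightarrow> \<phi> \<in> schwartz \<Longrightarrow> \<omega> g \<phi> \<in> schwartz"
  using w_rep unfolding mp_representation_def by blast

lemma w_1: "\<phi> \<in> schwartz \<Longrightarrow> \<omega> (mat 1, 1) \<phi> = \<phi>"
  using w_rep unfolding mp_representation_def by blast

lemma w_linear: "g \<in> Mp \<Longrightarrow> linear_on_space schwartz (\<omega> g)"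
  using w_rep unfolding mp_representation_def by blast

lemma schwartz_subspace: "cfun.subspace (schwartz :: ('p padic \<Rightarrow> complex) set)"
  using w_rep unfolding mp_representation_def by blast

lemma K0_Mp: "h \<in> K0 m \<Longrightarrow> (h, 1) \<in> (Mp :: 'p mp set)"
  by (simp add: Mp_def K0_SL2)

lemma w_K0:
  assumes "h1 \<in> K0 0" "h2 \<in> K0 0" "\<phi> \<in> schwartz"
  shows "\<omega> (h1 ** h2, 1) \<phi> = \<omega> (h1, 1) (\<omega> (h2, 1) \<phi>)"
  using w_mult[OF K0_Mp[OF assms(1)] K0_Mp[OF assms(2)] assms(3)]
    cocycle_splits[OF K0_SL2[OF assms(1)] K0_primitive[OF assms(1)] assms(2)]
  by (simp add: mp_mult_def)

lemma w_h:
  assumes "u \<in> Zp_units" "\<phi> \<in> schwartz" "\<epsilon> \<in> {1, - 1}"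
  shows "\<omega> (hmat u, \<epsilon>) \<phi> y = of_int \<epsilon> * lc k u * \<phi> (u * y)"
proof -
  have "\<omega> (hmat u, \<epsilon>) \<phi> y = of_int \<epsilon> * abs_pow u (1/2) * inverse (gamma_rel u (twist \<psi> a)) * \<phi> (u * y)"
    using weil assms units_nonzero[OF assms(1)] unfolding weil_representation_def by blast
  moreover have "inverse (gamma_rel u (twist \<psi> a)) = lc k u"
    using gamma_rel_twist_unit[OF a_nonzero assms(1)] leg_cases[of u] by (auto simp: lc_def k_def)
  moreover have "abs_pow u (1/2) = 1" using assms(1) by (simp add: abs_pow_def Zp_units_def)
  ultimately show ?thesis by simp
qed

lemma w_x: "\<phi> \<in> schwartz \<Longrightarrow> \<omega> (xmat b, 1) \<phi> y = \<psi> (a * (b * y^2)) * \<phi> y"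
  using weil unfolding weil_representation_def twist_def by blast

lemma w_w:
  assumes "\<phi> \<in> schwartz"
  shows "\<omega> (wmat, 1) \<phi> y = weil_index (twist \<psi> a) * of_real (sqrt (padic_abs a)) * fint (2 * a) \<phi> y"
proof -
  have "\<omega> (wmat, 1) \<phi> y = weil_index (twist \<psi> a) * fourier (twist (twist \<psi> a) 2) \<phi> y"
    using weil assms unfolding weil_representation_def by blast
  then show ?thesis using a_nonzero by (simp add: twist_two fourier_psi two_mult)
qed

lemma w_sign:
  assumes h: "h \<in> SL2" and \<phi>: "\<phi> \<in> schwartz" and e: "\<epsilon> \<in> {1, - 1}"
  shows "\<omega> (h, \<epsilon>) \<phi> = cscale (of_int \<epsilon>) (\<omega> (h, 1) \<phi>)"
proof
  fix y
  have M: "(hmat 1, \<epsilon>) \<in> Mp" "(h, 1) \<in> Mp" using h e by (auto simp: Mp_def)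
  have "mp_mult (hmat 1, \<epsilon>) (h, 1) = (h, \<epsilon>)" using h by (simp add: mp_mult_def hmat_1 cocycle_1)
  then have "\<omega> (h, \<epsilon>) \<phi> = \<omega> (hmat 1, \<epsilon>) (\<omega> (h, 1) \<phi>)" using w_mult[OF M \<phi>] by simp
  then show "\<omega> (h, \<epsilon>) \<phi> y = cscale (of_int \<epsilon>) (\<omega> (h, 1) \<phi>) y"
    using w_h[OF units_1 w_schwartz[OF M(2) \<phi>] e, of y] by (simp add: cscale_def)
qed

text \<open>The inverse of \<open>wmat\<close>, written so that its action follows from the formulas
  for the torus and for \<open>wmat\<close>.\<close>

definition winv :: "'p padic^2^2" where "winv = hmat (- 1) ** wmat"

lemma winv: "winv \<in> K0 0" "wmat ** winv = mat 1" "winv ** wmat = mat 1"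
  unfolding winv_def
  by (intro K0_mult K0_hmat K0_generators, simp) (intro mat2_eqI; simp add: matmul2_nth)+

lemma nmat_wmat: "nmat c ** wmat = wmat ** xmat (- c)"
  by (intro mat2_eqI) (simp_all add: matmul2_nth)

lemma w_winv:
  assumes "\<phi> \<in> schwartz"
  shows "\<omega> (wmat, 1) (\<omega> (winv, 1) \<phi>) = \<phi>" "\<omega> (winv, 1) (\<omega> (wmat, 1) \<phi>) = \<phi>"
  using w_K0[OF K0_generators(3) winv(1) assms] w_K0[OF winv(1) K0_generators(3) assms] winv w_1[OF assms]
  by simp_all

lemma w_nmat:
  assumes "\<phi> \<in> schwartz" "c \<in> pball 0"
  shows "\<omega> (nmat c, 1) \<phi> = \<omega> (wmat, 1) (\<omega> (xmat (- c), 1) (\<omega> (winv, 1) \<phi>))"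
proof -
  have s: "\<omega> (winv, 1) \<phi> \<in> schwartz" by (rule w_schwartz[OF K0_Mp[OF winv(1)] assms(1)])
  have K: "nmat c \<in> K0 0" "xmat (- c) \<in> K0 0" using assms(2) by simp_all
  have "\<omega> (nmat c, 1) \<phi> = \<omega> (nmat c, 1) (\<omega> (wmat, 1) (\<omega> (winv, 1) \<phi>))"
    by (simp only: w_winv(1)[OF assms(1)])
  also have "\<dots> = \<omega> (nmat c ** wmat, 1) (\<omega> (winv, 1) \<phi>)"
    by (rule w_K0[OF K(1) K0_generators(3) s, symmetric])
  also have "\<dots> = \<omega> (wmat, 1) (\<omega> (xmat (- c), 1) (\<omega> (winv, 1) \<phi>))"
    unfolding nmat_wmat by (rule w_K0[OF K0_generators(3) K(2) s])
  finally show ?thesis .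
qed

lemma two_a: "2 * a \<noteq> 0" "padic_ord (2 * a) = padic_ord a"
  using a_nonzero two_mult(2)[OF a_nonzero] by simp_all

lemma integrality:
  assumes "\<And>b. b \<in> pball n \<Longrightarrow> \<psi> (a * (b * x^2)) = 1" and x: "x \<noteq> 0"
  shows "0 \<le> padic_ord a + n + 2 * padic_ord x"
proof -
  have "\<forall>b\<in>pball n. \<psi> (a * x^2 * b) = 1" using assms(1) by (simp add: mult_ac)
  then have "a * x^2 \<in> pball (- n)" unfolding psi_dual .
  then show ?thesis using x a_nonzero by (simp add: pball_iff padic_ord_mult power2_eq_square)
qed

lemma psi_a_1:
  assumes "x \<in> pball i" "b \<in> pball n" "0 \<le> padic_ord a + n + 2 * i"
  shows "\<psi> (a * (b * x^2)) = 1"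
proof -
  have "a * (b * (x * x)) \<in> pball (padic_ord a + (n + (i + i)))"
    using assms by (intro pball_mult) (auto simp: pball_iff)
  then have "a * (b * (x * x)) \<in> pball 0" using assms(3) by (intro pball_mono[of 0 "padic_ord a + (n + (i + i))"]) simp_all
  then show ?thesis by (simp add: psi_integral power2_eq_square)
qed

definition wiso :: "nat \<Rightarrow> ('p padic \<Rightarrow> complex) set" where "wiso m = isotypic even_schwartz \<omega> \<eta> m"

text \<open>The largest exponent for which \<open>a * c * x^2\<close> is integral whenever
  \<open>c\<close> lies in \<open>p^m\<close> and \<open>x\<close> in \<open>p^(- level m)\<close>.
  The pairing by \<open>2 a\<close> turns this support condition into the period lattice
  \<open>p^(level m - ord a)\<close>.\<close>

definition level :: "nat \<Rightarrow> int" where "level m = (padic_ord a + int m) div 2"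

lemma wiso_K0:
  assumes "\<phi> \<in> wiso m" "h \<in> K0 m"
  shows "\<omega> (h, 1) \<phi> = cscale (\<eta> (h $ 2 $ 2)) \<phi>"
  using assms unfolding wiso_def isotypic_def by auto

lemma wiso_schwartz: "\<phi> \<in> wiso m \<Longrightarrow> \<phi> \<in> schwartz"
  unfolding wiso_def isotypic_def even_schwartz_def by auto

text \<open>Invariance under the upper unipotents forces \<open>a * y^2\<close> to be integral where
  the function is nonzero. Since \<open>a\<close> has order 0 or 1, this makes \<open>y\<close>
  integral.\<close>

lemma wiso_support:
  assumes \<phi>: "\<phi> \<in> wiso m" and y: "y \<notin> pball 0"
  shows "\<phi> y = 0"
proof (rule ccontr)
  assume nz: "\<phi> y \<noteq> 0"
  have "\<psi> (a * (b * y^2)) = 1" if "b \<in> pball 0" for b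
    using wiso_K0[OF \<phi> K0_generators(1)[OF that]] w_x[OF wiso_schwartz[OF \<phi>], of b y] nz
    by (simp add: cscale_def)
  then have "0 \<le> padic_ord a + 0 + 2 * padic_ord y" using y by (intro integrality) auto
  then show False using y ord_a by (auto simp: pball_iff split: if_splits)
qed

lemma wiso_unit:
  assumes \<phi>: "\<phi> \<in> wiso m" and u: "u \<in> Zp_units"
  shows "\<phi> (u * y) = lc k u * lc l u * \<phi> y"
proof -
  have "lc k u * \<phi> (u * y) = lc l u * \<phi> y"
    using wiso_K0[OF \<phi> K0_hmat[OF u]] w_h[OF u wiso_schwartz[OF \<phi>], of 1 y] u
    by (simp add: cscale_def eta_unit units_inverse lc_inverse)
  then have "lc k u * (lc k u * \<phi> (u * y)) = lc k u * (lc l u * \<phi> y)" by simp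
  then show ?thesis by (simp add: mult.assoc[symmetric])
qed

text \<open>A lower unipotent is \<open>wmat\<close> times an upper one times \<open>winv\<close>.
  Hence the transform of the vector by \<open>winv\<close> is supported in
  \<open>p^(- level m)\<close>, and transforming back a function with such support yields the
  period.\<close>

lemma wiso_translate:
  assumes \<phi>: "\<phi> \<in> wiso m" and z: "z \<in> pball (level m - padic_ord a)"
  shows "\<phi> (y + z) = \<phi> y"
proof -
  note s = wiso_schwartz[OF \<phi>]
  define \<phi>' where "\<phi>' = \<omega> (winv, 1) \<phi>"
  have s': "\<phi>' \<in> schwartz" unfolding \<phi>'_def by (rule w_schwartz[OF K0_Mp[OF winv(1)] s])
  have fx: "\<omega> (xmat (- c), 1) \<phi>' = \<phi>'" if c: "c \<in> pball (int m)" for c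
  proof -
    have c0: "c \<in> pball 0" using c pball_mono[of 0 "int m"] by simp
    have "\<omega> (wmat, 1) (\<omega> (xmat (- c), 1) \<phi>') = \<phi>"
      unfolding \<phi>'_def w_nmat[OF s c0, symmetric] wiso_K0[OF \<phi> K0_generators(2)[OF c]] by (simp add: cscale_def)
    then have "\<omega> (winv, 1) \<phi> = \<omega> (winv, 1) (\<omega> (wmat, 1) (\<omega> (xmat (- c), 1) \<phi>'))" by simp
    also have "\<dots> = \<omega> (xmat (- c), 1) \<phi>'"
      using c0 by (intro w_winv(2) w_schwartz[OF _ s'] K0_Mp[of _ 0]) simp
    finally show ?thesis by (simp add: \<phi>'_def)
  qed
  have supp: "- level m \<le> padic_ord x" if "\<phi>' x \<noteq> 0" "x \<noteq> 0" for x
  proof -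
    have "\<psi> (a * (b * x^2)) = 1" if "b \<in> pball (int m)" for b
      using fun_cong[OF fx[of "- b"], of x] w_x[OF s', of b x] that \<open>\<phi>' x \<noteq> 0\<close> by simp
    then have "0 \<le> padic_ord a + int m + 2 * padic_ord x" by (rule integrality[OF _ that(2)])
    then show ?thesis unfolding level_def by linarith
  qed
  have "\<phi>' x * \<psi> (2 * a * (x * (y + z))) = \<phi>' x * \<psi> (2 * a * (x * y))" for x
  proof (cases "\<phi>' x = 0 \<or> x = 0")
    case False
    then have "x \<in> pball (- level m)" using supp by (simp add: pball_iff)
    then have "2 * a * (x * z) \<in> pball (padic_ord a + (- level m + (level m - padic_ord a)))"
      using z two_a by (intro pball_mult) (auto simp: pball_iff)
    then have "\<psi> (2 * a * (x * y) + 2 * a * (x * z)) = \<psi> (2 * a * (x * y))"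
      by (intro psi_add_integral) simp
    then show ?thesis by (simp add: distrib_left)
  qed auto
  then have "fint (2 * a) \<phi>' (y + z) = fint (2 * a) \<phi>' y" unfolding fint_def by (simp only:)
  then have "\<omega> (wmat, 1) \<phi>' (y + z) = \<omega> (wmat, 1) \<phi>' y" unfolding w_w[OF s'] by simp
  then show ?thesis unfolding \<phi>'_def w_winv(1)[OF s] .
qed

lemma w_xmat_fix:
  assumes \<phi>: "\<phi> \<in> schwartz" and supp: "\<And>y. y \<notin> pball 0 \<Longrightarrow> \<phi> y = 0" and b: "b \<in> pball 0"
  shows "\<omega> (xmat b, 1) \<phi> = \<phi>"
proof
  fix y
  show "\<omega> (xmat b, 1) \<phi> y = \<phi> y"
    using w_x[OF \<phi>, of b y] supp[of y] psi_a_1[of y 0 b 0] b ord_a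
    by (cases "y \<in> pball 0") (auto split: if_splits)
qed

text \<open>The converse of \<open>wiso_translate\<close>: a period confines the Fourier transform
  to the dual lattice, where the phase of the upper unipotent is trivial.\<close>

lemma w_nmat_fix:
  assumes \<phi>: "\<phi> \<in> schwartz" and tr: "\<And>y z. z \<in> pball (level m - padic_ord a) \<Longrightarrow> \<phi> (y + z) = \<phi> y"
    and c: "c \<in> pball (int m)"
  shows "\<omega> (nmat c, 1) \<phi> = \<phi>"
proof -
  have supp: "fint (2 * a) \<phi> x = 0" if x: "x \<notin> pball (- level m)" for x
  proof -
    have "2 * a * x \<notin> pball (- (level m - padic_ord a))"
      using x two_a by (auto simp: pball_iff padic_ord_mult)
    then obtain z where z: "z \<in> pball (level m - padic_ord a)" "\<psi> (2 * a * x * z) \<noteq> 1"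
      using psi_dual by blast
    have "fint (2 * a) \<phi> x = (LINT y|haar. \<phi> (y + z) * \<psi> (2 * a * ((y + z) * x)))"
      unfolding fint_def by (rule schwartz_translate[OF schwartz_psi_mult[OF \<phi>], symmetric])
    also have "\<dots> = (LINT y|haar. \<psi> (2 * a * x * z) * (\<phi> y * \<psi> (2 * a * (y * x))))"
    proof (intro Bochner_Integration.integral_cong refl)
      fix y
      have "2 * a * ((y + z) * x) = 2 * a * x * z + 2 * a * (y * x)" by (simp add: algebra_simps)
      then show "\<phi> (y + z) * \<psi> (2 * a * ((y + z) * x)) = \<psi> (2 * a * x * z) * (\<phi> y * \<psi> (2 * a * (y * x)))"
        by (simp only: tr[OF z(1)] psi_add mult.left_commute)
    qed
    also have "\<dots> = \<psi> (2 * a * x * z) * fint (2 * a) \<phi> x"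
      unfolding fint_def by (rule integral_mult_right_zero)
    finally show ?thesis using z(2) by (metis mult_cancel_right1)
  qed
  define \<phi>' where "\<phi>' = \<omega> (winv, 1) \<phi>"
  have c0: "c \<in> pball 0" using c pball_mono[of 0 "int m"] by simp
  have sw: "\<omega> (wmat, 1) \<phi> \<in> schwartz" by (rule w_schwartz[OF K0_Mp[OF K0_generators(3)] \<phi>])
  have s': "\<phi>' \<in> schwartz" unfolding \<phi>'_def by (rule w_schwartz[OF K0_Mp[OF winv(1)] \<phi>])
  have m1: "- 1 \<in> (Zp_units :: 'p padic set)" by simp
  have "\<phi>' = \<omega> (hmat (- 1), 1) (\<omega> (wmat, 1) \<phi>)"
    unfolding \<phi>'_def winv_def by (rule w_K0[OF K0_hmat[OF m1] K0_generators(3) \<phi>])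
  then have v: "\<phi>' x = lc k (- 1) * (weil_index (twist \<psi> a) * of_real (sqrt (padic_abs a)) * fint (2 * a) \<phi> (- x))" for x
    using w_h[OF m1 sw, of 1 x] by (simp add: w_w[OF \<phi>])
  have "\<omega> (xmat (- c), 1) \<phi>' = \<phi>'"
  proof
    fix x
    show "\<omega> (xmat (- c), 1) \<phi>' x = \<phi>' x"
    proof (cases "x \<in> pball (- level m)")
      case True
      have "0 \<le> padic_ord a + int m + 2 * (- level m)" unfolding level_def by linarith
      then have "\<psi> (a * (- c * x^2)) = 1" using True c by (intro psi_a_1[of x "- level m" "- c" "int m"]) simp_all
      then show ?thesis using w_x[OF s', of "- c" x] by simp
    next
      case False
      then have "\<phi>' x = 0" unfolding v using supp[of "- x"] by simp
      then show ?thesis using w_x[OF s', of "- c" x] by simp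
    qed
  qed
  then show ?thesis using w_nmat[OF \<phi> c0] w_winv(1)[OF \<phi>] by (simp add: \<phi>'_def)
qed

lemma w_hmat_eq:
  assumes \<phi>: "\<phi> \<in> schwartz" and un: "\<And>u y. u \<in> Zp_units \<Longrightarrow> \<phi> (u * y) = lc k u * lc l u * \<phi> y" and u: "u \<in> Zp_units"
  shows "\<omega> (hmat u, 1) \<phi> = cscale (lc l u) \<phi>"
proof
  fix y
  have "lc k u * (lc k u * lc l u * \<phi> y) = (lc k u * lc k u) * lc l u * \<phi> y" by (simp only: mult.assoc)
  then show "\<omega> (hmat u, 1) \<phi> y = cscale (lc l u) \<phi> y"
    using w_h[OF u \<phi>, of 1 y] un[OF u, of y] by (simp add: cscale_def)
qed

lemma wiso_memberI:
  assumes even: "\<phi> \<in> even_schwartz"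
    and K: "\<And>h. h \<in> K0 m \<Longrightarrow> \<omega> (h, 1) \<phi> = cscale (\<eta> (h $ 2 $ 2)) \<phi>"
  shows "\<phi> \<in> wiso m"
proof -
  have s: "\<phi> \<in> schwartz" using even by (simp add: even_schwartz_def)
  have "\<omega> (h, \<epsilon>) \<phi> = cscale (of_int \<epsilon> * \<eta> (h $ 2 $ 2)) \<phi>" if "h \<in> K0 m" "\<epsilon> \<in> {1, - 1}" for h \<epsilon>
    using w_sign[OF K0_SL2[OF that(1)] s that(2)] K[OF that(1)] by (simp add: cscale_def mult.assoc)
  then show ?thesis using even unfolding wiso_def isotypic_def by blast
qed

text \<open>From level 1 on the lower right entry is a unit, so every element of \<open>K0 m\<close>
  factors into a torus element, an upper and a lower unipotent, one for each of the last three
  conditions.\<close>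

lemma wisoI:
  assumes even: "\<phi> \<in> even_schwartz" and m: "m \<ge> 1"
    and supp: "\<And>y. y \<notin> pball 0 \<Longrightarrow> \<phi> y = 0"
    and un: "\<And>u y. u \<in> Zp_units \<Longrightarrow> \<phi> (u * y) = lc k u * lc l u * \<phi> y"
    and tr: "\<And>y z. z \<in> pball (level m - padic_ord a) \<Longrightarrow> \<phi> (y + z) = \<phi> y"
  shows "\<phi> \<in> wiso m"
proof (rule wiso_memberI[OF even])
  have s: "\<phi> \<in> schwartz" using even by (simp add: even_schwartz_def)
  fix h :: "'p padic^2^2" assume h: "h \<in> K0 m"
  let ?c = "h $ 2 $ 1" and ?d = "h $ 2 $ 2" and ?b = "h $ 1 $ 2"
  have du: "?d \<in> Zp_units" by (rule K0_1_units(1)[OF h m])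
  have dz: "?d \<noteq> 0" "inverse ?d \<in> Zp_units" using du units_nonzero units_inverse by auto
  have z: "?c * inverse ?d \<in> pball (int m)"
    using pball_mult[of ?c "int m" "inverse ?d" 0] h dz(2) by (auto simp: K0_iff units_pball)
  have b: "?d * ?b \<in> pball 0" using pball_mult[of ?d 0 ?b 0] h by (auto simp: K0_iff)
  have e: "h = hmat (inverse ?d) ** (xmat (?d * ?b) ** nmat (?c * inverse ?d))"
    using K0_SL2[OF h] dz by (intro mat2_eqI) (auto simp: matmul2_nth SL2_iff field_simps)
  have n0: "nmat (?c * inverse ?d) \<in> K0 0" using z pball_mono[of 0 "int m"] by (intro K0_generators) simp
  have x0: "xmat (?d * ?b) \<in> K0 0" using b by simp
  have "\<omega> (h, 1) \<phi> = \<omega> (hmat (inverse ?d), 1) (\<omega> (xmat (?d * ?b) ** nmat (?c * inverse ?d), 1) \<phi>)"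
    by (subst e) (rule w_K0[OF K0_hmat[OF dz(2)] K0_mult[OF x0 n0] s])
  also have "\<omega> (xmat (?d * ?b) ** nmat (?c * inverse ?d), 1) \<phi> = \<phi>"
  proof -
    have "\<omega> (nmat (?c * inverse ?d), 1) \<phi> = \<phi>" by (rule w_nmat_fix[OF s _ z]) (rule tr)
    moreover have "\<omega> (xmat (?d * ?b), 1) \<phi> = \<phi>" by (rule w_xmat_fix[OF s _ b]) (rule supp)
    ultimately show ?thesis unfolding w_K0[OF x0 n0 s] by simp
  qed
  also have "\<omega> (hmat (inverse ?d), 1) \<phi> = cscale (lc l (inverse ?d)) \<phi>" by (rule w_hmat_eq[OF s un dz(2)])
  finally show "\<omega> (h, 1) \<phi> = cscale (\<eta> ?d) \<phi>" using du by (simp add: eta_unit lc_inverse)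
qed

lemma wiso_subspace: "cfun.subspace (wiso m)"
proof (rule cfun.subspaceI)
  have lin: "\<omega> g (f1 + f2) = \<omega> g f1 + \<omega> g f2" "\<omega> g (cscale c f1) = cscale c (\<omega> g f1)"
    if "g \<in> Mp" "f1 \<in> schwartz" "f2 \<in> schwartz" for g f1 f2 c
    using w_linear[OF that(1)] that unfolding linear_on_space_def by blast+
  have z: "(0 :: 'p padic \<Rightarrow> complex) \<in> schwartz" by (rule cfun.subspace_0[OF schwartz_subspace])
  have "\<omega> (h, 1) 0 = 0" if "h \<in> K0 m" for h
    using lin(2)[OF K0_Mp[OF that] z z, of 0] by (simp add: cscale_def zero_fun_def)
  then show "0 \<in> wiso m" using z by (intro wiso_memberI) (auto simp: even_schwartz_def cscale_def zero_fun_def)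
  show "f1 + f2 \<in> wiso m" if "f1 \<in> wiso m" "f2 \<in> wiso m" for f1 f2
  proof (rule wiso_memberI)
    show "f1 + f2 \<in> even_schwartz"
      using that cfun.subspace_add[OF schwartz_subspace, of f1 f2] by (auto simp: wiso_def isotypic_def even_schwartz_def)
    show "\<omega> (h, 1) (f1 + f2) = cscale (\<eta> (h $ 2 $ 2)) (f1 + f2)" if "h \<in> K0 m" for h
      using lin(1)[OF K0_Mp[OF that], of f1 f2] wiso_K0[OF _ that] wiso_schwartz \<open>f1 \<in> wiso m\<close> \<open>f2 \<in> wiso m\<close>
      by (simp add: cscale_def fun_eq_iff distrib_left)
  qed
  show "cscale c f \<in> wiso m" if "f \<in> wiso m" for c f
  proof (rule wiso_memberI)
    show "cscale c f \<in> even_schwartz"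
      using that cfun.subspace_scale[OF schwartz_subspace, of f c] by (auto simp: wiso_def isotypic_def even_schwartz_def cscale_def)
    show "\<omega> (h, 1) (cscale c f) = cscale (\<eta> (h $ 2 $ 2)) (cscale c f)" if "h \<in> K0 m" for h
      using lin(2)[OF K0_Mp[OF that], of f f c] wiso_K0[OF _ that] wiso_schwartz \<open>f \<in> wiso m\<close>
      by (simp add: cscale_def fun_eq_iff mult.left_commute)
  qed
qed

lemma wiso_lattice_Zp:
  assumes "\<phi> \<in> wiso m" "level m - padic_ord a \<le> 0"
  shows "\<phi> y = \<phi> 0 * ind 0 0 y"
  using wiso_support[OF assms(1)] wiso_translate[OF assms(1) pball_mono[OF assms(2)], of y 0]
  by (cases "y \<in> pball 0") (auto simp: ind_0_iff)

lemma ind_wiso: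
  assumes kl: "k = l" and m: "m \<ge> 1" "level m - padic_ord a \<ge> 0"
  shows "ind 0 0 \<in> wiso m"
proof (rule wisoI)
  show "ind 0 0 \<in> (even_schwartz :: ('p padic \<Rightarrow> complex) set)" by (simp add: even_schwartz_def ind_0_iff)
  show "ind 0 0 (u * y) = lc k u * lc l u * ind 0 0 (y :: 'p padic)" if "u \<in> Zp_units" for u y
    using units_mult_pball[OF that] by (simp add: kl ind_0_iff)
  show "ind 0 0 (y + z) = ind 0 0 (y :: 'p padic)" if "z \<in> pball (level m - padic_ord a)" for y z
    by (rule ind_0_shift[OF pball_mono[OF m(2) that]])
qed (use m in \<open>simp_all add: ind_0_iff\<close>)

text \<open>Level 0 needs only \<open>wmat\<close> in addition to \<open>K0 1\<close>. As
  \<open>a\<close> is a unit, the indicator of \<open>\<int>\<^sub>p\<close> is its own Fourier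
  transform and the Weil index is 1.\<close>

lemma ind_wiso_0:
  assumes "\<not> k" "\<not> l"
  shows "ind 0 0 \<in> wiso 0"
proof (rule wiso_memberI)
  let ?i = "ind 0 0 :: 'p padic \<Rightarrow> complex"
  have a0: "padic_ord a = 0" "padic_abs a = 1" using ord_a assms padic_abs_ord[OF a_nonzero] by simp_all
  have l1: "level 1 - padic_ord a = 0" by (simp add: level_def a0)
  have i1: "?i \<in> wiso 1" by (rule ind_wiso) (use assms l1 in simp_all)
  show "?i \<in> even_schwartz" by (simp add: even_schwartz_def ind_0_iff)
  have s: "?i \<in> schwartz" by simp
  have w: "\<omega> (wmat, 1) ?i = ?i"
  proof
    fix y
    show "\<omega> (wmat, 1) ?i y = ?i y"
      unfolding w_w[OF s] fint_ind[OF two_a(1)] weil_index_psi[OF a_nonzero] two_a(2) by (simp add: a0)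
  qed
  fix h :: "'p padic^2^2" assume h: "h \<in> K0 0"
  have e1: "\<eta> x = 1" for x using assms(2) by (simp add: eta_def)
  have "\<omega> (h, 1) ?i = ?i"
  proof (cases "h $ 2 $ 1 \<in> pball 1")
    case True
    then have "h \<in> K0 1" using h by (simp add: K0_iff)
    then show ?thesis using wiso_K0[OF i1] by (simp add: e1 cscale_def)
  next
    case False
    from K0_SL2[OF h] K0_primitive[OF h] show ?thesis
    proof (cases rule: primitive_row_decomp)
      case (1 u s x)
      then have "h $ 2 $ 1 = inverse u * x" by (simp add: matmul2_nth)
      then show ?thesis using False 1 units_mult_pball[OF units_inverse[OF 1(1)]] by simp
    next
      case (2 u t y)
      have fxs: "\<omega> (xmat c, 1) ?i = ?i" if "c \<in> pball 0" for c
        using wiso_K0[OF i1 K0_generators(1)[OF that]] by (simp add: e1 cscale_def)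
      have u: "\<omega> (hmat u, 1) ?i = ?i" using wiso_K0[OF i1 K0_hmat[OF 2(1)]] by (simp add: e1 cscale_def)
      have y: "xmat y \<in> K0 0" using 2(2) by simp
      have "u * (h $ 1 $ 1) = - (u^2 * t)" using 2(3) by (simp add: matmul2_nth power2_eq_square)
      then have "u * (t * u) = u * (- h $ 1 $ 1)" by (simp add: power2_eq_square mult_ac)
      then have "t * u = - h $ 1 $ 1" using units_nonzero[OF 2(1)] by (simp only: mult_cancel_left) simp
      then have "t = (- h $ 1 $ 1) / u" using units_nonzero[OF 2(1)] by (intro eq_divide_imp)
      then have "t = - (inverse u * h $ 1 $ 1)" by (simp add: divide_inverse mult.commute)
      moreover have "inverse u * h $ 1 $ 1 \<in> pball 0"
        using h units_mult_pball[OF units_inverse[OF 2(1)]] by (simp add: K0_iff)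
      ultimately have t: "t \<in> pball 0" by simp
      have wy: "wmat ** xmat y \<in> K0 0" by (rule K0_mult[OF K0_generators(3) y])
      have "h = hmat u ** (xmat t ** (wmat ** xmat y))" by (simp add: 2(3) matrix_mul_assoc)
      then have "\<omega> (h, 1) ?i = \<omega> (hmat u, 1) (\<omega> (xmat t ** (wmat ** xmat y), 1) ?i)"
        using w_K0[OF K0_hmat[OF 2(1)] K0_mult[OF K0_generators(1)[OF t] wy] s] by simp
      also have "\<omega> (xmat t ** (wmat ** xmat y), 1) ?i = \<omega> (xmat t, 1) (\<omega> (wmat ** xmat y, 1) ?i)"
        by (rule w_K0[OF K0_generators(1)[OF t] wy s])
      also have "\<omega> (wmat ** xmat y, 1) ?i = ?i"
        unfolding w_K0[OF K0_generators(3) y s] fxs[OF 2(2)] by (rule w)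
      finally show ?thesis by (simp add: fxs[OF t] u)
    qed
  qed
  then show "\<omega> (h, 1) ?i = cscale (\<eta> (h $ 2 $ 2)) ?i" by (simp add: e1 cscale_def)
qed

definition leg_fun :: "'p padic \<Rightarrow> complex" where
  "leg_fun y = (if y \<in> Zp_units then of_int (leg y) else 0)"

text \<open>The product of the two characters is the Legendre symbol in the mixed cases. Evenness
  holds because -1 is a square, and periodicity modulo \<open>p\<close> is why exponent 1 is
  required.\<close>

lemma leg_fun_wiso:
  assumes kl: "k \<noteq> l" and m: "m \<ge> 1" "level m - padic_ord a \<ge> 1"
  shows "leg_fun \<in> wiso m"
proof (rule wisoI)
  have tr: "leg_fun (y + z) = leg_fun y" if z: "z \<in> pball 1" for y z
  proof (cases "y \<in> Zp_units")
    case True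
    then show ?thesis using units_add_pball[OF True z] leg_cong[of "y + z" y] z by (simp add: leg_fun_def)
  next
    case False
    then have "y + z \<notin> Zp_units" using units_add_pball[of "y + z" "- z"] z by auto
    then show ?thesis using False by (simp add: leg_fun_def)
  qed
  show "leg_fun \<in> even_schwartz"
  proof -
    have "step_fun 0 1 leg_fun" using tr by (auto simp: step_fun_def leg_fun_def units_pball)
    then have "leg_fun \<in> schwartz" by (rule step_fun_schwartz)
    moreover have "leg_fun (- y) = leg_fun y" for y
      using leg_minus_1[OF kl] leg_minus_1_eq[of y] by (simp add: leg_fun_def)
    ultimately show ?thesis by (simp add: even_schwartz_def)
  qed
  show "leg_fun y = 0" if "y \<notin> pball 0" for y using that by (simp add: leg_fun_def units_pball)
  show "leg_fun (u * y) = lc k u * lc l u * leg_fun y" if "u \<in> Zp_units" for u y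
  proof -
    have "u * y \<in> Zp_units \<longleftrightarrow> y \<in> Zp_units" using units_mult_pball[OF that] by (simp add: units_pball)
    then show ?thesis using leg_mult[OF that, of y] by (simp add: leg_fun_def lc_neq'[OF kl])
  qed
  show "leg_fun (y + z) = leg_fun y" if "z \<in> pball (level m - padic_ord a)" for y z
    by (rule tr[OF pball_mono[OF m(2) that]])
qed (rule m)

lemma wiso_inj:
  assumes \<phi>: "\<phi> \<in> wiso m" and m: "level m - padic_ord a \<le> 1" and kl: "k \<noteq> l" and z: "\<phi> 1 = 0"
  shows "\<phi> = 0"
proof
  fix y
  \<comment> \<open>Scaling by \<open>\<beta>\<close> fixes the origin but must multiply the value
    by -1, so the value there vanishes.\<close>
  have "lc k \<beta> * lc l \<beta> = - 1" using lc_neq'[OF kl, of \<beta>] leg_beta by simp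
  then have 0: "\<phi> 0 = 0" using wiso_unit[OF \<phi> beta_unit, of 0] by simp
  show "\<phi> y = 0 y"
  proof (cases "y \<in> Zp_units")
    case True
    then show ?thesis using wiso_unit[OF \<phi> True, of 1] z by simp
  next
    case False
    then show ?thesis
      using wiso_support[OF \<phi>, of y] wiso_translate[OF \<phi> pball_mono[OF m], of y 0] 0 by (auto simp: units_pball)
  qed
qed

text \<open>The period contains \<open>\<int>\<^sub>p\<close>, so the vector is a multiple of its
  indicator, and scaling by \<open>\<beta>\<close> forces the value at the origin to vanish.\<close>

lemma wiso_trivial:
  assumes "level m - padic_ord a \<le> 0" and kl: "k \<noteq> l"
  shows "wiso m = {0}"
proof -
  have "\<phi> = 0" if \<phi>: "\<phi> \<in> wiso m" for \<phi>
  proof -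
    have "lc k \<beta> * lc l \<beta> = - 1" using lc_neq'[OF kl, of \<beta>] leg_beta by simp
    then have "\<phi> 0 = 0" using wiso_unit[OF \<phi> beta_unit, of 0] by simp
    then have "\<phi> y = 0" for y using wiso_lattice_Zp[OF \<phi> assms(1), of y] by simp
    then show ?thesis by (intro ext) (simp only: zero_fun_apply)
  qed
  then show ?thesis using cfun.subspace_0[OF wiso_subspace] by blast
qed

lemma wiso_span:
  assumes "\<phi> \<in> wiso m" "level m - padic_ord a \<le> 0"
  shows "\<phi> = cscale (\<phi> 0) (ind 0 0)"
  by (rule ext, unfold cscale_def) (rule wiso_lattice_Zp[OF assms])

lemma wiso_span_leg:
  assumes kl: "k \<noteq> l" and m: "m \<ge> 1" "level m - padic_ord a = 1" and \<phi>: "\<phi> \<in> wiso m"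
  shows "\<phi> = cscale (\<phi> 1) leg_fun"
proof -
  have "leg_fun \<in> wiso m" using m by (intro leg_fun_wiso[OF kl]) simp_all
  then have "\<phi> - cscale (\<phi> 1) leg_fun \<in> wiso m"
    by (intro cfun.subspace_diff[OF wiso_subspace] cfun.subspace_scale[OF wiso_subspace] \<phi>)
  then have "\<phi> - cscale (\<phi> 1) leg_fun = 0"
    by (rule wiso_inj[OF _ _ kl]) (simp_all add: m cscale_def leg_fun_def)
  then show ?thesis by simp
qed

lemma dim_1I:
  assumes "\<phi>0 \<in> wiso m" "\<phi>0 x = 1" "\<And>\<phi>. \<phi> \<in> wiso m \<Longrightarrow> \<phi> = cscale (\<phi> x) \<phi>0"
  shows "has_dim (wiso m) 1"
proof -
  have "has_dim (wiso m) (card {x})"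
  proof (rule has_dim_eval[OF wiso_subspace, where b="\<lambda>_. \<phi>0"])
    show "f = 0" if "f \<in> wiso m" "\<And>x'. x' \<in> {x} \<Longrightarrow> f x' = 0" for f
    proof -
      have "f = cscale 0 \<phi>0" using assms(3)[OF that(1)] unfolding that(2)[OF singletonI] .
      then show ?thesis by simp
    qed
  qed (use assms in auto)
  then show ?thesis by simp
qed

end

context weil
begin

lemma dim_wiso_1:
  assumes kl: "k = l"
  shows "has_dim (wiso 1) 1"
proof (rule dim_1I[of "ind 0 0" _ 0])
  have lv: "level 1 - padic_ord a = 0" by (simp add: level_def ord_a)
  show "ind 0 0 \<in> wiso 1" by (rule ind_wiso[OF kl]) (simp_all only: lv order_refl)
  show "\<phi> = cscale (\<phi> 0) (ind 0 0)" if "\<phi> \<in> wiso 1" for \<phi>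
    by (rule wiso_span[OF that]) (simp only: lv order_refl)
qed (simp add: ind_0_iff)

lemma dim_wiso_0:
  assumes "\<not> k" "\<not> l"
  shows "has_dim (wiso 0) 1"
proof (rule dim_1I[of "ind 0 0" _ 0])
  show "ind 0 0 \<in> wiso 0" by (rule ind_wiso_0[OF assms])
  show "\<phi> = cscale (\<phi> 0) (ind 0 0)" if "\<phi> \<in> wiso 0" for \<phi>
    by (rule wiso_span[OF that]) (simp add: level_def ord_a assms)
qed (simp add: ind_0_iff)

text \<open>\<open>M\<close> is the first level whose period lattice has exponent 1:
  \<open>(1 + 3) div 2 - 1\<close> for \<open>a\<close> of order 1 and \<open>2 div 2\<close> for
  order 0.\<close>

lemma dim_wiso_neq:
  assumes kl: "k \<noteq> l" and M: "M = (if k then 3 else 2)"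
  shows "has_dim (wiso M) 1"
proof (rule dim_1I[of leg_fun _ 1])
  have lv: "1 \<le> M" "level M - padic_ord a = 1" by (simp_all add: M level_def ord_a)
  show "leg_fun \<in> wiso M" by (rule leg_fun_wiso[OF kl lv(1)]) (simp only: lv order_refl)
  show "\<phi> = cscale (\<phi> 1) leg_fun" if "\<phi> \<in> wiso M" for \<phi> by (rule wiso_span_leg[OF kl lv that])
qed (simp add: leg_fun_def)

lemma wiso_neq_trivial: "k \<noteq> l \<Longrightarrow> m < (if k then 3 else 2) \<Longrightarrow> wiso m = {0}"
  by (rule wiso_trivial) (auto simp: level_def ord_a split: if_splits)

end

section \<open>Steinberg representations\<close>

lemma has_dim_0_iff: "has_dim V 0 \<longleftrightarrow> V = {0}"
  by (auto simp: has_dim_def cfun.independent_empty)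

lemma has_dim_Suc_nonzero:
  assumes "has_dim V (Suc n)"
  shows "V \<noteq> {0}"
proof
  assume V: "V = {0}"
  obtain B where B: "card B = Suc n" "B \<subseteq> V" "cfun.independent B"
    using assms unfolding has_dim_def by blast
  have "B \<noteq> {}" using B(1) by auto
  then have "0 \<in> B" using B(2) V by blast
  then show False using cfun.dependent_zero B(3) by blast
qed

text \<open>Rank and nullity for a map onto a line: a basis of the kernel together with
  \<open>f0\<close> spans \<open>V\<close>, and comparison with the given finite basis bounds its
  size from both sides.\<close>

lemma has_dim_kernel:
  fixes T :: "('x \<Rightarrow> complex) \<Rightarrow> 'y \<Rightarrow> complex"
  assumes V: "cfun.subspace V" and dim: "has_dim V (Suc n)" and lin: "linear_on_space V T"
    and f0: "f0 \<in> V" "T f0 = \<phi>" "\<phi> \<noteq> 0" and line: "\<And>f. f \<in> V \<Longrightarrow> \<exists>c. T f = cscale c \<phi>"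
  shows "has_dim {f \<in> V. T f = 0} n"
proof -
  have add: "T (u + v) = T u + T v" if "u \<in> V" "v \<in> V" for u v
    using lin that unfolding linear_on_space_def by blast
  have scale: "T (cscale c v) = cscale c (T v)" if "v \<in> V" for c v
    using lin that unfolding linear_on_space_def by blast
  define W where "W = {f \<in> V. T f = 0}"
  have W: "cfun.subspace W"
    unfolding W_def using V scale[OF cfun.subspace_0[OF V], of 0]
    by (auto simp: cfun.subspace_def add scale)
  obtain C where C: "C \<subseteq> W" "cfun.independent C" "W \<subseteq> cfun.span C"
    by (rule cfun.maximal_independent_subset)
  have spanC: "cfun.span C = W" using cfun.span_minimal[OF C(1) W] C(3) by blast
  have "f0 \<notin> W" using f0 by (simp add: W_def)
  then have fC: "f0 \<notin> cfun.span C" "f0 \<notin> C" using spanC C(1) by auto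
  have ind: "cfun.independent (insert f0 C)" using C(2) fC by (simp add: cfun.independent_insert)
  have CV: "insert f0 C \<subseteq> V" using C(1) f0 by (auto simp: W_def)
  have sp: "V \<subseteq> cfun.span (insert f0 C)"
  proof
    fix f assume f: "f \<in> V"
    obtain c where c: "T f = cscale c \<phi>" using line[OF f] by blast
    have e: "f + cscale (- c) f0 \<in> W"
      using f f0 add[OF f cfun.subspace_scale[OF V f0(1)], of "- c"] scale[OF f0(1), of "- c"] c
        cfun.subspace_add[OF V f cfun.subspace_scale[OF V f0(1)], of "- c"]
      by (simp add: W_def cscale_def zero_fun_def plus_fun_def)
    have m: "cfun.span C \<subseteq> cfun.span (insert f0 C)" by (rule cfun.span_mono) blast
    have "f + cscale (- c) f0 \<in> cfun.span (insert f0 C)" using e m spanC by blast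
    moreover have "cscale c f0 \<in> cfun.span (insert f0 C)" by (intro cfun.span_scale cfun.span_base insertI1)
    ultimately have "f + cscale (- c) f0 + cscale c f0 \<in> cfun.span (insert f0 C)" by (rule cfun.span_add)
    moreover have "f + cscale (- c) f0 + cscale c f0 = f" by (simp add: fun_eq_iff cscale_def)
    ultimately show "f \<in> cfun.span (insert f0 C)" by simp
  qed
  obtain B where B: "finite B" "card B = Suc n" "B \<subseteq> V" "cfun.independent B" "cfun.span B = V"
    using dim unfolding has_dim_def by blast
  have 1: "finite (insert f0 C) \<and> card (insert f0 C) \<le> card B"
    by (rule cfun.independent_span_bound[OF B(1) ind]) (use CV B(5) in simp)
  then have 2: "card B \<le> card (insert f0 C)"
    using cfun.independent_span_bound[OF _ B(4), of "insert f0 C"] B(3) sp by blast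
  have "finite C" "card C = n" using 1 2 B(2) fC(2) by auto
  then show ?thesis using C spanC unfolding has_dim_def W_def by blast
qed

lemma linear_on_space_sum:
  assumes lin: "linear_on_space V T" and V: "cfun.subspace V" and O: "finite X" "\<And>v. v \<in> X \<Longrightarrow> v \<in> V"
  shows "T (\<Sum>v\<in>X. v) = (\<Sum>v\<in>X. T v)"
  using O
proof (induction X rule: finite_induct)
  case empty
  have "T (cscale 0 0) = cscale 0 (T 0)"
    using lin cfun.subspace_0[OF V] unfolding linear_on_space_def by blast
  then show ?case by (simp add: cscale_def zero_fun_def)
next
  case (insert v X)
  have "T (v + sum (\<lambda>v. v) X) = T v + T (sum (\<lambda>v. v) X)"
    using lin insert.prems cfun.subspace_sum[OF V, of X "\<lambda>v. v"] unfolding linear_on_space_def by blast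
  moreover have "T (sum (\<lambda>v. v) X) = sum T X" by (rule insert.IH) (use insert.prems in blast)
  ultimately show ?case by (simp only: sum.insert[OF insert.hyps])
qed

lemma finite_image_factor:
  assumes "finite (g ` A)" and "\<And>x y. x \<in> A \<Longrightarrow> y \<in> A \<Longrightarrow> g x = g y \<Longrightarrow> f x = f y"
  shows "finite (f ` A)"
proof -
  define s where "s c = (SOME x. x \<in> A \<and> g x = c)" for c
  have "s (g x) \<in> A \<and> g (s (g x)) = g x" if "x \<in> A" for x
    unfolding s_def by (rule someI[of _ x]) (simp add: that)
  then have "f x = f (s (g x))" if "x \<in> A" for x using assms(2) that by metis
  then have "f ` A \<subseteq> (\<lambda>c. f (s c)) ` (g ` A)" by blast
  then show ?thesis using assms(1) by (rule finite_subset[OF _ finite_imageI])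
qed

section \<open>Finite quotients of \<open>K0 m\<close> and averaging\<close>

context odd_padic
begin

lemma Kcong_iff: "A \<in> Kcong n \<longleftrightarrow> A \<in> SL2 \<and> (\<forall>i j. (A - mat 1) $ i $ j \<in> pball (int n))" for A :: "'p padic^2^2"
  by (simp add: Kcong_def pZp_pball)

lemma K0_nth: "A \<in> K0 m \<Longrightarrow> A $ i $ j \<in> (pball 0 :: 'p padic set)"
  by (simp add: K0_def Zp_pball)

lemma Kcong_mult:
  assumes A: "A \<in> Kcong n" and B: "B \<in> Kcong n"
  shows "A ** B \<in> (Kcong n :: ('p padic^2^2) set)"
proof -
  have Bz: "B $ i $ j \<in> pball 0" for i j using Kcong_K0[of 0 n] B K0_nth by blast
  have e: "A ** B - mat 1 = (A - mat 1) ** B + (B - mat 1)"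
    by (intro mat2_eqI) (simp_all add: matmul2_nth algebra_simps)
  have "(A ** B - mat 1) $ i $ j \<in> pball (int n)" for i j
    unfolding e vector_add_component matmul2_nth
    using A B pball_mult[OF _ Bz, of _ "int n"] unfolding Kcong_iff
    by (intro pball_add) simp_all
  then show ?thesis using A B SL2_mult unfolding Kcong_iff by blast
qed

lemma Kcong_generators:
  assumes "c \<in> pball (int n)"
  shows "nmat c \<in> (Kcong n :: ('p padic^2^2) set)" "xmat c \<in> (Kcong n :: ('p padic^2^2) set)"
  using assms by (simp_all add: Kcong_iff forall_2)

lemma Kcong_quotient:
  assumes h: "h \<in> K0 m" "h' \<in> K0 m" and eq: "\<And>i j. h $ i $ j - h' $ i $ j \<in> (pball (int n) :: 'p padic set)"
  shows "inv2 h' ** h \<in> Kcong n"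
proof -
  have e: "inv2 h' ** h - mat 1 = inv2 h' ** (h - h')"
  proof -
    have "inv2 h' ** (h - h') = inv2 h' ** h - inv2 h' ** h'"
      by (intro mat2_eqI) (simp_all add: matmul2_nth algebra_simps)
    then show ?thesis using inv2_mult(1)[OF K0_SL2[OF h(2)]] by simp
  qed
  have "(inv2 h' ** h - mat 1) $ i $ j \<in> pball (int n)" for i j
    unfolding e matmul2_nth vector_minus_component
    using pball_mult[OF K0_nth[OF K0_inv2[OF h(2)]] eq] by (intro pball_add) simp_all
  then show ?thesis
    unfolding Kcong_iff using SL2_mult[OF inv2_SL2[OF K0_SL2[OF h(2)]] K0_SL2[OF h(1)]] by blast
qed

lemma finite_residues:
  obtains r :: "'p padic \<Rightarrow> nat" where "\<And>x. r x < CARD('p) ^ n"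
    "\<And>x y. x \<in> pball 0 \<Longrightarrow> y \<in> pball 0 \<Longrightarrow> r x = r y \<Longrightarrow> x - y \<in> pball (int n)"
proof -
  have "\<exists>j. j < CARD('p) ^ n \<and> (x \<in> pball 0 \<longrightarrow> x - of_nat j \<in> pball (int n))" for x :: "'p padic"
  proof (cases "x \<in> pball 0")
    case True
    then show ?thesis using Zp_residue[of x n] by (metis Zp_pball)
  next
    case False
    then show ?thesis using card_gt_1[where 'p='p] by (intro exI[of _ 0]) simp
  qed
  then obtain r where r: "\<And>x :: 'p padic. r x < CARD('p) ^ n \<and> (x \<in> pball 0 \<longrightarrow> x - of_nat (r x) \<in> pball (int n))"
    by metis
  have "x - y \<in> pball (int n)" if "x \<in> pball 0" "y \<in> pball 0" "r x = r y" for x y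
    using pball_diff[of "x - of_nat (r x)" "int n" "y - of_nat (r y)"] r[of x] r[of y] that by simp
  then show thesis using r by (intro that[of r]) blast+
qed

text \<open>The four entries modulo \<open>p^n\<close> determine the coset of
  \<open>Kcong n\<close>, so \<open>F\<close> factors through finitely many residues and no quotient
  group has to be formed.\<close>

lemma finite_K0_image:
  assumes F: "\<And>h h'. h \<in> K0 m \<Longrightarrow> h' \<in> K0 m \<Longrightarrow> inv2 h' ** h \<in> (Kcong n :: ('p padic^2^2) set) \<Longrightarrow> F h = F h'"
  shows "finite (F ` K0 m)"
proof -
  obtain r :: "'p padic \<Rightarrow> nat" where r: "\<And>x. r x < CARD('p) ^ n"
    "\<And>x y. x \<in> pball 0 \<Longrightarrow> y \<in> pball 0 \<Longrightarrow> r x = r y \<Longrightarrow> x - y \<in> pball (int n)"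
    using finite_residues[of n] by blast
  define g where "g h = (r (h $ 1 $ 1), r (h $ 1 $ 2), r (h $ 2 $ 1), r (h $ 2 $ 2))" for h :: "'p padic^2^2"
  have "g ` K0 m \<subseteq> {..<CARD('p) ^ n} \<times> {..<CARD('p) ^ n} \<times> {..<CARD('p) ^ n} \<times> {..<CARD('p) ^ n}"
    using r(1) by (auto simp: g_def)
  then have "finite (g ` K0 m)" by (rule finite_subset) simp
  moreover have "F h = F h'" if h: "h \<in> K0 m" "h' \<in> K0 m" "g h = g h'" for h h'
  proof (rule F[OF h(1,2) Kcong_quotient[OF h(1,2)]])
    fix i j :: 2
    have "r (h $ i $ j) = r (h' $ i $ j)"
      using h(3) exhaust_2[of i] exhaust_2[of j] by (auto simp: g_def)
    then show "h $ i $ j - h' $ i $ j \<in> pball (int n)"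
      by (intro r(2) K0_nth[OF h(1)] K0_nth[OF h(2)])
  qed
  ultimately show ?thesis by (rule finite_image_factor)
qed

end

context pair
begin

text \<open>Each point of the family has its own level of local constancy. Nearby parameters differ
  by a congruence factor on the right, so a finite subcover of the parameter ball yields a common
  level.\<close>

lemma PS_uniform_family:
  fixes F :: "'p padic \<Rightarrow> 'p padic^2^2"
  assumes f: "f \<in> PS" and F: "\<And>x. x \<in> pball 0 \<Longrightarrow> F x \<in> K0 0"
    and step: "\<And>x y n. x - y \<in> pball (int n) \<Longrightarrow> \<exists>\<kappa>\<in>Kcong n. F x = F y ** \<kappa>"
  shows "\<exists>N. \<forall>x\<in>pball 0. \<forall>h\<in>Kcong N. f (F x ** h, 1) = f (F x, 1)"
proof -
  have "\<exists>n. \<forall>h\<in>Kcong n. f (F x ** h, 1) = f (F x, 1)" if x: "x \<in> pball 0" for x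
  proof -
    have "(F x, 1) \<in> Mp" using F[OF x] by (simp add: Mp_def K0_SL2)
    then obtain n where n: "\<forall>h\<in>Kcong n. f (mp_mult (F x, 1) (h, 1)) = f (F x, 1)"
      using PS_locally_constant[OF f] by blast
    have "mp_mult (F x, 1) (h, 1) = (F x ** h, 1)" if "h \<in> Kcong n" for h
      using cocycle_splits[OF K0_SL2 K0_primitive, OF F[OF x] F[OF x]] Kcong_K0[of 0 n] that
      by (simp add: mp_mult_def)
    then show ?thesis using n by (intro exI[of _ n]) metis
  qed
  then obtain n where n: "\<And>x h. x \<in> pball 0 \<Longrightarrow> h \<in> Kcong (n x) \<Longrightarrow> f (F x ** h, 1) = f (F x, 1)"
    by metis
  have "pball 0 \<subseteq> (\<Union>x\<in>pball 0. coset x (int (n x)))"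
  proof
    show "x \<in> (\<Union>x\<in>pball 0. coset x (int (n x)))" if "x \<in> pball 0" for x :: "'p padic"
      by (rule UN_I[OF that]) (simp add: coset_def)
  qed
  from compactE_image[OF compact_pball open_coset this]
  obtain D where D: "D \<subseteq> pball 0" "finite D" "pball 0 \<subseteq> (\<Union>x\<in>D. coset x (int (n x)))" by blast
  define N where "N = Max (insert 0 (n ` D))"
  have "f (F x ** h, 1) = f (F x, 1)" if x: "x \<in> pball 0" and h: "h \<in> Kcong N" for x h
  proof -
    obtain y where y: "y \<in> D" "x - y \<in> pball (int (n y))" using D(3) x by (auto simp: coset_def)
    have "n y \<le> N" using y D by (simp add: N_def)
    then have hy: "h \<in> Kcong (n y)" using h Kcong_mono by blast
    obtain \<kappa> where \<kappa>: "\<kappa> \<in> Kcong (n y)" "F x = F y ** \<kappa>" using step[OF y(2)] by blast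
    have yz: "y \<in> pball 0" using y D by blast
    show ?thesis
      using n[OF yz \<kappa>(1)] n[OF yz Kcong_mult[OF \<kappa>(1) hy]] by (simp add: \<kappa>(2) matrix_mul_assoc)
  qed
  then show ?thesis by blast
qed

text \<open>Up to Borel factors on the left, which commute with right translation,
  \<open>K0 0\<close> is covered by two families over a compact parameter ball.\<close>

lemma PS_level:
  assumes f: "f \<in> PS"
  shows "\<exists>n. \<forall>\<kappa>\<in>Kcong n. right_translation (\<kappa>, 1) f = f"
proof -
  have "\<exists>N. \<forall>x\<in>pball 0. \<forall>h\<in>Kcong N. f (nmat x ** h, 1) = f (nmat x, 1)"
  proof (rule PS_uniform_family[OF f])
    show "nmat x \<in> K0 0" if "x \<in> pball 0" for x :: "'p padic" using that by simp
    show "\<exists>\<kappa>\<in>Kcong n. nmat x = nmat y ** \<kappa>" if "x - y \<in> pball (int n)" for x y :: "'p padic" and n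
      by (rule bexI[OF _ Kcong_generators(1)[OF that]]) (intro mat2_eqI; simp add: matmul2_nth)
  qed
  then obtain N1 where N1: "\<And>x h. x \<in> pball 0 \<Longrightarrow> h \<in> Kcong N1 \<Longrightarrow> f (nmat x ** h, 1) = f (nmat x, 1)" by blast
  have "\<exists>N. \<forall>x\<in>pball 0. \<forall>h\<in>Kcong N. f ((wmat ** xmat x) ** h, 1) = f (wmat ** xmat x, 1)"
  proof (rule PS_uniform_family[OF f])
    show "wmat ** xmat x \<in> K0 0" if "x \<in> pball 0" for x :: "'p padic"
      using that by (intro K0_mult K0_generators)
    show "\<exists>\<kappa>\<in>Kcong n. wmat ** xmat x = wmat ** xmat y ** \<kappa>" if "x - y \<in> pball (int n)" for x y :: "'p padic" and n
      by (rule bexI[OF _ Kcong_generators(2)[OF that]]) (intro mat2_eqI; simp add: matmul2_nth)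
  qed
  then obtain N2 where N2: "\<And>x h. x \<in> pball 0 \<Longrightarrow> h \<in> Kcong N2 \<Longrightarrow> f ((wmat ** xmat x) ** h, 1) = f (wmat ** xmat x, 1)" by blast
  have "right_translation (\<kappa>, 1) f = f" if \<kappa>: "\<kappa> \<in> Kcong (max N1 N2)" for \<kappa>
  proof (rule PS_ext)
    have k0: "\<kappa> \<in> K0 0" by (rule Kcong_K0[OF _ \<kappa>]) simp
    have \<kappa>N: "\<kappa> \<in> Kcong N1" "\<kappa> \<in> Kcong N2" using \<kappa> Kcong_mono[of N1 "max N1 N2"] Kcong_mono[of N2 "max N1 N2"] by auto
    show "right_translation (\<kappa>, 1) f \<in> PS" by (rule rt_PS[OF f k0])
    fix g :: "'p padic^2^2" assume g: "g \<in> K0 0"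
    have borel: "f (hmat u ** xmat s ** r ** \<kappa>, 1) = f (hmat u ** xmat s ** r, 1)"
      if u: "u \<in> Zp_units" and r: "r \<in> K0 0" and eq: "f (r ** \<kappa>, 1) = f (r, 1)" for u s r
    proof -
      have rk: "r ** \<kappa> \<in> K0 0" by (rule K0_mult[OF r k0])
      have "hmat u ** xmat s ** r ** \<kappa> = hmat u ** xmat s ** (r ** \<kappa>)" by (simp add: matrix_mul_assoc)
      then show ?thesis
        using PS_K[OF f K0_primitive[OF rk] K0_SL2[OF rk] u, of s] PS_K[OF f K0_primitive[OF r] K0_SL2[OF r] u, of s] eq
        by simp
    qed
    from K0_SL2[OF g] K0_primitive[OF g] have "f (g ** \<kappa>, 1) = f (g, 1)"
    proof (cases rule: primitive_row_decomp)
      case (1 u s x)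
      have x: "x \<in> pball 0" by (rule pball_mono[OF _ 1(2)]) simp
      show ?thesis unfolding 1(3) by (rule borel[OF 1(1) K0_generators(2) N1[OF x \<kappa>N(1)]]) (use x in simp)
    next
      case (2 u s y)
      have "wmat ** xmat y \<in> K0 0" using 2(2) by (intro K0_mult K0_generators)
      then show ?thesis unfolding 2(3) by (rule borel[OF 2(1) _ N2[OF 2(2) \<kappa>N(2)]])
    qed
    then show "right_translation (\<kappa>, 1) f (g, 1) = f (g, 1)" by (simp add: rt_apply_K[OF g k0])
  qed (rule f)
  then show ?thesis by blast
qed

text \<open>The sum runs over the finite set of distinct translates of \<open>f\<close> twisted by
  \<open>\<eta>\<close>. The twisted action of \<open>K0 m\<close> permutes this set, so the sum is
  fixed by it; as \<open>\<eta>\<close> is quadratic, this is isotypy. The sum is left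
  unnormalized.\<close>

lemma isotypic_average:
  assumes f: "f \<in> PS" and lm: "l \<Longrightarrow> m \<ge> 1"
  shows "\<exists>X. finite X \<and> X \<noteq> {} \<and> (\<Sum>v\<in>X. v) \<in> iso m \<and>
    (\<forall>v\<in>X. \<exists>h\<in>K0 m. v = cscale (\<eta> (h $ 2 $ 2)) (right_translation (h, 1) f))"
proof -
  define F where "F h = cscale (\<eta> (h $ 2 $ 2)) (right_translation (h, 1) f)" for h :: "'p padic^2^2"
  obtain n0 where n0: "\<And>\<kappa>. \<kappa> \<in> Kcong n0 \<Longrightarrow> right_translation (\<kappa>, 1) f = f" using PS_level[OF f] by blast
  \<comment> \<open>Large enough for \<open>Kcong n\<close> to fix \<open>f\<close>, to lie in
    \<open>K0 m\<close> and to have \<open>\<eta>\<close> trivial on its lower right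
    entries.\<close>
  define n where "n = max n0 (max m 1)"
  have K00: "h \<in> K0 0" if "h \<in> K0 m" for h :: "'p padic^2^2" by (rule K0_mono[OF _ that]) simp
  have fin: "finite (F ` K0 m)"
  proof (rule finite_K0_image)
    fix h h' :: "'p padic^2^2" assume h: "h \<in> K0 m" "h' \<in> K0 m" and k: "inv2 h' ** h \<in> Kcong n"
    let ?k = "inv2 h' ** h"
    have hk: "h = h' ** ?k" using inv2_mult(2)[OF K0_SL2[OF h(2)]] by (simp add: matrix_mul_assoc)
    have kn: "?k \<in> Kcong n0" using k Kcong_mono[of n0 n] by (auto simp: n_def)
    have km: "?k \<in> K0 m" by (rule Kcong_K0[OF _ k]) (simp add: n_def)
    have "n \<ge> 1" by (simp add: n_def)
    then have "\<eta> (?k $ 2 $ 2) = 1"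
      using Kcong_22[OF _ k] lc_cong[of "?k $ 2 $ 2" 1 l] by (simp add: eta_unit)
    then have e: "\<eta> (h $ 2 $ 2) = \<eta> (h' $ 2 $ 2)" using eta_K0_mult[OF h(2) km lm] hk by simp
    have "right_translation (h', 1) f = right_translation (h', 1) (right_translation (?k, 1) f)" by (simp only: n0[OF kn])
    also have "\<dots> = right_translation (h, 1) f" using rt_mult[OF K00[OF h(2)] K00[OF km], of f] hk by simp
    finally show "F h = F h'" by (simp add: F_def e)
  qed
  have act: "cscale (\<eta> (h $ 2 $ 2)) (right_translation (h, 1) (F h1)) = F (h ** h1)"
    if h: "h \<in> K0 m" "h1 \<in> K0 m" for h h1
  proof -
    have "right_translation (h, 1) (F h1) = cscale (\<eta> (h1 $ 2 $ 2)) (right_translation (h ** h1, 1) f)"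
      unfolding rt_mult[OF K00[OF h(1)] K00[OF h(2)], symmetric] F_def
      by (simp add: right_translation_def cscale_def fun_eq_iff)
    then show ?thesis using eta_K0_mult[OF h lm] by (simp add: F_def cscale_def fun_eq_iff)
  qed
  let ?X = "F ` K0 m"
  have FPS: "F h \<in> PS" if "h \<in> K0 m" for h
    unfolding F_def by (intro cfun.subspace_scale[OF PS_subspace] rt_PS[OF f] K00[OF that])
  have "(\<Sum>v\<in>?X. v) \<in> iso m"
    unfolding iso_iff
  proof (intro conjI ballI)
    show "(\<Sum>v\<in>?X. v) \<in> PS" by (rule cfun.subspace_sum[OF PS_subspace]) (use FPS in auto)
    fix h k0 :: "'p padic^2^2" assume h: "h \<in> K0 m" and k0: "k0 \<in> K0 0"
    define P where "P v = cscale (\<eta> (h $ 2 $ 2)) (right_translation (h, 1) v)" for v :: "'p mp \<Rightarrow> complex"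
    have "P ` ?X = ?X"
    proof
      show "P ` ?X \<subseteq> ?X" using act[OF h] K0_mult[OF h] by (auto simp: P_def)
      show "?X \<subseteq> P ` ?X"
      proof
        fix v assume "v \<in> ?X"
        then obtain h2 where h2: "h2 \<in> K0 m" "v = F h2" by blast
        have "inv2 h ** h2 \<in> K0 m" by (rule K0_mult[OF K0_inv2[OF h] h2(1)])
        moreover have "h ** (inv2 h ** h2) = h2" using inv2_mult(2)[OF K0_SL2[OF h]] by (simp add: matrix_mul_assoc)
        ultimately have "v = P (F (inv2 h ** h2))" "F (inv2 h ** h2) \<in> ?X" using act[OF h, of "inv2 h ** h2"] h2(2) by (auto simp: P_def)
        then show "v \<in> P ` ?X" by blast
      qed
    qed
    then have bij: "bij_betw P ?X ?X" using fin by (simp add: bij_betw_def eq_card_imp_inj_on)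
    have "(\<Sum>v\<in>?X. v) (k0, 1) = (\<Sum>v\<in>?X. P v) (k0, 1)" using sum.reindex_bij_betw[OF bij, of "\<lambda>v. v"] by simp
    also have "\<dots> = (\<Sum>v\<in>?X. \<eta> (h $ 2 $ 2) * v (k0 ** h, 1))"
      by (simp add: sum_fun_apply P_def cscale_def rt_apply_K[OF k0 K00[OF h]])
    also have "\<dots> = \<eta> (h $ 2 $ 2) * (\<Sum>v\<in>?X. v) (k0 ** h, 1)" by (simp add: sum_fun_apply sum_distrib_left)
    finally have "\<eta> (h $ 2 $ 2) * (\<Sum>v\<in>?X. v) (k0, 1) = (\<eta> (h $ 2 $ 2) * \<eta> (h $ 2 $ 2)) * (\<Sum>v\<in>?X. v) (k0 ** h, 1)"
      by (simp only: mult.assoc)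
    moreover have "\<eta> (h $ 2 $ 2) * \<eta> (h $ 2 $ 2) = 1" by (rule eta_square[OF h]) (rule lm)
    ultimately show "(\<Sum>v\<in>?X. v) (k0 ** h, 1) = \<eta> (h $ 2 $ 2) * (\<Sum>v\<in>?X. v) (k0, 1)"
      by (simp only: mult_1_left)
  qed
  moreover have "?X \<noteq> {}" by (metis K0_generators(4) image_is_empty empty_iff)
  moreover have "\<forall>v\<in>?X. \<exists>h\<in>K0 m. v = cscale (\<eta> (h $ 2 $ 2)) (right_translation (h, 1) f)"
    unfolding F_def by blast
  ultimately show ?thesis using fin by blast
qed

end

section \<open>The quotient map on isotypic vectors\<close>

locale weil_quotient = weil p_type \<psi> a k l \<mu> \<eta> \<beta> \<omega>
  for p_type :: "'p::prime_card itself" and \<psi> a k l \<mu> \<eta> \<beta> \<omega> +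
  fixes T :: "('p mp \<Rightarrow> complex) \<Rightarrow> 'p padic \<Rightarrow> complex"
  assumes T_intertwiner: "mp_intertwiner PS right_translation even_schwartz \<omega> T"
    and T_onto: "T ` PS = even_schwartz"
begin

definition kiso :: "nat \<Rightarrow> ('p mp \<Rightarrow> complex) set" where
  "kiso m = isotypic {f \<in> PS. T f = 0} right_translation \<eta> m"

lemma kiso_eq: "kiso m = {f \<in> iso m. T f = 0}"
  by (auto simp: kiso_def iso_def isotypic_def)

lemma T_linear: "linear_on_space PS T"
  using T_intertwiner by (simp add: mp_intertwiner_def)

lemma T_scale: "f \<in> PS \<Longrightarrow> T (cscale c f) = cscale c (T f)"
  using T_linear unfolding linear_on_space_def by blast

lemma T_act: "g \<in> Mp \<Longrightarrow> f \<in> PS \<Longrightarrow> T (right_translation g f) = \<omega> g (T f)"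
  using T_intertwiner unfolding mp_intertwiner_def by blast

lemma T_iso:
  assumes f: "f \<in> iso m"
  shows "T f \<in> wiso m"
proof (rule wiso_memberI)
  show "T f \<in> even_schwartz" using T_onto iso_PS[OF f] by blast
  fix h :: "'p padic^2^2" assume h: "h \<in> K0 m"
  have "right_translation (h, 1) f = cscale (\<eta> (h $ 2 $ 2)) f"
    using f h unfolding iso_def isotypic_def by auto
  then show "\<omega> (h, 1) (T f) = cscale (\<eta> (h $ 2 $ 2)) (T f)"
    using T_act[OF K0_Mp[OF h] iso_PS[OF f]] T_scale[OF iso_PS[OF f]] by simp
qed

text \<open>Every twisted translate of a preimage is again a preimage, because the target vector is
  isotypic and \<open>\<eta>\<close> squares to 1. Their sum maps to the target times the positive
  number of translates, which can be divided out.\<close>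

lemma T_iso_onto:
  assumes \<phi>: "\<phi> \<in> wiso m" and lm: "l \<Longrightarrow> m \<ge> 1"
  obtains f where "f \<in> iso m" "T f = \<phi>"
proof -
  have "\<phi> \<in> T ` PS" using \<phi> unfolding T_onto by (simp add: wiso_def isotypic_def)
  then obtain f where f: "f \<in> PS" "T f = \<phi>" by blast
  obtain X where X: "finite X" "X \<noteq> {}" "(\<Sum>v\<in>X. v) \<in> iso m"
    "\<forall>v\<in>X. \<exists>h\<in>K0 m. v = cscale (\<eta> (h $ 2 $ 2)) (right_translation (h, 1) f)"
    using isotypic_average[OF f(1) lm] by blast
  have Tv: "v \<in> PS \<and> T v = \<phi>" if v: "v \<in> X" for v
  proof -
    obtain h where h: "h \<in> K0 m" "v = cscale (\<eta> (h $ 2 $ 2)) (right_translation (h, 1) f)" using X(4) v by blast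
    have r: "right_translation (h, 1) f \<in> PS" by (rule rt_PS[OF f(1) K0_mono[OF _ h(1)]]) simp
    have "T v = cscale (\<eta> (h $ 2 $ 2)) (cscale (\<eta> (h $ 2 $ 2)) \<phi>)"
      using wiso_K0[OF \<phi> h(1)] by (simp add: h(2) T_scale[OF r] T_act[OF K0_Mp[OF h(1)] f(1)] f(2))
    also have "\<dots> = \<phi>" by (simp add: eta_square[OF h(1) lm])
    finally show ?thesis using cfun.subspace_scale[OF PS_subspace r] by (simp add: h(2))
  qed
  have "T (\<Sum>v\<in>X. v) = (\<Sum>v\<in>X. \<phi>)"
    using linear_on_space_sum[OF T_linear PS_subspace X(1)] Tv by simp
  also have "\<dots> = cscale (of_nat (card X)) \<phi>" by (simp add: fun_eq_iff sum_fun_apply cscale_def)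
  finally have "T (cscale (1 / of_nat (card X)) (\<Sum>v\<in>X. v)) = \<phi>"
    using T_scale[OF iso_PS[OF X(3)]] X(1,2) by simp
  then show thesis using that cfun.subspace_scale[OF iso_subspace X(3)] by blast
qed

lemma kiso_dim:
  assumes "has_dim (iso m) (Suc n)" "has_dim (wiso m) 1" "l \<Longrightarrow> m \<ge> 1"
  shows "has_dim (kiso m) n"
proof -
  obtain B where B: "card B = 1" "B \<subseteq> wiso m" "cfun.independent B" "cfun.span B = wiso m"
    using assms(2) unfolding has_dim_def by blast
  then obtain \<phi> where \<phi>: "B = {\<phi>}" by (auto simp: card_1_singleton_iff)
  have nz: "\<phi> \<noteq> 0" using B(3) \<phi> cfun.dependent_zero by blast
  obtain f0 where f0: "f0 \<in> iso m" "T f0 = \<phi>" using T_iso_onto[of \<phi> m] B(2) \<phi> assms(3) by blast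
  have lin: "linear_on_space (iso m) T"
    using T_linear iso_PS unfolding linear_on_space_def by blast
  have line: "\<exists>c. T f = cscale c \<phi>" if "f \<in> iso m" for f
    using T_iso[OF that] B(4) unfolding \<phi> cfun.span_singleton by blast
  show ?thesis
    unfolding kiso_eq by (rule has_dim_kernel[OF iso_subspace assms(1) lin f0 nz line])
qed

lemma kiso_trivial:
  assumes "wiso m = {0}"
  shows "kiso m = iso m"
  using T_iso assms by (auto simp: kiso_eq)

end

section \<open>The tables\<close>

lemma is_eta_conductorI:
  assumes "conductor_exp \<eta> \<le> n" "has_dim (isotypic V \<rho> \<eta> n) (Suc d)"
    "\<And>m. conductor_exp \<eta> \<le> m \<Longrightarrow> m < n \<Longrightarrow> isotypic V \<rho> \<eta> m = {0}"
  shows "is_eta_conductor V \<rho> \<eta> n"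
  unfolding is_eta_conductor_def using assms has_dim_Suc_nonzero[OF assms(2)] by blast

context pair_beta
begin

lemma conductor_lc:
  assumes "\<And>u. u \<in> Zp_units \<Longrightarrow> \<xi> u = lc b u"
  shows "conductor_exp \<xi> = (if b then 1 else 0)"
proof (cases b)
  case True
  have "\<xi> u = 1" if "u \<in> unit_filtration 1" for u
  proof -
    have u: "u - 1 \<in> pball 1" using that by (simp add: unit_filtration_def pZp_pball)
    have "u \<in> Zp_units" using units_add_pball[OF units_1 u] by simp
    then show ?thesis using assms lc_cong[OF _ u, of b] by simp
  qed
  moreover have "1 \<le> n" if "\<forall>u\<in>unit_filtration n. \<xi> u = 1" for n
  proof (rule ccontr)
    assume "\<not> 1 \<le> n"
    then have "\<xi> \<beta> = 1" using that beta_unit by (simp add: unit_filtration_def)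
    then show False using assms[OF beta_unit] True by (simp add: lc_def leg_beta)
  qed
  ultimately have "conductor_exp \<xi> = 1" unfolding conductor_exp_def by (intro Least_equality) blast+
  then show ?thesis using True by simp
next
  case False
  then have "\<forall>u\<in>unit_filtration 0. \<xi> u = 1" using assms by (simp add: unit_filtration_def lc_def)
  then have "conductor_exp \<xi> = 0" unfolding conductor_exp_def by (rule Least_eq_0)
  then show ?thesis using False by simp
qed

lemma conductor_quad_char: "conductor_exp (quad_char a) = (if k then 1 else 0)"
  by (rule conductor_lc) (rule quad_char_unit)

lemma conductor_eta: "conductor_exp \<eta> = (if l then 1 else 0)"
  by (rule conductor_lc) (rule eta_unit)

lemmas conductors = conductor_quad_char conductor_eta

lemma principal_series_table:
  "(conductor_exp (quad_char a) = 0 \<and> conductor_exp \<eta> = 0 \<longrightarrow>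
      is_eta_conductor PS right_translation \<eta> 0 \<and>
      has_dim (iso 0) 1 \<and> has_dim (iso 1) 2) \<and>
   (conductor_exp (quad_char a) = 1 \<and> conductor_exp \<eta> = 0 \<longrightarrow>
      is_eta_conductor PS right_translation \<eta> 2 \<and>
      has_dim (iso 2) 2 \<and> (\<forall>m<2. iso m = {0})) \<and>
   (conductor_exp (quad_char a) = 0 \<and> conductor_exp \<eta> = 1 \<longrightarrow>
      is_eta_conductor PS right_translation \<eta> 2 \<and>
      has_dim (iso 2) 2 \<and> iso 1 = {0}) \<and>
   (conductor_exp (quad_char a) = 1 \<and> conductor_exp \<eta> = 1 \<longrightarrow>
      is_eta_conductor PS right_translation \<eta> 1 \<and> has_dim (iso 1) 2)"
proof -
  have cond: "is_eta_conductor PS right_translation \<eta> n"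
    if "conductor_exp \<eta> \<le> n" "has_dim (iso n) (Suc d)"
      "\<And>m. conductor_exp \<eta> \<le> m \<Longrightarrow> m < n \<Longrightarrow> iso m = {0}" for n d
    using is_eta_conductorI[where V=PS and \<rho>=right_translation] that unfolding iso_def by blast
  consider "\<not> k" "\<not> l" | "k \<noteq> l" | "k" "l" by blast
  then show ?thesis
  proof cases
    case 1
    then have kl: "k = l" by blast
    have "is_eta_conductor PS right_translation \<eta> 0"
      by (rule cond[of 0 0]) (use 1 dim_iso_0[OF 1] in \<open>simp_all add: conductors\<close>)
    then show ?thesis using 1 dim_iso_0[OF 1] dim_iso_1[OF kl] by (simp add: conductors)
  next
    case 2
    have z: "iso m = {0}" if "m < 2" for m using that by (intro iso_neq_1[OF 2]) simp
    have "is_eta_conductor PS right_translation \<eta> 2"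
      by (rule cond[of 2 1]) (use dim_iso_2[OF 2] z in \<open>simp_all add: conductors numeral_2_eq_2\<close>)
    then show ?thesis using 2 dim_iso_2[OF 2] z by (cases k) (simp_all add: conductors)
  next
    case 3
    then have kl: "k = l" by blast
    have "is_eta_conductor PS right_translation \<eta> 1"
      by (rule cond[of 1 1]) (use 3 dim_iso_1[OF kl] in \<open>simp_all add: conductors numeral_2_eq_2\<close>)
    then show ?thesis using 3 dim_iso_1[OF kl] by (simp add: conductors)
  qed
qed

end

context weil
begin

lemma weil_table:
  "(conductor_exp (quad_char a) = 0 \<and> conductor_exp \<eta> = 0 \<longrightarrow>
      is_eta_conductor even_schwartz \<omega> \<eta> 0 \<and>
      has_dim (wiso 0) 1 \<and> has_dim (wiso 1) 1) \<and>
   (conductor_exp (quad_char a) = 1 \<and> conductor_exp \<eta> = 0 \<longrightarrow>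
      is_eta_conductor even_schwartz \<omega> \<eta> 3 \<and>
      has_dim (wiso 2) 0 \<and> (\<forall>m<2. wiso m = {0})) \<and>
   (conductor_exp (quad_char a) = 0 \<and> conductor_exp \<eta> = 1 \<longrightarrow>
      is_eta_conductor even_schwartz \<omega> \<eta> 2 \<and>
      has_dim (wiso 2) 1 \<and> wiso 1 = {0}) \<and>
   (conductor_exp (quad_char a) = 1 \<and> conductor_exp \<eta> = 1 \<longrightarrow>
      is_eta_conductor even_schwartz \<omega> \<eta> 1 \<and> has_dim (wiso 1) 1)"
proof -
  have cond: "is_eta_conductor even_schwartz \<omega> \<eta> n"
    if "conductor_exp \<eta> \<le> n" "has_dim (wiso n) 1"
      "\<And>m. conductor_exp \<eta> \<le> m \<Longrightarrow> m < n \<Longrightarrow> wiso m = {0}" for n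
    using is_eta_conductorI[where V=even_schwartz and \<rho>=\<omega> and d=0] that unfolding wiso_def One_nat_def by blast
  consider "\<not> k" "\<not> l" | "k \<noteq> l" | "k" "l" by blast
  then show ?thesis
  proof cases
    case 1
    then have kl: "k = l" by blast
    have "is_eta_conductor even_schwartz \<omega> \<eta> 0"
      by (rule cond) (use 1 dim_wiso_0[OF 1] in \<open>simp_all add: conductors\<close>)
    then show ?thesis using 1 dim_wiso_0[OF 1] dim_wiso_1[OF kl] by (simp add: conductors)
  next
    case 2
    define M :: nat where "M = (if k then 3 else 2)"
    have d: "has_dim (wiso M) 1" by (rule dim_wiso_neq[OF 2 M_def])
    have z: "wiso m = {0}" if "m < M" for m by (rule wiso_neq_trivial[OF 2]) (use that in \<open>simp only: M_def\<close>)
    have c: "is_eta_conductor even_schwartz \<omega> \<eta> M"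
      by (rule cond[OF _ d z]) (simp_all add: conductors M_def)
    show ?thesis
    proof (cases k)
      case True
      then have "has_dim (wiso 2) 0" "\<forall>m<2. wiso m = {0}" using z by (simp_all add: M_def has_dim_0_iff)
      then show ?thesis using True 2 c by (simp add: conductors M_def)
    next
      case False
      then show ?thesis using 2 c d z[of 1] by (simp add: conductors M_def)
    qed
  next
    case 3
    then have kl: "k = l" by blast
    have "is_eta_conductor even_schwartz \<omega> \<eta> 1"
      by (rule cond) (use 3 dim_wiso_1[OF kl] in \<open>simp_all add: conductors\<close>)
    then show ?thesis using 3 dim_wiso_1[OF kl] by (simp add: conductors)
  qed
qed

end

context weil_quotient
begin

lemma steinberg_table:
  assumes St: "St = {f \<in> PS. T f = 0}"
  shows
   "(conductor_exp (quad_char a) = 0 \<and> conductor_exp \<eta> = 0 \<longrightarrow>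
      is_eta_conductor St right_translation \<eta> 1 \<and>
      has_dim (isotypic St right_translation \<eta> 0) 0 \<and>
      has_dim (isotypic St right_translation \<eta> 1) 1) \<and>
   (conductor_exp (quad_char a) = 1 \<and> conductor_exp \<eta> = 0 \<longrightarrow>
      is_eta_conductor St right_translation \<eta> 2 \<and>
      has_dim (isotypic St right_translation \<eta> 2) 2 \<and>
      (\<forall>m<2. isotypic St right_translation \<eta> m = {0})) \<and>
   (conductor_exp (quad_char a) = 0 \<and> conductor_exp \<eta> = 1 \<longrightarrow>
      is_eta_conductor St right_translation \<eta> 2 \<and>
      has_dim (isotypic St right_translation \<eta> 2) 1 \<and>
      isotypic St right_translation \<eta> 1 = {0}) \<and>
   (conductor_exp (quad_char a) = 1 \<and> conductor_exp \<eta> = 1 \<longrightarrow>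
      is_eta_conductor St right_translation \<eta> 1 \<and>
      has_dim (isotypic St right_translation \<eta> 1) 1)"
proof -
  have iso_kiso: "isotypic St right_translation \<eta> m = kiso m" for m by (simp only: St kiso_def)
  have cond: "is_eta_conductor St right_translation \<eta> n"
    if "conductor_exp \<eta> \<le> n" "has_dim (kiso n) (Suc d)"
      "\<And>m. conductor_exp \<eta> \<le> m \<Longrightarrow> m < n \<Longrightarrow> kiso m = {0}" for n d
    by (rule is_eta_conductorI[where d=d], unfold iso_kiso) (fact that)+
  consider "\<not> k" "\<not> l" | "k \<noteq> l" | "k" "l" by blast
  then show ?thesis
  proof cases
    case 1
    then have kl: "k = l" by blast
    have d0: "has_dim (kiso 0) 0" by (rule kiso_dim[OF _ dim_wiso_0[OF 1]]) (use 1 dim_iso_0[OF 1] in simp_all)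
    have d1: "has_dim (kiso 1) 1" by (rule kiso_dim[OF _ dim_wiso_1[OF kl]]) (use 1 dim_iso_1[OF kl] in \<open>simp_all add: numeral_2_eq_2\<close>)
    have "is_eta_conductor St right_translation \<eta> 1"
      by (rule cond[of 1 0]) (use 1 d0 d1 in \<open>simp_all add: conductors has_dim_0_iff\<close>)
    then show ?thesis using 1 d0 d1 by (simp add: conductors iso_kiso)
  next
    case 2
    have z: "kiso m = {0}" if "m < 2" for m
    proof -
      have "kiso m = iso m" using that by (intro kiso_trivial wiso_neq_trivial[OF 2]) simp
      then show ?thesis using that by (simp add: iso_neq_1[OF 2])
    qed
    have c: "is_eta_conductor St right_translation \<eta> 2" if "has_dim (kiso 2) (Suc d)" for d
      by (rule cond[OF _ that z]) (simp_all add: conductors)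
    show ?thesis
    proof (cases k)
      case True
      have "kiso 2 = iso 2" using True by (intro kiso_trivial wiso_neq_trivial[OF 2]) simp
      then have d: "has_dim (kiso 2) 2" using dim_iso_2[OF 2] by simp
      then show ?thesis using True 2 c[of 1] z by (simp add: conductors iso_kiso numeral_2_eq_2)
    next
      case False
      have "has_dim (wiso 2) 1" by (rule dim_wiso_neq[OF 2]) (simp add: False)
      then have d: "has_dim (kiso 2) 1"
        by (rule kiso_dim[rotated]) (use dim_iso_2[OF 2] in \<open>simp_all add: numeral_2_eq_2\<close>)
      then show ?thesis using False 2 c[of 0] z[of 1] by (simp add: conductors iso_kiso)
    qed
  next
    case 3
    then have kl: "k = l" by blast
    have d1: "has_dim (kiso 1) 1" by (rule kiso_dim[OF _ dim_wiso_1[OF kl]]) (use dim_iso_1[OF kl] in \<open>simp_all add: numeral_2_eq_2\<close>)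
    have "is_eta_conductor St right_translation \<eta> 1"
      by (rule cond[of 1 0]) (use 3 d1 in \<open>simp_all add: conductors\<close>)
    then show ?thesis using 3 d1 by (simp add: conductors iso_kiso)
  qed
qed

end

context weil
begin

lemmas weil_rows = weil_table[unfolded wiso_def]

lemma steinberg_rows:
  assumes "steinberg \<psi> a \<omega> St"
  shows
   "(conductor_exp (quad_char a) = 0 \<and> conductor_exp \<eta> = 0 \<longrightarrow>
      is_eta_conductor St right_translation \<eta> 1 \<and>
      has_dim (isotypic St right_translation \<eta> 0) 0 \<and>
      has_dim (isotypic St right_translation \<eta> 1) 1) \<and>
   (conductor_exp (quad_char a) = 1 \<and> conductor_exp \<eta> = 0 \<longrightarrow>
      is_eta_conductor St right_translation \<eta> 2 \<and>
      has_dim (isotypic St right_translation \<eta> 2) 2 \<and>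
      (\<forall>m<2. isotypic St right_translation \<eta> m = {0})) \<and>
   (conductor_exp (quad_char a) = 0 \<and> conductor_exp \<eta> = 1 \<longrightarrow>
      is_eta_conductor St right_translation \<eta> 2 \<and>
      has_dim (isotypic St right_translation \<eta> 2) 1 \<and>
      isotypic St right_translation \<eta> 1 = {0}) \<and>
   (conductor_exp (quad_char a) = 1 \<and> conductor_exp \<eta> = 1 \<longrightarrow>
      is_eta_conductor St right_translation \<eta> 1 \<and>
      has_dim (isotypic St right_translation \<eta> 1) 1)"
proof -
  have V: "principal_series \<psi> (\<lambda>x. quad_char a x * abs_pow x (1/2)) = PS" by (rule trans[OF _ PS_def[symmetric]], rule arg_cong[OF mu_def[symmetric]])
  obtain T where T: "mp_intertwiner PS right_translation even_schwartz \<omega> T" "T ` PS = even_schwartz"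
    "St = {f \<in> PS. T f = 0}"
    using assms unfolding steinberg_def Let_def V by blast
  interpret weil_quotient p_type \<psi> a k l \<mu> \<eta> \<beta> \<omega> T by unfold_locales (fact T(1,2))+
  show ?thesis by (rule steinberg_table[OF T(3)])
qed

end

theorem proposition4p7:
  fixes \<psi> \<mu> \<eta> :: "'p::prime_card padic \<Rightarrow> complex" and \<beta> a :: "'p padic"
    and PS :: "('p mp \<Rightarrow> complex) set"
  assumes "odd CARD('p)"
    and "additive_character \<psi>" and "conductor_zero \<psi>"
    and "\<beta> \<in> Zp_units" and "\<nexists>x. x^2 = \<beta>"
    and "a \<in> {1, \<beta>, of_nat CARD('p), of_nat CARD('p) * \<beta>}"
    and "\<mu> = (\<lambda>x. quad_char a x * abs_pow x (1/2))"
    and "\<eta> = (\<lambda>_. 1) \<or> \<eta> = legendre_char"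
    and "\<eta> (- 1) = quad_char a (- 1)"
    and "PS = principal_series \<psi> \<mu>"
  shows
    "((conductor_exp (quad_char a) = 0 \<and> conductor_exp \<eta> = 0 \<longrightarrow>
          is_eta_conductor PS right_translation \<eta> 0 \<and>
          has_dim (isotypic PS right_translation \<eta> 0) 1 \<and>
          has_dim (isotypic PS right_translation \<eta> 1) 2) \<and>
      (conductor_exp (quad_char a) = 1 \<and> conductor_exp \<eta> = 0 \<longrightarrow>
          is_eta_conductor PS right_translation \<eta> 2 \<and>
          has_dim (isotypic PS right_translation \<eta> 2) 2 \<and>
          (\<forall>m<2. isotypic PS right_translation \<eta> m = {0})) \<and>
      (conductor_exp (quad_char a) = 0 \<and> conductor_exp \<eta> = 1 \<longrightarrow>
          is_eta_conductor PS right_translation \<eta> 2 \<and>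
          has_dim (isotypic PS right_translation \<eta> 2) 2 \<and>
          isotypic PS right_translation \<eta> 1 = {0}) \<and>
      (conductor_exp (quad_char a) = 1 \<and> conductor_exp \<eta> = 1 \<longrightarrow>
          is_eta_conductor PS right_translation \<eta> 1 \<and>
          has_dim (isotypic PS right_translation \<eta> 1) 2)) \<and>
     (\<forall>\<omega>. weil_representation (twist \<psi> a) \<omega> \<longrightarrow>
       (conductor_exp (quad_char a) = 0 \<and> conductor_exp \<eta> = 0 \<longrightarrow>
          is_eta_conductor even_schwartz \<omega> \<eta> 0 \<and>
          has_dim (isotypic even_schwartz \<omega> \<eta> 0) 1 \<and>
          has_dim (isotypic even_schwartz \<omega> \<eta> 1) 1) \<and>
       (conductor_exp (quad_char a) = 1 \<and> conductor_exp \<eta> = 0 \<longrightarrow>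
          is_eta_conductor even_schwartz \<omega> \<eta> 3 \<and>
          has_dim (isotypic even_schwartz \<omega> \<eta> 2) 0 \<and>
          (\<forall>m<2. isotypic even_schwartz \<omega> \<eta> m = {0})) \<and>
       (conductor_exp (quad_char a) = 0 \<and> conductor_exp \<eta> = 1 \<longrightarrow>
          is_eta_conductor even_schwartz \<omega> \<eta> 2 \<and>
          has_dim (isotypic even_schwartz \<omega> \<eta> 2) 1 \<and>
          isotypic even_schwartz \<omega> \<eta> 1 = {0}) \<and>
       (conductor_exp (quad_char a) = 1 \<and> conductor_exp \<eta> = 1 \<longrightarrow>
          is_eta_conductor even_schwartz \<omega> \<eta> 1 \<and>
          has_dim (isotypic even_schwartz \<omega> \<eta> 1) 1) \<and>
       (\<forall>St. steinberg \<psi> a \<omega> St \<longrightarrow>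
         (conductor_exp (quad_char a) = 0 \<and> conductor_exp \<eta> = 0 \<longrightarrow>
            is_eta_conductor St right_translation \<eta> 1 \<and>
            has_dim (isotypic St right_translation \<eta> 0) 0 \<and>
            has_dim (isotypic St right_translation \<eta> 1) 1) \<and>
         (conductor_exp (quad_char a) = 1 \<and> conductor_exp \<eta> = 0 \<longrightarrow>
            is_eta_conductor St right_translation \<eta> 2 \<and>
            has_dim (isotypic St right_translation \<eta> 2) 2 \<and>
            (\<forall>m<2. isotypic St right_translation \<eta> m = {0})) \<and>
         (conductor_exp (quad_char a) = 0 \<and> conductor_exp \<eta> = 1 \<longrightarrow>
            is_eta_conductor St right_translation \<eta> 2 \<and>
            has_dim (isotypic St right_translation \<eta> 2) 1 \<and>
            isotypic St right_translation \<eta> 1 = {0}) \<and>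
         (conductor_exp (quad_char a) = 1 \<and> conductor_exp \<eta> = 1 \<longrightarrow>
            is_eta_conductor St right_translation \<eta> 1 \<and>
            has_dim (isotypic St right_translation \<eta> 1) 1)))"
proof -
  interpret padic_char "TYPE('p)" \<psi> by unfold_locales (rule assms(1-3))+
  define k l where "k = odd (padic_ord a)" and "l = (\<eta> \<noteq> (\<lambda>_. 1))"
  have \<beta>: "\<beta> \<noteq> 0" "padic_ord \<beta> = 0" using assms(4) by (simp_all add: Zp_units_iff)
  have a: "a \<noteq> 0" "padic_ord a = (if k then 1 else 0)"
    using assms(6) \<beta> padic_ord_unit[OF units_1, where 'p='p] by (auto simp: k_def padic_ord_mult)
  have eta: "\<eta> = (if l then legendre_char else (\<lambda>_. 1))" using assms(8) by (auto simp: l_def)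
  have m1: "- 1 \<in> (Zp_units :: 'p padic set)" by simp
  have "lc l (- 1) = \<eta> (- 1)" by (simp add: eta lc_def legendre_char_leg[OF m1])
  moreover have "lc k (- 1) = quad_char a (- 1)"
    by (simp add: quad_char_def lc_def k_def hilbert_unit_right[OF a(1) m1])
  ultimately have parity: "lc k (- 1) = lc l (- 1)" using assms(9) by simp
  have leg: "leg \<beta> = - 1" using assms(5) by (simp add: leg_def)
  interpret P: pair_beta "TYPE('p)" \<psi> a k l \<mu> \<eta> \<beta>
    by unfold_locales (fact a(1) k_def assms(7) eta parity assms(4) leg a(2))+
  have PS: "P.PS = PS" by (simp only: assms(10) P.PS_def)
  note rows = P.principal_series_table[unfolded P.iso_def PS]
    weil.weil_rows[OF weil.intro[OF P.pair_beta_axioms weil_axioms.intro]]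
    weil.steinberg_rows[OF weil.intro[OF P.pair_beta_axioms weil_axioms.intro]]
  have conj: "A \<and> B \<and> C \<and> D \<and> E" if "A \<and> B \<and> C \<and> D" E for A B C D E using that by blast
  show ?thesis
    by (rule conjI[OF rows(1)], rule allI, rule impI,
        rule conj[OF rows(2)], assumption, rule allI, rule impI, rule rows(3), assumption, assumption)
qed

end
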